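(* Let $(\mathcal K,[A])$ be soliton data, $[A]$ in an irreducible $g$-dimensional positroid cell $\mathcal S\subset Gr^{\mathrm{TNN}}(k,n)$, let $\mathcal G$ be a reduced planar bipartite graph in the disk with black boundary vertices representing $\mathcal S$ whose internal vertices are bivalent or trivalent, let $\Gamma=\Gamma(\mathcal G)$ be the associated reducible curve and $\vec x_0$ a reference time such that $v_b(\vec x_0)\neq0$ for all $b\in\mathcal B$. Then the normalized wave function $\hat\psi(P,\vec x)$ and the KP-II divisor $\mathcal D_{\mathrm{KP},\Gamma}$ on $\Gamma$ constructed from the Kasteleyn system of relations coincide with those constructed from the Lam system of relations for the geometric signatures, for any given soliton data $(\mathcal K,[A])$ and reference time $\vec x_0$.
   Context: Graphs. A planar bipartite graph in the disk is a finite undirected planar graph $\mathcal G=(\mathcal B\cup\mathcal W,\mathcal E)$ in a closed disk with internal vertices black or white strictly inside the disk, $n$ boundary vertices $b_1,\dots,b_n$ in clockwise order on the boundary circle, of the same color and degree one, every edge joining different colors, and admitting a perfect orientation (each internal black vertex has exactly one outgoing edge, each internal white vertex exactly one incoming edge). The source sets $I\subset[n]$ of perfect orientations have the same cardinality $k$ and form a positroid $\mathcal M$; $\mathcal G$ represents the cell $\mathcal S=\{[A]\in Gr^{\mathrm{TNN}}(k,n):\Delta_I(A)>0\iff I\in\mathcal M\}$; irreducible means for each $j$ there are $I,J\in\mathcal M$ with $j\in I,j\notin J$. Reduced: every component contains a boundary vertex; internal vertices of degree 1 are adjacent to a boundary vertex; at most one edge joins a given pair of vertices; the number of faces is minimal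 among graphs with the same positroid (it equals $g+1$). Finite faces are all faces except the one containing the boundary arc going clockwise from $b_n$ to $b_1$. A Kasteleyn signature is $\sigma:\mathcal E\to\{\pm1\}$ with $\prod_{e\in\partial\Omega}\sigma(e)=(-1)^{|\Omega|/2+1}$ for each finite face ($|\Omega|$ = number of bounding edges of $\mathcal G$). Positive edge weights $t_{bw}$ represent $[A]$ if the Plücker coordinates of $[A]$ are $D_I=\sum_{M:\partial M=I}\prod_{e\in M}t_e$, over sets of edges $M$ covering each internal vertex exactly once and each boundary vertex at most once, with set $\partial M=I$ of used (black) boundary vertices. $K^{\sigma,wt}_{bw}=\sigma(\overline{bw})t_{bw}$ (zero if no edge). KP data. $\mathcal K=\{\kappa_1<\dots<\kappa_n\}\subset\mathbb R$; $\vec x=(x_1=x,x_2=y,x_3=t,\dots)$ finite; $\theta_j=\sum_i\kappa_j^ix_i$; $f_i=\sum_jA^i_je^{\theta_j}$, $i\in[k]$; $\mathfrak D=\partial_x^k-\mathfrak w_1\partial_x^{k-1}-\cdots-\mathfrak w_k$ is the operator with $\mathfrak Df_i\equiv0$; $\gamma^{(S)}_l(\vec x)\in[\kappa_1,\kappa_n]$ are the roots of $\zeta^k-\mathfrak w_1(\vec x)\zeta^{k-1}-\cdots-\mathfrak w_k(\vec x)$; $\psi(\kappa_j,\vec x)=\prod_l(\kappa_j-\gamma_l^{(S)}(\vec x))e^{\theta_j(\vec x)}$. Kasteleyn construction: $v_b(\vec x)$, $b\in\mathcal B$, is the unique solution of $\sum_bK^{\sigma,wt}_{bw}v_b(\vec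 x)=0$, $w\in\mathcal W$, with $v_{b_j}(\vec x)=\psi(\kappa_j,\vec x)$, $j\in[n]$; set $\hat v_b(\vec x)=v_b(\vec x)/v_b(\vec x_0)$. Geometric construction: fix a perfect orientation with source set $I$, $\bar I=[n]\setminus I$, a gauge ray direction, and the geometric signature $\epsilon$ (below), with directed weights $t_{\overrightarrow{wb}}=t_{bw}$, $t_{\overrightarrow{bw}}=t_{bw}^{-1}$. Solve the Lam system in half-edge variables: $z_{u,e}=(-1)^{\epsilon(e)}t_{\overrightarrow{uv}}z_{v,e}$ for $e=\overrightarrow{uv}$; $\sum_{e\ni w}z_{w,e}=0$ at white $w$; $z_{b,e}=z_{b,e'}=:z_b$ for all edges at black $b$; with $z_{b_j}(\vec x)=\psi(\kappa_j,\vec x)$, $j\in\bar I$. The un-normalized wave function at the double points is $\psi^{(g)}(P_b,\vec x)=z_b(\vec x)$, $b\in\mathcal B$, and the normalized one is $z_b(\vec x)/z_b(\vec x_0)$. Curve, wave function, divisor. $\Gamma_0=\mathbb{CP}^1$ with coordinate $\zeta$, marked points $\kappa_1,\dots,\kappa_n$, $P_0=\{\zeta=\infty\}$. Each internal vertex $u$ gives a copy $\Gamma_u$ of $\mathbb{CP}^1$ with one real marked point per edge at $u$, in cyclic order; an edge joining internal vertices glues the corresponding marked points; the edge at $b_j$ joining it to $w$ glues $\kappa_j\in\Gamma_0$ to the corresponding point of $\Gamma_w$. In either construction $\hat\psi$ on $\Gamma_0\setminus\{P_0\}$ is $\frac{\prod_l(\zeta-\gamma_l^{(S)}(\vec x))}{\prod_l(\zeta-\gamma_l^{(S)}(\vec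 x_0))}\exp(\sum_i\zeta^i(x_i-x_{i,0}))$; at the points glued by an edge $\overline{bw}$ it is the normalized value at $b$ ($\hat v_b(\vec x)$, resp. $z_b(\vec x)/z_b(\vec x_0)$); it is constant in the spectral parameter on components of black and bivalent white vertices; on $\Gamma_w$, $w$ trivalent white with marked points $Q_1,Q_2,Q_3$ clockwise and coordinate $\zeta(Q_1)=0,\zeta(Q_2)=1,\zeta(Q_3)=\infty$, it is $\frac{\hat\psi(Q_3,\vec x)\zeta-\hat\psi(Q_1,\vec x)\gamma_w}{\zeta-\gamma_w}$, where $\gamma_w$ is the constant with $\gamma_w\hat\psi(Q_1,\vec x)+(1-\gamma_w)\hat\psi(Q_2,\vec x)=\hat\psi(Q_3,\vec x)$ for all $\vec x$. The divisor $\mathcal D_{\mathrm{KP},\Gamma}$ is the sum of the $k$ points of $\Gamma_0$ with coordinates $\gamma_l^{(S)}(\vec x_0)$ and of the $g-k$ points $P_w\in\Gamma_w$ with $\zeta(P_w)=\gamma_w$, $w$ trivalent white. Geometric signature. Edges are straight segments, boundary vertices lie on a common straight interval. A gauge ray direction $\mathfrak l$ is an oriented direction such that rays of direction $\mathfrak l$ from boundary vertices point inside the disk and contain no internal vertices, and no internal edge is parallel to $\mathfrak l$. $s(a,b)=+1,0,-1$ if the ordered pair of directions is positively oriented, parallel, negatively oriented; $wind(e,e')=\pm1$ if $s(e,e')=s(e,\mathfrak l)=s(\mathfrak l,e')=\pm1$, and $0$ otherwise; $int(e)$ is the number (signed by the orientation of $(\mathfrak l,e)$) of intersections of $e$ with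 the rays starting at the boundary sources, the common starting point of a ray and the edge at its source not being counted. For $e=\overrightarrow{uv}$, modulo 2: $\epsilon(e)=int(e)$ if $v$ is white and $u$ internal; $int(e)+1$ if $u$ is a boundary source; $1+int(e)+wind(e_1,e)+wind(e,e_5)$ if $v$ is black internal ($e_1$ ends at $u$, $e_5$ starts at $v$); $1+int(e)+wind(e_1,e)$ if $v$ is a boundary sink ($e_1$ ends at $u$). *)

theory Defs
  imports
    "HOL-Analysis.Analysis"
    "HOL-Computational_Algebra.Polynomial"
    "HOL-Library.Multiset"
    "Jordan_Normal_Form.Determinant"
    "Jordan_Normal_Form.DL_Submatrix"
begin

section \<open>Planar bipartite graphs in the disk\<close>

text \<open>
  Graphs are given by a straight-line drawing, with the vertices being points of the plane
  and the disk a convex one.  The boundary vertices \<open>bdry G 0, \<dots>, bdry G (bnum G - 1)\<close> are black.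
  An edge is the pair of its black and its white end, so multiple edges do not occur.
\<close>

record disk_graph =
  disk :: "complex set"
  bnum :: nat
  bdry :: "nat \<Rightarrow> complex"
  iblack :: "complex set"
  white :: "complex set"
  edges :: "(complex \<times> complex) set"

definition bvertices :: "disk_graph \<Rightarrow> complex set" where
  "bvertices G = bdry G ` {..<bnum G}"

definition black :: "disk_graph \<Rightarrow> complex set" where
  "black G = iblack G \<union> bvertices G"

definition internal :: "disk_graph \<Rightarrow> complex set" where
  "internal G = iblack G \<union> white G"

definition nbrs :: "disk_graph \<Rightarrow> complex \<Rightarrow> complex set" where
  "nbrs G u = {v. (u, v) \<in> edges G \<or> (v, u) \<in> edges G}"

definition degr :: "disk_graph \<Rightarrow> complex \<Rightarrow> nat" where
  "degr G u = card (nbrs G u)"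

abbreviation seg :: "complex \<times> complex \<Rightarrow> complex set" where
  "seg e \<equiv> closed_segment (fst e) (snd e)"

text \<open>Orientation sign of an ordered pair of directions (\<open>Im (cnj a * b)\<close> is their determinant).\<close>

definition orient :: "complex \<Rightarrow> complex \<Rightarrow> int" where
  "orient a b = (if Im (cnj a * b) > 0 then 1 else if Im (cnj a * b) < 0 then - 1 else 0)"

definition perfect_orientation :: "disk_graph \<Rightarrow> (complex \<times> complex) set \<Rightarrow> bool" where
  "perfect_orientation G Or \<longleftrightarrow>
     Or \<subseteq> edges G \<union> (edges G)\<inverse> \<and>
     (\<forall>(b, w) \<in> edges G. (b, w) \<in> Or \<longleftrightarrow> (w, b) \<notin> Or) \<and>
     (\<forall>b \<in> iblack G. \<exists>!w. (b, w) \<in> Or) \<and>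
     (\<forall>w \<in> white G. \<exists>!b. (b, w) \<in> Or)"

definition sources :: "disk_graph \<Rightarrow> (complex \<times> complex) set \<Rightarrow> nat set" where
  "sources G Or = {j. j < bnum G \<and> (\<exists>w. (bdry G j, w) \<in> Or)}"

text \<open>
  The clause with \<open>orient\<close> says that the interior of the disk is to the right when one moves from
  an earlier to a later boundary vertex, that is, the boundary vertices are in clockwise order.
\<close>

definition planar_bipartite_disk_graph :: "disk_graph \<Rightarrow> bool" where
  "planar_bipartite_disk_graph G \<longleftrightarrow>
     compact (disk G) \<and> convex (disk G) \<and> interior (disk G) \<noteq> {} \<and>
     finite (iblack G) \<and> finite (white G) \<and> iblack G \<inter> white G = {} \<and>
     internal G \<subseteq> interior (disk G) \<and>
     inj_on (bdry G) {..<bnum G} \<and>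
     (\<exists>p q. closed_segment p q \<subseteq> frontier (disk G) \<and> bvertices G \<subseteq> closed_segment p q) \<and>
     (\<forall>i j. \<forall>p \<in> interior (disk G). i < j \<and> j < bnum G \<longrightarrow>
        orient (bdry G j - bdry G i) (p - bdry G i) = - 1) \<and>
     edges G \<subseteq> black G \<times> white G \<and>
     (\<forall>e \<in> edges G. \<forall>e' \<in> edges G. e \<noteq> e' \<longrightarrow>
        seg e \<inter> seg e' \<subseteq> {fst e, snd e} \<inter> {fst e', snd e'}) \<and>
     (\<forall>e \<in> edges G. seg e \<inter> (black G \<union> white G) = {fst e, snd e}) \<and>
     (\<forall>b \<in> bvertices G. degr G b = 1) \<and>
     (\<exists>Or. perfect_orientation G Or)"

definition positroid :: "disk_graph \<Rightarrow> nat set set" where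
  "positroid G = {sources G Or | Or. perfect_orientation G Or}"

definition faces :: "disk_graph \<Rightarrow> complex set set" where
  "faces G = components (disk G - (black G \<union> white G \<union> (\<Union>e \<in> edges G. seg e)))"

text \<open>
  As the boundary vertices lie in clockwise order on a straight part of the boundary circle,
  the arc going clockwise from the last one to the first one is the complement of the segment
  between them.
\<close>

definition infinite_arc :: "disk_graph \<Rightarrow> complex set" where
  "infinite_arc G = frontier (disk G) - closed_segment (bdry G 0) (bdry G (bnum G - 1))"

definition finite_faces :: "disk_graph \<Rightarrow> complex set set" where
  "finite_faces G = {\<Omega> \<in> faces G. \<Omega> \<inter> infinite_arc G = {}}"

definition face_edges :: "disk_graph \<Rightarrow> complex set \<Rightarrow> (complex \<times> complex) set" where
  "face_edges G \<Omega> = {e \<in> edges G. seg e \<subseteq> frontier \<Omega>}"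

definition reduced_graph :: "disk_graph \<Rightarrow> bool" where
  "reduced_graph G \<longleftrightarrow>
     (\<forall>u \<in> black G \<union> white G. \<exists>b \<in> bvertices G. (u, b) \<in> (edges G \<union> (edges G)\<inverse>)\<^sup>*) \<and>
     (\<forall>u \<in> internal G. degr G u = 1 \<longrightarrow> nbrs G u \<subseteq> bvertices G) \<and>
     (\<forall>G'. planar_bipartite_disk_graph G' \<and> bnum G' = bnum G \<and> positroid G' = positroid G \<longrightarrow>
        card (faces G) \<le> card (faces G'))"


section \<open>Positroid cells and edge weights\<close>

text \<open>Columns of matrices, boundary vertices and phases are numbered from \<open>0\<close>.\<close>

definition plucker :: "real mat \<Rightarrow> nat set \<Rightarrow> real" where
  "plucker A I = Determinant.det (submatrix A UNIV I)"

definition ksubsets :: "nat \<Rightarrow> nat \<Rightarrow> nat set set" where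
  "ksubsets k n = {I. I \<subseteq> {..<n} \<and> card I = k}"

text \<open>\<open>A\<close> represents a point of the cell of \<open>M\<close> in the totally non-negative Grassmannian.\<close>

definition represents_cell_point :: "nat \<Rightarrow> nat \<Rightarrow> nat set set \<Rightarrow> real mat \<Rightarrow> bool" where
  "represents_cell_point k n M A \<longleftrightarrow>
     A \<in> carrier_mat k n \<and>
     (\<exists>I \<in> ksubsets k n. plucker A I \<noteq> 0) \<and>
     (\<forall>I \<in> ksubsets k n. plucker A I \<ge> 0) \<and>
     (\<forall>I \<in> ksubsets k n. plucker A I > 0 \<longleftrightarrow> I \<in> M)"

text \<open>
  The cell as a subspace of the Grassmannian in its Pluecker embedding; a point of projective space
  with non-negative homogeneous coordinates is identified with the unique coordinate vector of
  sum one.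
\<close>

definition plucker_point :: "nat \<Rightarrow> nat \<Rightarrow> real mat \<Rightarrow> nat set \<Rightarrow> real" where
  "plucker_point k n A I =
     (if I \<in> ksubsets k n then plucker A I / (\<Sum>J \<in> ksubsets k n. plucker A J) else 0)"

definition positroid_cell :: "nat \<Rightarrow> nat \<Rightarrow> nat set set \<Rightarrow> (nat set \<Rightarrow> real) set" where
  "positroid_cell k n M = plucker_point k n ` {A. represents_cell_point k n M A}"

definition cell_dimension :: "(nat set \<Rightarrow> real) set \<Rightarrow> nat \<Rightarrow> bool" where
  "cell_dimension S g \<longleftrightarrow> top_of_set S homeomorphic_space Euclidean_space g"

definition irreducible_positroid :: "nat \<Rightarrow> nat set set \<Rightarrow> bool" where
  "irreducible_positroid n M \<longleftrightarrow> (\<forall>j < n. (\<exists>I \<in> M. j \<in> I) \<and> (\<exists>J \<in> M. j \<notin> J))"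

definition almost_perfect_matchings :: "disk_graph \<Rightarrow> nat set \<Rightarrow> (complex \<times> complex) set set" where
  "almost_perfect_matchings G I =
     {m. m \<subseteq> edges G \<and>
         (\<forall>u \<in> internal G. \<exists>!e. e \<in> m \<and> (fst e = u \<or> snd e = u)) \<and>
         I = {j. j < bnum G \<and> (\<exists>w. (bdry G j, w) \<in> m)}}"

definition matching_sum :: "disk_graph \<Rightarrow> (complex \<times> complex \<Rightarrow> real) \<Rightarrow> nat set \<Rightarrow> real" where
  "matching_sum G t I = (\<Sum>m \<in> almost_perfect_matchings G I. \<Prod>e \<in> m. t e)"

text \<open>Pluecker coordinates are homogeneous, hence the factor \<open>c\<close>.\<close>

definition weights_represent :: "disk_graph \<Rightarrow> nat \<Rightarrow> (complex \<times> complex \<Rightarrow> real) \<Rightarrow> real mat \<Rightarrow> bool" where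
  "weights_represent G k t A \<longleftrightarrow>
     (\<forall>e \<in> edges G. t e > 0) \<and>
     (\<exists>c. c \<noteq> 0 \<and> (\<forall>I \<in> ksubsets k (bnum G). plucker A I = c * matching_sum G t I))"

definition kasteleyn_signature :: "disk_graph \<Rightarrow> (complex \<times> complex \<Rightarrow> real) \<Rightarrow> bool" where
  "kasteleyn_signature G \<sigma> \<longleftrightarrow>
     (\<forall>e \<in> edges G. \<sigma> e = 1 \<or> \<sigma> e = - 1) \<and>
     (\<forall>\<Omega> \<in> finite_faces G.
        (\<Prod>e \<in> face_edges G \<Omega>. \<sigma> e) = (- 1) ^ (card (face_edges G \<Omega>) div 2 + 1))"


section \<open>KP data on the Sato component\<close>

text \<open>KP times \<open>x 1, x 2, \<dots>\<close>, finitely many of them non-zero; the entry \<open>x 0\<close> is a dummy.\<close>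

definition kp_times :: "(nat \<Rightarrow> real) set" where
  "kp_times = {x. x 0 = 0 \<and> finite {i. x i \<noteq> 0}}"

definition theta :: "(nat \<Rightarrow> real) \<Rightarrow> nat \<Rightarrow> (nat \<Rightarrow> real) \<Rightarrow> real" where
  "theta \<kappa> j x = (\<Sum>i | x i \<noteq> 0. \<kappa> j ^ i * x i)"

definition heat_solution :: "(nat \<Rightarrow> real) \<Rightarrow> real mat \<Rightarrow> nat \<Rightarrow> (nat \<Rightarrow> real) \<Rightarrow> real" where
  "heat_solution \<kappa> A i x = (\<Sum>j < dim_col A. A $$ (i, j) * exp (theta \<kappa> j x))"

definition dx_pow :: "nat \<Rightarrow> ((nat \<Rightarrow> real) \<Rightarrow> real) \<Rightarrow> (nat \<Rightarrow> real) \<Rightarrow> real" where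
  "dx_pow m f x = (deriv ^^ m) (\<lambda>s. f (x(1 := s))) (x 1)"

text \<open>\<open>wc m\<close> is the coefficient \<open>\<ww>\<^sub>m\<close> of the dressing operator.\<close>

definition dressing_coeffs ::
  "nat \<Rightarrow> (nat \<Rightarrow> real) \<Rightarrow> real mat \<Rightarrow> (nat \<Rightarrow> (nat \<Rightarrow> real) \<Rightarrow> real) \<Rightarrow> bool" where
  "dressing_coeffs k \<kappa> A wc \<longleftrightarrow>
     (\<forall>x \<in> kp_times. \<forall>i < k.
        dx_pow k (heat_solution \<kappa> A i) x
          - (\<Sum>m = 1..k. wc m x * dx_pow (k - m) (heat_solution \<kappa> A i) x) = 0)"

definition sato_roots ::
  "nat \<Rightarrow> nat \<Rightarrow> (nat \<Rightarrow> real) \<Rightarrow> (nat \<Rightarrow> (nat \<Rightarrow> real) \<Rightarrow> real) \<Rightarrow> (nat \<Rightarrow> (nat \<Rightarrow> real) \<Rightarrow> real) \<Rightarrow> bool" where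
  "sato_roots k n \<kappa> wc \<gamma> \<longleftrightarrow>
     (\<forall>x \<in> kp_times. (\<forall>l < k. \<gamma> l x \<in> {\<kappa> 0..\<kappa> (n - 1)}) \<and>
        monom 1 k - (\<Sum>m = 1..k. monom (wc m x) (k - m)) = (\<Prod>l < k. [:- \<gamma> l x, 1:]))"

definition sato_psi ::
  "nat \<Rightarrow> (nat \<Rightarrow> real) \<Rightarrow> (nat \<Rightarrow> (nat \<Rightarrow> real) \<Rightarrow> real) \<Rightarrow> nat \<Rightarrow> (nat \<Rightarrow> real) \<Rightarrow> real" where
  "sato_psi k \<kappa> \<gamma> j x = (\<Prod>l < k. \<kappa> j - \<gamma> l x) * exp (theta \<kappa> j x)"


section \<open>The Kasteleyn system of relations\<close>

definition kasteleyn_matrix ::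
  "disk_graph \<Rightarrow> (complex \<times> complex \<Rightarrow> real) \<Rightarrow> (complex \<times> complex \<Rightarrow> real) \<Rightarrow> complex \<Rightarrow> complex \<Rightarrow> real" where
  "kasteleyn_matrix G \<sigma> t b w = (if (b, w) \<in> edges G then \<sigma> (b, w) * t (b, w) else 0)"

definition kasteleyn_solution ::
  "disk_graph \<Rightarrow> (complex \<times> complex \<Rightarrow> real) \<Rightarrow> (complex \<times> complex \<Rightarrow> real) \<Rightarrow>
   (nat \<Rightarrow> (nat \<Rightarrow> real) \<Rightarrow> real) \<Rightarrow> (complex \<Rightarrow> (nat \<Rightarrow> real) \<Rightarrow> real) \<Rightarrow> bool" where
  "kasteleyn_solution G \<sigma> t \<psi> v \<longleftrightarrow>
     (\<forall>x \<in> kp_times.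
        (\<forall>w \<in> white G. (\<Sum>b \<in> black G. kasteleyn_matrix G \<sigma> t b w * v b x) = 0) \<and>
        (\<forall>j < bnum G. v (bdry G j) x = \<psi> j x))"


section \<open>Geometric signature and the Lam system of relations\<close>

definition gauge_direction :: "disk_graph \<Rightarrow> complex \<Rightarrow> bool" where
  "gauge_direction G \<ll> \<longleftrightarrow>
     \<ll> \<noteq> 0 \<and>
     (\<forall>b \<in> bvertices G. \<exists>r > 0. b + of_real r * \<ll> \<in> interior (disk G)) \<and>
     (\<forall>b \<in> bvertices G. \<forall>r \<ge> 0. b + of_real r * \<ll> \<notin> internal G) \<and>
     (\<forall>(b, w) \<in> edges G. b \<in> iblack G \<longrightarrow> orient \<ll> (w - b) \<noteq> 0)"

definition wind :: "complex \<Rightarrow> complex \<Rightarrow> complex \<Rightarrow> int" where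
  "wind \<ll> e e' =
     (if orient e e' = orient e \<ll> \<and> orient e \<ll> = orient \<ll> e' then orient e e' else 0)"

text \<open>
  The rays are open at their starting points, so that a ray is not counted as meeting the edge
  at its source.  A ray meets an edge not parallel to it at most once.
\<close>

definition int_number ::
  "disk_graph \<Rightarrow> (complex \<times> complex) set \<Rightarrow> complex \<Rightarrow> complex \<times> complex \<Rightarrow> int" where
  "int_number G Or \<ll> e =
     (\<Sum>j | j \<in> sources G Or \<and> seg e \<inter> {bdry G j + of_real r * \<ll> | r. r > 0} \<noteq> {}.
        orient \<ll> (snd e - fst e))"

definition geometric_signature ::
  "disk_graph \<Rightarrow> (complex \<times> complex) set \<Rightarrow> complex \<Rightarrow> complex \<times> complex \<Rightarrow> int" where
  "geometric_signature G Or \<ll> e =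
     (let u = fst e; v = snd e;
          d = v - u;
          d1 = u - (THE p. (p, u) \<in> Or);
          d5 = (THE q. (v, q) \<in> Or) - v;
          i = int_number G Or \<ll> e
      in if v \<in> white G then (if u \<in> internal G then i else i + 1)
         else if v \<in> internal G then 1 + i + wind \<ll> d1 d + wind \<ll> d d5
         else 1 + i + wind \<ll> d1 d)"

definition arc_edge :: "disk_graph \<Rightarrow> complex \<times> complex \<Rightarrow> complex \<times> complex" where
  "arc_edge G e = (if e \<in> edges G then e else (snd e, fst e))"

definition arc_weight :: "disk_graph \<Rightarrow> (complex \<times> complex \<Rightarrow> real) \<Rightarrow> complex \<times> complex \<Rightarrow> real" where
  "arc_weight G t e = (if e \<in> edges G then inverse (t e) else t (snd e, fst e))"

text \<open>\<open>h u e\<close> is the half-edge variable of the edge \<open>e\<close> at its end \<open>u\<close>, and \<open>z b\<close> the common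
  value of the half-edge variables at the black vertex \<open>b\<close>.\<close>

definition lam_solution ::
  "disk_graph \<Rightarrow> (complex \<times> complex) set \<Rightarrow> complex \<Rightarrow> (complex \<times> complex \<Rightarrow> real) \<Rightarrow>
   (nat \<Rightarrow> (nat \<Rightarrow> real) \<Rightarrow> real) \<Rightarrow>
   (complex \<Rightarrow> complex \<times> complex \<Rightarrow> (nat \<Rightarrow> real) \<Rightarrow> real) \<Rightarrow> (complex \<Rightarrow> (nat \<Rightarrow> real) \<Rightarrow> real) \<Rightarrow> bool" where
  "lam_solution G Or \<ll> t \<psi> h z \<longleftrightarrow>
     (\<forall>x \<in> kp_times.
        (\<forall>(u, v) \<in> Or. h u (arc_edge G (u, v)) x =
           (- 1) powi geometric_signature G Or \<ll> (u, v) * arc_weight G t (u, v)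
             * h v (arc_edge G (u, v)) x) \<and>
        (\<forall>w \<in> white G. (\<Sum>e \<in> {e \<in> edges G. snd e = w}. h w e x) = 0) \<and>
        (\<forall>(b, w) \<in> edges G. h b (b, w) x = z b x) \<and>
        (\<forall>j < bnum G. j \<notin> sources G Or \<longrightarrow> z (bdry G j) x = \<psi> j x))"


section \<open>The reducible curve\<close>

datatype cp1 = Fin complex | Infty

datatype curve_component = Sato | Vert complex

definition clockwise :: "complex \<Rightarrow> complex \<Rightarrow> complex \<Rightarrow> complex \<Rightarrow> bool" where
  "clockwise u q1 q2 q3 \<longleftrightarrow>
     0 < Arg2pi ((q3 - u) / (q1 - u)) \<and> Arg2pi ((q3 - u) / (q1 - u)) < Arg2pi ((q2 - u) / (q1 - u))"

text \<open>
  \<open>mk u v\<close> is the marked point of the edge joining \<open>u\<close> and \<open>v\<close> on the component of \<open>u\<close>.  The marked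
  points at trivalent vertices are, in clockwise order, \<open>0, 1, \<infinity>\<close>; at black vertices this is a choice
  of the coordinate.
\<close>

definition marking :: "disk_graph \<Rightarrow> (complex \<Rightarrow> complex \<Rightarrow> cp1) \<Rightarrow> bool" where
  "marking G mk \<longleftrightarrow>
     (\<forall>u \<in> internal G.
        inj_on (mk u) (nbrs G u) \<and>
        mk u ` nbrs G u \<subseteq> insert Infty {Fin (of_real r) | r. True} \<and>
        (degr G u = 3 \<longrightarrow>
          (\<exists>q1 q2 q3. nbrs G u = {q1, q2, q3} \<and> clockwise u q1 q2 q3 \<and>
             mk u q1 = Fin 0 \<and> mk u q2 = Fin 1 \<and> mk u q3 = Infty)))"

definition normalization :: "disk_graph \<Rightarrow> (curve_component \<times> cp1) set" where
  "normalization G = insert Sato (Vert ` internal G) \<times> UNIV"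

definition node ::
  "disk_graph \<Rightarrow> (complex \<Rightarrow> complex \<Rightarrow> cp1) \<Rightarrow> (nat \<Rightarrow> real) \<Rightarrow> complex \<times> complex \<Rightarrow>
   (curve_component \<times> cp1) set" where
  "node G mk \<kappa> e =
     (let b = fst e; w = snd e in
      {(Vert w, mk w b)} \<union>
      (if b \<in> iblack G then {(Vert b, mk b w)}
       else {(Sato, Fin (of_real (\<kappa> j))) | j. j < bnum G \<and> bdry G j = b}))"

definition gluing ::
  "disk_graph \<Rightarrow> (complex \<Rightarrow> complex \<Rightarrow> cp1) \<Rightarrow> (nat \<Rightarrow> real) \<Rightarrow>
   ((curve_component \<times> cp1) \<times> (curve_component \<times> cp1)) set" where
  "gluing G mk \<kappa> =
     {(p, q) \<in> normalization G \<times> normalization G.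
        p = q \<or> (\<exists>e \<in> edges G. p \<in> node G mk \<kappa> e \<and> q \<in> node G mk \<kappa> e)}"

text \<open>The points of the curve are the classes of points of its normalization.\<close>

definition curve ::
  "disk_graph \<Rightarrow> (complex \<Rightarrow> complex \<Rightarrow> cp1) \<Rightarrow> (nat \<Rightarrow> real) \<Rightarrow> (curve_component \<times> cp1) set set" where
  "curve G mk \<kappa> = normalization G // gluing G mk \<kappa>"

definition curve_point ::
  "disk_graph \<Rightarrow> (complex \<Rightarrow> complex \<Rightarrow> cp1) \<Rightarrow> (nat \<Rightarrow> real) \<Rightarrow> curve_component \<times> cp1 \<Rightarrow>
   (curve_component \<times> cp1) set" where
  "curve_point G mk \<kappa> p = gluing G mk \<kappa> `` {p}"


section \<open>Wave function and divisor\<close>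

text \<open>
  Both constructions proceed in the same way from the un-normalized values \<open>y b x\<close> at the black
  vertices: \<open>y\<close> is \<open>v\<close> for the Kasteleyn and \<open>z\<close> for the Lam system of relations.
\<close>

definition normalized_value ::
  "(complex \<Rightarrow> (nat \<Rightarrow> real) \<Rightarrow> real) \<Rightarrow> (nat \<Rightarrow> real) \<Rightarrow> complex \<Rightarrow> (nat \<Rightarrow> real) \<Rightarrow> real" where
  "normalized_value y x0 b x = y b x / y b x0"

definition nbr_at :: "disk_graph \<Rightarrow> (complex \<Rightarrow> complex \<Rightarrow> cp1) \<Rightarrow> complex \<Rightarrow> cp1 \<Rightarrow> complex" where
  "nbr_at G mk w q = (THE b. b \<in> nbrs G w \<and> mk w b = q)"

definition white_divisor_number ::
  "disk_graph \<Rightarrow> (complex \<Rightarrow> complex \<Rightarrow> cp1) \<Rightarrow> (complex \<Rightarrow> (nat \<Rightarrow> real) \<Rightarrow> real) \<Rightarrow> (nat \<Rightarrow> real) \<Rightarrow>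
   complex \<Rightarrow> real" where
  "white_divisor_number G mk y x0 w =
     (THE c. \<forall>x \<in> kp_times.
        c * normalized_value y x0 (nbr_at G mk w (Fin 0)) x
          + (1 - c) * normalized_value y x0 (nbr_at G mk w (Fin 1)) x
        = normalized_value y x0 (nbr_at G mk w Infty) x)"

definition trivalent_white :: "disk_graph \<Rightarrow> complex set" where
  "trivalent_white G = {w \<in> white G. degr G w = 3}"

fun sato_wave ::
  "nat \<Rightarrow> (nat \<Rightarrow> (nat \<Rightarrow> real) \<Rightarrow> real) \<Rightarrow> (nat \<Rightarrow> real) \<Rightarrow> cp1 \<Rightarrow> (nat \<Rightarrow> real) \<Rightarrow> complex" where
  "sato_wave k \<gamma> x0 (Fin \<zeta>) x =
     (\<Prod>l < k. \<zeta> - of_real (\<gamma> l x)) / (\<Prod>l < k. \<zeta> - of_real (\<gamma> l x0))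
       * exp (\<Sum>i | x i \<noteq> x0 i. \<zeta> ^ i * of_real (x i - x0 i))"
| "sato_wave k \<gamma> x0 Infty x = undefined"

fun white_wave :: "real \<Rightarrow> real \<Rightarrow> real \<Rightarrow> cp1 \<Rightarrow> complex" where
  "white_wave c \<psi>1 \<psi>3 (Fin \<zeta>) =
     (of_real \<psi>3 * \<zeta> - of_real (\<psi>1 * c)) / (\<zeta> - of_real c)"
| "white_wave c \<psi>1 \<psi>3 Infty = of_real \<psi>3"

text \<open>
  On a component of a bivalent white vertex the wave function has the common value at the two
  marked points, whence the choice of a neighbour below.
\<close>

definition wave_normalization ::
  "disk_graph \<Rightarrow> (complex \<Rightarrow> complex \<Rightarrow> cp1) \<Rightarrow> nat \<Rightarrow> (nat \<Rightarrow> real) \<Rightarrow> (nat \<Rightarrow> (nat \<Rightarrow> real) \<Rightarrow> real) \<Rightarrow>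
   (nat \<Rightarrow> real) \<Rightarrow> (complex \<Rightarrow> (nat \<Rightarrow> real) \<Rightarrow> real) \<Rightarrow> curve_component \<times> cp1 \<Rightarrow> (nat \<Rightarrow> real) \<Rightarrow> complex" where
  "wave_normalization G mk k \<kappa> \<gamma> x0 y p x =
     (if \<exists>e \<in> edges G. p \<in> node G mk \<kappa> e
      then of_real (normalized_value y x0 (fst (THE e. e \<in> edges G \<and> p \<in> node G mk \<kappa> e)) x)
      else case fst p of
        Sato \<Rightarrow> sato_wave k \<gamma> x0 (snd p) x
      | Vert u \<Rightarrow>
          (if u \<in> trivalent_white G
           then white_wave (white_divisor_number G mk y x0 u)
                  (normalized_value y x0 (nbr_at G mk u (Fin 0)) x)
                  (normalized_value y x0 (nbr_at G mk u Infty) x) (snd p)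
           else if u \<in> white G then of_real (normalized_value y x0 (SOME b. b \<in> nbrs G u) x)
           else of_real (normalized_value y x0 u x)))"

definition wave_function ::
  "disk_graph \<Rightarrow> (complex \<Rightarrow> complex \<Rightarrow> cp1) \<Rightarrow> nat \<Rightarrow> (nat \<Rightarrow> real) \<Rightarrow> (nat \<Rightarrow> (nat \<Rightarrow> real) \<Rightarrow> real) \<Rightarrow>
   (nat \<Rightarrow> real) \<Rightarrow> (complex \<Rightarrow> (nat \<Rightarrow> real) \<Rightarrow> real) \<Rightarrow> (curve_component \<times> cp1) set \<Rightarrow> (nat \<Rightarrow> real) \<Rightarrow> complex" where
  "wave_function G mk k \<kappa> \<gamma> x0 y P x =
     the_elem ((\<lambda>p. wave_normalization G mk k \<kappa> \<gamma> x0 y p x) ` P)"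

definition kp_divisor ::
  "disk_graph \<Rightarrow> (complex \<Rightarrow> complex \<Rightarrow> cp1) \<Rightarrow> nat \<Rightarrow> (nat \<Rightarrow> real) \<Rightarrow> (nat \<Rightarrow> (nat \<Rightarrow> real) \<Rightarrow> real) \<Rightarrow>
   (nat \<Rightarrow> real) \<Rightarrow> (complex \<Rightarrow> (nat \<Rightarrow> real) \<Rightarrow> real) \<Rightarrow> (curve_component \<times> cp1) set multiset" where
  "kp_divisor G mk k \<kappa> \<gamma> x0 y =
     image_mset (\<lambda>l. curve_point G mk \<kappa> (Sato, Fin (of_real (\<gamma> l x0)))) (mset_set {..<k}) +
     image_mset (\<lambda>w. curve_point G mk \<kappa> (Vert w, Fin (of_real (white_divisor_number G mk y x0 w))))
       (mset_set (trivalent_white G))"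

end

theory Submission
  imports Defs
begin

text \<open>
  The solutions of the two systems of relations agree up to a sign at each vertex that does not
  depend on the times (\<open>solutions_agree\<close>).  Such signs cancel in the normalized values at the
  black vertices, and these determine the wave function and the divisor
  (\<open>constructions_agree\<close>).

  Eliminating the half-edge variables turns the Lam system into a system of the same form as the
  Kasteleyn one, with the signs \<open>(- 1) powi \<epsilon>(e)\<close> in place of \<open>\<sigma>(e)\<close> (\<open>lam_equation\<close>).
  One passes from one system of signs to the other by signs at the vertices that are \<open>1\<close> on the
  boundary, once both have equal products along all directed polygons and all directed paths from a
  source to a sink of the perfect orientation: the sign at a vertex is then the quotient of the two
  products along any directed walk from it to the boundary (\<open>gauge_exists\<close>).  Both products are
  computed with an additional factor \<open>\<i>\<close> for each edge.

  On the Kasteleyn side, the product around any polygon is \<open>- 1\<close> if the number of vertices inside is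
  even and \<open>1\<close> otherwise (\<open>kasteleyn_polygon\<close>).  A polygon with nothing inside bounds a
  face, and every other polygon is cut by a chord.  The segments between consecutive boundary vertices
  are admitted as sides, so that this applies to paths between boundary vertices as well.  A perfect
  orientation matches the vertices inside a directed polygon with each other, so their number is even;
  for a path from a source to a sink the vertices that are left over are matched with the sources in
  between (\<open>inside_vertices_matched\<close>).

  On the geometric side, the winding numbers of consecutive edges add up, modulo two, to the turning
  number of a polygon, which is odd (\<open>turning_number_odd\<close>).  Whether a path crosses a gauge
  ray an even or an odd number of times depends on its ends only.  This yields the same two values
  (\<open>directed_cycle_sign\<close>, \<open>directed_boundary_path_sign\<close>).

  The existence of chords and of directed walks to the boundary uses that the graph is reduced: every
  edge is traversed in both directions by suitable perfect orientations (\<open>all_flexible\<close>).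
  Otherwise removing edges would merge two faces without changing the positroid.  Finally, the Kasteleyn
  system has at most one solution with given values at the sinks (\<open>kernel_trivial\<close>), because
  a solution of the homogeneous system would produce a directed polygon with the wrong sign.
\<close>

section \<open>Polygons in straight-line plane graphs\<close>

text \<open>The pairs of consecutive entries of a list: the steps of a walk given by its vertices.\<close>

definition steps :: "'a list \<Rightarrow> ('a \<times> 'a) list" where
  "steps xs = zip xs (tl xs)"

text \<open>The closed walk that visits the vertices of a list in their order and then returns to the first one.\<close>

definition circ :: "'a list \<Rightarrow> 'a list" where
  "circ cs = cs @ [hd cs]"

lemma steps_simps [simp]:
  "steps [] = []" "steps [a] = []" "steps (a # b # xs) = (a, b) # steps (b # xs)"
  by (simp_all add: steps_def)

lemma steps_append: "steps (xs @ a # ys) = steps (xs @ [a]) @ steps (a # ys)"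
  by (induction xs rule: induct_list012) (auto simp: neq_Nil_conv)

lemma steps_rev: "steps (rev xs) = rev (map prod.swap (steps xs))"
proof (induction xs rule: induct_list012)
  case (3 a b xs)
  have "steps (rev (a # b # xs)) = steps (rev xs @ b # [a])" by simp
  also have "\<dots> = steps (rev (b # xs)) @ [(b, a)]" by (subst steps_append) simp
  finally show ?case using 3 by simp
qed auto

lemma successively_steps: "successively R xs \<longleftrightarrow> (\<forall>(a, b) \<in> set (steps xs). R a b)"
  by (induction xs rule: induct_list012) auto

lemma in_steps: "(a, b) \<in> set (steps xs) \<Longrightarrow> a \<in> set xs \<and> b \<in> set xs"
  by (induction xs rule: induct_list012) auto

lemma set_steps_append: "set (steps (xs @ a # ys)) = set (steps (xs @ [a])) \<union> set (steps (a # ys))"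
  by (subst steps_append) auto

lemma set_steps_rev: "set (steps (rev xs)) = (set (steps xs))\<inverse>"
  by (auto simp: steps_rev)

lemma distinct_steps: "distinct xs \<Longrightarrow> distinct (steps (xs @ [a]))"
proof (induction xs rule: induct_list012)
  case (3 x y xs)
  then show ?case using in_steps[of x y "y # xs @ [a]"]
    by (cases xs) (auto dest: in_steps)
qed auto

lemma circ_rotate:
  fixes f :: "'a \<times> 'a \<Rightarrow> 'b :: comm_monoid_mult"
  shows "prod_list (map f (steps (circ (us @ vs)))) = prod_list (map f (steps (circ (vs @ us))))"
    and "set (steps (circ (us @ vs))) = set (steps (circ (vs @ us)))"
proof -
  have "mset (steps (circ (us @ vs))) = mset (steps (circ (vs @ us)))"
  proof (cases us)
    case Nil
    then show ?thesis by simp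
  next
    case us: (Cons a us')
    show ?thesis
    proof (cases vs)
      case Nil
      then show ?thesis by simp
    next
      case (Cons b vs')
      then show ?thesis
        using steps_append[of us b "vs' @ [a]"] steps_append[of vs a "us' @ [b]"] us
        by (simp add: circ_def)
    qed
  qed
  then have *: "mset (map f (steps (circ (us @ vs)))) = mset (map f (steps (circ (vs @ us))))"
    and "set_mset (mset (steps (circ (us @ vs)))) = set_mset (mset (steps (circ (vs @ us))))"
    by (simp_all only: mset_map)
  then show "set (steps (circ (us @ vs))) = set (steps (circ (vs @ us)))" by simp
  show "prod_list (map f (steps (circ (us @ vs)))) = prod_list (map f (steps (circ (vs @ us))))"
    using * by (metis prod_mset_prod_list)
qed

text \<open>
  A plane graph with straight edges, given by its adjacency relation: different edges meet in common
  ends only.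
\<close>

definition plane_adj :: "(complex \<Rightarrow> complex \<Rightarrow> bool) \<Rightarrow> bool" where
  "plane_adj A \<longleftrightarrow>
     (\<forall>a b. A a b \<longrightarrow> A b a \<and> a \<noteq> b) \<and>
     (\<forall>a b c d. A a b \<and> A c d \<and> {a, b} \<noteq> {c, d} \<longrightarrow>
        closed_segment a b \<inter> closed_segment c d \<subseteq> {a, b} \<inter> {c, d})"

text \<open>
  A closed walk with at least three vertices that does not repeat a vertex.  For a plane adjacency
  relation it is a polygon without self-intersections; for a directed relation it is a directed one.
\<close>

definition cycle :: "('a \<Rightarrow> 'a \<Rightarrow> bool) \<Rightarrow> 'a list \<Rightarrow> bool" where
  "cycle A cs \<longleftrightarrow> 3 \<le> length cs \<and> distinct cs \<and> successively A (circ cs)"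

text \<open>The union of the segments of a polygonal path.\<close>

definition ptrace :: "complex list \<Rightarrow> complex set" where
  "ptrace xs = (\<Union>(a, b) \<in> set (steps xs). closed_segment a b)"

lemma plane_adjD:
  assumes "plane_adj A"
  shows "A a b \<Longrightarrow> A b a" "A a b \<Longrightarrow> a \<noteq> b"
    "A a b \<Longrightarrow> A c d \<Longrightarrow> {a, b} \<noteq> {c, d} \<Longrightarrow>
       closed_segment a b \<inter> closed_segment c d \<subseteq> {a, b} \<inter> {c, d}"
  using assms unfolding plane_adj_def by blast+

lemma ptrace_append: "ptrace (xs @ a # ys) = ptrace (xs @ [a]) \<union> ptrace (a # ys)"
  unfolding ptrace_def by (subst set_steps_append) simp

lemma ptrace_rev: "ptrace (rev xs) = ptrace xs"
  by (auto simp: ptrace_def set_steps_rev closed_segment_commute)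

lemma set_subset_ptrace: "2 \<le> length xs \<Longrightarrow> set xs \<subseteq> ptrace xs"
proof (induction xs rule: induct_list012)
  case (3 a b xs)
  then show ?case by (cases xs) (auto simp: ptrace_def)
qed auto

lemma ptrace_inter:
  assumes "plane_adj A" "successively A xs" "successively A ys"
    and "\<And>a b. (a, b) \<in> set (steps xs) \<Longrightarrow> (a, b) \<notin> set (steps ys) \<and> (b, a) \<notin> set (steps ys)"
  shows "ptrace xs \<inter> ptrace ys \<subseteq> set xs \<inter> set ys"
proof
  fix x assume "x \<in> ptrace xs \<inter> ptrace ys"
  then obtain a b c d where ab: "(a, b) \<in> set (steps xs)" "x \<in> closed_segment a b"
    and cd: "(c, d) \<in> set (steps ys)" "x \<in> closed_segment c d"
    unfolding ptrace_def by blast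
  have "{a, b} \<noteq> {c, d}"
    using assms(4)[OF ab(1)] cd(1) by (auto simp: doubleton_eq_iff)
  then have "x \<in> {a, b} \<inter> {c, d}"
    using plane_adjD(3)[OF assms(1), of a b c d] assms(2,3) ab cd
    unfolding successively_steps by blast
  then show "x \<in> set xs \<inter> set ys" using in_steps[OF ab(1)] in_steps[OF cd(1)] by blast
qed

text \<open>
  The parametrized polygonal path with the given vertices.  Lists with fewer than two entries get a
  dummy value.
\<close>

fun polyline :: "complex list \<Rightarrow> real \<Rightarrow> complex" where
  "polyline [a, b] = linepath a b"
| "polyline (a # b # c # xs) = linepath a b +++ polyline (b # c # xs)"
| "polyline xs = linepath 0 0"

lemma pathstart_polyline: "pathstart (polyline (a # b # xs)) = a"
  by (cases xs) auto

lemma pathfinish_polyline: "pathfinish (polyline (xs @ [a, b])) = b"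
proof (induction xs)
  case (Cons x xs)
  show ?case
  proof (cases xs)
    case (Cons y ys)
    then have "polyline (x # xs @ [a, b]) = linepath x y +++ polyline (xs @ [a, b])"
      by (cases ys) auto
    then show ?thesis using Cons.IH by simp
  qed simp
qed auto

lemma pathfinish_polyline_snoc: "xs \<noteq> [] \<Longrightarrow> pathfinish (polyline (xs @ [b])) = b"
  using pathfinish_polyline[of "butlast xs" "last xs" b] by (cases xs rule: rev_cases) simp_all

lemma path_image_polyline: "2 \<le> length xs \<Longrightarrow> path_image (polyline xs) = ptrace xs"
  by (induction xs rule: polyline.induct) (auto simp: ptrace_def path_image_join pathstart_polyline)

lemma arc_polyline:
  assumes "plane_adj A" "distinct xs" "successively A xs" "2 \<le> length xs"
  shows "arc (polyline xs)"
  using assms(2-)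
proof (induction xs rule: polyline.induct)
  case (1 a b)
  then show ?case by (simp add: arc_linepath)
next
  case (2 a b c xs)
  have "ptrace [a, b] \<inter> ptrace (b # c # xs) \<subseteq> set [a, b] \<inter> set (b # c # xs)"
    using 2(2,3) assms(1) by (intro ptrace_inter[of A]) (auto dest: in_steps)
  then have "path_image (linepath a b) \<inter> path_image (polyline (b # c # xs)) \<subseteq> {b}"
    using 2(2) path_image_polyline[of "b # c # xs"] by (auto simp: ptrace_def)
  then show ?case
    using 2 by (simp add: arc_join_eq pathstart_polyline arc_linepath)
qed auto

lemma cycle_rotate: "cycle A (us @ vs) \<longleftrightarrow> cycle A (vs @ us)"
  unfolding cycle_def successively_steps by (auto simp: circ_rotate(2)[of us vs])

lemma ptrace_rotate: "ptrace (circ (us @ vs)) = ptrace (circ (vs @ us))"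
  by (simp add: ptrace_def circ_rotate(2)[of us vs])

lemma ptrace_circ_split:
  "ptrace (circ (a # xs @ b # ys)) = ptrace (a # xs @ [b]) \<union> ptrace (b # ys @ [a])"
  using ptrace_append[of "a # xs" b "ys @ [a]"] by (simp add: circ_def)

lemma set_subset_ptrace_circ: "2 \<le> length cs \<Longrightarrow> set cs \<subseteq> ptrace (circ cs)"
  using set_subset_ptrace[of "circ cs"] by (auto simp: circ_def)

lemma steps_ends:
  assumes "distinct (a # xs @ [b])" "(u, v) \<in> set (steps (a # xs @ [b]))"
    and "u \<in> {a, b}" "v \<in> {a, b}" "u \<noteq> v"
  shows "xs = []"
proof (cases xs)
  case (Cons x xs')
  have 1: "(u, v) = (a, x) \<or> (u, v) \<in> set (steps (x # xs' @ [b]))"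
    using assms(2) unfolding Cons by simp
  have 2: "a \<notin> set (x # xs' @ [b])" "x \<noteq> b" "x \<noteq> a" using assms(1) Cons by auto
  have False
  proof (cases "(u, v) = (a, x)")
    case True
    then show False using 2 assms(4) by auto
  next
    case False
    then have "u \<in> set (x # xs' @ [b])" "v \<in> set (x # xs' @ [b])" using 1 in_steps[of u v "x # xs' @ [b]"] by blast+
    then show False using 2 assms(3-5) by blast
  qed
  then show ?thesis ..
qed

lemma steps_circ_split:
  "steps (circ (a # xs @ b # ys)) = steps (a # xs @ [b]) @ steps (b # ys @ [a])"
  using steps_append[of "a # xs" b "ys @ [a]"] by (simp add: circ_def)

lemma cycle_arcs:
  assumes "cycle A (a # xs @ b # ys)"
  shows "successively A (a # xs @ [b])" "successively A (b # ys @ [a])"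
  using assms unfolding cycle_def successively_steps steps_circ_split by (simp_all add: ball_Un)

text \<open>Two arcs of a polygon with common ends meet in their ends only.\<close>

lemma cycle_arcs_inter:
  assumes "plane_adj A" "cycle A (a # xs @ b # ys)"
  shows "ptrace (a # xs @ [b]) \<inter> ptrace (b # ys @ [a]) = {a, b}"
proof -
  have sc: "successively A (a # xs @ [b])" "successively A (b # ys @ [a])"
    by (fact cycle_arcs[OF assms(2)])+
  have d: "distinct (a # xs @ b # ys)" using assms(2) unfolding cycle_def by blast
  have "3 \<le> length (a # xs @ b # ys)" using assms(2) unfolding cycle_def by blast
  then have len: "xs \<noteq> [] \<or> ys \<noteq> []" by fastforce
  have d1: "distinct (a # xs @ [b])" and d2: "distinct (b # ys @ [a])" using d by auto
  have "ptrace (a # xs @ [b]) \<inter> ptrace (b # ys @ [a]) \<subseteq> set (a # xs @ [b]) \<inter> set (b # ys @ [a])"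
  proof (rule ptrace_inter[OF assms(1) sc])
    fix u v assume uv: "(u, v) \<in> set (steps (a # xs @ [b]))"
    have ne: "u \<noteq> v" using uv plane_adjD(2)[OF assms(1), of u v] sc(1)
      unfolding successively_steps by blast
    show "(u, v) \<notin> set (steps (b # ys @ [a])) \<and> (v, u) \<notin> set (steps (b # ys @ [a]))"
    proof (rule ccontr)
      assume "\<not> ?thesis"
      then consider "(u, v) \<in> set (steps (b # ys @ [a]))" | "(v, u) \<in> set (steps (b # ys @ [a]))"
        by blast
      then have "u \<in> {a, b} \<and> v \<in> {a, b} \<and> ys = []"
      proof cases
        case 1
        have "u \<in> {a, b}" "v \<in> {a, b}" using in_steps[OF uv] in_steps[OF 1] d by auto
        then show ?thesis using steps_ends[OF d2 1] ne by blast
      next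
        case 2
        have "u \<in> {a, b}" "v \<in> {a, b}" using in_steps[OF uv] in_steps[OF 2] d by auto
        then show ?thesis using steps_ends[OF d2 2] ne by blast
      qed
      then show False using steps_ends[OF d1 uv] ne len by blast
    qed
  qed
  also have "\<dots> = {a, b}" using d by auto
  finally have "ptrace (a # xs @ [b]) \<inter> ptrace (b # ys @ [a]) \<subseteq> {a, b}" .
  moreover have "{a, b} \<subseteq> ptrace (a # xs @ [b])" "{a, b} \<subseteq> ptrace (b # ys @ [a])"
    using set_subset_ptrace[of "a # xs @ [b]"] set_subset_ptrace[of "b # ys @ [a]"] by simp_all
  ultimately show ?thesis by blast
qed

text \<open>The closed polygonal curve with the vertices \<open>cs\<close>.\<close>

abbreviation rim :: "complex list \<Rightarrow> complex set" where
  "rim cs \<equiv> ptrace (circ cs)"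

lemma successively_rev_plane:
  "plane_adj A \<Longrightarrow> successively A xs \<Longrightarrow> successively A (rev xs)"
  unfolding successively_steps set_steps_rev using plane_adjD(1) by fastforce

lemma cycle_loop:
  assumes "plane_adj A" "cycle A cs"
  obtains c where "simple_path c" "pathfinish c = pathstart c" "path_image c = rim cs"
proof -
  obtain a b xs where cs: "cs = a # b # xs"
    using assms(2) by (cases cs; cases "tl cs") (auto simp: cycle_def)
  have c: "cycle A (a # [] @ b # xs)" using assms(2) cs by simp
  have d: "distinct (b # xs @ [a])" "a \<noteq> b" using c by (auto simp: cycle_def)
  let ?p = "linepath a b" and ?q = "polyline (b # xs @ [a])"
  have q: "arc ?q" using arc_polyline[OF assms(1) d(1) cycle_arcs(2)[OF c]] by simp
  have iq: "path_image ?q = ptrace (b # xs @ [a])" by (rule path_image_polyline) simp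
  have ip: "path_image ?p = ptrace [a, b]" by (simp add: ptrace_def)
  have ends: "pathstart ?q = b" "pathfinish ?q = a"
    using pathfinish_polyline_snoc[of "b # xs" a] by (cases xs; simp add: pathstart_polyline)+
  have "simple_path (?p +++ ?q)"
    using q d(2) cycle_arcs_inter[OF assms(1) c] ip iq ends
    by (intro simple_path_join_loop arc_linepath) auto
  moreover have "path_image (?p +++ ?q) = rim cs"
    using ip iq ends ptrace_circ_split[of a "[]" b xs] cs by (simp add: path_image_join)
  ultimately show ?thesis using that[of "?p +++ ?q"] ends by simp
qed

text \<open>The Jordan curve theorem for polygons.\<close>

lemma cycle_Jordan:
  assumes "plane_adj A" "cycle A cs"
  shows "open (inside (rim cs))" "connected (inside (rim cs))" "open (outside (rim cs))"
    "frontier (inside (rim cs)) = rim cs" "frontier (outside (rim cs)) = rim cs"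
    "closure (inside (rim cs)) = inside (rim cs) \<union> rim cs"
    "inside (rim cs) \<noteq> {}"
proof -
  obtain c where "simple_path c" "pathfinish c = pathstart c" and c: "path_image c = rim cs"
    using cycle_loop[OF assms] .
  then have J: "inside (rim cs) \<noteq> {} \<and> open (inside (rim cs)) \<and> connected (inside (rim cs)) \<and>
     open (outside (rim cs)) \<and> frontier (inside (rim cs)) = rim cs \<and>
     frontier (outside (rim cs)) = rim cs"
    using Jordan_inside_outside[of c] by simp
  then show "open (inside (rim cs))" "connected (inside (rim cs))" "open (outside (rim cs))"
    "frontier (inside (rim cs)) = rim cs" "frontier (outside (rim cs)) = rim cs"
    "inside (rim cs) \<noteq> {}" by auto
  show "closure (inside (rim cs)) = inside (rim cs) \<union> rim cs"
    using J closure_Un_frontier[of "inside (rim cs)"] by simp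
qed

text \<open>A chord inside a polygon cuts it into two polygons.\<close>

lemma chord_split:
  assumes A: "plane_adj A" and C: "cycle A (a # xs @ b # ys)"
    and ps: "distinct ps" "set ps \<inter> set (a # xs @ b # ys) = {}"
    and sp: "successively A (a # ps @ [b])"
    and ins: "ptrace (a # ps @ [b]) \<inter> inside (rim (a # xs @ b # ys)) \<noteq> {}"
  shows "cycle A (a # xs @ b # rev ps)" "cycle A (a # ps @ b # ys)"
    "inside (rim (a # xs @ b # rev ps)) \<inter> inside (rim (a # ps @ b # ys)) = {}"
    "inside (rim (a # xs @ b # rev ps)) \<union> inside (rim (a # ps @ b # ys)) \<union>
       (ptrace (a # ps @ [b]) - {a, b}) = inside (rim (a # xs @ b # ys))"
proof -
  have d: "distinct (a # xs @ b # ys)" using C by (simp add: cycle_def)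
  have ab: "a \<noteq> b" using d by auto
  note rimC = ptrace_circ_split[of a xs b ys]
  have rv: "rev (a # ps @ [b]) = b # rev ps @ [a]" by simp
  have rt: "ptrace (b # rev ps @ [a]) = ptrace (a # ps @ [b])"
    using ptrace_rev[of "a # ps @ [b]"] by simp
  have sr: "successively A (b # rev ps @ [a])"
    using successively_rev_plane[OF A sp] by simp
  have ps0: False if "ps = []" "ptrace [a, b] \<subseteq> rim (a # xs @ b # ys)"
  proof -
    have "ptrace (a # ps @ [b]) \<subseteq> rim (a # xs @ b # ys)" using that by simp
    then show False using ins inside_no_overlap[of "rim (a # xs @ b # ys)"] by blast
  qed
  have sub1: "ptrace (a # xs @ [b]) \<subseteq> rim (a # xs @ b # ys)"
    and sub2: "ptrace (b # ys @ [a]) \<subseteq> rim (a # xs @ b # ys)"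
    unfolding rimC by blast+
  have x0: "xs \<noteq> [] \<or> ps \<noteq> []"
  proof (rule ccontr)
    assume h: "\<not> ?thesis"
    then have "ptrace [a, b] \<subseteq> rim (a # xs @ b # ys)" using sub1 by simp
    then show False using ps0 h by blast
  qed
  have y0: "ys \<noteq> [] \<or> ps \<noteq> []"
  proof (rule ccontr)
    assume h: "\<not> ?thesis"
    then have "ptrace [a, b] \<subseteq> rim (a # xs @ b # ys)" using sub2 ptrace_rev[of "[a, b]"] by simp
    then show False using ps0 h by blast
  qed
  note CA = cycle_arcs[OF C]
  show C1: "cycle A (a # xs @ b # rev ps)"
    unfolding cycle_def
  proof (intro conjI)
    show "3 \<le> length (a # xs @ b # rev ps)" using x0 by (cases xs; cases ps) auto
    show "distinct (a # xs @ b # rev ps)" using d ps by auto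
    show "successively A (circ (a # xs @ b # rev ps))"
      using CA(1) sr unfolding successively_steps steps_circ_split by (simp add: ball_Un)
  qed
  show C2: "cycle A (a # ps @ b # ys)"
    unfolding cycle_def
  proof (intro conjI)
    show "3 \<le> length (a # ps @ b # ys)" using y0 by (cases ys; cases ps) auto
    show "distinct (a # ps @ b # ys)" using d ps by auto
    show "successively A (circ (a # ps @ b # ys))"
      using CA(2) sp unfolding successively_steps steps_circ_split by (simp add: ball_Un)
  qed
  have rt2: "ptrace (a # rev ys @ [b]) = ptrace (b # ys @ [a])"
    using ptrace_rev[of "b # ys @ [a]"] by simp
  have s2: "successively A (a # rev ys @ [b])"
    using successively_rev_plane[OF A CA(2)] by simp
  have simple: "simple_path (polyline (a # zs @ [b])) \<and> pathstart (polyline (a # zs @ [b])) = a \<and>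
      pathfinish (polyline (a # zs @ [b])) = b \<and> path_image (polyline (a # zs @ [b])) = ptrace (a # zs @ [b])"
    if "distinct (a # zs @ [b])" "successively A (a # zs @ [b])" for zs
  proof (intro conjI)
    show "simple_path (polyline (a # zs @ [b]))"
      using arc_polyline[OF A that] by (simp add: arc_imp_simple_path)
    show "pathstart (polyline (a # zs @ [b])) = a"
      by (cases zs) (simp_all add: pathstart_polyline)
    show "pathfinish (polyline (a # zs @ [b])) = b"
      using pathfinish_polyline_snoc[of "a # zs" b] by simp
    show "path_image (polyline (a # zs @ [b])) = ptrace (a # zs @ [b])"
      by (rule path_image_polyline) simp
  qed
  have d1: "distinct (a # xs @ [b])" "distinct (a # rev ys @ [b])" "distinct (a # ps @ [b])"
    using d ps by auto
  note P1 = simple[OF d1(1) CA(1)] and P2 = simple[OF d1(2) s2] and P3 = simple[OF d1(3) sp]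
  have "inside (rim (a # xs @ b # rev ps)) \<inter> inside (rim (a # ps @ b # ys)) = {} \<and>
    inside (rim (a # xs @ b # rev ps)) \<union> inside (rim (a # ps @ b # ys)) \<union>
       (ptrace (a # ps @ [b]) - {a, b}) = inside (rim (a # xs @ b # ys))"
  proof (rule split_inside_simple_closed_curve[of "polyline (a # xs @ [b])" a b
        "polyline (a # rev ys @ [b])" "polyline (a # ps @ [b])"])
    show "path_image (polyline (a # xs @ [b])) \<inter> path_image (polyline (a # rev ys @ [b])) = {a, b}"
      using cycle_arcs_inter[OF A C] P1 P2 rt2 by simp
    show "path_image (polyline (a # xs @ [b])) \<inter> path_image (polyline (a # ps @ [b])) = {a, b}"
      using cycle_arcs_inter[OF A C1] P1 P3 rt by simp
    show "path_image (polyline (a # rev ys @ [b])) \<inter> path_image (polyline (a # ps @ [b])) = {a, b}"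
      using cycle_arcs_inter[OF A C2] P2 P3 rt2 by (simp add: Int_commute)
    show "path_image (polyline (a # ps @ [b])) \<inter>
        inside (path_image (polyline (a # xs @ [b])) \<union> path_image (polyline (a # rev ys @ [b]))) \<noteq> {}"
      using ins P1 P2 P3 rt2 rimC by simp
  next
    assume h: "inside (path_image (polyline (a # xs @ [b])) \<union> path_image (polyline (a # ps @ [b]))) \<inter>
        inside (path_image (polyline (a # rev ys @ [b])) \<union> path_image (polyline (a # ps @ [b]))) = {}"
      "inside (path_image (polyline (a # xs @ [b])) \<union> path_image (polyline (a # ps @ [b]))) \<union>
        inside (path_image (polyline (a # rev ys @ [b])) \<union> path_image (polyline (a # ps @ [b]))) \<union>
        (path_image (polyline (a # ps @ [b])) - {a, b}) =
        inside (path_image (polyline (a # xs @ [b])) \<union> path_image (polyline (a # rev ys @ [b])))"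
    have e1: "rim (a # xs @ b # rev ps) = ptrace (a # xs @ [b]) \<union> ptrace (a # ps @ [b])"
      using ptrace_circ_split[of a xs b "rev ps"] rt by simp
    have e2: "rim (a # ps @ b # ys) = ptrace (a # rev ys @ [b]) \<union> ptrace (a # ps @ [b])"
      using ptrace_circ_split[of a ps b ys] rt2 by (simp add: Un_commute)
    have e3: "rim (a # xs @ b # ys) = ptrace (a # xs @ [b]) \<union> ptrace (a # rev ys @ [b])"
      using rimC rt2 by simp
    show "inside (rim (a # xs @ b # rev ps)) \<inter> inside (rim (a # ps @ b # ys)) = {} \<and>
      inside (rim (a # xs @ b # rev ps)) \<union> inside (rim (a # ps @ b # ys)) \<union>
       (ptrace (a # ps @ [b]) - {a, b}) = inside (rim (a # xs @ b # ys))"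
      unfolding e1 e2 e3 using h P1 P2 P3 by simp
  qed (use P1 P2 P3 ab in simp_all)
  then show "inside (rim (a # xs @ b # rev ps)) \<inter> inside (rim (a # ps @ b # ys)) = {}"
    "inside (rim (a # xs @ b # rev ps)) \<union> inside (rim (a # ps @ b # ys)) \<union>
       (ptrace (a # ps @ [b]) - {a, b}) = inside (rim (a # xs @ b # ys))" by blast+
qed

section \<open>The turning number of a polygon modulo two\<close>

text \<open>
  The upper half plane together with the positive real half line; of two opposite directions exactly
  one is upper.
\<close>

definition upper :: "complex \<Rightarrow> bool" where
  "upper z \<longleftrightarrow> Im z > 0 \<or> (Im z = 0 \<and> Re z > 0)"

text \<open>
  The segment from \<open>a\<close> to \<open>b\<close> crosses the positive real half line, which counts as a part of the
  upper half plane.  For a closed polygon that avoids the origin the number of crossings has the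
  parity of the winding number around the origin.
\<close>

definition crosses :: "complex \<Rightarrow> complex \<Rightarrow> bool" where
  "crosses a b \<longleftrightarrow>
     (upper a \<and> \<not> upper b \<and> Im (cnj a * b) < 0) \<or> (\<not> upper a \<and> upper b \<and> Im (cnj a * b) > 0)"

definition cross_sign :: "complex \<Rightarrow> complex \<Rightarrow> real" where
  "cross_sign a b = (if crosses a b then - 1 else 1)"

lemma cross_sign_same [simp]: "cross_sign a a = 1"
  by (simp add: cross_sign_def crosses_def)

lemma upper_uminus: "z \<noteq> 0 \<Longrightarrow> upper (- z) \<longleftrightarrow> \<not> upper z"
  by (auto simp: upper_def complex_eq_iff)

lemma upper_scale: "r > 0 \<Longrightarrow> upper (of_real r * z) \<longleftrightarrow> upper z"
  by (auto simp: upper_def zero_less_mult_iff)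

lemma not_upper_add:
  "\<not> upper b \<Longrightarrow> \<not> upper d \<Longrightarrow> r \<ge> 0 \<Longrightarrow> s \<ge> 0 \<Longrightarrow> \<not> upper (of_real r * b + of_real s * d)"
proof -
  assume h: "\<not> upper b" "\<not> upper d" "r \<ge> 0" "s \<ge> 0"
  have b: "Im b \<le> 0" "Im b = 0 \<Longrightarrow> Re b \<le> 0" and d: "Im d \<le> 0" "Im d = 0 \<Longrightarrow> Re d \<le> 0"
    using h(1,2) by (auto simp: upper_def)
  have 1: "r * Im b \<le> 0" "s * Im d \<le> 0" using b d h(3,4) by (auto simp: mult_le_0_iff)
  have 2: "r * Re b + s * Re d \<le> 0" if "r * Im b + s * Im d = 0"
  proof -
    have "r * Im b = 0" "s * Im d = 0" using 1 that by linarith+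
    then have "r * Re b \<le> 0" "s * Re d \<le> 0"
      using b d h(3,4) by (auto simp: mult_le_0_iff)
    then show ?thesis by linarith
  qed
  show ?thesis using 1 2 by (auto simp: upper_def)
qed

lemma cross_sign_commute: "cross_sign a b = cross_sign b a"
proof -
  define t where "t = Im (cnj a * b)"
  have t: "Im (cnj a * b) = t" "Im (cnj b * a) = - t" by (simp_all add: t_def mult.commute)
  show ?thesis unfolding cross_sign_def crosses_def t by auto
qed

text \<open>The origin is not in the triangle with the vertices \<open>a\<close>, \<open>b\<close> and \<open>d\<close>.\<close>

definition avoids :: "complex \<Rightarrow> complex \<Rightarrow> complex \<Rightarrow> bool" where
  "avoids a b d \<longleftrightarrow>
     (\<forall>u v w. u \<ge> 0 \<and> v \<ge> 0 \<and> w \<ge> 0 \<and> u + v + w > 0 \<longrightarrow>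
        complex_of_real u * a + of_real v * b + of_real w * d \<noteq> 0)"

lemma avoidsD:
  "avoids a b d \<Longrightarrow> u \<ge> 0 \<Longrightarrow> v \<ge> 0 \<Longrightarrow> w \<ge> 0 \<Longrightarrow> u + v + w > 0 \<Longrightarrow>
     complex_of_real u * a + of_real v * b + of_real w * d \<noteq> 0"
  unfolding avoids_def by blast

lemma avoids_perm: "avoids a b d \<Longrightarrow> avoids b a d" "avoids a b d \<Longrightarrow> avoids a d b"
  unfolding avoids_def by (metis add.assoc add.commute)+

lemma avoids_uminus: "avoids (- a) (- b) (- d) \<longleftrightarrow> avoids a b d"
proof -
  have "complex_of_real u * - a + of_real v * - b + of_real w * - d =
    - (complex_of_real u * a + of_real v * b + of_real w * d)" for u v w by simp
  then show ?thesis unfolding avoids_def by (metis neg_equal_0_iff_equal)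
qed

lemma avoids_nonzero: "avoids a b d \<Longrightarrow> a \<noteq> 0"
  unfolding avoids_def by (drule spec[of _ 1], drule spec[of _ 0], drule spec[of _ 0]) simp

lemma parallel_eq:
  assumes "a \<noteq> 0" "Im (cnj a * z) = 0"
  obtains s where "z = of_real s * a"
proof -
  have "cnj a * z = of_real (Re (cnj a * z))" using assms(2) by (simp add: complex_eq_iff)
  moreover have "a * cnj a = of_real ((cmod a)\<^sup>2)" by (simp only: complex_norm_square)
  ultimately have "of_real ((cmod a)\<^sup>2) * z = a * of_real (Re (cnj a * z))"
    by (metis mult.assoc)
  then have "z = of_real (Re (cnj a * z) / (cmod a)\<^sup>2) * a"
    using assms(1) by (simp add: field_simps)
  then show ?thesis using that by blast
qed

text \<open>
  If \<open>d\<close> were on the other side of the line through \<open>a\<close>, then the segment from \<open>b\<close> to \<open>d\<close> would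
  meet the ray opposite to \<open>a\<close>, and the triangle would contain the origin.
\<close>

lemma upper_det:
  assumes "avoids a b d" "upper a" "\<not> upper b" "\<not> upper d"
    and "Im (cnj a * b) \<le> 0"
  shows "Im (cnj a * d) < 0"
proof (rule ccontr)
  assume h: "\<not> ?thesis"
  define r s where "r = Im (cnj a * d)" and "s = - Im (cnj a * b)"
  have rs: "r \<ge> 0" "s \<ge> 0" using h assms(5) by (auto simp: r_def s_def)
  have a0: "a \<noteq> 0" using avoids_nonzero assms(1) .
  show False
  proof (cases "r + s > 0")
    case True
    define z where "z = of_real r * b + of_real s * d"
    have "cnj a * z = of_real r * (cnj a * b) + of_real s * (cnj a * d)"
      unfolding z_def by (simp only: distrib_left mult.left_commute)
    then have "Im (cnj a * z) = r * Im (cnj a * b) + s * Im (cnj a * d)"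
      by simp
    moreover have "Im (cnj a * b) = - s" "Im (cnj a * d) = r" by (simp_all only: r_def s_def minus_minus)
    ultimately have "Im (cnj a * z) = 0" by (simp only:) simp
    then obtain q where q: "z = of_real q * a" using parallel_eq a0 by blast
    have "\<not> upper z" unfolding z_def using not_upper_add assms rs by blast
    then have "q \<le> 0" using upper_scale[of q a] assms(2) q by force
    moreover have "of_real (- q) * a + of_real r * b + of_real s * d = of_real (- q) * a + z"
      by (simp add: z_def)
    then have "of_real (- q) * a + of_real r * b + of_real s * d = 0" by (simp add: q)
    ultimately show False
      using avoidsD[OF assms(1), of "- q" r s] rs True by simp
  next
    case False
    then have "Im (cnj a * b) = 0" using rs by (simp add: s_def)
    then obtain q where q: "b = of_real q * a" using parallel_eq a0 by blast
    then have "q \<le> 0" using upper_scale[of q a] assms(2,3) by force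
    moreover have "of_real (- q) * a + of_real 1 * b + of_real 0 * d = 0" using q by simp
    ultimately show False
      using avoidsD[OF assms(1), of "- q" 1 0] by simp
  qed
qed

lemma upper_det_same:
  assumes "avoids a b d" "upper a" "\<not> upper b" "\<not> upper d"
  shows "Im (cnj a * b) \<noteq> 0 \<and> (Im (cnj a * b) < 0 \<longleftrightarrow> Im (cnj a * d) < 0)"
proof -
  have "Im (cnj a * b) \<le> 0 \<Longrightarrow> Im (cnj a * d) < 0" using upper_det assms .
  moreover have "Im (cnj a * d) \<le> 0 \<Longrightarrow> Im (cnj a * b) < 0"
    using upper_det avoids_perm(2)[OF assms(1)] assms(2,4,3) .
  ultimately show ?thesis by linarith
qed

lemma lower_det_same:
  assumes "avoids a b d" "\<not> upper a" "upper b" "upper d"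
  shows "Im (cnj a * b) \<noteq> 0 \<and> (Im (cnj a * b) < 0 \<longleftrightarrow> Im (cnj a * d) < 0)"
proof -
  have "a \<noteq> 0" "b \<noteq> 0" "d \<noteq> 0"
    using assms(1) avoids_nonzero avoids_perm by blast+
  then show ?thesis
    using upper_det_same[of "- a" "- b" "- d"] assms avoids_uminus[of a b d]
    by (simp add: upper_uminus)
qed

text \<open>The crossings of the sides of a triangle not containing the origin add up to an even number.\<close>

lemma cross_sign_triangle:
  assumes "avoids a b d"
  shows "cross_sign a d = cross_sign a b * cross_sign b d"
proof -
  have one: "cross_sign x y = cross_sign x z"
    if "avoids x y z" "upper x \<noteq> upper y" "upper y = upper z" for x y z
    using that upper_det_same[of x y z] lower_det_same[of x y z]
      upper_det_same[of x z y] lower_det_same[of x z y] avoids_perm(2)[of x y z]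
    unfolding cross_sign_def crosses_def
    by (smt (verit))
  have same: "cross_sign x y = 1" if "upper x = upper y" for x y
    using that by (simp add: cross_sign_def crosses_def)
  have sq: "cross_sign x y * cross_sign x y = 1" for x y by (simp add: cross_sign_def)
  note p = avoids_perm(1)[OF assms] avoids_perm(2)[OF assms] 
  consider "upper a = upper b" "upper b = upper d" | "upper a \<noteq> upper b" "upper b = upper d"
    | "upper b \<noteq> upper a" "upper a = upper d" | "upper d \<noteq> upper a" "upper a = upper b"
    by blast
  then show ?thesis
  proof cases
    case 1
    then show ?thesis using same by simp
  next
    case 2
    then show ?thesis using one[OF assms] same[of b d] by simp
  next
    case 3
    then show ?thesis using one[OF p(1)] same[of a d] sq[of b a] cross_sign_commute by metis
  next
    case 4
    have "cross_sign d a = cross_sign d b"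
      using one[of d a b] 4 avoids_perm[OF assms] avoids_perm(1)[OF p(2)] by blast
    then show ?thesis using same[of a b] 4 by (simp add: cross_sign_commute)
  qed
qed

lemma cross_sign_uminus:
  assumes "avoids a b d"
  shows "cross_sign a b * cross_sign (- a) (- b) = (if upper a = upper b then 1 else - 1)"
proof -
  have n: "a \<noteq> 0" "b \<noteq> 0" using assms avoids_nonzero avoids_perm by blast+
  have "avoids a b b"
    unfolding avoids_def
  proof (intro allI impI)
    fix u v w :: real assume "u \<ge> 0 \<and> v \<ge> 0 \<and> w \<ge> 0 \<and> u + v + w > 0"
    then have "complex_of_real u * a + of_real (v + w) * b + of_real 0 * d \<noteq> 0"
      using avoidsD[OF assms, of u "v + w" 0] by simp
    then show "complex_of_real u * a + of_real v * b + of_real w * b \<noteq> 0"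
      by (simp add: algebra_simps)
  qed
  then have "Im (cnj a * b) \<noteq> 0" if "upper a \<noteq> upper b"
    using that upper_det_same[of a b b] lower_det_same[of a b b] by blast
  moreover obtain t where t: "Im (cnj a * b) = t" "Im (cnj (- a) * (- b)) = t" by simp
  ultimately have "upper a = upper b \<or> t < 0 \<or> t > 0" by linarith
  then show ?thesis
    unfolding cross_sign_def crosses_def t upper_uminus[OF n(1)] upper_uminus[OF n(2)] by auto
qed

lemma prod_lessThan_double:
  fixes f :: "nat \<Rightarrow> 'a :: comm_monoid_mult"
  shows "(\<Prod>m<2 * n. f m) = (\<Prod>i<n. f (2 * i) * f (2 * i + 1))"
  by (induction n) (simp_all add: mult.assoc)

lemma prod_shift_periodic:
  fixes f :: "nat \<Rightarrow> 'a :: comm_monoid_mult"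
  assumes "f n = f 0"
  shows "(\<Prod>i<n. f (Suc i)) = (\<Prod>i<n. f i)"
proof (cases n)
  case (Suc m)
  then show ?thesis using assms prod.lessThan_Suc_shift[of f m] prod.lessThan_Suc[of "\<lambda>i. f (Suc i)" m]
    by (simp add: mult.commute)
qed simp

text \<open>
  A discrete form of Hopf's proof of his Umlaufsatz.  The secants \<open>p j - p i\<close> with \<open>j - i\<close> close
  to \<open>e / 2\<close> form a closed polygon that avoids the origin.  Raising \<open>e\<close> by one changes it by
  triangles that avoid the origin, as disjoint sides of the polygon have no common points.  For
  \<open>e = 2\<close> the polygon consists of the sides of \<open>p\<close>; for \<open>e = N\<close> it is symmetric with respect to the
  origin and thus winds around it an odd number of times.
\<close>

lemma turning_number_odd:
  fixes p :: "nat \<Rightarrow> complex" and c :: complex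
  assumes N: "3 \<le> N" and per: "\<And>i. p (i + N) = p i" and c: "c \<noteq> 0"
    and ne: "\<And>i. p i \<noteq> p (Suc i)"
    and adjacent: "\<And>i. closed_segment (p i) (p (Suc i)) \<inter> closed_segment (p (Suc i)) (p (Suc (Suc i)))
      \<subseteq> {p (Suc i)}"
    and disjoint: "\<And>i k. 2 \<le> k \<Longrightarrow> k \<le> N - 2 \<Longrightarrow>
      closed_segment (p i) (p (Suc i)) \<inter> closed_segment (p (i + k)) (p (Suc (i + k))) = {}"
  shows "(\<Prod>i<N. cross_sign (c * (p (Suc i) - p i)) (c * (p (Suc (Suc i)) - p (Suc i)))) = - 1"
proof -
  define q where "q i j = c * (p j - p i)" for i j
  define z where "z e m = q (m div 2) ((m + e) div 2)" for e m
  define S where "S e = (\<Prod>m<2 * N. cross_sign (z e m) (z e (Suc m)))" for e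
  have inseg: "complex_of_real u * a + of_real v * b \<in> closed_segment a b"
    if "u \<ge> 0" "v \<ge> 0" "u + v = 1" for u v and a b :: complex
  proof -
    have "u = 1 - v" "v \<le> 1" using that by auto
    then show ?thesis
      using that unfolding in_segment scaleR_conv_of_real by blast
  qed
  \<comment> \<open>A convex combination of the secants below is a difference of points of two sides.\<close>
  have secant: "avoids (q i j) (q i (Suc j)) (q (Suc i) (Suc j))"
    if "1 \<le> k" "k \<le> N - 2" "j = i + k" for i j k
    unfolding avoids_def
  proof (intro allI impI notI)
    fix u v w :: real
    assume uvw: "u \<ge> 0 \<and> v \<ge> 0 \<and> w \<ge> 0 \<and> u + v + w > 0"
      and eq: "complex_of_real u * q i j + of_real v * q i (Suc j) + of_real w * q (Suc i) (Suc j) = 0"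
    define r where "r = u + v + w"
    define x where "x = complex_of_real (u / r) * p j + of_real ((v + w) / r) * p (Suc j)"
    define y where "y = complex_of_real ((u + v) / r) * p i + of_real (w / r) * p (Suc i)"
    have r: "r > 0" using uvw by (simp add: r_def)
    have "of_real r * c * (x - y) = complex_of_real u * q i j + of_real v * q i (Suc j) + of_real w * q (Suc i) (Suc j)"
      using r by (simp add: x_def y_def q_def field_simps)
    then have xy: "x = y" using eq c r by simp
    have r1: "u / r + (v + w) / r = 1" "(u + v) / r + w / r = 1"
      using r by (simp_all add: r_def add_divide_distrib[symmetric] add.assoc)
    have x: "x \<in> closed_segment (p j) (p (Suc j))"
      unfolding x_def using uvw r by (intro inseg r1) auto
    have y: "y \<in> closed_segment (p i) (p (Suc i))"
      unfolding y_def using uvw r by (intro inseg r1) auto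
    show False
    proof (cases "k = 1")
      case False
      then show False using disjoint[of k i] that x y xy by auto
    next
      case True
      then have j: "j = Suc i" using that by simp
      then have xe: "x = p j" using adjacent[of i] x y xy by auto
      have "of_real ((v + w) / r) * (p (Suc j) - p j) = x - (of_real (u / r + (v + w) / r)) * p j"
        unfolding x_def of_real_add by (simp only: algebra_simps)
      also have "\<dots> = 0" using r1(1) xe by simp
      finally have "(v + w) / r = 0"
        using ne[of j] by (metis mult_eq_0_iff of_real_eq_0_iff right_minus_eq)
      then have w0: "w = 0" "v = 0" using r uvw by auto
      have "y = p i" using w0 r1(2) by (simp add: y_def)
      then show False using xe xy ne[of i] j by simp
    qed
  qed
  have secant': "avoids (q i j) (q (Suc i) j) (q (Suc i) (Suc j))"
    if "2 \<le> k" "k \<le> N - 2" "j = i + k" for i j k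
    unfolding avoids_def
  proof (intro allI impI notI)
    fix u v w :: real
    assume uvw: "u \<ge> 0 \<and> v \<ge> 0 \<and> w \<ge> 0 \<and> u + v + w > 0"
      and eq: "complex_of_real u * q i j + of_real v * q (Suc i) j + of_real w * q (Suc i) (Suc j) = 0"
    define r where "r = u + v + w"
    define x where "x = complex_of_real ((u + v) / r) * p j + of_real (w / r) * p (Suc j)"
    define y where "y = complex_of_real (u / r) * p i + of_real ((v + w) / r) * p (Suc i)"
    have r: "r > 0" using uvw by (simp add: r_def)
    have "of_real r * c * (x - y) = complex_of_real u * q i j + of_real v * q (Suc i) j + of_real w * q (Suc i) (Suc j)"
      using r by (simp add: x_def y_def q_def field_simps)
    then have xy: "x = y" using eq c r by simp
    have r1: "u / r + (v + w) / r = 1" "(u + v) / r + w / r = 1"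
      using r by (simp_all add: r_def add_divide_distrib[symmetric] add.assoc)
    have x: "x \<in> closed_segment (p j) (p (Suc j))"
      unfolding x_def using uvw r by (intro inseg r1) auto
    have y: "y \<in> closed_segment (p i) (p (Suc i))"
      unfolding y_def using uvw r by (intro inseg r1) auto
    show False using disjoint[of k i] that x y xy by auto
  qed
  have per2: "q (i + N) (j + N) = q i j" for i j by (simp add: q_def per)
  have S2: "S 2 = (\<Prod>i<N. cross_sign (c * (p (Suc i) - p i)) (c * (p (Suc (Suc i)) - p (Suc i))))"
    unfolding S_def prod_lessThan_double by (simp add: z_def q_def)
  have step: "S (Suc e) = S e" if "2 \<le> e" "e < N" for e
  proof (cases "even e")
    case True
    then obtain k where k: "e = 2 * k" by blast
    show ?thesis
      unfolding S_def prod_lessThan_double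
    proof (rule prod.cong[OF refl])
      fix i
      have "avoids (q i (i + k)) (q i (Suc (i + k))) (q (Suc i) (Suc (i + k)))"
        by (rule secant[of k]) (use that k N in auto)
      from cross_sign_triangle[OF this]
      show "cross_sign (z (Suc e) (2 * i)) (z (Suc e) (Suc (2 * i))) *
            cross_sign (z (Suc e) (2 * i + 1)) (z (Suc e) (Suc (2 * i + 1))) =
          cross_sign (z e (2 * i)) (z e (Suc (2 * i))) *
            cross_sign (z e (2 * i + 1)) (z e (Suc (2 * i + 1)))"
        by (simp add: z_def k)
    qed
  next
    case False
    then obtain k where k: "e = 2 * k + 1" by (metis oddE)
    define f where "f i = cross_sign (q i (i + k)) (q i (Suc (i + k)))" for i
    define h where "h i = cross_sign (q i (Suc (i + k))) (q (Suc i) (Suc (i + k)))" for i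
    have "S (Suc e) = (\<Prod>i<N. h i * f (Suc i))"
      unfolding S_def prod_lessThan_double
    proof (rule prod.cong[OF refl])
      fix i
      have "avoids (q i (Suc (i + k))) (q (Suc i) (Suc (i + k))) (q (Suc i) (Suc (Suc (i + k))))"
        by (rule secant'[of "Suc k"]) (use that k N in auto)
      from cross_sign_triangle[OF this]
      show "cross_sign (z (Suc e) (2 * i)) (z (Suc e) (Suc (2 * i))) *
            cross_sign (z (Suc e) (2 * i + 1)) (z (Suc e) (Suc (2 * i + 1))) = h i * f (Suc i)"
        by (simp add: z_def k f_def h_def)
    qed
    also have "\<dots> = (\<Prod>i<N. h i) * (\<Prod>i<N. f i)"
    proof -
      have "f N = f 0"
        using per2[of 0 k] per2[of 0 "Suc k"] by (simp add: f_def add.commute)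
      then show ?thesis by (simp add: prod.distrib prod_shift_periodic)
    qed
    also have "\<dots> = (\<Prod>i<N. f i * h i)" by (simp add: prod.distrib mult.commute)
    also have "\<dots> = S e"
      unfolding S_def prod_lessThan_double
      by (rule prod.cong[OF refl]) (simp add: z_def k f_def h_def)
    finally show ?thesis .
  qed
  have "S (2 + d) = S 2" if "2 + d \<le> N" for d
    using that by (induction d) (use step in auto)
  moreover have "2 + (N - 2) = N" using N by simp
  ultimately have SN: "S N = S 2" by (metis order_refl)
  \<comment> \<open>The polygon of secants for \<open>e = N\<close> is symmetric with respect to the origin.\<close>
  have zN: "z N (m + N) = - z N m" for m
  proof -
    have "(m + N + N) div 2 = m div 2 + N" by simp
    then have "z N (m + N) = q ((m + N) div 2) (m div 2 + N)" by (simp only: z_def)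
    then show ?thesis by (simp only: z_def q_def per) (simp add: algebra_simps)
  qed
  then have zN': "z N (Suc (m + N)) = - z N (Suc m)" for m by (metis add_Suc)
  have av: "\<exists>d. avoids (z N m) (z N (Suc m)) d" for m
  proof -
    define k where "k = N div 2"
    have k: "1 \<le> k" "k \<le> N - 2" using N by (auto simp: k_def)
    define i where "i = m div 2"
    have A: "avoids (q i (i + k)) (q i (Suc (i + k))) (q (Suc i) (Suc (i + k)))"
      using secant k by simp
    have dup: "\<exists>d. avoids a a d" if "avoids a b d" for a b d
    proof -
      have "avoids a a d"
        unfolding avoids_def
      proof (intro allI impI)
        fix u v w :: real assume "u \<ge> 0 \<and> v \<ge> 0 \<and> w \<ge> 0 \<and> u + v + w > 0"
        then show "complex_of_real u * a + of_real v * a + of_real w * d \<noteq> 0"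
          using avoidsD[OF that, of "u + v" 0 w] by (simp add: algebra_simps)
      qed
      then show ?thesis ..
    qed
    consider "even m" "even N" | "odd m" "even N" | "even m" "odd N" | "odd m" "odd N" by blast
    then show ?thesis
    proof cases
      case 1
      then have "z N m = q i (i + k)" "z N (Suc m) = q i (i + k)"
        by (auto simp: z_def i_def k_def elim!: evenE)
      then show ?thesis using dup[OF A] by simp
    next
      case 2
      then have "z N m = q i (i + k)" "z N (Suc m) = q (Suc i) (Suc (i + k))"
        by (auto simp: z_def i_def k_def elim!: evenE oddE)
      then show ?thesis using avoids_perm(2)[OF A] by auto
    next
      case 3
      then have "z N m = q i (i + k)" "z N (Suc m) = q i (Suc (i + k))"
        by (auto simp: z_def i_def k_def elim!: evenE oddE)
      then show ?thesis using A by auto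
    next
      case 4
      then have "z N m = q i (Suc (i + k))" "z N (Suc m) = q (Suc i) (Suc (i + k))"
        by (auto simp: z_def i_def k_def elim!: evenE oddE)
      then show ?thesis using avoids_perm(2)[OF avoids_perm(1)[OF A]] by auto
    qed
  qed
  define U :: "nat \<Rightarrow> real" where "U m = (if upper (z N m) then 1 else - 1)" for m
  have "S N = (\<Prod>m<N. cross_sign (z N m) (z N (Suc m)) * cross_sign (- z N m) (- z N (Suc m)))"
  proof -
    have "S N = (\<Prod>m<N. cross_sign (z N m) (z N (Suc m))) *
        (\<Prod>m<N. cross_sign (z N (m + N)) (z N (Suc (m + N))))"
      unfolding S_def
    proof -
      have "{..<2 * N} = {..<N} \<union> {N..<N + N}" by auto
      then have "prod f {..<2 * N} = prod f {..<N} * prod f {N..<N + N}" for f :: "nat \<Rightarrow> real"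
        using prod.union_disjoint[of "{..<N}" "{N..<N + N}" f] ivl_disj_int_one(2)[of N "N + N"] by simp
      moreover have "prod f {N..<N + N} = (\<Prod>m<N. f (m + N))" for f :: "nat \<Rightarrow> real"
        using prod.shift_bounds_nat_ivl[of f 0 N N] by (simp add: atLeast0LessThan)
      ultimately show "(\<Prod>m<2 * N. cross_sign (z N m) (z N (Suc m))) =
        (\<Prod>m<N. cross_sign (z N m) (z N (Suc m))) *
        (\<Prod>m<N. cross_sign (z N (m + N)) (z N (Suc (m + N))))" by simp
    qed
    then show ?thesis
      by (simp only: zN zN' prod.distrib)
  qed
  also have "\<dots> = (\<Prod>m<N. U m * U (Suc m))"
  proof (rule prod.cong[OF refl])
    fix m
    obtain d where "avoids (z N m) (z N (Suc m)) d" using av by blast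
    then show "cross_sign (z N m) (z N (Suc m)) * cross_sign (- z N m) (- z N (Suc m)) = U m * U (Suc m)"
      by (simp add: cross_sign_uminus U_def)
  qed
  also have "\<dots> = U 0 * U N"
  proof (induction N)
    case 0
    then show ?case by (simp add: U_def)
  next
    case (Suc n)
    then show ?case by (simp add: U_def)
  qed
  also have "\<dots> = - 1"
  proof -
    have "z N 0 \<noteq> 0" using av[of 0] avoids_nonzero by blast
    then show ?thesis using zN[of 0] by (simp add: U_def upper_uminus)
  qed
  finally show ?thesis using SN S2 by simp
qed

text \<open>The product of a function of three vertices over all triples of consecutive vertices of a walk.\<close>

fun corner_prod :: "('a \<Rightarrow> 'a \<Rightarrow> 'a \<Rightarrow> real) \<Rightarrow> 'a list \<Rightarrow> real" where
  "corner_prod f (a # b # d # xs) = f a b d * corner_prod f (b # d # xs)"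
| "corner_prod f xs = 1"

lemma corner_prod_append:
  "corner_prod f (xs @ a # b # ys) = corner_prod f (xs @ [a, b]) * corner_prod f (a # b # ys)"
proof (induction xs)
  case (Cons x xs)
  show ?case
  proof (cases xs)
    case Nil
    then show ?thesis by simp
  next
    case (Cons y zs)
    then show ?thesis using Cons.IH by (cases zs) simp_all
  qed
qed simp

lemma corner_prod_nth:
  "corner_prod f xs = (\<Prod>i<length xs - 2. f (xs ! i) (xs ! Suc i) (xs ! Suc (Suc i)))"
proof (induction f xs rule: corner_prod.induct)
  case (1 f a b d xs)
  then show ?case by (simp add: prod.lessThan_Suc_shift del: prod.lessThan_Suc)
qed auto

text \<open>
  The turning number of a polygon is odd: its tangent directions cross a given half line an odd number
  of times.  The first two vertices are repeated at the end so that all corners are taken into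
  account.  The factor \<open>c\<close> rotates the half line.
\<close>

lemma cycle_turning:
  assumes A: "plane_adj A" and C: "cycle A cs" and c: "c \<noteq> 0"
  shows "corner_prod (\<lambda>a b d. cross_sign (c * (b - a)) (c * (d - b))) (cs @ take 2 cs) = - 1"
proof -
  define N where "N = length cs"
  define p where "p i = cs ! (i mod N)" for i
  have N: "3 \<le> N" and dist: "distinct cs" and sc: "successively A (circ cs)"
    using C by (auto simp: cycle_def N_def)
  have inj: "p i = p j \<longleftrightarrow> i mod N = j mod N" for i j
  proof -
    have "i mod N < length cs" "j mod N < length cs" using N unfolding N_def by (auto intro!: mod_less_divisor)
    then show ?thesis unfolding p_def using nth_eq_iff_index_eq[OF dist] by blast
  qed
  have neq: "p i \<noteq> p (i + k)" if "0 < k" "k < N" for i k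
  proof
    assume "p i = p (i + k)"
    then have "i mod N = (i + k) mod N" using inj by blast
    then have "(i + k - i) mod N = 0" using mod_eq_dvd_iff_nat[of i "i + k" N]
      by (metis le_add1 mod_0_imp_dvd dvd_imp_mod_0)
    then show False using that by simp
  qed
  have nthc: "circ cs ! i = p i" if "i \<le> N" for i
    using that N by (auto simp: circ_def nth_append p_def N_def hd_conv_nth)
      (metis hd_conv_nth length_0_conv mod_self not_numeral_le_zero le_antisym)
  have adj: "A (p i) (p (Suc i))" for i
  proof -
    have len: "length (circ cs) = Suc N" by (simp add: circ_def N_def)
    have "i mod N < N" using N by simp
    then have "A (circ cs ! (i mod N)) (circ cs ! Suc (i mod N))"
      using sc len by (simp add: successively_conv_nth)
    moreover have "circ cs ! (i mod N) = p i" "circ cs ! Suc (i mod N) = p (Suc i)"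
      using nthc[of "i mod N"] nthc[of "Suc (i mod N)"] \<open>i mod N < N\<close> inj by (auto simp: mod_Suc_eq)
    ultimately show ?thesis by simp
  qed
  have "(\<Prod>i<N. cross_sign (c * (p (Suc i) - p i)) (c * (p (Suc (Suc i)) - p (Suc i)))) = - 1"
  proof (rule turning_number_odd[OF N _ c])
    show "p (i + N) = p i" for i by (simp add: p_def)
    show "p i \<noteq> p (Suc i)" for i using adj plane_adjD(2)[OF A] by blast
    fix i
    have "p i \<noteq> p (Suc (Suc i))" using neq[of 2 i] N by simp
    then have "{p i, p (Suc i)} \<noteq> {p (Suc i), p (Suc (Suc i))}"
      "{p i, p (Suc i)} \<inter> {p (Suc i), p (Suc (Suc i))} \<subseteq> {p (Suc i)}"
      using plane_adjD(2)[OF A adj[of i]] by (auto simp: doubleton_eq_iff)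
    then show "closed_segment (p i) (p (Suc i)) \<inter> closed_segment (p (Suc i)) (p (Suc (Suc i))) \<subseteq> {p (Suc i)}"
      using plane_adjD(3)[OF A adj[of i] adj[of "Suc i"]] by blast
    fix k :: nat assume k: "2 \<le> k" "k \<le> N - 2"
    have "p i \<noteq> p (i + k)" "p i \<noteq> p (Suc (i + k))" "p (Suc i) \<noteq> p (i + k)" "p (Suc i) \<noteq> p (Suc (i + k))"
      using neq[of k i] neq[of "Suc k" i] neq[of "k - 1" "Suc i"] neq[of k "Suc i"] k N by simp_all
    then have "{p i, p (Suc i)} \<inter> {p (i + k), p (Suc (i + k))} = {}"
      "{p i, p (Suc i)} \<noteq> {p (i + k), p (Suc (i + k))}" by auto
    then show "closed_segment (p i) (p (Suc i)) \<inter> closed_segment (p (i + k)) (p (Suc (i + k))) = {}"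
      using plane_adjD(3)[OF A adj[of i] adj[of "i + k"]] by blast
  qed
  moreover have "(cs @ take 2 cs) ! i = p i" if "i < N + 2" for i
    using that N by (auto simp: nth_append p_def N_def mod_if)
  moreover have "length (cs @ take 2 cs) - 2 = N" using N by (simp add: N_def)
  ultimately show ?thesis
    unfolding corner_prod_nth by simp
qed

section \<open>The graph together with the segments between consecutive boundary vertices\<close>

text \<open>A planar bipartite graph in the disk with a gauge ray direction \<open>\<ll>\<close>.\<close>

locale gauged_graph =
  fixes G :: disk_graph and \<ll> :: complex
  assumes planar: "planar_bipartite_disk_graph G" and gauge: "gauge_direction G \<ll>"
begin

text \<open>
  The coordinate perpendicular to the gauge rays, up to the factor \<open>cmod \<ll>\<close>: it is constant along
  each ray.
\<close>

definition hgt :: "complex \<Rightarrow> real" where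
  "hgt p = Im (cnj \<ll> * p)"

text \<open>Adjacency in \<open>G\<close>.\<close>

definition adjG :: "complex \<Rightarrow> complex \<Rightarrow> bool" where
  "adjG u v \<longleftrightarrow> (u, v) \<in> edges G \<or> (v, u) \<in> edges G"

text \<open>The two points are consecutive boundary vertices, in either order.\<close>

definition bottom :: "complex \<Rightarrow> complex \<Rightarrow> bool" where
  "bottom u v \<longleftrightarrow> (\<exists>i. Suc i < bnum G \<and> {u, v} = {bdry G i, bdry G (Suc i)})"

text \<open>
  Adjacency in \<open>G\<close> with the segments between consecutive boundary vertices added.  Paths between
  boundary vertices close up to polygons in this graph.
\<close>

definition adjp :: "complex \<Rightarrow> complex \<Rightarrow> bool" where
  "adjp u v \<longleftrightarrow> adjG u v \<or> bottom u v"

abbreviation int_disk :: "complex set" where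
  "int_disk \<equiv> interior (disk G)"

lemma disk: "compact (disk G)" "convex (disk G)" "int_disk \<noteq> {}" "closed (disk G)"
  using planar compact_imp_closed by (auto simp: planar_bipartite_disk_graph_def)

lemma finite_vertices: "finite (iblack G)" "finite (white G)" "finite (black G)" "finite (bvertices G)"
  "finite (internal G)"
  using planar by (auto simp: planar_bipartite_disk_graph_def black_def bvertices_def internal_def)

lemma internal_int: "u \<in> internal G \<Longrightarrow> u \<in> int_disk"
  using planar by (auto simp: planar_bipartite_disk_graph_def)

lemma bvertices_frontier: "b \<in> bvertices G \<Longrightarrow> b \<in> frontier (disk G)"
  using planar by (auto simp: planar_bipartite_disk_graph_def)

lemma frontier_int: "x \<in> frontier (disk G) \<Longrightarrow> x \<notin> int_disk"
  by (simp add: frontier_def)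

lemma frontier_disk: "x \<in> frontier (disk G) \<Longrightarrow> x \<in> disk G"
  using disk(4) by (simp add: frontier_def)

lemma bvertices_not_internal: "b \<in> bvertices G \<Longrightarrow> b \<notin> internal G"
  using internal_int bvertices_frontier frontier_int by blast

lemma edgesD: "(b, w) \<in> edges G \<Longrightarrow> b \<in> black G \<and> w \<in> white G"
  using planar by (auto simp: planar_bipartite_disk_graph_def)

lemma finite_edges: "finite (edges G)"
  using finite_vertices edgesD by (intro finite_subset[of "edges G" "black G \<times> white G"]) auto

lemma black_white: "black G \<inter> white G = {}"
proof -
  have "iblack G \<inter> white G = {}" using planar by (simp add: planar_bipartite_disk_graph_def)
  moreover have "bvertices G \<inter> white G = {}"
    using bvertices_not_internal by (auto simp: internal_def)
  ultimately show ?thesis by (auto simp: black_def)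
qed

lemma black_cases: "b \<in> black G \<Longrightarrow> b \<in> iblack G \<or> b \<in> bvertices G"
  by (auto simp: black_def)

lemma black_disk: "b \<in> black G \<Longrightarrow> b \<in> disk G"
  using internal_int bvertices_frontier frontier_disk interior_subset[of "disk G"]
  by (auto simp: black_def internal_def)

lemma white_int: "w \<in> white G \<Longrightarrow> w \<in> int_disk"
  using internal_int by (simp add: internal_def)

lemma edge_int: "(b, w) \<in> edges G \<Longrightarrow> open_segment b w \<subseteq> int_disk"
  using in_interior_closure_convex_segment[OF disk(2) white_int, of w b] edgesD black_disk
    closure_subset open_segment_commute by blast

lemma inj_bdry: "i < bnum G \<Longrightarrow> j < bnum G \<Longrightarrow> bdry G i = bdry G j \<longleftrightarrow> i = j"
  using planar by (auto simp: planar_bipartite_disk_graph_def inj_on_def)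

lemma boundary_orient:
  assumes "i < j" "j < bnum G" "p \<in> int_disk"
  shows "Im (cnj (bdry G j - bdry G i) * (p - bdry G i)) < 0"
proof -
  have "orient (bdry G j - bdry G i) (p - bdry G i) = - 1"
    using planar assms by (auto simp: planar_bipartite_disk_graph_def)
  then show ?thesis unfolding orient_def by (auto split: if_splits)
qed

lemma boundary_orient':
  assumes "i < j" "j < bnum G" "p \<in> int_disk"
  shows "Im (cnj (bdry G j - bdry G i) * (p - bdry G j)) < 0"
proof -
  define d where "d = bdry G j - bdry G i"
  have "p - bdry G j = (p - bdry G i) - d" by (simp add: d_def)
  then have "cnj d * (p - bdry G j) = cnj d * (p - bdry G i) - cnj d * d"
    by (simp only: right_diff_distrib)
  moreover have "Im (cnj d * d) = 0" by (simp add: mult.commute)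
  ultimately have "Im (cnj d * (p - bdry G j)) = Im (cnj d * (p - bdry G i))"
    by (simp only: minus_complex.sel diff_zero)
  then show ?thesis using boundary_orient[OF assms] unfolding d_def by simp
qed

lemma gauge_into:
  assumes "i < bnum G"
  obtains r where "r > 0" "bdry G i + of_real r * \<ll> \<in> int_disk"
  using gauge assms unfolding gauge_direction_def bvertices_def by blast

lemma hgt_diff: "hgt p - hgt q = Im (cnj \<ll> * (p - q))"
  by (simp add: hgt_def right_diff_distrib)

text \<open>
  As the gauge rays point into the disk and the boundary vertices are ordered clockwise, the
  coordinate in the direction perpendicular to the rays increases along the boundary.
\<close>

lemma hgt_less:
  assumes "i < j" "j < bnum G"
  shows "hgt (bdry G i) < hgt (bdry G j)"
proof -
  obtain r where r: "r > 0" "bdry G i + of_real r * \<ll> \<in> int_disk"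
    using gauge_into assms by (metis less_trans)
  define d where "d = bdry G j - bdry G i"
  have "Im (cnj d * (of_real r * \<ll>)) < 0"
    using boundary_orient[OF assms r(2)] by (simp add: d_def)
  then have "r * Im (cnj d * \<ll>) < 0" by (simp add: algebra_simps)
  then have "Im (cnj d * \<ll>) < 0" using r(1) by (simp add: mult_less_0_iff)
  then have "Im (cnj \<ll> * d) > 0" by (simp add: mult.commute)
  then show ?thesis using hgt_diff[of "bdry G j" "bdry G i"] by (simp add: d_def)
qed

lemma hgt_less_iff:
  assumes "i < bnum G" "j < bnum G"
  shows "hgt (bdry G i) < hgt (bdry G j) \<longleftrightarrow> i < j"
  using hgt_less[of i j] hgt_less[of j i] assms by (cases i j rule: linorder_cases) auto

lemma hgt_segment:
  assumes "x \<in> closed_segment a b" "hgt a < hgt b"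
  shows "hgt a \<le> hgt x" "hgt x \<le> hgt b" "hgt x = hgt a \<Longrightarrow> x = a" "hgt x = hgt b \<Longrightarrow> x = b"
proof -
  obtain t where t: "0 \<le> t" "t \<le> 1" "x = (1 - t) *\<^sub>R a + t *\<^sub>R b"
    using assms(1) by (auto simp: in_segment)
  have "cnj \<ll> * x = of_real (1 - t) * (cnj \<ll> * a) + of_real t * (cnj \<ll> * b)"
    unfolding t(3) scaleR_conv_of_real by (simp only: distrib_left mult.left_commute)
  then have "hgt x = (1 - t) * hgt a + t * hgt b"
    unfolding hgt_def by (simp del: of_real_diff)
  then have h: "hgt x = hgt a + t * (hgt b - hgt a)" by (simp add: algebra_simps)
  have "t * (hgt b - hgt a) \<ge> 0" using t assms(2) by simp
  then show "hgt a \<le> hgt x" using h by simp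
  have "t * (hgt b - hgt a) \<le> 1 * (hgt b - hgt a)" using t assms(2) by (intro mult_right_mono) auto
  then show "hgt x \<le> hgt b" using h by simp
  show "x = a" if "hgt x = hgt a"
    using that h assms(2) t(3) by simp
  show "x = b" if "hgt x = hgt b"
  proof -
    have "(1 - t) * (hgt b - hgt a) = 0" using that h by (simp add: algebra_simps)
    then show ?thesis using assms(2) t(3) by simp
  qed
qed

lemma bottom_frontier:
  assumes "bottom u v" "x \<in> closed_segment u v"
  shows "x \<in> frontier (disk G)"
proof -
  have "\<exists>p q. closed_segment p q \<subseteq> frontier (disk G) \<and> bvertices G \<subseteq> closed_segment p q"
    using planar unfolding planar_bipartite_disk_graph_def by (elim conjE)
  then obtain p q where pq: "closed_segment p q \<subseteq> frontier (disk G)" "bvertices G \<subseteq> closed_segment p q"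
    by blast
  have "u \<in> bvertices G" "v \<in> bvertices G"
    using assms(1) unfolding bottom_def bvertices_def by (auto simp: doubleton_eq_iff)
  then have "closed_segment u v \<subseteq> closed_segment p q"
    using pq(2) by (intro closed_segment_subset) auto
  then show ?thesis using pq(1) assms(2) by blast
qed

text \<open>The only boundary vertices on the segment between two consecutive ones are its ends.\<close>

lemma bottom_meets:
  assumes "Suc i < bnum G" "m < bnum G" "bdry G m \<in> closed_segment (bdry G i) (bdry G (Suc i))"
  shows "m = i \<or> m = Suc i"
proof -
  have "hgt (bdry G i) \<le> hgt (bdry G m)" "hgt (bdry G m) \<le> hgt (bdry G (Suc i))"
    using hgt_segment[OF assms(3) hgt_less] assms(1) by auto
  then have "\<not> m < i" "\<not> Suc i < m" using hgt_less_iff assms(1,2) by (auto simp: not_less[symmetric])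
  then show ?thesis by linarith
qed

lemma segment_hits_frontier:
  assumes "(b, w) \<in> edges G" "x \<in> closed_segment b w" "x \<in> frontier (disk G)"
  shows "x = b" "b \<in> bvertices G"
proof -
  have "x \<notin> open_segment b w" "x \<noteq> w"
    using edge_int[OF assms(1)] assms(3) frontier_int edgesD[OF assms(1)] white_int by blast+
  then show x: "x = b" using assms(2) by (auto simp: open_segment_def)
  show "b \<in> bvertices G"
    using edgesD[OF assms(1)] black_cases internal_int assms(3) frontier_int x
    by (auto simp: internal_def)
qed

lemma edge_edge:
  assumes "(b, w) \<in> edges G" "(b', w') \<in> edges G" "(b, w) \<noteq> (b', w')"
  shows "closed_segment b w \<inter> closed_segment b' w' \<subseteq> {b, w} \<inter> {b', w'}"
proof -
  have "\<forall>e \<in> edges G. \<forall>e' \<in> edges G. e \<noteq> e' \<longrightarrow>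
        seg e \<inter> seg e' \<subseteq> {fst e, snd e} \<inter> {fst e', snd e'}"
    using planar unfolding planar_bipartite_disk_graph_def by blast
  from this[rule_format, OF assms] show ?thesis by simp
qed

lemma edge_bottom:
  assumes "(b, w) \<in> edges G" "Suc i < bnum G"
  shows "closed_segment b w \<inter> closed_segment (bdry G i) (bdry G (Suc i)) \<subseteq> {b, w} \<inter> {bdry G i, bdry G (Suc i)}"
proof
  fix x assume x: "x \<in> closed_segment b w \<inter> closed_segment (bdry G i) (bdry G (Suc i))"
  have "bottom (bdry G i) (bdry G (Suc i))" using assms(2) unfolding bottom_def by blast
  then have "x \<in> frontier (disk G)" using bottom_frontier x by blast
  then have xb: "x = b" "b \<in> bvertices G" using segment_hits_frontier assms(1) x by blast+
  then obtain m where "m < bnum G" "b = bdry G m" by (auto simp: bvertices_def)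
  then show "x \<in> {b, w} \<inter> {bdry G i, bdry G (Suc i)}"
    using bottom_meets[OF assms(2)] xb x by auto
qed

lemma bottom_bottom:
  assumes "Suc i < bnum G" "Suc j < bnum G" "i < j"
  shows "closed_segment (bdry G i) (bdry G (Suc i)) \<inter> closed_segment (bdry G j) (bdry G (Suc j))
    \<subseteq> {bdry G i, bdry G (Suc i)} \<inter> {bdry G j, bdry G (Suc j)}"
proof
  fix x assume x: "x \<in> closed_segment (bdry G i) (bdry G (Suc i)) \<inter> closed_segment (bdry G j) (bdry G (Suc j))"
  have 1: "hgt x \<le> hgt (bdry G (Suc i))" "hgt x = hgt (bdry G (Suc i)) \<Longrightarrow> x = bdry G (Suc i)"
    using hgt_segment[of x "bdry G i" "bdry G (Suc i)"] hgt_less[of i "Suc i"] x assms by auto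
  have 2: "hgt (bdry G j) \<le> hgt x" "hgt x = hgt (bdry G j) \<Longrightarrow> x = bdry G j"
    using hgt_segment[of x "bdry G j" "bdry G (Suc j)"] hgt_less[of j "Suc j"] x assms by auto
  have "hgt (bdry G (Suc i)) \<le> hgt (bdry G j)"
    using hgt_less[of "Suc i" j] assms by (cases "Suc i = j") auto
  then have "x = bdry G (Suc i)" "x = bdry G j" using 1 2 by linarith+
  then show "x \<in> {bdry G i, bdry G (Suc i)} \<inter> {bdry G j, bdry G (Suc j)}" by auto
qed

lemma edge_irrefl: "adjp u v \<Longrightarrow> u \<noteq> v"
  using edgesD black_white inj_bdry unfolding adjp_def adjG_def bottom_def
  by (fastforce simp: doubleton_eq_iff)

lemma adjp_sym: "adjp u v \<Longrightarrow> adjp v u"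
  unfolding adjp_def adjG_def bottom_def by (metis insert_commute)

lemma adjp_plane: "plane_adj adjp"
proof -
  have inter: "closed_segment a b \<inter> closed_segment c d \<subseteq> {a, b} \<inter> {c, d}"
    if h: "adjp a b" "adjp c d" "{a, b} \<noteq> {c, d}" for a b c d
  proof -
    have rep: "(\<exists>p q. (p, q) \<in> edges G \<and> closed_segment u v = closed_segment p q \<and> {u, v} = {p, q}) \<or>
        (\<exists>i. Suc i < bnum G \<and> closed_segment u v = closed_segment (bdry G i) (bdry G (Suc i)) \<and>
          {u, v} = {bdry G i, bdry G (Suc i)})" if "adjp u v" for u v
      using that closed_segment_commute unfolding adjp_def adjG_def bottom_def
      by (metis doubleton_eq_iff)
    from rep[OF h(1)] rep[OF h(2)] show ?thesis
    proof (elim disjE exE conjE)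
      fix p q p' q'
      assume ee: "(p, q) \<in> edges G" "closed_segment a b = closed_segment p q" "{a, b} = {p, q}"
        "(p', q') \<in> edges G" "closed_segment c d = closed_segment p' q'" "{c, d} = {p', q'}"
      then have "(p, q) \<noteq> (p', q')" using h(3) by auto
      then show ?thesis unfolding ee(2,3,5,6) using edge_edge ee(1,4) by blast
    next
      fix p q i
      assume eb: "(p, q) \<in> edges G" "closed_segment a b = closed_segment p q" "{a, b} = {p, q}"
        "Suc i < bnum G" "closed_segment c d = closed_segment (bdry G i) (bdry G (Suc i))"
        "{c, d} = {bdry G i, bdry G (Suc i)}"
      show ?thesis unfolding eb(2,3,5,6) using edge_bottom eb(1,4) by blast
    next
      fix i p q
      assume be: "Suc i < bnum G" "closed_segment a b = closed_segment (bdry G i) (bdry G (Suc i))"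
        "{a, b} = {bdry G i, bdry G (Suc i)}"
        "(p, q) \<in> edges G" "closed_segment c d = closed_segment p q" "{c, d} = {p, q}"
      show ?thesis unfolding be(2,3,5,6) using edge_bottom[OF be(4,1)] by blast
    next
      fix i j
      assume bb: "Suc i < bnum G" "closed_segment a b = closed_segment (bdry G i) (bdry G (Suc i))"
        "{a, b} = {bdry G i, bdry G (Suc i)}"
        "Suc j < bnum G" "closed_segment c d = closed_segment (bdry G j) (bdry G (Suc j))"
        "{c, d} = {bdry G j, bdry G (Suc j)}"
      then have "i \<noteq> j" using h(3) by auto
      then consider "i < j" | "j < i" by linarith
      then show ?thesis
        unfolding bb(2,3,5,6) using bottom_bottom[OF bb(1,4)] bottom_bottom[OF bb(4,1)] by cases blast+
    qed
  qed
  have "\<forall>a b. adjp a b \<longrightarrow> adjp b a \<and> a \<noteq> b"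
  proof (intro allI impI)
    fix a b assume h: "adjp a b"
    show "adjp b a \<and> a \<noteq> b" by (rule conjI[OF adjp_sym[OF h] edge_irrefl[OF h]])
  qed
  moreover have "\<forall>a b c d. adjp a b \<and> adjp c d \<and> {a, b} \<noteq> {c, d} \<longrightarrow>
      closed_segment a b \<inter> closed_segment c d \<subseteq> {a, b} \<inter> {c, d}"
    by (intro allI impI, elim conjE, rule inter)
  ultimately show ?thesis unfolding plane_adj_def by (rule conjI)
qed

end

section \<open>Polygons and faces\<close>

text \<open>The assumptions on the graph in the theorem.\<close>

locale kp_graph = gauged_graph +
  assumes reduced: "reduced_graph G"
    and valency: "\<forall>u \<in> internal G. degr G u = 2 \<or> degr G u = 3"
    and irreducible: "irreducible_positroid (bnum G) (positroid G)"
begin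

text \<open>The points of the drawing of the graph.\<close>

definition gset :: "complex set" where
  "gset = black G \<union> white G \<union> (\<Union>e \<in> edges G. seg e)"

lemma faces_eq: "faces G = components (disk G - gset)"
  by (simp add: faces_def gset_def)

lemma nbrs_eq: "nbrs G u = {v. adjG u v}"
  by (simp add: nbrs_def adjG_def)

lemma adjG_vertices: "adjG u v \<Longrightarrow> u \<in> black G \<union> white G \<and> v \<in> black G \<union> white G"
  using edgesD unfolding adjG_def by blast

lemma adjG_sym: "adjG u v \<Longrightarrow> adjG v u"
  unfolding adjG_def by blast

lemma adjG_adjp: "adjG u v \<Longrightarrow> adjp u v"
  by (simp add: adjp_def)

lemma finite_nbrs: "finite (nbrs G u)"
  using adjG_vertices finite_vertices
  by (intro finite_subset[of "nbrs G u" "black G \<union> white G"]) (auto simp: nbrs_eq)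

lemma vertex_cases: "u \<in> black G \<union> white G \<Longrightarrow> u \<in> bvertices G \<or> u \<in> internal G"
  unfolding black_def internal_def by blast

lemma degr_bvertex: "b \<in> bvertices G \<Longrightarrow> degr G b = 1"
proof -
  have "\<forall>b \<in> bvertices G. degr G b = 1"
    using planar unfolding planar_bipartite_disk_graph_def by (elim conjE)
  then show "b \<in> bvertices G \<Longrightarrow> degr G b = 1" by simp
qed

lemma degr_bounds: "u \<in> black G \<union> white G \<Longrightarrow> degr G u \<ge> 1 \<and> degr G u \<le> 3"
  using vertex_cases[of u] degr_bvertex[of u] valency by force

lemma has_nbr:
  assumes "u \<in> black G \<union> white G"
  obtains v where "adjG u v"
proof -
  have "card (nbrs G u) \<noteq> 0" using degr_bounds[OF assms] by (simp add: degr_def)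
  then have "nbrs G u \<noteq> {}" by auto
  then show ?thesis using that by (auto simp: nbrs_eq)
qed

lemma bvertex_nbr_unique: "b \<in> bvertices G \<Longrightarrow> adjG b u \<Longrightarrow> adjG b v \<Longrightarrow> u = v"
proof -
  assume b: "b \<in> bvertices G" "adjG b u" "adjG b v"
  then obtain x where "nbrs G b = {x}"
    using degr_bvertex[of b] by (auto simp: degr_def card_1_singleton_iff)
  then have "u \<in> {x}" "v \<in> {x}" using b(2,3) nbrs_eq[of b] by blast+
  then show "u = v" by simp
qed

lemma adjG_open_segment: "adjG u v \<Longrightarrow> open_segment u v \<subseteq> int_disk"
  unfolding adjG_def using edge_int[of u v] edge_int[of v u] open_segment_commute[of u v] by metis

lemma adjG_gset: "adjG u v \<Longrightarrow> closed_segment u v \<subseteq> gset"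
proof -
  have "closed_segment a b \<subseteq> gset" if "(a, b) \<in> edges G" for a b
    using that unfolding gset_def by force
  then show "adjG u v \<Longrightarrow> closed_segment u v \<subseteq> gset"
    unfolding adjG_def using closed_segment_commute[of u v] by metis
qed

lemma gset_cases:
  assumes "x \<in> gset"
  obtains u v where "adjG u v" "x \<in> closed_segment u v"
proof -
  consider "x \<in> black G \<union> white G" | e where "e \<in> edges G" "x \<in> seg e"
    using assms unfolding gset_def by blast
  then show ?thesis
  proof cases
    case 1
    then show ?thesis using has_nbr[OF 1] that ends_in_segment(1) by metis
  next
    case 2
    then show ?thesis using that[of "fst e" "snd e"] by (simp add: adjG_def)
  qed
qed

lemma bottom_not_open: "bottom u v \<Longrightarrow> x \<in> closed_segment u v \<Longrightarrow> x \<notin> int_disk"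
  using bottom_frontier frontier_int by blast

lemma adjp_disk: "adjp u v \<Longrightarrow> closed_segment u v \<subseteq> disk G"
proof -
  assume "adjp u v"
  then consider "adjG u v" | "bottom u v" by (auto simp: adjp_def)
  then show ?thesis
  proof cases
    case 1
    then have "u \<in> disk G" "v \<in> disk G"
      using adjG_vertices[OF 1] black_disk white_int interior_subset by blast+
    then show ?thesis using disk(2) by (simp add: closed_segment_subset)
  next
    case 2
    then show ?thesis using bottom_frontier frontier_disk by blast
  qed
qed

lemma stepsD: "cycle adjp cs \<Longrightarrow> (u, v) \<in> set (steps (circ cs)) \<Longrightarrow> adjp u v"
  unfolding cycle_def successively_steps by auto

lemma rimE:
  assumes "x \<in> rim cs"
  obtains u v where "(u, v) \<in> set (steps (circ cs))" "x \<in> closed_segment u v"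
  using assms unfolding ptrace_def by blast

lemma rim_disk:
  assumes "cycle adjp cs"
  shows "rim cs \<subseteq> disk G"
proof
  fix x assume "x \<in> rim cs"
  then obtain u v where "(u, v) \<in> set (steps (circ cs))" "x \<in> closed_segment u v"
    using rimE by blast
  then show "x \<in> disk G" using adjp_disk[OF stepsD[OF assms]] by blast
qed

lemma inside_disk:
  assumes "cycle adjp cs"
  shows "inside (rim cs) \<subseteq> int_disk"
proof -
  have "- disk G \<subseteq> outside (rim cs)"
    using outside_mono[OF rim_disk[OF assms]] outside_convex[OF disk(2)] by simp
  then have "inside (rim cs) \<subseteq> disk G"
    using inside_Int_outside[of "rim cs"] by blast
  then show ?thesis
    using cycle_Jordan(1)[OF adjp_plane assms] by (rule interior_maximal)
qed

text \<open>\<open>uv\<close> is a side of the polygon.\<close>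

definition side_of :: "complex \<Rightarrow> complex \<Rightarrow> complex list \<Rightarrow> bool" where
  "side_of u v cs \<longleftrightarrow> (u, v) \<in> set (steps (circ cs)) \<or> (v, u) \<in> set (steps (circ cs))"

lemma side_rim: "side_of u v cs \<Longrightarrow> closed_segment u v \<subseteq> rim cs"
proof -
  have "closed_segment a b \<subseteq> rim cs" if "(a, b) \<in> set (steps (circ cs))" for a b
    using that unfolding ptrace_def by force
  then show "side_of u v cs \<Longrightarrow> closed_segment u v \<subseteq> rim cs"
    unfolding side_of_def using closed_segment_commute[of u v] by metis
qed

lemma steps_circ_set: "(u, v) \<in> set (steps (circ cs)) \<Longrightarrow> cs \<noteq> [] \<Longrightarrow> u \<in> set cs \<and> v \<in> set cs"
  using in_steps[of u v "circ cs"] by (auto simp: circ_def)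

lemma cycle_nonempty: "cycle A cs \<Longrightarrow> cs \<noteq> []"
  by (auto simp: cycle_def)

lemma open_segment_rim:
  assumes "cycle adjp cs" "adjp u v" "\<not> side_of u v cs"
  shows "open_segment u v \<inter> rim cs = {}"
proof (rule ccontr)
  assume "\<not> ?thesis"
  then obtain x where xo: "x \<in> open_segment u v" "x \<in> rim cs" by blast
  obtain c d where cd: "(c, d) \<in> set (steps (circ cs))" "x \<in> closed_segment c d"
    using rimE[OF xo(2)] .
  note x = xo(1) cd
  have "{u, v} \<noteq> {c, d}" using assms(3) x(2) unfolding side_of_def doubleton_eq_iff by blast
  then have "x \<in> {u, v}"
    using plane_adjD(3)[OF adjp_plane assms(2) stepsD[OF assms(1) x(2)]] x by (auto simp: open_segment_def)
  then show False using x(1) by (auto simp: open_segment_def)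
qed

lemma vertex_rim:
  assumes "cycle adjp cs" "adjp u v" "u \<in> rim cs"
  shows "u \<in> set cs"
proof (rule ccontr)
  assume n: "u \<notin> set cs"
  obtain c d where x: "(c, d) \<in> set (steps (circ cs))" "u \<in> closed_segment c d"
    using rimE[OF assms(3)] .
  have cd: "c \<in> set cs" "d \<in> set cs" using steps_circ_set[OF x(1)] cycle_nonempty[OF assms(1)] by auto
  then have "{u, v} \<noteq> {c, d}" using n by (auto simp: doubleton_eq_iff)
  then have "u \<in> {c, d}"
    using plane_adjD(3)[OF adjp_plane assms(2) stepsD[OF assms(1) x(1)]] x by auto
  then show False using cd n by blast
qed

lemma set_rim: "cycle adjp cs \<Longrightarrow> set cs \<subseteq> rim cs"
  using set_subset_ptrace_circ[of cs] by (simp add: cycle_def)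

lemma inside_rim_disjoint: "x \<in> inside (rim cs) \<Longrightarrow> x \<notin> rim cs"
  using inside_no_overlap[of "rim cs"] by blast

lemma inside_spread:
  assumes "cycle adjp cs" "connected X" "X \<inter> rim cs = {}" "X \<inter> inside (rim cs) \<noteq> {}"
  shows "X \<subseteq> inside (rim cs)"
proof (rule ccontr)
  assume "\<not> ?thesis"
  then have "X - inside (rim cs) \<noteq> {}" by blast
  then have "X \<inter> frontier (inside (rim cs)) \<noteq> {}"
    using connected_Int_frontier[OF assms(2,4)] by blast
  then show False using cycle_Jordan(4)[OF adjp_plane assms(1)] assms(3) by simp
qed

lemma open_segment_near:
  fixes u v :: complex
  assumes "open U" "u \<in> U" "u \<noteq> v"
  shows "open_segment u v \<inter> U \<noteq> {}"
proof -
  have "u \<in> closure (open_segment u v)" using assms(3) by (simp add: closure_open_segment)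
  then show ?thesis using assms(1,2) open_Int_closure_eq_empty[OF assms(1), of "open_segment u v"]
    by (auto simp: Int_commute)
qed

text \<open>An edge with an end inside a polygon runs inside it, up to its other end.\<close>

lemma edge_inside:
  assumes C: "cycle adjp cs" and uv: "adjp u v" and u: "u \<in> inside (rim cs)"
  shows "open_segment u v \<subseteq> inside (rim cs)" "v \<in> inside (rim cs) \<or> v \<in> set cs"
proof -
  have ne: "u \<noteq> v" using edge_irrefl[OF uv] .
  have "\<not> side_of u v cs" using side_rim[of u v cs] inside_rim_disjoint[OF u] by auto
  then have o: "open_segment u v \<inter> rim cs = {}" using open_segment_rim[OF C uv] by blast
  show os: "open_segment u v \<subseteq> inside (rim cs)"
    using inside_spread[OF C _ o] open_segment_near[OF cycle_Jordan(1)[OF adjp_plane C] u ne]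
    by (simp add: convex_connected)
  have "v \<in> closure (open_segment u v)" using ne by (simp add: closure_open_segment)
  then have "v \<in> closure (inside (rim cs))" using os closure_mono by blast
  then show "v \<in> inside (rim cs) \<or> v \<in> set cs"
    using cycle_Jordan(6)[OF adjp_plane C] vertex_rim[OF C adjp_sym[OF uv]] by blast
qed

lemma bvertex_not_inside: "cycle adjp cs \<Longrightarrow> b \<in> bvertices G \<Longrightarrow> b \<notin> inside (rim cs)"
  using inside_disk bvertices_frontier frontier_int by blast

text \<open>
  Near a point of a polygon that lies on none of its sides in \<open>G\<close>, that is, on the boundary of the
  disk only, the interior of the disk lies inside the polygon.
\<close>

lemma near_bottom:
  assumes C: "cycle adjp cs" and q: "q \<in> rim cs"
    and off: "\<And>u v. side_of u v cs \<Longrightarrow> adjG u v \<Longrightarrow> q \<notin> closed_segment u v"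
  obtains r where "r > 0" "ball q r \<inter> int_disk \<subseteq> inside (rim cs)"
proof -
  define K where "K = (\<Union>(u, v) \<in> {p \<in> set (steps (circ cs)). adjG (fst p) (snd p)}. closed_segment u v)"
  have K1: "q \<notin> K"
  proof
    assume "q \<in> K"
    then obtain u v where "(u, v) \<in> set (steps (circ cs))" "adjG u v" "q \<in> closed_segment u v"
      unfolding K_def by auto
    then show False using off unfolding side_of_def by blast
  qed
  have "closed K" unfolding K_def by (intro closed_UN) auto
  then obtain r where r: "r > 0" "ball q r \<subseteq> - K"
    using K1 open_contains_ball[of "- K"] by (auto simp: open_Compl)
  define B where "B = ball q r \<inter> int_disk"
  have "B \<inter> rim cs = {}"
  proof (rule ccontr)
    assume "\<not> ?thesis"
    then obtain x where x: "x \<in> B" "x \<in> rim cs" by blast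
    then obtain u v where uv: "(u, v) \<in> set (steps (circ cs))" "x \<in> closed_segment u v"
      using rimE by blast
    have "adjG u v"
      using stepsD[OF C uv(1)] bottom_not_open[of u v x] uv(2) x(1) by (auto simp: adjp_def B_def)
    then have "x \<in> K" using uv unfolding K_def by force
    then show False using x r(2) by (auto simp: B_def)
  qed
  moreover have "connected B"
    unfolding B_def using disk(2) by (intro convex_connected convex_Int convex_ball convex_interior)
  moreover have "B \<inter> inside (rim cs) \<noteq> {}"
  proof -
    have "q \<in> closure (inside (rim cs))" using q cycle_Jordan(6)[OF adjp_plane C] by blast
    then have "ball q r \<inter> inside (rim cs) \<noteq> {}"
      using open_Int_closure_eq_empty[OF open_ball, of q r "inside (rim cs)"] centre_in_ball[of q r] r(1)
      by blast
    then show ?thesis using inside_disk[OF C] by (auto simp: B_def)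
  qed
  ultimately have "B \<subseteq> inside (rim cs)" using inside_spread[OF C] by blast
  then show ?thesis using that r(1) by (auto simp: B_def)
qed

text \<open>
  The part of the complement of the graph that lies inside or on a polygon is open and closed in the
  complement, although it may contain points of the boundary of the disk.  Hence no face crosses a
  polygon.
\<close>

lemma closed_hull_clopen:
  assumes C: "cycle adjp cs"
  defines "F \<equiv> (inside (rim cs) \<union> rim cs) \<inter> (disk G - gset)"
  shows "closedin (top_of_set (disk G - gset)) F" "openin (top_of_set (disk G - gset)) F"
proof -
  note J = cycle_Jordan[OF adjp_plane C]
  have "closed (inside (rim cs) \<union> rim cs)" using J(6) closed_closure by metis
  then show "closedin (top_of_set (disk G - gset)) F"
    unfolding F_def by (subst Int_commute) (rule closedin_closed_Int)
  show "openin (top_of_set (disk G - gset)) F"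
  proof (subst openin_contains_ball, intro conjI ballI)
    show "F \<subseteq> disk G - gset" by (auto simp: F_def)
    fix q assume q: "q \<in> F"
    show "\<exists>e>0. ball q e \<inter> (disk G - gset) \<subseteq> F"
    proof (cases "q \<in> inside (rim cs)")
      case True
      then obtain e where "e > 0" "ball q e \<subseteq> inside (rim cs)"
        using J(1) open_contains_ball by blast
      then show ?thesis unfolding F_def by blast
    next
      case False
      then have qr: "q \<in> rim cs" "q \<notin> gset" using q by (auto simp: F_def)
      have off: "\<And>u v. side_of u v cs \<Longrightarrow> adjG u v \<Longrightarrow> q \<notin> closed_segment u v"
        using adjG_gset qr(2) by blast
      obtain r where r: "r > 0" "ball q r \<inter> int_disk \<subseteq> inside (rim cs)"
        using near_bottom[OF C qr(1) off] .
      have "ball q r \<inter> (disk G - gset) \<subseteq> F"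
      proof
        fix x assume x: "x \<in> ball q r \<inter> (disk G - gset)"
        have "x \<in> closure int_disk"
          using x convex_closure_interior[OF disk(2,3)] closure_subset by blast
        then have "x \<in> closure (ball q r \<inter> int_disk)"
          using x open_Int_closure_subset[of "ball q r" int_disk] by blast
        then have "x \<in> inside (rim cs) \<union> rim cs"
          using closure_mono[OF r(2)] J(6) by blast
        then show "x \<in> F" using x by (auto simp: F_def)
      qed
      then show ?thesis using r(1) by blast
    qed
  qed
qed

lemma face_inside:
  assumes C: "cycle adjp cs" and f: "f \<in> faces G" "f \<inter> inside (rim cs) \<noteq> {}"
  shows "f \<subseteq> inside (rim cs) \<union> rim cs"
proof -
  define F where "F = (inside (rim cs) \<union> rim cs) \<inter> (disk G - gset)"
  note F = closed_hull_clopen[OF C, folded F_def]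
  have f': "f \<subseteq> disk G - gset" "connected f"
    using f(1) in_components_subset in_components_connected unfolding faces_eq by blast+
  have "openin (top_of_set f) (f \<inter> F)" "closedin (top_of_set f) (f \<inter> F)"
  proof -
    obtain U where U: "open U" "F = (disk G - gset) \<inter> U" using F(2) unfolding openin_open by blast
    have "f \<inter> F = f \<inter> U" using U(2) f'(1) by blast
    then show "openin (top_of_set f) (f \<inter> F)" using U(1) by (simp add: openin_open_Int)
    obtain K where K: "closed K" "F = (disk G - gset) \<inter> K" using F(1) unfolding closedin_closed by blast
    have "f \<inter> F = f \<inter> K" using K(2) f'(1) by blast
    then show "closedin (top_of_set f) (f \<inter> F)" using K(1) by (simp add: closedin_closed_Int)
  qed
  then have "f \<inter> F = {} \<or> f \<inter> F = f" using f'(2) connected_clopen by blast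
  moreover have "f \<inter> F \<noteq> {}" using f(2) f'(1) by (auto simp: F_def)
  ultimately show ?thesis by (auto simp: F_def)
qed

text \<open>Points on a line transversal to the gauge rays are ordered by \<open>hgt\<close>.\<close>

lemma collinear_between:
  assumes "a \<in> closed_segment p q" "b \<in> closed_segment p q" "c \<in> closed_segment p q"
    and "hgt a \<le> hgt b" "hgt b \<le> hgt c" "hgt a < hgt c"
  shows "b \<in> closed_segment a c"
proof -
  have rep: "\<exists>s. x = p + of_real s * (q - p) \<and> hgt x = hgt p + s * hgt (q - p)"
    if x: "x \<in> closed_segment p q" for x
  proof -
    obtain s where s: "x = (1 - s) *\<^sub>R p + s *\<^sub>R q" using x unfolding in_segment by blast
    then have 1: "x = p + of_real s * (q - p)" by (simp add: scaleR_conv_of_real algebra_simps)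
    have "cnj \<ll> * x = cnj \<ll> * p + of_real s * (cnj \<ll> * (q - p))"
      unfolding 1 by (simp only: distrib_left mult.left_commute)
    then have "hgt x = hgt p + s * hgt (q - p)"
      unfolding hgt_def by (simp del: minus_complex.sel right_diff_distrib_numeral)
    then show ?thesis using 1 by blast
  qed
  obtain s1 s2 s3 where s: "a = p + of_real s1 * (q - p)" "hgt a = hgt p + s1 * hgt (q - p)"
    "b = p + of_real s2 * (q - p)" "hgt b = hgt p + s2 * hgt (q - p)"
    "c = p + of_real s3 * (q - p)" "hgt c = hgt p + s3 * hgt (q - p)"
    using rep assms(1-3) by meson
  define D where "D = hgt (q - p)"
  have D: "(s3 - s1) * D > 0" "(s2 - s1) * D \<ge> 0" "(s3 - s2) * D \<ge> 0"
    using assms(4-6) unfolding s(2,4,6) D_def by (simp_all add: algebra_simps)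
  then have ne: "s3 - s1 \<noteq> 0" "D \<noteq> 0" by auto
  define t where "t = (s2 - s1) / (s3 - s1)"
  have t: "t = ((s2 - s1) * D) / ((s3 - s1) * D)" using ne by (simp add: t_def)
  have "0 \<le> t" unfolding t using D by (intro divide_nonneg_pos)
  moreover have "t \<le> 1" unfolding t using D by (simp add: divide_le_eq algebra_simps)
  moreover have "b = (1 - t) *\<^sub>R a + t *\<^sub>R c"
  proof -
    have "t * (s3 - s1) = s2 - s1" using ne by (simp add: t_def)
    then have s2: "s2 = (1 - t) * s1 + t * s3" by (simp add: algebra_simps)
    show ?thesis unfolding s(1,3,5) scaleR_conv_of_real
      by (subst s2) (simp add: algebra_simps)
  qed
  ultimately show ?thesis unfolding in_segment by blast
qed

lemma bottom_in_arc:
  assumes "bottom u v"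
  shows "closed_segment u v \<subseteq> closed_segment (bdry G 0) (bdry G (bnum G - 1))"
proof -
  have "\<exists>p q. closed_segment p q \<subseteq> frontier (disk G) \<and> bvertices G \<subseteq> closed_segment p q"
    using planar unfolding planar_bipartite_disk_graph_def by (elim conjE)
  then obtain p q where pq: "bvertices G \<subseteq> closed_segment p q" by blast
  obtain i where i: "Suc i < bnum G" "{u, v} = {bdry G i, bdry G (Suc i)}"
    using assms by (auto simp: bottom_def)
  have mem: "bdry G m \<in> closed_segment (bdry G 0) (bdry G (bnum G - 1))" if "m < bnum G" for m
  proof (rule collinear_between)
    show "bdry G 0 \<in> closed_segment p q" "bdry G m \<in> closed_segment p q"
      "bdry G (bnum G - 1) \<in> closed_segment p q"
      using pq that by (auto simp: bvertices_def)
    show "hgt (bdry G 0) \<le> hgt (bdry G m)"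
      using hgt_less[of 0 m] that by (cases "m = 0") auto
    show "hgt (bdry G m) \<le> hgt (bdry G (bnum G - 1))"
    proof (cases "m = bnum G - 1")
      case False
      then have "m < bnum G - 1" "bnum G - 1 < bnum G" using that by linarith+
      then show ?thesis using hgt_less less_imp_le by blast
    qed simp
    show "hgt (bdry G 0) < hgt (bdry G (bnum G - 1))"
      using hgt_less[of 0 "bnum G - 1"] i(1) by auto
  qed
  have "u \<in> {bdry G i, bdry G (Suc i)}" "v \<in> {bdry G i, bdry G (Suc i)}" using i(2) by blast+
  then show ?thesis using mem[of i] mem[of "Suc i"] i(1) by (intro closed_segment_subset) auto
qed

text \<open>A polygon with nothing of the graph inside bounds a finite face.\<close>

lemma empty_polygon_face:
  assumes C: "cycle adjp cs" and E: "inside (rim cs) \<inter> gset = {}"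
  obtains F where "F \<in> finite_faces G" "face_edges G F = {(b, w) \<in> edges G. side_of b w cs}"
proof -
  define F where "F = (inside (rim cs) \<union> rim cs) \<inter> (disk G - gset)"
  note J = cycle_Jordan[OF adjp_plane C] and cl = closed_hull_clopen[OF C, folded F_def]
  have sub: "inside (rim cs) \<subseteq> F" "F \<subseteq> closure (inside (rim cs))"
    using E inside_disk[OF C] interior_subset[of "disk G"] J(6) unfolding F_def by blast+
  have conn: "connected F" using connected_intermediate_closure[OF J(2) sub] .
  have ne: "F \<noteq> {}" using sub J(7) by blast
  have face: "F \<in> faces G"
    unfolding faces_eq in_components_maximal
  proof (intro conjI allI impI)
    show "F \<noteq> {}" "connected F" by (fact ne, fact conn)
    show "F \<subseteq> disk G - gset" by (simp add: F_def)
    fix d assume d: "d \<noteq> {} \<and> F \<subseteq> d \<and> d \<subseteq> disk G - gset \<and> connected d"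
    have "openin (top_of_set d) F" "closedin (top_of_set d) F"
      using openin_subset_trans[OF cl(2), of d] closedin_subset_trans[OF cl(1), of d] d by simp_all
    then show "d = F" using d ne connected_clopen[of d] by blast
  qed
  have "F \<inter> infinite_arc G = {}"
  proof (rule ccontr)
    assume "\<not> ?thesis"
    then obtain x where x: "x \<in> F" "x \<in> frontier (disk G)"
      "x \<notin> closed_segment (bdry G 0) (bdry G (bnum G - 1))"
      unfolding infinite_arc_def by blast
    have "x \<in> rim cs" "x \<notin> gset"
      using x(1,2) inside_disk[OF C] frontier_int unfolding F_def by blast+
    then obtain u v where uv: "(u, v) \<in> set (steps (circ cs))" "x \<in> closed_segment u v"
      using rimE by blast
    have "bottom u v" using stepsD[OF C uv(1)] adjG_gset[of u v] uv(2) \<open>x \<notin> gset\<close>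
      by (auto simp: adjp_def)
    then show False using bottom_in_arc uv(2) x(3) by blast
  qed
  then have fin: "F \<in> finite_faces G" using face by (simp add: finite_faces_def)
  have fr: "frontier F = rim cs"
  proof -
    have "closure F = inside (rim cs) \<union> rim cs"
      using closure_mono[OF sub(1)] closure_minimal[OF sub(2) closed_closure] J(6) by blast
    moreover have "interior F = inside (rim cs)"
    proof
      show "inside (rim cs) \<subseteq> interior F" using sub(1) J(1) by (rule interior_maximal)
      show "interior F \<subseteq> inside (rim cs)"
      proof
        fix x assume x: "x \<in> interior F"
        have "interior F \<subseteq> int_disk" unfolding F_def by (rule interior_mono) auto
        then have xi: "x \<in> int_disk" using x by blast
        have xF: "x \<in> F" using x interior_subset by blast
        show "x \<in> inside (rim cs)"
        proof (rule ccontr)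
          assume "x \<notin> inside (rim cs)"
          then have "x \<in> rim cs" "x \<notin> gset" using xF by (auto simp: F_def)
          then obtain u v where uv: "(u, v) \<in> set (steps (circ cs))" "x \<in> closed_segment u v"
            using rimE by blast
          have "bottom u v" using stepsD[OF C uv(1)] adjG_gset[of u v] uv(2) \<open>x \<notin> gset\<close>
            by (auto simp: adjp_def)
          then show False using bottom_not_open uv(2) xi by blast
        qed
      qed
    qed
    ultimately show ?thesis using inside_rim_disjoint by (auto simp: frontier_def)
  qed
  have "face_edges G F = {(b, w) \<in> edges G. side_of b w cs}"
  proof -
    have "closed_segment b w \<subseteq> rim cs \<longleftrightarrow> side_of b w cs" if e: "(b, w) \<in> edges G" for b w
    proof
      assume h: "closed_segment b w \<subseteq> rim cs"
      have a: "adjp b w" using e by (simp add: adjp_def adjG_def)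
      show "side_of b w cs"
      proof (rule ccontr)
        assume "\<not> side_of b w cs"
        then have "open_segment b w \<inter> rim cs = {}" using open_segment_rim[OF C a] by blast
        moreover have "open_segment b w \<noteq> {}" using edge_irrefl[OF a] by simp
        ultimately show False using h segment_open_subset_closed by blast
      qed
    qed (rule side_rim)
    then have "e \<in> edges G \<and> seg e \<subseteq> rim cs \<longleftrightarrow> e \<in> edges G \<and> side_of (fst e) (snd e) cs" for e
      by (cases e) (simp cong: conj_cong)
    then show ?thesis unfolding face_edges_def fr by auto
  qed
  then show ?thesis using that fin by blast
qed

end

section \<open>Kasteleyn signs of polygons\<close>

lemma in_steps_snoc: "(u, v) \<in> set (steps (xs @ [z])) \<Longrightarrow> u \<in> set xs"
  by (induction xs rule: induct_list012) auto

text \<open>A polygon does not traverse a side in both directions.\<close>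

lemma cycle_no_reverse:
  assumes "cycle A cs" "(a, b) \<in> set (steps (circ cs))"
  shows "(b, a) \<notin> set (steps (circ cs))"
proof
  assume ba: "(b, a) \<in> set (steps (circ cs))"
  have "a \<in> set cs" using in_steps_snoc[of a b cs] assms(2) by (simp add: circ_def)
  then obtain us vs where cs: "cs = us @ a # vs" by (auto simp: in_set_conv_decomp)
  define rest where "rest = vs @ us"
  have S: "set (steps (circ cs)) = set (steps (a # rest @ [a]))"
    using circ_rotate(2)[of us "a # vs"] by (simp add: cs circ_def rest_def)
  have d: "distinct (a # rest)" and len: "3 \<le> length (a # rest)"
    using assms(1) by (auto simp: cs rest_def cycle_def)
  then obtain s t rest' where rest: "rest = s # t # rest'" by (cases rest; cases "tl rest") auto
  have b: "b = s"
    using assms(2) in_steps_snoc[of a b rest a] d unfolding S rest by auto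
  define xs where "xs = butlast rest"
  have rl: "rest = xs @ [last rest]" by (simp add: xs_def rest)
  have "steps (rest @ [a]) = steps rest @ [(last rest, a)]"
    using steps_append[of xs "last rest" "[a]"] rl by (metis append.assoc append_Cons append_Nil steps_simps(2,3))
  moreover have "(s, a) \<in> set (steps (rest @ [a]))"
    using ba d unfolding S b rest by auto
  ultimately have "s = last rest" using d in_steps[of s a rest] by auto
  then show False using d by (simp add: rest split: if_splits)
qed

lemma cycle_nbrs:
  assumes "cycle A cs" "a \<in> set cs"
  obtains p s where "p \<noteq> s" "p \<in> set cs" "s \<in> set cs"
    "(p, a) \<in> set (steps (circ cs))" "(a, s) \<in> set (steps (circ cs))"
proof -
  obtain us vs where cs: "cs = us @ a # vs" using assms(2) by (auto simp: in_set_conv_decomp)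
  define rest where "rest = vs @ us"
  have S: "set (steps (circ cs)) = set (steps (a # rest @ [a]))"
    using circ_rotate(2)[of us "a # vs"] by (simp add: cs circ_def rest_def)
  have d: "distinct (a # rest)" and len: "3 \<le> length (a # rest)"
    using assms(1) by (auto simp: cs rest_def cycle_def)
  then obtain s t rest' where rest: "rest = s # t # rest'" by (cases rest; cases "tl rest") auto
  have rl: "rest = butlast rest @ [last rest]" by (simp add: rest)
  have "set (steps (a # rest @ [a])) = set (steps (a # rest)) \<union> {(last rest, a)}"
    using set_steps_append[of "a # butlast rest" "last rest" "[a]"] rl
    by (metis append.assoc append_Cons append_Nil list.simps(15) set_empty steps_simps(2,3))
  then have "(last rest, a) \<in> set (steps (circ cs))" using S by blast
  moreover have "(a, s) \<in> set (steps (circ cs))" using S by (simp add: rest)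
  moreover have "last rest \<noteq> s" using d by (auto simp: rest)
  moreover have "last rest \<in> set cs" "s \<in> set cs"
  proof -
    have "last rest \<in> set rest" "s \<in> set rest" unfolding rest by simp_all
    then show "last rest \<in> set cs" "s \<in> set cs" by (auto simp: cs rest_def)
  qed
  ultimately show ?thesis using that by blast
qed

lemma prod_steps_telescope:
  fixes f :: "'a \<Rightarrow> 'b :: comm_ring_1"
  assumes "\<And>u. f u * f u = 1" "xs \<noteq> []"
  shows "prod_list (map (\<lambda>(u, v). f u * f v) (steps xs)) = f (hd xs) * f (last xs)"
  using assms(2)
proof (induction xs rule: induct_list012)
  case (3 a b xs)
  have "f a * f b * (f b * f (last (b # xs))) = f a * (f b * f b) * f (last (b # xs))"
    by (simp only: mult.assoc)
  then show ?case using 3 assms(1) by simp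
qed (use assms(1) in auto)

context kp_graph
begin

text \<open>
  Every edge, followed in either direction, can be continued to a polygon through that edge or to
  the boundary without meeting the edge again.
\<close>

definition continuable :: bool where
  "continuable \<longleftrightarrow> (\<forall>a c. adjG a c \<longrightarrow>
     (\<exists>qs. qs \<noteq> [] \<and> distinct qs \<and> successively adjG qs \<and> hd qs = c \<and>
       ((last qs = a \<and> 3 \<le> length qs) \<or> (last qs \<in> bvertices G \<and> a \<notin> set qs))))"

lemma side_not_open: "side_of u v cs \<Longrightarrow> open_segment u v \<inter> inside (rim cs) = {}"
  using side_rim[of u v cs] segment_open_subset_closed[of u v] inside_rim_disjoint by blast

lemma edge_meets_inside:
  assumes C: "cycle adjp cs" and uv: "adjG u v" and m: "closed_segment u v \<inter> inside (rim cs) \<noteq> {}"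
  shows "open_segment u v \<subseteq> inside (rim cs)"
proof -
  have ap: "adjp u v" "adjp v u" using adjG_adjp[OF uv] adjG_adjp[OF adjG_sym[OF uv]] .
  obtain x where x: "x \<in> closed_segment u v" "x \<in> inside (rim cs)" using m by blast
  consider "x = u" | "x = v" | "x \<in> open_segment u v" using x(1) by (auto simp: open_segment_def)
  then show ?thesis
  proof cases
    case 1
    then show ?thesis using edge_inside(1)[OF C ap(1)] x(2) by simp
  next
    case 2
    then show ?thesis using edge_inside(1)[OF C ap(2)] x(2) by (metis open_segment_commute)
  next
    case 3
    then have "\<not> side_of u v cs" using side_not_open x(2) by blast
    then have "open_segment u v \<inter> rim cs = {}" using open_segment_rim[OF C ap(1)] by blast
    then show ?thesis using inside_spread[OF C] 3 x(2) by (meson convex_connected convex_open_segment disjoint_iff)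
  qed
qed

text \<open>
  If an edge runs inside a polygon, then there is also one that starts at a vertex of the polygon: every
  vertex is connected with the boundary of the disk, which is not inside.
\<close>

lemma boundary_edge_inside:
  assumes C: "cycle adjp cs" and uv: "adjG u v" and ins: "open_segment u v \<subseteq> inside (rim cs)"
  obtains a c where "adjG a c" "a \<in> set cs" "open_segment a c \<subseteq> inside (rim cs)"
proof (cases "u \<in> set cs")
  case True
  then show ?thesis using that uv ins by blast
next
  case False
  have ne: "u \<noteq> v" using edge_irrefl[OF adjG_adjp[OF uv]] .
  have "u \<in> closure (open_segment u v)" using ne by simp
  then have "u \<in> closure (inside (rim cs))" using ins closure_mono by blast
  then have u: "u \<in> inside (rim cs)"
    using cycle_Jordan(6)[OF adjp_plane C] vertex_rim[OF C adjG_adjp[OF uv]] False by blast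
  have "\<forall>u \<in> black G \<union> white G. \<exists>b \<in> bvertices G. (u, b) \<in> (edges G \<union> (edges G)\<inverse>)\<^sup>*"
    using reduced unfolding reduced_graph_def by (elim conjE)
  then obtain b where b: "b \<in> bvertices G" "(u, b) \<in> (edges G \<union> (edges G)\<inverse>)\<^sup>*"
    using adjG_vertices[OF uv] by blast
  have "\<exists>x y. (x, y) \<in> edges G \<union> (edges G)\<inverse> \<and> x \<in> inside (rim cs) \<and> y \<notin> inside (rim cs)"
    using b(2) bvertex_not_inside[OF C b(1)] u
  proof (induction rule: converse_rtrancl_induct)
    case base
    then show ?case by simp
  next
    case (step y z)
    then show ?case by (cases "z \<in> inside (rim cs)") auto
  qed
  then obtain x y where xy: "adjG x y" "x \<in> inside (rim cs)" "y \<notin> inside (rim cs)"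
    by (auto simp: adjG_def)
  have "y \<in> set cs" using edge_inside(2)[OF C adjG_adjp[OF xy(1)] xy(2)] xy(3) by blast
  moreover have "open_segment y x \<subseteq> inside (rim cs)"
    using edge_inside(1)[OF C adjG_adjp[OF xy(1)] xy(2)] by (metis open_segment_commute)
  ultimately show ?thesis using that adjG_sym[OF xy(1)] by blast
qed

lemma internal_not_bottom: "a \<in> internal G \<Longrightarrow> adjp a b \<Longrightarrow> adjG a b"
proof -
  assume h: "a \<in> internal G" "adjp a b"
  have "\<not> bottom a b"
  proof
    assume "bottom a b"
    then obtain i where i: "Suc i < bnum G" "{a, b} = {bdry G i, bdry G (Suc i)}"
      unfolding bottom_def by blast
    then have "a \<in> bvertices G" unfolding bvertices_def doubleton_eq_iff by auto
    then show False using bvertices_not_internal h(1) by blast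
  qed
  then show "adjG a b" using h(2) by (simp add: adjp_def)
qed

text \<open>
  A polygon with an edge inside has a chord.  Follow an edge that enters the inside at the vertex \<open>a\<close>
  until the path returns to the polygon.  This does not happen at \<open>a\<close>, which would have four
  neighbours otherwise.  The list of the vertices is rotated to start at \<open>a\<close>.
\<close>

lemma find_chord:
  assumes C: "cycle adjp cs" and cont: continuable
    and uv: "adjG u v" and ins: "open_segment u v \<subseteq> inside (rim cs)"
  obtains a b xs ys ps us vs where "cs = us @ vs" "vs @ us = a # xs @ b # ys"
    "distinct ps" "set ps \<inter> set cs = {}" "successively adjG (a # ps @ [b])"
    "set ps \<subseteq> inside (rim cs)" "ptrace (a # ps @ [b]) \<inter> inside (rim cs) \<noteq> {}"
    "\<exists>c. (a, c) \<in> set (steps (a # ps @ [b])) \<and> open_segment a c \<subseteq> inside (rim cs)"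
proof -
  obtain a c where ac: "adjG a c" "a \<in> set cs" "open_segment a c \<subseteq> inside (rim cs)"
    using boundary_edge_inside[OF C uv ins] .
  have nea: "a \<noteq> c" using edge_irrefl[OF adjG_adjp[OF ac(1)]] .
  have an: "a \<notin> inside (rim cs)" using ac(2) set_rim[OF C] inside_rim_disjoint by blast
  have "\<exists>b ps. b \<in> set cs \<and> b \<noteq> a \<and> distinct ps \<and> set ps \<subseteq> inside (rim cs) \<and>
      successively adjG (a # ps @ [b]) \<and> (ps = [] \<and> b = c \<or> ps \<noteq> [] \<and> hd ps = c)"
  proof (cases "c \<in> inside (rim cs)")
    case False
    have "c \<in> closure (open_segment a c)" using nea by simp
    then have "c \<in> closure (inside (rim cs))" using ac(3) closure_mono by blast
    then have "c \<in> set cs"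
      using False cycle_Jordan(6)[OF adjp_plane C] vertex_rim[OF C adjG_adjp[OF adjG_sym[OF ac(1)]]] by blast
    then show ?thesis using ac(1) nea by (intro exI[of _ c] exI[of _ "[]"]) auto
  next
    case True
    obtain qs where qs: "qs \<noteq> []" "distinct qs" "successively adjG qs" "hd qs = c"
      "(last qs = a \<and> 3 \<le> length qs) \<or> (last qs \<in> bvertices G \<and> a \<notin> set qs)"
      using cont ac(1) unfolding continuable_def by metis
    define ps where "ps = takeWhile (\<lambda>x. x \<in> inside (rim cs)) qs"
    have last: "last qs \<notin> inside (rim cs)" using qs(5) an bvertex_not_inside[OF C] by blast
    then have dn: "dropWhile (\<lambda>x. x \<in> inside (rim cs)) qs \<noteq> []"
      using qs(1) by (auto simp: dropWhile_eq_Nil_conv)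
    then obtain b rest where br: "dropWhile (\<lambda>x. x \<in> inside (rim cs)) qs = b # rest"
      by (cases "dropWhile (\<lambda>x. x \<in> inside (rim cs)) qs") auto
    have q: "qs = ps @ b # rest" using br takeWhile_dropWhile_id unfolding ps_def by metis
    have bn: "b \<notin> inside (rim cs)" using br hd_dropWhile[OF dn] by simp
    have psi: "set ps \<subseteq> inside (rim cs)" unfolding ps_def by (auto dest: set_takeWhileD)
    have pn: "ps \<noteq> []" using qs(1,4) True unfolding ps_def by (cases qs) auto
    have hp: "hd ps = c" using q pn qs(4) by simp
    have sl: "successively adjG (ps @ [b])"
      using qs(3) unfolding q by (simp add: successively_append_iff)
    have lb: "adjG (last ps) b" using sl pn by (simp add: successively_append_iff)
    have li: "last ps \<in> inside (rim cs)" using psi pn by auto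
    have bc: "b \<in> set cs" using edge_inside(2)[OF C adjG_adjp[OF lb] li] bn by blast
    have "b \<noteq> a"
    proof
      assume ba: "b = a"
      then have aq: "a \<in> set qs" using q by simp
      then have l: "last qs = a" "3 \<le> length qs" using qs(5) by auto
      then have "rest = []" using q ba qs(2) by (cases rest rule: rev_cases) auto
      then have "2 \<le> length ps" using l(2) q by simp
      then have fc: "last ps \<noteq> c" using hp qs(2) q by (cases ps; cases "tl ps") auto
      have nb: "adjG a (last ps)" "adjG a c" using lb ba adjG_sym ac(1) by auto
      have "a \<notin> bvertices G" using bvertex_nbr_unique[OF _ nb] fc by blast
      then have ai: "a \<in> internal G" using vertex_cases adjG_vertices[OF ac(1)] by blast
      obtain p s where ps: "p \<noteq> s" "p \<in> set cs" "s \<in> set cs"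
        "(p, a) \<in> set (steps (circ cs))" "(a, s) \<in> set (steps (circ cs))"
        using cycle_nbrs[OF C ac(2)] .
      have "adjG a p" "adjG a s"
        using stepsD[OF C ps(4)] stepsD[OF C ps(5)] adjp_sym internal_not_bottom[OF ai] by blast+
      then have "{last ps, c, p, s} \<subseteq> nbrs G a" using nb by (auto simp: nbrs_eq)
      moreover have "card {last ps, c, p, s} = 4"
      proof -
        have "last ps \<notin> set cs" "c \<notin> set cs"
          using li True set_rim[OF C] inside_rim_disjoint by blast+
        then have "last ps \<noteq> p" "last ps \<noteq> s" "c \<noteq> p" "c \<noteq> s" using ps by auto
        then show ?thesis using fc ps(1) by simp
      qed
      ultimately have "4 \<le> degr G a" using card_mono[OF finite_nbrs, of _ a] by (metis degr_def)
      then show False using valency ai by force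
    qed
    moreover have "successively adjG (a # ps @ [b])"
      using sl ac(1) hp pn by (cases ps) auto
    ultimately show ?thesis using bc qs(2) q psi pn hp by (intro exI[of _ b] exI[of _ ps]) auto
  qed
  then obtain b ps where b: "b \<in> set cs" "b \<noteq> a" "distinct ps" "set ps \<subseteq> inside (rim cs)"
    "successively adjG (a # ps @ [b])" "ps = [] \<and> b = c \<or> ps \<noteq> [] \<and> hd ps = c" by metis
  obtain us vs where cs: "cs = us @ a # vs" using ac(2) by (auto simp: in_set_conv_decomp)
  have "b \<in> set (vs @ us)" using b(1,2) cs by auto
  then obtain xs ys where xy: "vs @ us = xs @ b # ys" by (meson split_list)
  have disj: "set ps \<inter> set cs = {}" using b(4) set_rim[OF C] inside_rim_disjoint by blast
  have step: "(a, c) \<in> set (steps (a # ps @ [b]))" using b(6) by (cases ps) auto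
  then have "open_segment a c \<subseteq> ptrace (a # ps @ [b])"
    using segment_open_subset_closed unfolding ptrace_def by fastforce
  moreover have "open_segment a c \<noteq> {}" using nea by simp
  ultimately have "ptrace (a # ps @ [b]) \<inter> inside (rim cs) \<noteq> {}" using ac(3) by blast
  then show ?thesis
    using that[of us "a # vs" a xs b ys ps] cs xy b(3,4,5) disj step ac(3) by auto
qed

text \<open>
  The extension of a function on the edges, which are pairs of a black and a white vertex, to steps in
  either direction.  Steps that are no edges have the value \<open>1\<close>; this applies to the segments between
  boundary vertices.
\<close>

definition edge_fun :: "(complex \<times> complex \<Rightarrow> 'a) \<Rightarrow> complex \<times> complex \<Rightarrow> 'a :: comm_ring_1" where
  "edge_fun g = (\<lambda>(u, v). if (u, v) \<in> edges G then g (u, v) else if (v, u) \<in> edges G then g (v, u) else 1)"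

lemma edge_asym: "(u, v) \<in> edges G \<Longrightarrow> (v, u) \<notin> edges G"
  using edgesD black_white by blast

lemma edge_fun_swap: "edge_fun g (prod.swap p) = edge_fun g p"
  using edge_asym by (cases p) (auto simp: edge_fun_def)

lemma edge_fun_rev: "prod_list (map (edge_fun g) (steps (rev xs))) = prod_list (map (edge_fun g) (steps xs))"
proof -
  have "prod_list (map (edge_fun g) (steps (rev xs))) = prod_list (rev (map (edge_fun g) (steps xs)))"
    by (simp add: steps_rev rev_map comp_def edge_fun_swap)
  also have "\<dots> = prod_list (map (edge_fun g) (steps xs))"
    by (metis mset_rev prod_mset_prod_list)
  finally show ?thesis .
qed

text \<open>
  The product along a polygon as a product over the edges of \<open>G\<close> among its sides.
\<close>

lemma prod_steps_sides:
  assumes C: "cycle adjp cs"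
  shows "prod_list (map (edge_fun g) (steps (circ cs))) = (\<Prod>e \<in> {(b, w) \<in> edges G. side_of b w cs}. g e)"
proof -
  define X where "X = set (steps (circ cs))"
  have "distinct (steps (circ cs))"
    using C distinct_steps[of cs "hd cs"] by (simp add: cycle_def circ_def)
  then have "prod_list (map (edge_fun g) (steps (circ cs))) = prod (edge_fun g) X"
    unfolding X_def by (simp add: prod.distinct_set_conv_list)
  also have "\<dots> = (\<Prod>e \<in> {(b, w) \<in> edges G. side_of b w cs}. g e)"
  proof -
    define A where "A = X \<inter> edges G"
    define B where "B = X \<inter> (edges G)\<inverse>"
    have fin: "finite X" by (simp add: X_def)
    have AB: "A \<inter> B = {}" unfolding A_def B_def using edge_asym by auto
    have "prod (edge_fun g) X = prod (edge_fun g) (A \<union> B)"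
      by (rule prod.mono_neutral_right[OF fin]) (auto simp: A_def B_def edge_fun_def split: if_splits)
    also have "\<dots> = prod (edge_fun g) A * prod (edge_fun g) B"
      using fin AB by (intro prod.union_disjoint) (auto simp: A_def B_def)
    also have "prod (edge_fun g) A = prod g A"
      by (rule prod.cong) (auto simp: A_def edge_fun_def)
    also have "prod (edge_fun g) B = prod g (B\<inverse>)"
    proof (rule prod.reindex_bij_witness[of _ prod.swap prod.swap])
      fix p assume "p \<in> B"
      then have "prod.swap p \<in> edges G" by (auto simp: B_def)
      then have "edge_fun g (prod.swap p) = g (prod.swap p)" by (cases p) (simp add: edge_fun_def)
      then show "g (prod.swap p) = edge_fun g p" using edge_fun_swap by metis
    qed auto
    also have "prod g A * prod g (B\<inverse>) = prod g (A \<union> B\<inverse>)"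
    proof (rule prod.union_disjoint[symmetric])
      show "finite A" "finite (B\<inverse>)" using fin by (auto simp: A_def B_def)
      show "A \<inter> B\<inverse> = {}"
        using cycle_no_reverse[OF C] by (auto simp: A_def B_def X_def)
    qed
    also have "A \<union> B\<inverse> = {(b, w) \<in> edges G. side_of b w cs}"
      by (auto simp: A_def B_def X_def side_of_def)
    finally show ?thesis .
  qed
  finally show ?thesis .
qed

text \<open>A polygon has an even number of sides in the bipartite graph.\<close>

lemma even_sides:
  assumes C: "cycle adjp cs"
  shows "even (card {(b, w) \<in> edges G. side_of b w cs})"
proof -
  define col :: "complex \<Rightarrow> int" where "col u = (if u \<in> white G then - 1 else 1)" for u
  have "edge_fun (\<lambda>_. - 1) (u, v) = col u * col v" if uv: "(u, v) \<in> set (steps (circ cs))" for u v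
  proof -
    consider "(u, v) \<in> edges G" | "(v, u) \<in> edges G" | "bottom u v" "(u, v) \<notin> edges G" "(v, u) \<notin> edges G"
      using stepsD[OF C uv] by (auto simp: adjp_def adjG_def)
    then show ?thesis
    proof cases
      case 3
      then have "u \<in> bvertices G" "v \<in> bvertices G"
        unfolding bottom_def bvertices_def by (auto simp: doubleton_eq_iff)
      then have "u \<notin> white G" "v \<notin> white G" using bvertices_not_internal by (auto simp: internal_def)
      then show ?thesis using 3 by (simp add: col_def edge_fun_def)
    qed (use edgesD black_white in \<open>auto simp: col_def edge_fun_def\<close>)
  qed
  then have "map (edge_fun (\<lambda>_. - 1)) (steps (circ cs)) = map (\<lambda>(u, v). col u * col v) (steps (circ cs))"
    by (auto intro!: map_cong)
  then have "prod_list (map (edge_fun (\<lambda>_. - 1)) (steps (circ cs))) = col (hd (circ cs)) * col (last (circ cs))"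
  proof -
    have "col u * col u = 1" for u by (simp add: col_def)
    moreover have "circ cs \<noteq> []" by (simp add: circ_def)
    ultimately have "prod_list (map (\<lambda>(u, v). col u * col v) (steps (circ cs))) = col (hd (circ cs)) * col (last (circ cs))"
      by (rule prod_steps_telescope)
    then show ?thesis
      using \<open>map (edge_fun (\<lambda>_. - 1)) (steps (circ cs)) = map (\<lambda>(u, v). col u * col v) (steps (circ cs))\<close>
      by (simp only:)
  qed
  also have "\<dots> = 1" using cycle_nonempty[OF C] by (simp add: circ_def col_def)
  finally have "(- 1) ^ card {(b, w) \<in> edges G. side_of b w cs} = (1 :: int)"
    unfolding prod_steps_sides[OF C] by simp
  then show ?thesis by (simp add: minus_one_power_iff split: if_splits)
qed

text \<open>
  The factor \<open>\<i>\<close> turns the sign \<open>(- 1) ^ (\<bar>\<Omega>\<bar> / 2 + 1)\<close> of a face into \<open>- 1\<close>.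
\<close>

abbreviation twist :: "(complex \<times> complex \<Rightarrow> real) \<Rightarrow> complex \<times> complex \<Rightarrow> complex" where
  "twist \<sigma> \<equiv> edge_fun (\<lambda>e. of_real (\<sigma> e) * \<i>)"

text \<open>The vertices strictly inside a polygon.\<close>

definition inside_vertices :: "complex list \<Rightarrow> complex set" where
  "inside_vertices cs = internal G \<inter> inside (rim cs)"

text \<open>
  The case of a polygon without edges inside: it bounds a finite face.
\<close>

lemma kasteleyn_face:
  assumes C: "cycle adjp cs" and K: "kasteleyn_signature G \<sigma>"
    and E: "\<And>b w. (b, w) \<in> edges G \<Longrightarrow> \<not> open_segment b w \<subseteq> inside (rim cs)"
  shows "prod_list (map (twist \<sigma>) (steps (circ cs))) = - 1" "inside_vertices cs = {}"
proof -
  have E': "\<not> open_segment u v \<subseteq> inside (rim cs)" if "adjG u v" for u v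
    using that E[of u v] E[of v u] unfolding adjG_def by (metis open_segment_commute)
  have emp: "inside (rim cs) \<inter> gset = {}"
  proof (rule ccontr)
    assume "\<not> ?thesis"
    then obtain x where x: "x \<in> inside (rim cs)" "x \<in> gset" by blast
    obtain u v where uv: "adjG u v" "x \<in> closed_segment u v" using gset_cases[OF x(2)] .
    then have "closed_segment u v \<inter> inside (rim cs) \<noteq> {}" using x(1) by blast
    then show False using edge_meets_inside[OF C uv(1)] E'[OF uv(1)] by blast
  qed
  have "internal G \<subseteq> gset" by (auto simp: internal_def gset_def black_def)
  then show "inside_vertices cs = {}" using emp by (auto simp: inside_vertices_def)
  obtain F where F: "F \<in> finite_faces G" "face_edges G F = {(b, w) \<in> edges G. side_of b w cs}"
    using empty_polygon_face[OF C emp] .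
  define m where "m = card (face_edges G F)"
  have s: "(\<Prod>e \<in> face_edges G F. \<sigma> e) = (- 1) ^ (m div 2 + 1)"
    using K F(1) unfolding kasteleyn_signature_def m_def by blast
  have "even m" using even_sides[OF C] F(2) by (simp add: m_def)
  then obtain k where k: "m = 2 * k" by blast
  have "prod_list (map (twist \<sigma>) (steps (circ cs))) = (\<Prod>e \<in> face_edges G F. of_real (\<sigma> e) * \<i>)"
    unfolding prod_steps_sides[OF C] F(2) ..
  also have "\<dots> = of_real (\<Prod>e \<in> face_edges G F. \<sigma> e) * \<i> ^ m"
    by (simp add: prod.distrib m_def)
  also have "\<dots> = - 1"
    unfolding s k by (simp add: power_mult power_add flip: power_mult_distrib)
  finally show "prod_list (map (twist \<sigma>) (steps (circ cs))) = - 1" .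
qed

lemma twist_path_square:
  assumes "kasteleyn_signature G \<sigma>" "successively adjG xs"
  shows "prod_list (map (twist \<sigma>) (steps xs)) * prod_list (map (twist \<sigma>) (steps xs)) = (- 1) ^ (length xs - 1)"
  using assms(2)
proof (induction xs rule: induct_list012)
  case (3 a b xs)
  have s: "of_real (\<sigma> e) * of_real (\<sigma> e) = (1 :: complex)" if "e \<in> edges G" for e
  proof -
    have "\<sigma> e = 1 \<or> \<sigma> e = - 1" using assms(1) that unfolding kasteleyn_signature_def by blast
    then show ?thesis by auto
  qed
  have "of_real (\<sigma> e) * \<i> * (of_real (\<sigma> e) * \<i>) = (- 1 :: complex)" if "e \<in> edges G" for e
  proof -
    have "of_real (\<sigma> e) * \<i> * (of_real (\<sigma> e) * \<i>) = (of_real (\<sigma> e) * of_real (\<sigma> e)) * (\<i> * \<i>)"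
      by (simp only: mult_ac)
    then show ?thesis using s[OF that] by simp
  qed
  then have t: "twist \<sigma> (a, b) * twist \<sigma> (a, b) = - 1"
    using 3 by (auto simp: edge_fun_def adjG_def)
  define P where "P = prod_list (map (twist \<sigma>) (steps (b # xs)))"
  have "P * P = (- 1) ^ length xs" using 3 by (simp add: P_def)
  moreover have "twist \<sigma> (a, b) * P * (twist \<sigma> (a, b) * P) = (twist \<sigma> (a, b) * twist \<sigma> (a, b)) * (P * P)"
    by (simp only: mult_ac)
  ultimately show ?case using t by (simp add: P_def)
qed auto

lemma vertices_on_path:
  assumes sp: "successively adjp xs" and len: "2 \<le> length xs"
  shows "internal G \<inter> ptrace xs \<subseteq> set xs"
proof
  fix x assume x: "x \<in> internal G \<inter> ptrace xs"
  then have "x \<in> black G \<union> white G" by (auto simp: internal_def black_def)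
  then obtain y where y: "adjG x y" using has_nbr by blast
  obtain c d where cd: "(c, d) \<in> set (steps xs)" "x \<in> closed_segment c d"
    using x unfolding ptrace_def by blast
  have mem: "c \<in> set xs" "d \<in> set xs" using in_steps[OF cd(1)] by auto
  have a: "adjp c d" using sp cd(1) unfolding successively_steps by blast
  show "x \<in> set xs"
  proof (cases "{x, y} = {c, d}")
    case True
    then show ?thesis using mem by (auto simp: doubleton_eq_iff)
  next
    case False
    then have "x \<in> {c, d}"
      using plane_adjD(3)[OF adjp_plane adjG_adjp[OF y] a] cd(2) by auto
    then show ?thesis using mem by blast
  qed
qed

text \<open>
  The induction is on the number of edges inside.  A chord cuts the polygon into two.  Its own
  product occurs in both parts; the square of this product is \<open>(- 1) ^ (m + 1)\<close> if there are \<open>m\<close>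
  vertices in the interior of the chord, which are counted inside the polygon but not inside either
  part.
\<close>

theorem kasteleyn_polygon:
  assumes cont: continuable and K: "kasteleyn_signature G \<sigma>" and C: "cycle adjp cs"
  shows "prod_list (map (twist \<sigma>) (steps (circ cs))) = - ((- 1) ^ card (inside_vertices cs))"
  using C
proof (induction "card {(b, w) \<in> edges G. open_segment b w \<subseteq> inside (rim cs)}" arbitrary: cs rule: less_induct)
  case less
  note C = less.prems
  define IE where "IE cs = {(b, w) \<in> edges G. open_segment b w \<subseteq> inside (rim cs)}" for cs
  have finIE: "finite (IE cs)" for cs
    using finite_edges by (rule finite_subset[rotated]) (auto simp: IE_def)
  show ?case
  proof (cases "IE cs = {}")
    case True
    then have "\<And>b w. (b, w) \<in> edges G \<Longrightarrow> \<not> open_segment b w \<subseteq> inside (rim cs)"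
      by (auto simp: IE_def)
    then show ?thesis using kasteleyn_face[OF C K] by simp
  next
    case False
    then obtain u v where uv: "adjG u v" "open_segment u v \<subseteq> inside (rim cs)"
      by (auto simp: IE_def adjG_def)
    obtain a b xs ys ps us vs where cs: "cs = us @ vs" "vs @ us = a # xs @ b # ys"
      and ps: "distinct ps" "set ps \<inter> set cs = {}" "successively adjG (a # ps @ [b])"
        "set ps \<subseteq> inside (rim cs)" "ptrace (a # ps @ [b]) \<inter> inside (rim cs) \<noteq> {}"
      and e: "\<exists>c. (a, c) \<in> set (steps (a # ps @ [b])) \<and> open_segment a c \<subseteq> inside (rim cs)"
      using find_chord[OF C cont uv] .
    define C0 where "C0 = a # xs @ b # ys"
    define C1 where "C1 = a # xs @ b # rev ps"
    define C2 where "C2 = a # ps @ b # ys"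
    have rot: "rim cs = rim C0" "prod_list (map f (steps (circ cs))) = prod_list (map f (steps (circ C0)))"
      for f :: "complex \<times> complex \<Rightarrow> complex"
      using ptrace_rotate[of us vs] circ_rotate(1)[of f us vs] cs by (simp_all add: C0_def)
    have cyc0: "cycle adjp C0" using C cycle_rotate[of adjp us vs] cs by (simp add: C0_def)
    have set0: "set cs = set C0"
    proof -
      have "set cs = set (vs @ us)" using cs(1) by auto
      then show ?thesis using cs(2) by (simp add: C0_def)
    qed
    have spp: "successively adjp (a # ps @ [b])"
      using ps(3) adjG_adjp unfolding successively_steps by blast
    have dj: "set ps \<inter> set (a # xs @ b # ys) = {}" using ps(2) set0 by (simp add: C0_def)
    have ins: "ptrace (a # ps @ [b]) \<inter> inside (rim (a # xs @ b # ys)) \<noteq> {}"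
      using ps(5) unfolding rot(1) C0_def .
    note split = chord_split[OF adjp_plane cyc0[unfolded C0_def] ps(1) dj spp ins,
        folded C0_def C1_def C2_def]
    have sub: "inside (rim C1) \<subseteq> inside (rim C0)" "inside (rim C2) \<subseteq> inside (rim C0)"
      using split(4) by blast+
    have chordC: "ptrace (a # ps @ [b]) \<subseteq> rim C1" "ptrace (a # ps @ [b]) \<subseteq> rim C2"
      unfolding C1_def C2_def ptrace_circ_split
      using ptrace_rev[of "a # ps @ [b]"] by auto
    obtain c where c: "(a, c) \<in> set (steps (a # ps @ [b]))" "open_segment a c \<subseteq> inside (rim cs)"
      using e by blast
    have ac: "adjG a c" using c(1) ps(3) unfolding successively_steps by blast
    have nac: "\<not> open_segment a c \<subseteq> inside (rim C')" if "ptrace (a # ps @ [b]) \<subseteq> rim C'" for C'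
    proof
      assume h: "open_segment a c \<subseteq> inside (rim C')"
      have "closed_segment a c \<subseteq> ptrace (a # ps @ [b])" using c(1) unfolding ptrace_def by force
      then have "open_segment a c \<subseteq> rim C'" using that segment_open_subset_closed by blast
      moreover have "open_segment a c \<noteq> {}" using edge_irrefl[OF adjG_adjp[OF ac]] by simp
      ultimately show False using h inside_rim_disjoint by blast
    qed
    have dec: "card (IE C') < card (IE cs)"
      if "inside (rim C') \<subseteq> inside (rim C0)" "ptrace (a # ps @ [b]) \<subseteq> rim C'" for C'
    proof (rule psubset_card_mono[OF finIE])
      obtain p q where pq: "(p, q) \<in> edges G" "open_segment p q = open_segment a c"
        using ac unfolding adjG_def by (metis open_segment_commute)
      then have "(p, q) \<in> IE cs" "(p, q) \<notin> IE C'" using c(2) nac[OF that(2)]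
        unfolding IE_def mem_Collect_eq prod.case pq(2) by blast+
      moreover have "IE C' \<subseteq> IE cs" using that(1) rot(1) by (auto simp: IE_def)
      ultimately show "IE C' \<subset> IE cs" by blast
    qed
    define w where "w zs = prod_list (map (twist \<sigma>) (steps zs))" for zs
    have k1: "w (circ C1) = - ((- 1) ^ card (inside_vertices C1))"
      unfolding w_def using less.hyps[OF _ split(1)] dec[OF sub(1) chordC(1)] unfolding IE_def by blast
    have k2: "w (circ C2) = - ((- 1) ^ card (inside_vertices C2))"
      unfolding w_def using less.hyps[OF _ split(2)] dec[OF sub(2) chordC(2)] unfolding IE_def by blast
    define Q where "Q = w (a # ps @ [b])"
    have Qr: "w (b # rev ps @ [a]) = Q"
      using edge_fun_rev[of "\<lambda>e. of_real (\<sigma> e) * \<i>" "a # ps @ [b]"] by (simp add: Q_def w_def)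
    have w0: "w (circ C0) = w (a # xs @ [b]) * w (b # ys @ [a])"
      unfolding w_def C0_def steps_circ_split by simp
    have w1: "w (circ C1) = w (a # xs @ [b]) * Q"
      unfolding Qr[symmetric] unfolding w_def C1_def steps_circ_split by simp
    have w2: "w (circ C2) = Q * w (b # ys @ [a])"
      unfolding Q_def unfolding w_def C2_def steps_circ_split by simp
    have QQ: "Q * Q = (- 1) ^ Suc (length ps)"
      using twist_path_square[OF K ps(3)] by (simp add: Q_def w_def)
    have cardV: "card (inside_vertices cs) = card (inside_vertices C1) + card (inside_vertices C2) + length ps"
    proof -
      have psv: "set ps \<subseteq> internal G"
      proof
        fix x assume x: "x \<in> set ps"
        then have "x \<in> black G \<union> white G"
        proof -
          obtain y where "(x, y) \<in> set (steps (a # ps @ [b]))"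
          proof -
            obtain p1 p2 where "ps = p1 @ x # p2" using x by (meson split_list)
            then show ?thesis
              using that[of "hd (p2 @ [b])"] set_steps_append[of "a # p1" x "p2 @ [b]"]
              by (cases "p2 @ [b]") auto
          qed
          then have "adjG x y" using ps(3) unfolding successively_steps by blast
          then show ?thesis using adjG_vertices by blast
        qed
        moreover have "x \<notin> bvertices G" using bvertex_not_inside[OF C] x ps(4) by blast
        ultimately show "x \<in> internal G" using vertex_cases by blast
      qed
      have onch: "internal G \<inter> (ptrace (a # ps @ [b]) - {a, b}) = set ps"
      proof
        show "internal G \<inter> (ptrace (a # ps @ [b]) - {a, b}) \<subseteq> set ps"
          using vertices_on_path[OF spp] by auto
        have "set ps \<inter> {a, b} = {}" using dj by auto
        then show "set ps \<subseteq> internal G \<inter> (ptrace (a # ps @ [b]) - {a, b})"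
          using psv set_subset_ptrace[of "a # ps @ [b]"] by auto
      qed
      have un: "inside_vertices cs = inside_vertices C1 \<union> inside_vertices C2 \<union> set ps"
        unfolding inside_vertices_def rot(1) split(4)[symmetric] using onch by blast
      have f: "finite (inside_vertices C1)" "finite (inside_vertices C2)"
        using finite_vertices(5) by (simp_all add: inside_vertices_def)
      have d1: "inside_vertices C1 \<inter> inside_vertices C2 = {}" using split(3) by (auto simp: inside_vertices_def)
      have "set ps \<subseteq> ptrace (a # ps @ [b])" using set_subset_ptrace[of "a # ps @ [b]"] by auto
      then have d2: "(inside_vertices C1 \<union> inside_vertices C2) \<inter> set ps = {}"
        using chordC inside_rim_disjoint unfolding inside_vertices_def by blast
      have "card (inside_vertices cs) = card (inside_vertices C1 \<union> inside_vertices C2) + card (set ps)"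
        unfolding un using f d2 by (intro card_Un_disjoint) auto
      also have "card (inside_vertices C1 \<union> inside_vertices C2) = card (inside_vertices C1) + card (inside_vertices C2)"
        using f d1 by (rule card_Un_disjoint)
      finally show ?thesis using ps(1) by (simp add: distinct_card)
    qed
    have "w (circ C0) * (Q * Q) = w (circ C1) * w (circ C2)"
      unfolding w0 w1 w2 by (simp only: mult_ac)
    then have "w (circ C0) * (- 1) ^ Suc (length ps) = (- 1) ^ (card (inside_vertices C1) + card (inside_vertices C2))"
      unfolding QQ k1 k2 by (simp add: power_add)
    then have "w (circ C0) * (- 1) ^ Suc (length ps) * (- 1) ^ Suc (length ps)
        = (- 1) ^ (card (inside_vertices C1) + card (inside_vertices C2)) * (- 1) ^ Suc (length ps)" by simp
    moreover have "(- 1) ^ Suc (length ps) * (- 1) ^ Suc (length ps) = (1 :: complex)"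
      by (metis power_mult_distrib mult_minus1 minus_minus power_one)
    ultimately have "w (circ C0) = (- 1) ^ (card (inside_vertices C1) + card (inside_vertices C2)) * (- 1) ^ Suc (length ps)"
      by (simp only: mult.assoc mult_1_right)
    also have "\<dots> = - ((- 1) ^ card (inside_vertices cs))" unfolding cardV by (simp add: power_add)
    finally show ?thesis unfolding rot(2) w_def .
  qed
qed

end

section \<open>Removing edges merges faces\<close>

lemma empty_interior_lines:
  fixes d :: "'i \<Rightarrow> complex"
  assumes "finite E" "\<And>e. e \<in> E \<Longrightarrow> d e \<noteq> 0"
  shows "interior (\<Union>e \<in> E. {x. inner (d e) x = r e}) = {} \<and> closed (\<Union>e \<in> E. {x. inner (d e) x = r e})"
  using assms
proof (induction rule: finite_induct)
  case (insert e E)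
  then have "interior ({x. inner (d e) x = r e} \<union> (\<Union>e \<in> E. {x. inner (d e) x = r e})) = interior {x. inner (d e) x = r e}"
    by (intro interior_closed_Un_empty_interior) (auto simp: closed_hyperplane)
  then show ?case using insert by (simp add: closed_hyperplane closed_Un)
qed simp

text \<open>
  A normal vector of the line through a segment; a point is treated as a segment on a horizontal line.
\<close>

definition line_normal :: "complex \<times> complex \<Rightarrow> complex" where
  "line_normal e = \<i> * (if fst e = snd e then 1 else snd e - fst e)"

lemma line_normal_nonzero: "line_normal e \<noteq> 0"
  by (simp add: line_normal_def)

lemma segment_on_line:
  assumes "x \<in> seg e"
  shows "inner (line_normal e) x = inner (line_normal e) (fst e)"
proof -
  obtain s where "x = (1 - s) *\<^sub>R fst e + s *\<^sub>R snd e" using assms unfolding in_segment by blast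
  then have "x = fst e + s *\<^sub>R (snd e - fst e)" by (simp add: algebra_simps)
  moreover have "inner (line_normal e) (snd e - fst e) = 0"
    by (simp add: line_normal_def inner_complex_def)
  ultimately show ?thesis by (simp only: inner_add_right inner_scaleR_right mult_zero_right add_0_right)
qed

text \<open>
  Every component of a convex set without some segments contains points that lie on none of the lines
  through these segments.
\<close>

lemma components_avoid_lines:
  assumes D: "convex D" "interior D \<noteq> {}" and E: "finite E"
    and F: "closed F" and c: "c \<in> components (D - F)"
  obtains x where "x \<in> c" "\<And>e. e \<in> E \<Longrightarrow> inner (line_normal e) x \<noteq> inner (line_normal e) (fst e)"
proof -
  obtain q where q: "q \<in> c" using in_components_nonempty[OF c] by blast
  have cs: "c \<subseteq> D - F" using in_components_subset[OF c] .
  then have "q \<in> - F" using q by blast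
  then obtain r where r: "r > 0" "ball q r \<subseteq> - F"
    using F open_contains_ball[of "- F"] by (auto simp: open_Compl)
  define B where "B = ball q r \<inter> D"
  have "B \<subseteq> c"
  proof (rule components_maximal[OF c])
    show "connected B" unfolding B_def using D(1) by (intro convex_connected convex_Int) auto
    show "B \<subseteq> D - F" using r by (auto simp: B_def)
    show "c \<inter> B \<noteq> {}" using q cs r(1) by (auto simp: B_def)
  qed
  then have "ball q r \<inter> interior D \<subseteq> c" using interior_subset by (auto simp: B_def)
  moreover have "ball q r \<inter> interior D \<noteq> {}"
  proof -
    have "q \<in> closure (interior D)"
      using q cs convex_closure_interior[OF D] closure_subset by blast
    then show ?thesis
      using open_Int_closure_eq_empty[OF open_ball, of q r "interior D"] centre_in_ball[of q r] r(1) by blast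
  qed
  moreover have "open (ball q r \<inter> interior D)" by (intro open_Int open_ball open_interior)
  moreover define L where "L = (\<Union>e \<in> E. {x. inner (line_normal e) x = inner (line_normal e) (fst e)})"
  moreover have "interior L = {}"
    unfolding L_def
    using empty_interior_lines[OF E, of line_normal "\<lambda>e. inner (line_normal e) (fst e)"] line_normal_nonzero by blast
  ultimately obtain x where "x \<in> ball q r \<inter> interior D" "x \<notin> L" "ball q r \<inter> interior D \<subseteq> c"
    using interior_maximal[of "ball q r \<inter> interior D" L] by blast
  then show ?thesis using that[of x] by (auto simp: L_def)
qed

text \<open>
  Two points off these lines that lie on the same side of each of them are joined by a segment that
  meets none of the given segments.  So a component is determined by the position of one of its points
  relative to the lines.
\<close>

lemma finite_components_segments:
  assumes D: "convex D" "interior D \<noteq> {}" and E: "finite E"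
  shows "finite (components (D - (\<Union>e \<in> E. seg e)))"
proof -
  define F where "F = (\<Union>e \<in> E. seg e)"
  define sg where "sg x = {e \<in> E. inner (line_normal e) x > inner (line_normal e) (fst e)}" for x
  define good where "good x \<longleftrightarrow> (\<forall>e \<in> E. inner (line_normal e) x \<noteq> inner (line_normal e) (fst e))" for x
  have F: "closed F" unfolding F_def using E by (intro closed_UN) auto
  have "\<exists>x. x \<in> c \<and> good x" if "c \<in> components (D - F)" for c
    using components_avoid_lines[OF D E F that] unfolding good_def by metis
  then obtain p where p: "\<And>c. c \<in> components (D - F) \<Longrightarrow> p c \<in> c \<and> good (p c)" by metis
  have "inj_on (\<lambda>c. sg (p c)) (components (D - F))"
  proof (rule inj_onI)
    fix c c' assume c: "c \<in> components (D - F)" "c' \<in> components (D - F)" "sg (p c) = sg (p c')"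
    define X where "X = closed_segment (p c) (p c')"
    have pD: "p c \<in> D" "p c' \<in> D" using p c in_components_subset by blast+
    have "x \<notin> F" if x: "x \<in> X" for x
    proof
      assume "x \<in> F"
      then obtain e where e: "e \<in> E" "x \<in> seg e" unfolding F_def by blast
      define n where "n = line_normal e"
      define r where "r = inner n (fst e)"
      have xr: "inner n x = r" using segment_on_line[OF e(2)] by (simp add: n_def r_def)
      obtain s where s: "0 \<le> s" "s \<le> 1" "x = (1 - s) *\<^sub>R p c + s *\<^sub>R p c'"
        using x unfolding X_def in_segment by blast
      have nx: "r = (1 - s) * (inner n (p c)) + s * (inner n (p c'))"
        using xr unfolding s(3) by (simp only: inner_add_right inner_scaleR_right)
      have ne: "inner n (p c) \<noteq> r" "inner n (p c') \<noteq> r"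
        using p[OF c(1)] p[OF c(2)] e(1) by (auto simp: good_def n_def r_def)
      have iff: "inner n (p c) > r \<longleftrightarrow> inner n (p c') > r"
        using c(3) e(1) unfolding sg_def n_def r_def by blast
      have "(1 - s) * (inner n (p c) - r) + s * (inner n (p c') - r) = 0" using nx by (simp add: algebra_simps)
      moreover have "(1 - s) * (inner n (p c) - r) + s * (inner n (p c') - r) > 0" if "inner n (p c) > r"
        using that iff s(1,2) by (cases "s = 0") (auto intro: add_nonneg_pos)
      moreover have "(1 - s) * (r - inner n (p c)) + s * (r - inner n (p c')) > 0" if "inner n (p c) < r"
        using that iff ne s(1,2) by (cases "s = 0") (auto intro: add_nonneg_pos)
      ultimately show False using ne by (smt (verit, best) mult_minus_right minus_diff_eq)
    qed
    moreover have "X \<subseteq> D" unfolding X_def using D(1) pD by (rule closed_segment_subset[rotated 2])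
    ultimately have XT: "X \<subseteq> D - F" by blast
    have "connected X" unfolding X_def by simp
    then have "X \<subseteq> c" "X \<subseteq> c'"
      using components_maximal[OF c(1) _ XT] components_maximal[OF c(2) _ XT] p[OF c(1)] p[OF c(2)]
      unfolding X_def by auto
    then have "c \<inter> c' \<noteq> {}" unfolding X_def by auto
    then show "c = c'" using components_nonoverlap[OF c(1,2)] by blast
  qed
  moreover have "(\<lambda>c. sg (p c)) ` components (D - F) \<subseteq> Pow E" by (auto simp: sg_def)
  ultimately show ?thesis
    using E finite_subset finite_imageD unfolding F_def by (metis finite_Pow_iff)
qed

text \<open>
  If fewer segments are removed, then each old component lies in a new one, and each new one
  contains an old one.  Hence the number of components drops when two old ones are joined.
\<close>

lemma card_components_less:
  assumes D: "convex D" "interior D \<noteq> {}" and E: "finite E" and E': "finite E'"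
    and sub: "(\<Union>e \<in> E'. seg e) \<subseteq> (\<Union>e \<in> E. seg e)"
    and f: "f1 \<in> components (D - (\<Union>e \<in> E. seg e))" "f2 \<in> components (D - (\<Union>e \<in> E. seg e))" "f1 \<noteq> f2"
    and X: "connected X" "X \<subseteq> D - (\<Union>e \<in> E'. seg e)" "X \<inter> f1 \<noteq> {}" "X \<inter> f2 \<noteq> {}"
  shows "card (components (D - (\<Union>e \<in> E'. seg e))) < card (components (D - (\<Union>e \<in> E. seg e)))"
proof -
  define T T' where "T = D - (\<Union>e \<in> E. seg e)" and "T' = D - (\<Union>e \<in> E'. seg e)"
  note f = f[folded T_def] and X = X[folded T'_def]
  have TT: "T \<subseteq> T'" using sub by (auto simp: T_def T'_def)
  have cl: "closed (\<Union>e \<in> E'. seg e)" using E' by (intro closed_UN) auto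
  have fin: "finite (components T)" unfolding T_def by (rule finite_components_segments[OF D E])
  have "\<exists>c' \<in> components T'. c \<subseteq> c'" if c: "c \<in> components T" for c
  proof -
    have "c \<noteq> {}" "connected c" "c \<subseteq> T'"
      using in_components_nonempty[OF c] in_components_connected[OF c] in_components_subset[OF c] TT by auto
    then show ?thesis using exists_component_superset[of c T'] by blast
  qed
  then obtain \<phi> where \<phi>: "\<And>c. c \<in> components T \<Longrightarrow> \<phi> c \<in> components T' \<and> c \<subseteq> \<phi> c" by metis
  have uniq: "\<phi> c = c'" if "c \<in> components T" "c' \<in> components T'" "c \<inter> c' \<noteq> {}" for c c'
  proof -
    have "\<phi> c \<inter> c' \<noteq> {}" using \<phi>[OF that(1)] that(3) by blast
    then show ?thesis using components_nonoverlap[of "\<phi> c" T' c'] \<phi>[OF that(1)] that(2) by blast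
  qed
  have surj: "components T' \<subseteq> \<phi> ` components T"
  proof
    fix c' assume c': "c' \<in> components T'"
    obtain x where x: "x \<in> c'" "\<And>e. e \<in> E \<Longrightarrow> inner (line_normal e) x \<noteq> inner (line_normal e) (fst e)"
      using components_avoid_lines[OF D E cl c'[unfolded T'_def]] by metis
    have "x \<notin> (\<Union>e \<in> E. seg e)" using x(2) segment_on_line by blast
    moreover have "x \<in> D" using in_components_subset[OF c'] x(1) by (auto simp: T'_def)
    ultimately have "x \<in> T" by (simp add: T_def)
    then obtain c where c: "c \<in> components T" "x \<in> c" using Union_components[of T] by blast
    then have "\<phi> c = c'" using uniq[OF c(1) c'] x(1) by blast
    then show "c' \<in> \<phi> ` components T" using c(1) by blast
  qed
  obtain c' where c': "c' \<in> components T'" "X \<subseteq> c'"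
    using exists_component_superset[OF X(2) _ X(1)] X(2,3) by blast
  have "f1 \<inter> c' \<noteq> {}" "f2 \<inter> c' \<noteq> {}" using X(3,4) c'(2) by blast+
  then have eq: "\<phi> f1 = \<phi> f2" using uniq[OF f(1) c'(1)] uniq[OF f(2) c'(1)] by simp
  have "\<phi> ` components T \<subseteq> \<phi> ` (components T - {f1})"
  proof (rule image_subsetI)
    fix c assume c: "c \<in> components T"
    show "\<phi> c \<in> \<phi> ` (components T - {f1})"
    proof (cases "c = f1")
      case True
      have "\<phi> f2 \<in> \<phi> ` (components T - {f1})" using f(2,3) by (intro imageI) simp
      then show ?thesis using True eq by simp
    next
      case False
      then show ?thesis using c by (intro imageI) simp
    qed
  qed
  then have "components T' \<subseteq> \<phi> ` (components T - {f1})" by (rule subset_trans[OF surj])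
  then have "card (components T') \<le> card (components T - {f1})"
    using surj_card_le[of "components T - {f1}" "components T'" \<phi>] fin by simp
  also have "\<dots> < card (components T)" using fin f(1) by (rule card_Diff1_less)
  finally show ?thesis by (simp only: T_def T'_def)
qed

section \<open>Perfect orientations\<close>

lemma rtrancl_simple_path:
  assumes "(u, v) \<in> R\<^sup>*"
  obtains xs where "xs \<noteq> []" "distinct xs" "hd xs = u" "last xs = v" "successively (\<lambda>x y. (x, y) \<in> R) xs"
proof -
  have "\<exists>xs. xs \<noteq> [] \<and> distinct xs \<and> hd xs = u \<and> last xs = v \<and> successively (\<lambda>x y. (x, y) \<in> R) xs"
    using assms
  proof (induction rule: converse_rtrancl_induct)
    case base
    then show ?case by (intro exI[of _ "[v]"]) simp
  next
    case (step y z)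
    then obtain xs where xs: "xs \<noteq> []" "distinct xs" "hd xs = z" "last xs = v"
      "successively (\<lambda>x y. (x, y) \<in> R) xs" by blast
    show ?case
    proof (cases "y \<in> set xs")
      case False
      then show ?thesis using xs step(1) by (intro exI[of _ "y # xs"]) (cases xs; auto)
    next
      case True
      then obtain ps qs where "xs = ps @ y # qs" by (meson split_list)
      then show ?thesis using xs by (intro exI[of _ "y # qs"]) (auto simp: successively_append_iff)
    qed
  qed
  then show ?thesis using that by blast
qed

lemma longest_list:
  assumes "finite A" "P xs0" "\<And>xs. P xs \<Longrightarrow> distinct xs \<and> set xs \<subseteq> A"
  obtains xs where "P xs" "\<And>ys. P ys \<Longrightarrow> length ys \<le> length xs"
proof -
  have "length xs \<le> card A" if "P xs" for xs
    using assms(3)[OF that] card_mono[OF assms(1), of "set xs"] by (simp add: distinct_card)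
  then have "\<exists>xs. P xs \<and> (\<forall>ys. P ys \<longrightarrow> length ys \<le> length xs)"
    using ex_has_greatest_nat[of P xs0 length "Suc (card A)"] assms(2) by (auto simp: less_Suc_eq_le)
  then show ?thesis using that by blast
qed

text \<open>
  In a finite relation that is balanced outside of a set of terminals, an arc can be followed
  until it either closes up or reaches a terminal.
\<close>

lemma follow_arc:
  assumes fin: "finite D" and uv: "(u, v) \<in> D" and irr: "\<And>x. (x, x) \<notin> D"
    and ex: "\<And>x y. (x, y) \<in> D \<Longrightarrow> y \<notin> T \<Longrightarrow> \<exists>z. (y, z) \<in> D"
    and un: "\<And>x x' y. (x, y) \<in> D \<Longrightarrow> (x', y) \<in> D \<Longrightarrow> y \<notin> T \<Longrightarrow> x = x'"
    and through: "\<And>x y z. (x, y) \<in> D \<Longrightarrow> (y, z) \<in> D \<Longrightarrow> y \<notin> T"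
  obtains qs where "qs \<noteq> []" "distinct qs" "successively (\<lambda>x y. (x, y) \<in> D) qs" "hd qs = v"
    "last qs = u \<or> (last qs \<in> T \<and> u \<notin> set qs)"
proof -
  define P where "P qs \<longleftrightarrow> qs \<noteq> [] \<and> distinct qs \<and> successively (\<lambda>x y. (x, y) \<in> D) qs \<and> hd qs = v \<and> set qs \<subseteq> Range D" for qs
  have "P [v]" using uv by (auto simp: P_def)
  moreover have "finite (Range D)" using fin by (rule finite_Range)
  ultimately obtain qs where qs: "P qs" and max: "\<And>ys. P ys \<Longrightarrow> length ys \<le> length qs"
    using longest_list[of "Range D" P "[v]"] unfolding P_def by metis
  have q: "qs \<noteq> []" "distinct qs" "successively (\<lambda>x y. (x, y) \<in> D) qs" "hd qs = v"
    using qs by (auto simp: P_def)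
  show ?thesis
  proof (cases "u \<in> set qs")
    case True
    then obtain a b where ab: "qs = a @ u # b" by (meson split_list)
    then have "hd (a @ [u]) = v" using q(4) by (cases a) auto
    then show ?thesis using that[of "a @ [u]"] q ab by (auto simp: successively_append_iff)
  next
    case False
    have "last qs \<in> T"
    proof (rule ccontr)
      assume nT: "last qs \<notin> T"
      have "set qs \<subseteq> Range D" using qs by (simp add: P_def)
      then have "last qs \<in> Range D" using last_in_set[OF q(1)] by blast
      then obtain x where "(x, last qs) \<in> D" by blast
      then obtain z where z: "(last qs, z) \<in> D" using ex nT by blast
      have "z \<in> set qs"
      proof (rule ccontr)
        assume "z \<notin> set qs"
        then have "P (qs @ [z])" using qs z by (auto simp: P_def successively_append_iff)
        then show False using max[of "qs @ [z]"] by simp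
      qed
      then obtain a b where ab: "qs = a @ z # b" by (meson split_list)
      have b: "b \<noteq> []"
      proof
        assume "b = []"
        then have "last qs = z" using ab by simp
        then show False using z irr by simp
      qed
      then have "(z, hd b) \<in> D" using q(3) ab by (cases b) (auto simp: successively_append_iff)
      then have zT: "z \<notin> T" using through z by blast
      show False
      proof (cases a rule: rev_cases)
        case Nil
        then have "z = v" using q(4) ab by simp
        then have "last qs = u" using un[OF z _ zT] uv by blast
        then show False using False q(1) last_in_set by metis
      next
        case (snoc a' y)
        then have "(y, z) \<in> D" using q(3) ab by (auto simp: successively_append_iff)
        then have "last qs = y" using un[OF z _ zT] by blast
        moreover have "last qs \<in> set b" using ab b by simp
        ultimately show False using q(2) ab snoc by auto
      qed
    qed
    then show ?thesis using that q False by blast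
  qed
qed

context gauged_graph
begin

lemma po_sub: "perfect_orientation G Or \<Longrightarrow> (u, v) \<in> Or \<Longrightarrow> (u, v) \<in> edges G \<or> (v, u) \<in> edges G"
  unfolding perfect_orientation_def by auto

lemma po_edge: "perfect_orientation G Or \<Longrightarrow> (b, w) \<in> edges G \<Longrightarrow> (b, w) \<in> Or \<longleftrightarrow> (w, b) \<notin> Or"
  unfolding perfect_orientation_def by blast

lemma po_black: "perfect_orientation G Or \<Longrightarrow> b \<in> iblack G \<Longrightarrow> \<exists>!w. (b, w) \<in> Or"
  unfolding perfect_orientation_def by blast

lemma po_white: "perfect_orientation G Or \<Longrightarrow> w \<in> white G \<Longrightarrow> \<exists>!b. (b, w) \<in> Or"
  unfolding perfect_orientation_def by blast

lemma po_asym: "perfect_orientation G Or \<Longrightarrow> (u, v) \<in> Or \<Longrightarrow> (v, u) \<notin> Or"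
  using po_sub po_edge by blast

lemma po_total: "perfect_orientation G Or \<Longrightarrow> adjG u v \<Longrightarrow> (u, v) \<in> Or \<or> (v, u) \<in> Or"
  using po_edge unfolding adjG_def by blast

lemma po_adjG: "perfect_orientation G Or \<Longrightarrow> (u, v) \<in> Or \<Longrightarrow> adjG u v"
  using po_sub unfolding adjG_def by blast

lemma po_finite: "perfect_orientation G Or \<Longrightarrow> finite Or"
  using finite_edges unfolding perfect_orientation_def by (meson finite_UnI finite_converse finite_subset)

lemma po_colors:
  assumes "perfect_orientation G Or" "(u, v) \<in> Or"
  shows "u \<in> black G \<and> v \<in> white G \<and> (u, v) \<in> edges G \<or> u \<in> white G \<and> v \<in> black G \<and> (v, u) \<in> edges G"
  using po_sub[OF assms] edgesD by blast

text \<open>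
  Two perfect orientations differ by the reversal of arcs that form directed polygons and directed
  paths between boundary vertices.
\<close>

lemma difference_next:
  assumes O: "perfect_orientation G Or" "perfect_orientation G Or'" and xy: "(x, y) \<in> Or - Or'"
    and y: "y \<notin> bvertices G"
  shows "\<exists>z. (y, z) \<in> Or - Or'" "(x', y) \<in> Or - Or' \<Longrightarrow> x = x'"
proof -
  have rev: "(y, a) \<in> Or'" if "(a, y) \<in> Or - Or'" for a
    using that po_total[OF O(2) po_adjG[OF O(1)]] by blast
  have "(x, y) \<in> Or" using xy by blast
  from po_colors[OF O(1) this]
  have *: "(\<exists>z. (y, z) \<in> Or - Or') \<and> ((x', y) \<in> Or - Or' \<longrightarrow> x = x')"
  proof (elim disjE)
    assume "x \<in> black G \<and> y \<in> white G \<and> (x, y) \<in> edges G"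
    then have w: "y \<in> white G" by blast
    obtain z where z: "(z, y) \<in> Or'" using po_white[OF O(2) w] by blast
    have "z \<noteq> x" using z xy by blast
    then have "(z, y) \<notin> Or" using po_white[OF O(1) w] xy by blast
    then have "(y, z) \<in> Or" using po_total[OF O(1) po_adjG[OF O(2) z]] by blast
    moreover have "(y, z) \<notin> Or'" using po_asym[OF O(2) z] .
    moreover have "(x', y) \<in> Or - Or' \<longrightarrow> x = x'" using po_white[OF O(1) w] xy by blast
    ultimately show ?thesis by blast
  next
    assume "x \<in> white G \<and> y \<in> black G \<and> (y, x) \<in> edges G"
    then have b: "y \<in> iblack G" using y black_cases by blast
    obtain z where z: "(y, z) \<in> Or" using po_black[OF O(1) b] by blast
    have "z \<noteq> x" using po_asym[OF O(1)] z xy by blast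
    then have "(y, z) \<notin> Or'" using po_black[OF O(2) b] rev[OF xy] by blast
    moreover have "(x', y) \<in> Or - Or' \<longrightarrow> x = x'" using po_black[OF O(2) b] rev xy by blast
    ultimately show ?thesis using z by blast
  qed
  show "\<exists>z. (y, z) \<in> Or - Or'" using * by blast
  show "(x', y) \<in> Or - Or' \<Longrightarrow> x = x'" using * by blast
qed

end

context kp_graph
begin

text \<open>Every edge has both directions in suitable perfect orientations.\<close>

definition flexible :: bool where
  "flexible \<longleftrightarrow> (\<forall>u v. adjG u v \<longrightarrow> (\<exists>Or. perfect_orientation G Or \<and> (u, v) \<in> Or))"

text \<open>
  Any arc can be followed until it closes up or reaches the boundary: compare the perfect orientation
  with one that has the arc reversed, and follow the arcs in which the two differ.
\<close>

lemma follow_orientation: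
  assumes flexible and O: "perfect_orientation G Or" and uv: "(u, v) \<in> Or"
  obtains qs where "qs \<noteq> []" "distinct qs" "successively (\<lambda>x y. (x, y) \<in> Or) qs" "hd qs = v"
    "last qs = u \<or> (last qs \<in> bvertices G \<and> u \<notin> set qs)"
proof -
  obtain Or' where O': "perfect_orientation G Or'" "(v, u) \<in> Or'"
    using assms(1) adjG_sym[OF po_adjG[OF O uv]] unfolding flexible_def by blast
  have D: "(u, v) \<in> Or - Or'" using uv po_asym[OF O'] by blast
  have fin: "finite (Or - Or')" using po_finite[OF O] by simp
  have irr: "(x, x) \<notin> Or - Or'" for x using po_asym[OF O] by blast
  have t: "y \<notin> bvertices G" if "(x, y) \<in> Or - Or'" "(y, z) \<in> Or - Or'" for x y z
  proof
    assume b: "y \<in> bvertices G"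
    have "x = z" using bvertex_nbr_unique[OF b adjG_sym[OF po_adjG[OF O]] po_adjG[OF O]] that by blast
    then show False using that po_asym[OF O] by blast
  qed
  obtain qs where qs: "qs \<noteq> []" "distinct qs" "successively (\<lambda>x y. (x, y) \<in> Or - Or') qs" "hd qs = v"
    "last qs = u \<or> (last qs \<in> bvertices G \<and> u \<notin> set qs)"
    using follow_arc[OF fin D irr difference_next(1)[OF O O'(1)] difference_next(2)[OF O O'(1)] t] .
  have "successively (\<lambda>x y. (x, y) \<in> Or) qs"
    using qs(3) unfolding successively_steps by auto
  then show ?thesis using that qs by blast
qed

lemma follow_orientation_back:
  assumes flexible and O: "perfect_orientation G Or" and uv: "(u, v) \<in> Or"
  obtains qs where "qs \<noteq> []" "distinct qs" "successively (\<lambda>x y. (x, y) \<in> Or) qs" "last qs = u"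
    "hd qs = v \<or> (hd qs \<in> bvertices G \<and> v \<notin> set qs)"
proof -
  obtain Or' where O': "perfect_orientation G Or'" "(v, u) \<in> Or'"
    using assms(1) adjG_sym[OF po_adjG[OF O uv]] unfolding flexible_def by blast
  have D: "(v, u) \<in> Or' - Or" using O' po_asym[OF O uv] by blast
  have fin: "finite (Or' - Or)" using po_finite[OF O'(1)] by simp
  have irr: "(x, x) \<notin> Or' - Or" for x using po_asym[OF O'(1)] by blast
  have t: "y \<notin> bvertices G" if "(x, y) \<in> Or' - Or" "(y, z) \<in> Or' - Or" for x y z
  proof
    assume b: "y \<in> bvertices G"
    have "x = z" using bvertex_nbr_unique[OF b adjG_sym[OF po_adjG[OF O'(1)]] po_adjG[OF O'(1)]] that by blast
    then show False using that po_asym[OF O'(1)] by blast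
  qed
  obtain qs where qs: "qs \<noteq> []" "distinct qs" "successively (\<lambda>x y. (x, y) \<in> Or' - Or) qs" "hd qs = u"
    "last qs = v \<or> (last qs \<in> bvertices G \<and> v \<notin> set qs)"
    using follow_arc[OF fin D irr difference_next(1)[OF O'(1) O] difference_next(2)[OF O'(1) O] t] .
  have "(x, y) \<in> Or" if "(y, x) \<in> Or' - Or" for x y
    using that po_total[OF O adjG_sym[OF po_adjG[OF O'(1)]]] by blast
  then have "successively (\<lambda>x y. (x, y) \<in> Or) (rev qs)"
    using qs(3) unfolding successively_steps set_steps_rev by fastforce
  then show ?thesis using that[of "rev qs"] qs by (simp add: hd_rev last_rev)
qed

lemma flexible_continuable: "flexible \<Longrightarrow> continuable"
  unfolding continuable_def
proof (intro allI impI)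
  fix a c assume fl: flexible and ac: "adjG a c"
  obtain Or where O: "perfect_orientation G Or" "(a, c) \<in> Or"
    using fl ac unfolding flexible_def by blast
  obtain qs where qs: "qs \<noteq> []" "distinct qs" "successively (\<lambda>x y. (x, y) \<in> Or) qs" "hd qs = c"
    "last qs = a \<or> (last qs \<in> bvertices G \<and> a \<notin> set qs)"
    using follow_orientation[OF fl O] .
  have "3 \<le> length qs" if "last qs = a"
  proof (rule ccontr)
    assume "\<not> ?thesis"
    then consider x where "qs = [x]" | x y where "qs = [x, y]"
      using qs(1) by (cases qs; cases "tl qs"; cases "tl (tl qs)") auto
    then show False
    proof cases
      case 1
      then show ?thesis using that qs(4) O(2) po_asym[OF O(1)] by auto
    next
      case 2
      then show ?thesis using that qs(3,4) O(2) po_asym[OF O(1)] by auto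
    qed
  qed
  moreover have "successively adjG qs"
    using qs(3) po_adjG[OF O(1)] unfolding successively_steps by blast
  ultimately show "\<exists>qs. qs \<noteq> [] \<and> distinct qs \<and> successively adjG qs \<and> hd qs = c \<and>
       ((last qs = a \<and> 3 \<le> length qs) \<or> (last qs \<in> bvertices G \<and> a \<notin> set qs))"
    using qs by blast
qed

end

section \<open>In a reduced graph every edge is flexible\<close>

context kp_graph
begin

text \<open>The edges that some perfect orientation directs from the black to the white end.\<close>

definition used :: "(complex \<times> complex) set" where
  "used = {e \<in> edges G. \<exists>Or. perfect_orientation G Or \<and> e \<in> Or}"

text \<open>The vertices that are connected with the boundary by used edges.\<close>

definition anchored :: "complex set" where
  "anchored = {u. \<exists>b \<in> bvertices G. (u, b) \<in> (used \<union> used\<inverse>)\<^sup>*}"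

text \<open>
  The graph without the edges that are not used and without the components that do not meet the
  boundary afterwards.
\<close>

definition pruned :: disk_graph where
  "pruned = G\<lparr>iblack := iblack G \<inter> anchored, white := white G \<inter> anchored,
     edges := {(b, w) \<in> used. b \<in> anchored}\<rparr>"

lemma pruned_simps [simp]:
  "disk pruned = disk G" "bnum pruned = bnum G" "bdry pruned = bdry G"
  "iblack pruned = iblack G \<inter> anchored" "white pruned = white G \<inter> anchored"
  "edges pruned = {(b, w) \<in> used. b \<in> anchored}" "bvertices pruned = bvertices G"
  by (simp_all add: pruned_def bvertices_def)

lemma used_edges: "used \<subseteq> edges G"
  by (auto simp: used_def)

lemma bvertices_anchored: "b \<in> bvertices G \<Longrightarrow> b \<in> anchored"
  by (auto simp: anchored_def)

lemma anchored_used: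
  assumes "(b, w) \<in> used"
  shows "b \<in> anchored \<longleftrightarrow> w \<in> anchored"
proof -
  have "(b, w) \<in> used \<union> used\<inverse>" "(w, b) \<in> used \<union> used\<inverse>" using assms by auto
  then show ?thesis
    unfolding anchored_def
    using converse_rtrancl_into_rtrancl[of b w "used \<union> used\<inverse>"]
      converse_rtrancl_into_rtrancl[of w b "used \<union> used\<inverse>"] by auto
qed

lemma edges_pruned: "edges pruned \<subseteq> edges G"
  using used_edges by auto

lemma black_pruned: "black pruned = black G \<inter> anchored"
  using bvertices_anchored by (auto simp: black_def)

lemma used_orientation: "perfect_orientation G Or \<Longrightarrow> (b, w) \<in> Or \<Longrightarrow> b \<in> black G \<Longrightarrow> (b, w) \<in> used"
  using po_colors black_white unfolding used_def by blast

lemma boundary_edge_used: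
  assumes "j < bnum G" "adjG (bdry G j) w"
  shows "(bdry G j, w) \<in> used" "\<exists>Or. perfect_orientation G Or \<and> (w, bdry G j) \<in> Or"
proof -
  have b: "bdry G j \<in> bvertices G" using assms(1) by (auto simp: bvertices_def)
  then have bb: "bdry G j \<in> black G" by (simp add: black_def)
  obtain I J where I: "I \<in> positroid G" "j \<in> I" and J: "J \<in> positroid G" "j \<notin> J"
    using irreducible assms(1) unfolding irreducible_positroid_def by blast
  obtain O1 where O1: "perfect_orientation G O1" "I = sources G O1" using I(1) unfolding positroid_def by blast
  obtain O2 where O2: "perfect_orientation G O2" "J = sources G O2" using J(1) unfolding positroid_def by blast
  obtain w' where w': "(bdry G j, w') \<in> O1" using I(2) O1(2) unfolding sources_def by blast
  have "w' = w" using bvertex_nbr_unique[OF b po_adjG[OF O1(1) w'] assms(2)] .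
  then show "(bdry G j, w) \<in> used" using used_orientation[OF O1(1) w' bb] by simp
  have "(bdry G j, w) \<notin> O2" using J(2) O2(2) assms(1) unfolding sources_def by blast
  then show "\<exists>Or. perfect_orientation G Or \<and> (w, bdry G j) \<in> Or"
    using po_total[OF O2(1) assms(2)] O2(1) by blast
qed

lemma bvertex_edge_used: "b \<in> bvertices G \<Longrightarrow> adjG b w \<Longrightarrow> (b, w) \<in> used"
  using boundary_edge_used(1) by (auto simp: bvertices_def)

lemma orientation_restrict:
  assumes O: "perfect_orientation G Or"
  shows "perfect_orientation pruned (Or \<inter> (edges pruned \<union> (edges pruned)\<inverse>))"
    and "sources pruned (Or \<inter> (edges pruned \<union> (edges pruned)\<inverse>)) = sources G Or"
proof -
  let ?O = "Or \<inter> (edges pruned \<union> (edges pruned)\<inverse>)"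
  have eq: "(b, w) \<in> ?O \<longleftrightarrow> (b, w) \<in> Or" if "b \<in> black G" "b \<in> anchored" for b w
  proof -
    have "(b, w) \<in> Or \<Longrightarrow> (b, w) \<in> edges pruned"
      using used_orientation[OF O _ that(1)] that(2) by simp
    then show ?thesis by blast
  qed
  have eq2: "(b, w) \<in> ?O \<longleftrightarrow> (b, w) \<in> Or" if w: "w \<in> white G" "w \<in> anchored" for b w
  proof -
    have "(b, w) \<in> edges pruned" if bw: "(b, w) \<in> Or"
    proof -
      have "b \<in> black G" using po_colors[OF O bw] w(1) black_white by blast
      then have "(b, w) \<in> used" using used_orientation[OF O bw] by blast
      then show ?thesis using anchored_used w(2) by simp
    qed
    then show ?thesis by blast
  qed
  show "perfect_orientation pruned ?O"
    unfolding perfect_orientation_def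
  proof (intro conjI ballI)
    show "?O \<subseteq> edges pruned \<union> (edges pruned)\<inverse>" by blast
    fix e assume e: "e \<in> edges pruned"
    then obtain b w where bw: "e = (b, w)" "(b, w) \<in> edges pruned" by (cases e) auto
    then have "(b, w) \<in> Or \<longleftrightarrow> (w, b) \<notin> Or" using po_edge[OF O] edges_pruned by blast
    then show "case e of (b, w) \<Rightarrow> ((b, w) \<in> ?O) = ((w, b) \<notin> ?O)" using bw by blast
  next
    fix b assume "b \<in> iblack pruned"
    then have b: "b \<in> iblack G" "b \<in> black G" "b \<in> anchored" by (auto simp: black_def)
    show "\<exists>!w. (b, w) \<in> ?O" unfolding eq[OF b(2,3)] using po_black[OF O b(1)] .
  next
    fix w assume "w \<in> white pruned"
    then have w: "w \<in> white G" "w \<in> anchored" by auto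
    show "\<exists>!b. (b, w) \<in> ?O" unfolding eq2[OF w] using po_white[OF O w(1)] .
  qed
  have "(bdry G j, w) \<in> ?O \<longleftrightarrow> (bdry G j, w) \<in> Or" if "j < bnum G" for j w
  proof (rule eq)
    have "bdry G j \<in> bvertices G" using that by (auto simp: bvertices_def)
    then show "bdry G j \<in> black G" "bdry G j \<in> anchored" using bvertices_anchored by (auto simp: black_def)
  qed
  then show "sources pruned ?O = sources G Or" unfolding sources_def pruned_simps by blast
qed

text \<open>
  A perfect orientation is determined by the set \<open>M\<close> of its arcs from black to white vertices.  An
  orientation of the pruned graph is extended by a fixed one of \<open>G\<close> on the vertices that are not
  anchored.
\<close>

lemma orientation_extend:
  assumes O': "perfect_orientation pruned Or'"
  obtains Or where "perfect_orientation G Or" "sources G Or = sources pruned Or'"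
proof -
  obtain O0 where O0: "perfect_orientation G O0"
    using planar unfolding planar_bipartite_disk_graph_def by (elim conjE exE)
  define M where "M = {(b, w) \<in> edges pruned. (b, w) \<in> Or'} \<union> {(b, w) \<in> edges G. b \<notin> anchored \<and> (b, w) \<in> O0}"
  define Or where "Or = M \<union> (edges G - M)\<inverse>"
  have ME: "M \<subseteq> edges G" using edges_pruned by (auto simp: M_def)
  have sub': "(u, v) \<in> edges pruned \<or> (v, u) \<in> edges pruned" if "(u, v) \<in> Or'" for u v
    using O' that unfolding perfect_orientation_def by blast
  have OM: "(b, w) \<in> Or \<longleftrightarrow> (b, w) \<in> M" if "b \<in> black G" for b w
  proof -
    have "(w, b) \<notin> edges G" using that edgesD black_white by blast
    then show ?thesis by (auto simp: Or_def)
  qed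
  have OM2: "(b, w) \<in> Or \<longleftrightarrow> (b, w) \<in> M" if "w \<in> white G" for b w
  proof -
    have "(w, b) \<notin> edges G" using that edgesD black_white by blast
    then show ?thesis by (auto simp: Or_def)
  qed
  have M1: "(b, w) \<in> M \<longleftrightarrow> (b, w) \<in> Or'" if "b \<in> black G" "b \<in> anchored" for b w
  proof -
    have "(w, b) \<notin> edges G" using that(1) edgesD black_white by blast
    then have "(b, w) \<in> Or' \<Longrightarrow> (b, w) \<in> edges pruned" using sub' edges_pruned by blast
    then show ?thesis using that(2) by (auto simp: M_def)
  qed
  have M2: "(b, w) \<in> M \<longleftrightarrow> (b, w) \<in> O0" if "b \<in> black G" "b \<notin> anchored" for b w
  proof -
    have "(b, w) \<in> O0 \<Longrightarrow> (b, w) \<in> edges G" using po_colors[OF O0] that(1) black_white by blast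
    then show ?thesis using that(2) by (auto simp: M_def)
  qed
  have M3: "(b, w) \<in> M \<longleftrightarrow> (b, w) \<in> Or'" if w: "w \<in> white G" "w \<in> anchored" for b w
  proof
    assume "(b, w) \<in> M"
    moreover have False if "(b, w) \<in> edges G" "b \<notin> anchored" "(b, w) \<in> O0"
    proof -
      have "(b, w) \<in> used" using that O0 by (auto simp: used_def)
      then show False using anchored_used w(2) that(2) by blast
    qed
    ultimately show "(b, w) \<in> Or'" by (auto simp: M_def)
  next
    assume h: "(b, w) \<in> Or'"
    have "(w, b) \<notin> edges G" using w(1) edgesD black_white by blast
    then have "(b, w) \<in> edges pruned" using sub'[OF h] edges_pruned by blast
    then show "(b, w) \<in> M" using h by (auto simp: M_def)
  qed
  have M4: "(b, w) \<in> M \<longleftrightarrow> (b, w) \<in> O0" if w: "w \<in> white G" "w \<notin> anchored" for b w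
  proof
    assume "(b, w) \<in> M"
    moreover have "(b, w) \<notin> edges pruned" using anchored_used w(2) by auto
    ultimately show "(b, w) \<in> O0" by (auto simp: M_def)
  next
    assume h: "(b, w) \<in> O0"
    have b: "b \<in> black G" "(b, w) \<in> edges G" using po_colors[OF O0 h] w(1) black_white by blast+
    have "(b, w) \<in> used" using used_orientation[OF O0 h b(1)] .
    then have "b \<notin> anchored" using anchored_used w(2) by blast
    then show "(b, w) \<in> M" using h b(2) by (auto simp: M_def)
  qed
  have "perfect_orientation G Or"
    unfolding perfect_orientation_def
  proof (intro conjI ballI)
    show "Or \<subseteq> edges G \<union> (edges G)\<inverse>" using ME by (auto simp: Or_def)
    fix e assume e: "e \<in> edges G"
    obtain b w where bw: "e = (b, w)" by (cases e)
    have "(w, b) \<notin> M" "(w, b) \<notin> edges G" "(b, w) \<in> edges G" using e bw ME edgesD black_white by blast+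
    then show "case e of (b, w) \<Rightarrow> ((b, w) \<in> Or) = ((w, b) \<notin> Or)" using bw by (auto simp: Or_def)
  next
    fix b assume b: "b \<in> iblack G"
    then have bb: "b \<in> black G" by (simp add: black_def)
    show "\<exists>!w. (b, w) \<in> Or"
    proof (cases "b \<in> anchored")
      case True
      then have "\<exists>!w. (b, w) \<in> Or'" using O' b unfolding perfect_orientation_def by simp
      then show ?thesis unfolding OM[OF bb] M1[OF bb True] .
    next
      case False
      show ?thesis unfolding OM[OF bb] M2[OF bb False] using po_black[OF O0 b] .
    qed
  next
    fix w assume w: "w \<in> white G"
    show "\<exists>!b. (b, w) \<in> Or"
    proof (cases "w \<in> anchored")
      case True
      then have "\<exists>!b. (b, w) \<in> Or'" using O' w unfolding perfect_orientation_def by simp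
      then show ?thesis unfolding OM2[OF w] M3[OF w True] .
    next
      case False
      show ?thesis unfolding OM2[OF w] M4[OF w False] using po_white[OF O0 w] .
    qed
  qed
  moreover have "sources G Or = sources pruned Or'"
  proof -
    have "(bdry G j, w) \<in> Or \<longleftrightarrow> (bdry G j, w) \<in> Or'" if "j < bnum G" for j w
    proof -
      have "bdry G j \<in> bvertices G" using that by (auto simp: bvertices_def)
      then have b: "bdry G j \<in> black G" "bdry G j \<in> anchored" using bvertices_anchored by (auto simp: black_def)
      show ?thesis unfolding OM[OF b(1)] M1[OF b] ..
    qed
    then show ?thesis unfolding sources_def pruned_simps by blast
  qed
  ultimately show ?thesis using that by blast
qed

lemma positroid_pruned: "positroid pruned = positroid G"
proof
  show "positroid pruned \<subseteq> positroid G"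
    unfolding positroid_def using orientation_extend by (smt (verit) mem_Collect_eq subsetI)
  show "positroid G \<subseteq> positroid pruned"
    unfolding positroid_def using orientation_restrict by (smt (verit) mem_Collect_eq subsetI)
qed

lemma planar_pruned: "planar_bipartite_disk_graph pruned"
proof -
  have sub: "black pruned \<union> white pruned \<subseteq> black G \<union> white G" using black_pruned by auto
  have deg: "degr pruned b = 1" if b: "b \<in> bvertices G" for b
  proof -
    have "nbrs pruned b = nbrs G b"
    proof
      show "nbrs pruned b \<subseteq> nbrs G b" using edges_pruned unfolding nbrs_def by blast
      show "nbrs G b \<subseteq> nbrs pruned b"
      proof
        fix x assume "x \<in> nbrs G b"
        then have "(b, x) \<in> edges pruned"
          using bvertex_edge_used[OF b] bvertices_anchored[OF b] by (simp add: nbrs_eq)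
        then show "x \<in> nbrs pruned b" by (simp add: nbrs_def)
      qed
    qed
    then show ?thesis using degr_bvertex[OF b] by (simp add: degr_def)
  qed
  have e: "seg e \<inter> (black pruned \<union> white pruned) = {fst e, snd e}" if ep: "e \<in> edges pruned" for e
  proof -
    have "\<forall>e \<in> edges G. seg e \<inter> (black G \<union> white G) = {fst e, snd e}"
      using planar unfolding planar_bipartite_disk_graph_def by (elim conjE)
    then have 1: "seg e \<inter> (black G \<union> white G) = {fst e, snd e}" using ep edges_pruned by blast
    obtain b w where bw: "e = (b, w)" "(b, w) \<in> used" "b \<in> anchored" using ep by auto
    then have "w \<in> anchored" using anchored_used by blast
    moreover have "b \<in> black G" "w \<in> white G" using edgesD bw(2) used_edges by blast+
    ultimately have "{fst e, snd e} \<subseteq> black pruned \<union> white pruned" using bw black_pruned by simp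
    then show ?thesis using 1 sub by blast
  qed
  have ed: "edges pruned \<subseteq> black pruned \<times> white pruned"
  proof
    fix e assume "e \<in> edges pruned"
    then obtain b w where bw: "e = (b, w)" "(b, w) \<in> used" "b \<in> anchored" by auto
    then have "w \<in> anchored" using anchored_used by blast
    moreover have "b \<in> black G" "w \<in> white G" using edgesD bw(2) used_edges by blast+
    ultimately show "e \<in> black pruned \<times> white pruned" using bw black_pruned by simp
  qed
  obtain O0 where O0: "perfect_orientation G O0"
    using planar unfolding planar_bipartite_disk_graph_def by (elim conjE exE)
  then have po: "\<exists>Or. perfect_orientation pruned Or" using orientation_restrict(1) by blast
  have int: "internal pruned \<subseteq> internal G" by (auto simp: internal_def)
  show ?thesis
    unfolding planar_bipartite_disk_graph_def pruned_simps(1-3,7)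
  proof (intro conjI)
    show "compact (disk G)" "convex (disk G)" "int_disk \<noteq> {}" by (rule disk)+
    show "finite (iblack pruned)" "finite (white pruned)" using finite_vertices by simp_all
    show "iblack pruned \<inter> white pruned = {}" using black_white by (auto simp: black_def)
    show "internal pruned \<subseteq> int_disk" using int internal_int by blast
    show "inj_on (bdry G) {..<bnum G}"
      using planar unfolding planar_bipartite_disk_graph_def by (elim conjE)
    show "\<exists>p q. closed_segment p q \<subseteq> frontier (disk G) \<and> bvertices G \<subseteq> closed_segment p q"
      using planar unfolding planar_bipartite_disk_graph_def by (elim conjE)
    show "\<forall>i j. \<forall>p\<in>int_disk. i < j \<and> j < bnum G \<longrightarrow> orient (bdry G j - bdry G i) (p - bdry G i) = - 1"
      using planar unfolding planar_bipartite_disk_graph_def by (elim conjE)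
    show "edges pruned \<subseteq> black pruned \<times> white pruned" by (rule ed)
    have pl: "\<forall>e \<in> edges G. \<forall>e' \<in> edges G. e \<noteq> e' \<longrightarrow>
        seg e \<inter> seg e' \<subseteq> {fst e, snd e} \<inter> {fst e', snd e'}"
      using planar unfolding planar_bipartite_disk_graph_def by (elim conjE)
    show "\<forall>e \<in> edges pruned. \<forall>e' \<in> edges pruned. e \<noteq> e' \<longrightarrow>
        seg e \<inter> seg e' \<subseteq> {fst e, snd e} \<inter> {fst e', snd e'}"
    proof (intro ballI impI)
      fix e e' assume "e \<in> edges pruned" "e' \<in> edges pruned" "e \<noteq> e'"
      then show "seg e \<inter> seg e' \<subseteq> {fst e, snd e} \<inter> {fst e', snd e'}"
        using pl[rule_format, of e e'] edges_pruned by blast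
    qed
    show "\<forall>e \<in> edges pruned. seg e \<inter> (black pruned \<union> white pruned) = {fst e, snd e}" using e by blast
    show "\<forall>b \<in> bvertices G. degr pruned b = 1" using deg by blast
    show "\<exists>Or. perfect_orientation pruned Or" by (rule po)
  qed
qed

text \<open>
  No edge removed by pruning lies on a polygon: the two sides of such an edge are different
  faces, and they become one face, whereas pruning does not change the positroid.
\<close>

lemma removed_edge_no_polygon:
  assumes C: "cycle adjp cs" and side: "side_of u v cs" and uv: "adjG u v"
    and rem: "(u, v) \<notin> edges pruned" "(v, u) \<notin> edges pruned"
  shows False
proof -
  define E where "E = edges G \<union> (\<lambda>x. (x, x)) ` (black G \<union> white G)"
  define E' where "E' = edges pruned \<union> (\<lambda>x. (x, x)) ` (black pruned \<union> white pruned)"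
  have gE: "gset = (\<Union>e \<in> E. seg e)" by (auto simp: gset_def E_def)
  have finE: "finite E" using finite_edges finite_vertices by (simp add: E_def)
  have E'E: "E' \<subseteq> E" using edges_pruned black_pruned by (auto simp: E_def E'_def)
  have finE': "finite E'" using finite_subset[OF E'E finE] .
  have fp: "faces pruned = components (disk G - (\<Union>e \<in> E'. seg e))"
  proof -
    have "black pruned \<union> white pruned \<union> (\<Union>e \<in> edges pruned. seg e) = (\<Union>e \<in> E'. seg e)"
      by (auto simp only: E'_def UN_Un UN_simps(10) image_iff) (auto simp: E'_def)
    then show ?thesis by (simp only: faces_def pruned_simps(1))
  qed
  have ne: "u \<noteq> v" using edge_irrefl[OF adjG_adjp[OF uv]] .
  define R where "R = {e \<in> E. e \<noteq> (u, v) \<and> e \<noteq> (v, u)}"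
  define m where "m = midpoint u v"
  have mo: "m \<in> open_segment u v" using ne by (simp add: m_def)
  have offR: "x \<notin> (\<Union>e \<in> R. seg e)" if x: "x \<in> open_segment u v" for x
  proof
    assume "x \<in> (\<Union>e \<in> R. seg e)"
    then obtain e where e: "e \<in> E" "e \<noteq> (u, v)" "e \<noteq> (v, u)" "x \<in> seg e" by (auto simp: R_def)
    have xuv: "x \<in> closed_segment u v" "x \<noteq> u" "x \<noteq> v" using x by (auto simp: open_segment_def)
    obtain c d where cd: "adjG c d" "{u, v} \<noteq> {c, d} \<or> x \<in> {c, d}" "x \<in> closed_segment c d"
    proof -
      consider "e \<in> edges G" | y where "y \<in> black G \<union> white G" "e = (y, y)" using e(1) by (auto simp: E_def)
      then show ?thesis
      proof cases
        case 1
        then show ?thesis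
          using that[of "fst e" "snd e"] e by (cases e) (auto simp: adjG_def doubleton_eq_iff)
      next
        case 2
        then have "x = y" using e(4) by simp
        then show ?thesis using that 2 has_nbr[of y] ends_in_segment(1) by (metis insertI1)
      qed
    qed
    show False
    proof (cases "{u, v} = {c, d}")
      case True
      then show False using cd(2) xuv by auto
    next
      case False
      then have "x \<in> {u, v}"
        using plane_adjD(3)[OF adjp_plane adjG_adjp[OF uv] adjG_adjp[OF cd(1)]] xuv cd(3) by blast
      then show False using xuv by blast
    qed
  qed
  have clR: "closed (\<Union>e \<in> R. seg e)" using finE by (intro closed_UN) (auto simp: R_def)
  have "open (int_disk - (\<Union>e \<in> R. seg e))" using clR by (intro open_Diff open_interior)
  moreover have "m \<in> int_disk - (\<Union>e \<in> R. seg e)" using adjG_open_segment[OF uv] mo offR by blast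
  ultimately obtain r where r: "r > 0" "ball m r \<subseteq> int_disk - (\<Union>e \<in> R. seg e)"
    using openE by metis
  have suv: "closed_segment u v \<subseteq> rim cs" using side_rim[OF side] .
  have "m \<in> rim cs" using suv mo segment_open_subset_closed by blast
  note J = cycle_Jordan[OF adjp_plane C]
  have mc: "m \<in> closure (inside (rim cs))" "m \<in> closure (outside (rim cs))"
    using \<open>m \<in> rim cs\<close> J(4,5) by (auto simp: frontier_def)
  obtain x where x: "x \<in> ball m r" "x \<in> inside (rim cs)"
    using mc(1) open_Int_closure_eq_empty[OF open_ball, of m r "inside (rim cs)"] centre_in_ball[of m r] r(1) by blast
  obtain y where y: "y \<in> ball m r" "y \<in> outside (rim cs)"
    using mc(2) open_Int_closure_eq_empty[OF open_ball, of m r "outside (rim cs)"] centre_in_ball[of m r] r(1) by blast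
  have inT: "p \<in> disk G - gset" if "p \<in> ball m r" "p \<notin> rim cs" for p
  proof -
    have "p \<notin> seg e" if "e \<in> E" for e
    proof (cases "e \<in> R")
      case True
      then show ?thesis using \<open>p \<in> ball m r\<close> r(2) by blast
    next
      case False
      then have "e = (u, v) \<or> e = (v, u)" using \<open>e \<in> E\<close> unfolding R_def by blast
      then have "seg e = closed_segment u v"
        by (elim disjE) (simp_all only: fst_conv snd_conv closed_segment_commute[of v u])
      then show ?thesis using suv \<open>p \<notin> rim cs\<close> by blast
    qed
    moreover have "p \<in> disk G" using that r(2) interior_subset by blast
    ultimately show ?thesis unfolding gE by blast
  qed
  have yo: "y \<notin> rim cs" "y \<notin> inside (rim cs)"
    using y(2) outside_no_overlap[of "rim cs"] inside_Int_outside[of "rim cs"] by blast+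
  obtain f1 where f1: "f1 \<in> components (disk G - gset)" "x \<in> f1"
    using inT[OF x(1) inside_rim_disjoint[OF x(2)]] Union_components[of "disk G - gset"] by blast
  obtain f2 where f2: "f2 \<in> components (disk G - gset)" "y \<in> f2"
    using inT[OF y(1) yo(1)] Union_components[of "disk G - gset"] by blast
  have "f1 \<subseteq> inside (rim cs) \<union> rim cs" using face_inside[OF C, of f1] f1 x(2) faces_eq by blast
  then have ff: "f1 \<noteq> f2" using f2(2) yo by blast
  have ballT: "ball m r \<subseteq> disk G - (\<Union>e \<in> E'. seg e)"
  proof
    fix p assume p: "p \<in> ball m r"
    have "p \<notin> seg e" if e: "e \<in> E'" for e
    proof -
      have "e \<noteq> (u, v)" "e \<noteq> (v, u)" using e rem ne unfolding E'_def by blast+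
      then have "e \<in> R" using e E'E by (auto simp: R_def)
      then show ?thesis using p r(2) by blast
    qed
    moreover have "p \<in> disk G" using p r(2) interior_subset by blast
    ultimately show "p \<in> disk G - (\<Union>e \<in> E'. seg e)" by blast
  qed
  have "card (faces pruned) < card (faces G)"
    unfolding fp faces_eq gE
  proof (rule card_components_less[OF disk(2,3) finE finE'])
    show "(\<Union>e \<in> E'. seg e) \<subseteq> (\<Union>e \<in> E. seg e)" using E'E by blast
    show "f1 \<in> components (disk G - (\<Union>e \<in> E. seg e))" "f2 \<in> components (disk G - (\<Union>e \<in> E. seg e))"
      using f1(1) f2(1) gE by simp_all
    show "f1 \<noteq> f2" by (rule ff)
    show "connected (ball m r)" by simp
    show "ball m r \<subseteq> disk G - (\<Union>e \<in> E'. seg e)" by (rule ballT)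
    show "ball m r \<inter> f1 \<noteq> {}" "ball m r \<inter> f2 \<noteq> {}" using x(1) y(1) f1(2) f2(2) by blast+
  qed
  moreover have "card (faces G) \<le> card (faces pruned)"
  proof -
    have "\<forall>G'. planar_bipartite_disk_graph G' \<and> bnum G' = bnum G \<and> positroid G' = positroid G \<longrightarrow>
        card (faces G) \<le> card (faces G')"
      using reduced unfolding reduced_graph_def by (elim conjE)
    then show ?thesis using planar_pruned positroid_pruned by simp
  qed
  ultimately show False by simp
qed

lemma cycleI:
  assumes "xs \<noteq> []" "3 \<le> length xs" "distinct xs" "successively A xs" "A (last xs) (hd xs)"
  shows "cycle A xs" "(last xs, hd xs) \<in> set (steps (circ xs))"
proof -
  obtain ys z where xs: "xs = ys @ [z]" using assms(1) by (cases xs rule: rev_cases) auto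
  have "set (steps (circ xs)) = set (steps xs) \<union> {(last xs, hd xs)}"
    unfolding circ_def using set_steps_append[of ys z "[hd xs]"] by (simp add: xs)
  then show "(last xs, hd xs) \<in> set (steps (circ xs))" "cycle A xs"
    using assms unfolding cycle_def successively_steps by auto
qed

text \<open>Adjacency in the pruned graph with the segments between consecutive boundary vertices added.\<close>

definition pruned_adj :: "complex \<Rightarrow> complex \<Rightarrow> bool" where
  "pruned_adj u v \<longleftrightarrow> (u, v) \<in> edges pruned \<or> (v, u) \<in> edges pruned \<or> bottom u v"

lemma pruned_adj_adjp: "pruned_adj u v \<Longrightarrow> adjp u v"
  using edges_pruned unfolding pruned_adj_def adjp_def adjG_def by blast

lemma pruned_adj_anchored: "pruned_adj u v \<Longrightarrow> u \<in> anchored \<and> v \<in> anchored"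
proof -
  assume "pruned_adj u v"
  then consider "(u, v) \<in> edges pruned" | "(v, u) \<in> edges pruned" | "bottom u v"
    by (auto simp: pruned_adj_def)
  then show ?thesis
  proof cases
    case 3
    then have "u \<in> bvertices G" "v \<in> bvertices G"
      unfolding bottom_def bvertices_def by (auto simp: doubleton_eq_iff)
    then show ?thesis using bvertices_anchored by blast
  qed (use anchored_used in auto)
qed

lemma bottom_connected:
  assumes "i < bnum G" "j < bnum G"
  shows "(bdry G i, bdry G j) \<in> {(u, v). pruned_adj u v}\<^sup>*"
proof -
  let ?R = "{(u, v). pruned_adj u v}"
  have s: "(bdry G i, bdry G (Suc i)) \<in> ?R \<and> (bdry G (Suc i), bdry G i) \<in> ?R" if "Suc i < bnum G" for i
    using that unfolding pruned_adj_def bottom_def by auto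
  have "(bdry G i, bdry G (i + d)) \<in> ?R\<^sup>* \<and> (bdry G (i + d), bdry G i) \<in> ?R\<^sup>*" if "i + d < bnum G" for i d
    using that
  proof (induction d)
    case (Suc d)
    then have "(bdry G (i + d), bdry G (Suc (i + d))) \<in> ?R" "(bdry G (Suc (i + d)), bdry G (i + d)) \<in> ?R"
      using s[of "i + d"] by auto
    then show ?case using Suc
      by (metis Suc_lessD add_Suc_right converse_rtrancl_into_rtrancl rtrancl.rtrancl_into_rtrancl)
  qed simp
  then show ?thesis using assms by (metis le_Suc_ex linear)
qed

text \<open>Two anchored vertices are joined by a path in the pruned graph and along the boundary.\<close>

lemma anchored_path:
  assumes "u \<in> anchored" "v \<in> anchored"
  obtains zs where "zs \<noteq> []" "distinct zs" "hd zs = u" "last zs = v" "successively pruned_adj zs"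
    "set zs \<subseteq> anchored"
proof -
  let ?R = "{(u, v). pruned_adj u v}"
  have to_b: "\<exists>b \<in> bvertices G. (u, b) \<in> ?R\<^sup>* \<and> (b, u) \<in> ?R\<^sup>*" if u: "u \<in> anchored" for u
  proof -
    obtain b where b: "b \<in> bvertices G" "(u, b) \<in> (used \<union> used\<inverse>)\<^sup>*" using u by (auto simp: anchored_def)
    have "(u, b) \<in> ?R\<^sup>* \<and> (b, u) \<in> ?R\<^sup>* \<and> u \<in> anchored"
      using b(2)
    proof (induction rule: converse_rtrancl_induct)
      case base
      then show ?case using bvertices_anchored b(1) by simp
    next
      case (step y z)
      have "y \<in> anchored" using step(1,3) anchored_used by blast
      then have "pruned_adj y z" "pruned_adj z y"
        using step(1,3) unfolding pruned_adj_def by auto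
      then have "(y, z) \<in> ?R" "(z, y) \<in> ?R" by simp_all
      then show ?case
        using step(3) \<open>y \<in> anchored\<close> converse_rtrancl_into_rtrancl[of y z ?R b] rtrancl_into_rtrancl[of b z ?R y]
        by blast
    qed
    then show ?thesis using b(1) by blast
  qed
  obtain b where b: "b \<in> bvertices G" "(u, b) \<in> ?R\<^sup>*" using to_b assms(1) by blast
  obtain b' where b': "b' \<in> bvertices G" "(b', v) \<in> ?R\<^sup>*" using to_b assms(2) by blast
  have "(b, b') \<in> ?R\<^sup>*" using b(1) b'(1) bottom_connected unfolding bvertices_def by auto
  then have "(u, v) \<in> ?R\<^sup>*" using b(2) b'(2) by (meson rtrancl_trans)
  then obtain zs where zs: "zs \<noteq> []" "distinct zs" "hd zs = u" "last zs = v"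
    "successively (\<lambda>x y. (x, y) \<in> ?R) zs"
    using rtrancl_simple_path by metis
  have sc: "successively pruned_adj zs" using zs(5) by simp
  have "set zs \<subseteq> anchored"
  proof (cases "length zs = 1")
    case True
    then have "set zs = {hd zs}" using zs(1) by (cases zs) auto
    then show ?thesis using zs(3) assms(1) by simp
  next
    case False
    have "x \<in> anchored" if x: "x \<in> set zs" for x
    proof -
      obtain a b where ab: "zs = a @ x # b" using split_list[OF x] by blast
      show ?thesis
      proof (cases b)
        case Nil
        then show ?thesis using zs(4) ab assms(2) by simp
      next
        case (Cons y c)
        then have "pruned_adj x y" using sc ab by (simp add: successively_append_iff)
        then show ?thesis using pruned_adj_anchored by blast
      qed
    qed
    then show ?thesis by blast
  qed
  then show ?thesis using that zs sc by blast
qed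

lemma successively_adjp_pruned: "successively pruned_adj zs \<Longrightarrow> successively adjp zs"
  unfolding successively_steps using pruned_adj_adjp by blast

text \<open>
  Consider a longest path among the vertices that are not anchored.  As these vertices have at least two
  neighbours, both ends of the path have anchored neighbours, unless the path closes up to a polygon
  of removed edges.  Joining the anchored neighbours by a path in the pruned graph and along the
  boundary yields a polygon with a removed side as well.  Both are
  excluded by \<open>removed_edge_no_polygon\<close>.
\<close>

lemma all_anchored:
  assumes "u \<in> black G \<union> white G"
  shows "u \<in> anchored"
proof (rule ccontr)
  assume un: "u \<notin> anchored"
  have rem: "(x, y) \<notin> edges pruned \<and> (y, x) \<notin> edges pruned" if "x \<notin> anchored" for x y
    using that anchored_used by auto
  define Y where "Y = (black G \<union> white G) - anchored"
  define P where "P ys \<longleftrightarrow> ys \<noteq> [] \<and> distinct ys \<and> set ys \<subseteq> Y \<and> successively adjG ys" for ys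
  have Pu: "P [u]" using un assms by (simp add: P_def Y_def)
  have finY: "finite Y" using finite_vertices by (simp add: Y_def)
  obtain ys where ys: "P ys" and max: "\<And>zs. P zs \<Longrightarrow> length zs \<le> length ys"
    using longest_list[OF finY, of P "[u]"] Pu unfolding P_def by metis
  have y: "ys \<noteq> []" "distinct ys" "set ys \<subseteq> Y" "successively adjG ys" using ys by (auto simp: P_def)
  have Yint: "x \<in> internal G" if "x \<in> Y" for x
    using that vertex_cases[of x] bvertices_anchored by (auto simp: Y_def)
  have next_nbr: "\<exists>v. adjG x v \<and> v \<noteq> p" if x: "x \<in> Y" for x p
  proof -
    have "degr G x \<ge> 2" using valency Yint[OF x] by force
    then have "\<not> nbrs G x \<subseteq> {p}" using card_mono[of "{p}" "nbrs G x"] by (auto simp: degr_def)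
    then show ?thesis by (auto simp: nbrs_eq)
  qed
  have absurd: False if "cycle adjp cs" "side_of x v cs" "adjG x v" "x \<notin> anchored" for cs x v
    using removed_edge_no_polygon[OF that(1-3)] rem[OF that(4)] by blast
  have sp: "successively adjp xs" if "successively adjG xs" for xs
    using that adjG_adjp unfolding successively_steps by blast
  \<comment> \<open>The end of a longest path outside of the anchored part has another, anchored neighbour.\<close>
  have ending: "\<exists>v. adjG (last zs) v \<and> v \<in> anchored \<and> v \<noteq> p"
    if Pz: "P zs" and mz: "length zs = length ys" and p: "p = last (butlast zs) \<or> length zs = 1 \<and> p \<in> anchored" for zs p
  proof -
    have z: "zs \<noteq> []" "distinct zs" "set zs \<subseteq> Y" "successively adjG zs" using Pz by (auto simp: P_def)
    have lY: "last zs \<in> Y" using z by auto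
    obtain v where v: "adjG (last zs) v" "v \<noteq> p" using next_nbr[OF lY] by blast
    have "v \<in> anchored"
    proof (rule ccontr)
      assume va: "v \<notin> anchored"
      then have vY: "v \<in> Y" using adjG_vertices[OF v(1)] by (simp add: Y_def)
      have "v \<in> set zs"
      proof (rule ccontr)
        assume "v \<notin> set zs"
        then have "P (zs @ [v])" using z v vY by (auto simp: P_def successively_append_iff)
        then show False using max[of "zs @ [v]"] mz by simp
      qed
      then obtain a b where ab: "zs = a @ v # b" by (meson split_list)
      define cs where "cs = v # b"
      have lv: "last zs \<noteq> v" using edge_irrefl[OF adjG_adjp[OF v(1)]] .
      have b1: "b \<noteq> []" using ab lv by auto
      have "length cs \<ge> 3"
      proof (rule ccontr)
        assume "\<not> ?thesis"
        then obtain c where c: "b = [c]" using b1 by (cases b; cases "tl b") (auto simp: cs_def)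
        then have "last (butlast zs) = v" using ab by (simp add: butlast_append)
        moreover have "length zs \<noteq> 1" using ab c by simp
        ultimately show False using p v(2) by simp
      qed
      moreover have "distinct cs" "successively adjp cs"
        using z sp[OF z(4)] ab by (auto simp: cs_def successively_append_iff)
      moreover have "adjp (last cs) (hd cs)" using adjG_adjp[OF v(1)] ab b1 by (simp add: cs_def)
      ultimately have C: "cycle adjp cs" "(last cs, hd cs) \<in> set (steps (circ cs))"
        using cycleI[of cs adjp] by (auto simp: cs_def)
      have "side_of (last zs) v cs" using C(2) ab b1 unfolding side_of_def by (simp add: cs_def)
      then show False using absurd[OF C(1) _ v(1)] lY by (simp add: Y_def)
    qed
    then show ?thesis using v by blast
  qed
  have yn: "set ys \<inter> anchored = {}" using y(3) by (auto simp: Y_def)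
  obtain v where v: "adjG (last ys) v" "v \<in> anchored" using ending[OF ys] by blast
  obtain v' where v': "adjG (hd ys) v'" "v' \<in> anchored" "length ys = 1 \<Longrightarrow> v' \<noteq> v"
  proof -
    have Pr: "P (rev ys)" using y unfolding P_def
      using adjG_sym by (auto simp: successively_steps set_steps_rev)
    show ?thesis
    proof (cases "length ys = 1")
      case True
      then show ?thesis using that ending[OF Pr, of v] v(2) y(1) by (auto simp: last_rev)
    next
      case False
      then show ?thesis using that ending[OF Pr, of "last (butlast (rev ys))"] y(1) by (auto simp: last_rev)
    qed
  qed
  obtain zs where zs: "zs \<noteq> []" "distinct zs" "hd zs = v" "last zs = v'" "successively pruned_adj zs"
    "set zs \<subseteq> anchored"
    using anchored_path[OF v(2) v'(2)] .
  define cs where "cs = ys @ zs"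
  have "3 \<le> length cs"
  proof (cases "length ys = 1")
    case True
    then have "v' \<noteq> v" by (rule v'(3))
    then have "length zs \<noteq> 1" using zs(3,4) by (cases zs) auto
    then have "length zs \<ge> 2" using zs(1) by (cases zs; cases "tl zs") auto
    then show ?thesis using True by (simp add: cs_def)
  next
    case False
    then have "length ys \<ge> 2" using y(1) by (cases ys; cases "tl ys") auto
    then show ?thesis using zs(1) by (cases zs) (auto simp: cs_def)
  qed
  moreover have "distinct cs" using y(2) zs(2,6) yn by (auto simp: cs_def)
  moreover have "successively adjp cs"
    using sp[OF y(4)] successively_adjp_pruned[OF zs(5)] adjG_adjp[OF v(1)] zs(3)
    by (simp add: cs_def successively_append_iff)
  moreover have "adjp (last cs) (hd cs)"
    using adjG_adjp[OF adjG_sym[OF v'(1)]] zs(1,4) y(1) by (simp add: cs_def)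
  ultimately have C: "cycle adjp cs" "(last cs, hd cs) \<in> set (steps (circ cs))"
    using cycleI[of cs adjp] y(1) by (auto simp: cs_def)
  have "side_of (hd ys) v' cs" using C(2) zs(1,4) y(1) unfolding side_of_def by (simp add: cs_def)
  moreover have "hd ys \<notin> anchored" using hd_in_set[OF y(1)] yn by blast
  ultimately show False using absurd[OF C(1) _ v'(1)] by blast
qed

text \<open>
  Otherwise the edge, together with a path that joins its ends in the pruned graph and along the
  boundary, would form a polygon with a removed side.
\<close>

lemma all_used: "edges G \<subseteq> used"
proof
  fix e assume e: "e \<in> edges G"
  obtain b w where bw: "e = (b, w)" by (cases e)
  show "e \<in> used"
  proof (rule ccontr)
    assume "e \<notin> used"
    have a: "adjG b w" using e bw by (simp add: adjG_def)
    have anc: "b \<in> anchored" "w \<in> anchored" using all_anchored adjG_vertices[OF a] by blast+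
    have rem: "(b, w) \<notin> edges pruned" "(w, b) \<notin> edges pruned"
    proof -
      show "(b, w) \<notin> edges pruned" using \<open>e \<notin> used\<close> bw by simp
      have "(w, b) \<notin> edges G" using e bw edgesD black_white by blast
      then show "(w, b) \<notin> edges pruned" using edges_pruned by blast
    qed
    obtain zs where zs: "zs \<noteq> []" "distinct zs" "hd zs = b" "last zs = w" "successively pruned_adj zs"
      using anchored_path[OF anc] by metis
    have "b \<noteq> w" using edge_irrefl[OF adjG_adjp[OF a]] .
    have "3 \<le> length zs"
    proof (rule ccontr)
      assume "\<not> ?thesis"
      then consider x where "zs = [x]" | x y where "zs = [x, y]"
        using zs(1) by (cases zs; cases "tl zs"; cases "tl (tl zs)") auto
      then show False
      proof cases
        case 1
        then show ?thesis using zs(3,4) \<open>b \<noteq> w\<close> by simp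
      next
        case 2
        then have "pruned_adj b w" using zs(3-5) by simp
        then have "bottom b w" using rem unfolding pruned_adj_def by blast
        then have "w \<in> bvertices G" unfolding bottom_def bvertices_def by (auto simp: doubleton_eq_iff)
        then show ?thesis using e bw edgesD bvertices_not_internal by (auto simp: internal_def)
      qed
    qed
    then have C: "cycle adjp zs" "(last zs, hd zs) \<in> set (steps (circ zs))"
      using cycleI[of zs adjp] zs successively_adjp_pruned adjG_adjp[OF adjG_sym[OF a]] by auto
    have "side_of b w zs" using C(2) zs(3,4) unfolding side_of_def by simp
    then show False using removed_edge_no_polygon[OF C(1) _ a] rem by blast
  qed
qed

text \<open>
  It remains to direct an edge from its white to its black end.  This is possible at a boundary vertex
  because the positroid is irreducible, and at an internal black vertex because a perfect orientation
  may leave it along another edge.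
\<close>

theorem all_flexible: flexible
  unfolding flexible_def
proof (intro allI impI)
  fix u v assume uv: "adjG u v"
  have used: "\<exists>Or. perfect_orientation G Or \<and> (b, w) \<in> Or" if "(b, w) \<in> edges G" for b w
    using that all_used by (auto simp: used_def)
  show "\<exists>Or. perfect_orientation G Or \<and> (u, v) \<in> Or"
  proof (cases "(u, v) \<in> edges G")
    case True
    then show ?thesis by (rule used)
  next
    case False
    then have vu: "(v, u) \<in> edges G" using uv by (simp add: adjG_def)
    show ?thesis
    proof (cases "v \<in> bvertices G")
      case True
      then obtain j where "j < bnum G" "v = bdry G j" by (auto simp: bvertices_def)
      then show ?thesis using boundary_edge_used(2)[of j u] adjG_sym[OF uv] by blast
    next
      case False
      \<comment> \<open>An orientation that uses another edge at the black vertex \<open>v\<close>.\<close>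
      then have v: "v \<in> iblack G" using edgesD[OF vu] black_cases by blast
      then have "degr G v \<ge> 2" using valency by (force simp: internal_def)
      then have "\<not> nbrs G v \<subseteq> {u}" using card_mono[of "{u}" "nbrs G v"] by (auto simp: degr_def)
      then obtain x where x: "adjG v x" "x \<noteq> u" by (auto simp: nbrs_eq)
      have "(v, x) \<in> edges G" using x(1) edgesD[OF vu] edgesD black_white unfolding adjG_def by blast
      then obtain Or where O: "perfect_orientation G Or" "(v, x) \<in> Or" using used by blast
      then have "(v, u) \<notin> Or" using po_black[OF O(1) v] x(2) by blast
      then show ?thesis using po_total[OF O(1) uv] O(1) by blast
    qed
  qed
qed

end

section \<open>Signs of directed polygons for the geometric signature\<close>

lemma powi_minus_one_add: "(- 1 :: real) powi (a + b) = (- 1) powi a * (- 1) powi b"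
  by (simp add: power_int_add)

lemma powi_minus_one_sum:
  assumes "c = 1 \<or> c = (- 1 :: int)"
  shows "(- 1 :: real) powi (\<Sum>j\<in>A. c) = (- 1) ^ card A"
proof -
  have "inverse ((- 1 :: real) ^ n) = (- 1) ^ n" for n by (induction n) auto
  then show ?thesis
    using assms by (auto simp: power_int_minus)
qed

lemma prod_list_prod:
  fixes g :: "'i \<Rightarrow> 'a \<Rightarrow> 'b :: comm_monoid_mult"
  shows "prod_list (map (\<lambda>p. \<Prod>m\<in>M. g m p) xs) = (\<Prod>m\<in>M. prod_list (map (g m) xs))"
  by (induction xs) (simp_all add: prod.distrib)

context kp_graph
begin

text \<open>
  The points of the line through \<open>b\<close> in the direction of the gauge rays.
\<close>

lemma line_coordinate:
  assumes "hgt x = hgt b"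
  obtains s where "x = b + of_real s * \<ll>"
proof -
  have "\<ll> \<noteq> 0" using gauge by (simp add: gauge_direction_def)
  moreover have "Im (cnj \<ll> * (x - b)) = 0" using assms hgt_diff[of x b] by simp
  ultimately obtain s where "x - b = of_real s * \<ll>" using parallel_eq by blast
  then have "x = b + of_real s * \<ll>" by (simp add: algebra_simps)
  then show ?thesis by (rule that)
qed

text \<open>A gauge ray meets the interior of the disk in its positive half only.\<close>

lemma ray_positive:
  assumes "m < bnum G" "bdry G m + of_real s * \<ll> \<in> int_disk"
  shows "s > 0"
proof (rule ccontr)
  assume "\<not> s > 0"
  then have s: "s \<le> 0" by simp
  obtain r where r: "r > 0" "bdry G m + of_real r * \<ll> \<in> int_disk" using gauge_into[OF assms(1)] .
  define t where "t = r / (r - s)"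
  have rs: "r - s > 0" using r s by simp
  have t: "0 \<le> t" "t \<le> 1" using r(1) s rs by (simp_all add: t_def divide_le_eq)
  have "t * (r - s) = r" using rs by (simp add: t_def)
  then have "(1 - t) * r + t * s = 0" by (simp add: algebra_simps)
  then have z: "complex_of_real (1 - t) * of_real r + of_real t * of_real s = 0"
    by (metis of_real_0 of_real_add of_real_mult)
  have "(1 - t) *\<^sub>R (bdry G m + of_real r * \<ll>) + t *\<^sub>R (bdry G m + of_real s * \<ll>)
      = bdry G m + (complex_of_real (1 - t) * of_real r + of_real t * of_real s) * \<ll>"
    by (simp add: scaleR_conv_of_real algebra_simps)
  then have "(1 - t) *\<^sub>R (bdry G m + of_real r * \<ll>) + t *\<^sub>R (bdry G m + of_real s * \<ll>) = bdry G m"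
    unfolding z by simp
  then have "bdry G m \<in> closed_segment (bdry G m + of_real r * \<ll>) (bdry G m + of_real s * \<ll>)"
    using t unfolding in_segment by metis
  then have "bdry G m \<in> int_disk"
    using closed_segment_subset[OF r(2) assms(2) convex_interior[OF disk(2)]] by blast
  then show False
    using bvertices_frontier[of "bdry G m"] frontier_int assms(1) by (auto simp: bvertices_def)
qed

lemma hgt_vertex:
  assumes "m < bnum G" "p \<in> black G \<union> white G" "p \<noteq> bdry G m"
  shows "hgt p \<noteq> hgt (bdry G m)"
proof
  assume h: "hgt p = hgt (bdry G m)"
  show False
  proof (cases "p \<in> bvertices G")
    case True
    then obtain i where i: "i < bnum G" "p = bdry G i" by (auto simp: bvertices_def)
    then have "i \<noteq> m" using assms(3) by auto
    then show False using h hgt_less_iff[OF i(1) assms(1)] hgt_less_iff[OF assms(1) i(1)] i by auto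
  next
    case False
    then have p: "p \<in> internal G" using vertex_cases assms(2) by blast
    obtain s where s: "p = bdry G m + of_real s * \<ll>" using line_coordinate[OF h] .
    have "s > 0" using ray_positive[OF assms(1)] internal_int[OF p] s by simp
    moreover have "\<forall>b \<in> bvertices G. \<forall>r \<ge> 0. b + of_real r * \<ll> \<notin> internal G"
      using gauge unfolding gauge_direction_def by (elim conjE)
    ultimately show False using p s assms(1) by (auto simp: bvertices_def)
  qed
qed

lemma hgt_edge:
  assumes "adjp u v"
  shows "hgt u \<noteq> hgt v"
proof -
  have e: "hgt b \<noteq> hgt w" if bw: "(b, w) \<in> edges G" for b w
  proof (cases "b \<in> iblack G")
    case True
    have "\<forall>(b, w) \<in> edges G. b \<in> iblack G \<longrightarrow> orient \<ll> (w - b) \<noteq> 0"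
      using gauge unfolding gauge_direction_def by (elim conjE)
    then have "orient \<ll> (w - b) \<noteq> 0" using bw True by blast
    then have "Im (cnj \<ll> * (w - b)) \<noteq> 0" by (auto simp: orient_def)
    then show ?thesis using hgt_diff[of w b] by simp
  next
    case False
    then have "b \<in> bvertices G" using edgesD[OF bw] black_cases by blast
    then obtain m where m: "m < bnum G" "b = bdry G m" by (auto simp: bvertices_def)
    have "w \<noteq> b" using edgesD[OF bw] black_white by blast
    then show ?thesis using hgt_vertex[OF m(1), of w] m(2) edgesD[OF bw] by force
  qed
  consider "adjG u v" | "bottom u v" using assms by (auto simp: adjp_def)
  then show ?thesis
  proof cases
    case 1
    then show ?thesis using e[of u v] e[of v u] by (auto simp: adjG_def)
  next
    case 2
    then obtain i where i: "Suc i < bnum G" "{u, v} = {bdry G i, bdry G (Suc i)}" by (auto simp: bottom_def)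
    then show ?thesis using hgt_less[of i "Suc i"] by (auto simp: doubleton_eq_iff)
  qed
qed

text \<open>The side of the gauge ray of the boundary vertex \<open>m\<close> on which a vertex lies.\<close>

definition ray_side :: "nat \<Rightarrow> complex \<Rightarrow> real" where
  "ray_side m p = (if hgt p > hgt (bdry G m) then 1 else - 1)"

text \<open>The open gauge ray that starts at the boundary vertex \<open>m\<close> meets the edge.\<close>

definition ray_meets :: "nat \<Rightarrow> complex \<times> complex \<Rightarrow> bool" where
  "ray_meets m e \<longleftrightarrow> seg e \<inter> {bdry G m + of_real r * \<ll> | r. r > 0} \<noteq> {}"

text \<open>The sign that an intersection of the edge with the ray contributes.\<close>

definition ray_sign :: "nat \<Rightarrow> complex \<times> complex \<Rightarrow> real" where
  "ray_sign m e = (if ray_meets m e then - 1 else 1)"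

lemma ray_side_sq: "ray_side m p * ray_side m p = 1"
  by (simp add: ray_side_def)

lemma hgt_ray: "hgt (b + of_real r * \<ll>) = hgt b"
proof -
  have "Im (cnj \<ll> * (of_real r * \<ll>)) = 0" by (simp add: algebra_simps)
  then show ?thesis using hgt_diff[of "b + of_real r * \<ll>" b] by simp
qed

lemma hgt_convex: "hgt ((1 - t) *\<^sub>R a + t *\<^sub>R b) = (1 - t) * hgt a + t * hgt b"
  unfolding hgt_def by (simp add: algebra_simps)

text \<open>
  An edge not ending at the start of a ray meets the ray if and only if its ends lie on different sides:
  the part of the line of the ray in the interior of the disk belongs to the ray.
\<close>

lemma ray_sign_edge:
  assumes m: "m < bnum G" and uv: "adjG u v" and ne: "u \<noteq> bdry G m" "v \<noteq> bdry G m"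
  shows "ray_sign m (u, v) = ray_side m u * ray_side m v"
proof -
  define h where "h = hgt (bdry G m)"
  have hn: "hgt u \<noteq> h" "hgt v \<noteq> h"
    using hgt_vertex[OF m] adjG_vertices[OF uv] ne by (auto simp: h_def)
  have "ray_meets m (u, v) \<longleftrightarrow> (hgt u > h) \<noteq> (hgt v > h)"
  proof
    assume "ray_meets m (u, v)"
    then obtain r where r: "bdry G m + of_real r * \<ll> \<in> closed_segment u v" by (auto simp: ray_meets_def)
    then obtain t where t: "0 \<le> t" "t \<le> 1" "bdry G m + of_real r * \<ll> = (1 - t) *\<^sub>R u + t *\<^sub>R v"
      unfolding in_segment by blast
    have e: "h = (1 - t) * hgt u + t * hgt v"
      using hgt_ray[of "bdry G m" r] hgt_convex[of t u v] t(3) by (simp add: h_def)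
    show "(hgt u > h) \<noteq> (hgt v > h)"
    proof
      assume same: "(hgt u > h) = (hgt v > h)"
      have z: "(1 - t) * (hgt u - h) + t * (hgt v - h) = 0" using e by (simp add: algebra_simps)
      show False
      proof (cases "hgt u > h")
        case True
        then have "(1 - t) * (hgt u - h) + t * (hgt v - h) > 0"
          using same t by (cases "t = 0") (auto intro: add_nonneg_pos)
        then show False using z by simp
      next
        case False
        then have "(1 - t) * (h - hgt u) + t * (h - hgt v) > 0"
          using same t hn by (cases "t = 0") (auto intro: add_nonneg_pos)
        then show False using z by (simp add: algebra_simps)
      qed
    qed
  next
    assume diff: "(hgt u > h) \<noteq> (hgt v > h)"
    define t where "t = (h - hgt u) / (hgt v - hgt u)"
    have d: "hgt v - hgt u \<noteq> 0" using diff by auto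
    have t: "0 < t \<and> t < 1"
    proof (cases "hgt u > h")
      case True
      then have "hgt v < h" using diff hn by auto
      then show ?thesis using True by (simp add: t_def zero_less_divide_iff divide_less_eq)
    next
      case False
      then have "hgt u < h" "hgt v > h" using diff hn by auto
      then show ?thesis by (simp add: t_def zero_less_divide_iff divide_less_eq)
    qed
    define x where "x = (1 - t) *\<^sub>R u + t *\<^sub>R v"
    have "t * (hgt v - hgt u) = h - hgt u" using d by (simp add: t_def)
    then have "hgt x = h" unfolding x_def hgt_convex by (simp add: algebra_simps)
    then obtain s where s: "x = bdry G m + of_real s * \<ll>" using line_coordinate h_def by metis
    have "u \<noteq> v" using edge_irrefl[OF adjG_adjp[OF uv]] .
    then have xo: "x \<in> open_segment u v" using t unfolding in_segment x_def by blast
    then have "x \<in> int_disk" using adjG_open_segment[OF uv] by blast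
    then have "s > 0" using ray_positive[OF m] s by simp
    moreover have "x \<in> closed_segment u v" using xo segment_open_subset_closed by blast
    ultimately show "ray_meets m (u, v)" unfolding ray_meets_def using s by auto
  qed
  then show ?thesis by (auto simp: ray_sign_def ray_side_def h_def)
qed

lemma ray_sign_own:
  assumes "m < bnum G" "adjG (bdry G m) w"
  shows "ray_sign m (bdry G m, w) = 1"
proof -
  have "\<not> ray_meets m (bdry G m, w)"
  proof
    assume "ray_meets m (bdry G m, w)"
    then obtain r where r: "r > 0" "bdry G m + of_real r * \<ll> \<in> closed_segment (bdry G m) w"
      by (auto simp: ray_meets_def)
    obtain t where t: "bdry G m + of_real r * \<ll> = (1 - t) *\<^sub>R bdry G m + t *\<^sub>R w"
      using r(2) unfolding in_segment by blast
    have "hgt (bdry G m) = (1 - t) * hgt (bdry G m) + t * hgt w"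
      using hgt_ray[of "bdry G m" r] hgt_convex[of t "bdry G m" w] t by simp
    moreover have "t * (hgt w - hgt (bdry G m)) = ((1 - t) * hgt (bdry G m) + t * hgt w) - hgt (bdry G m)"
      by (simp add: algebra_simps)
    ultimately have "t * (hgt w - hgt (bdry G m)) = 0" by linarith
    then have "t = 0" using hgt_edge[OF adjG_adjp[OF assms(2)]] by auto
    then have "of_real r * \<ll> = 0" using t by simp
    then show False using r(1) gauge by (simp add: gauge_direction_def)
  qed
  then show ?thesis by (simp add: ray_sign_def)
qed

lemma orient_edge: "adjp u v \<Longrightarrow> orient \<ll> (v - u) = 1 \<or> orient \<ll> (v - u) = - 1"
  using hgt_edge[of u v] hgt_diff[of v u] by (auto simp: orient_def)

lemma finite_sources: "finite (sources G Or)"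
  by (rule finite_subset[of _ "{..<bnum G}"]) (auto simp: sources_def)

lemma int_sign:
  assumes "adjp u v"
  shows "(- 1 :: real) powi int_number G Or \<ll> (u, v) = (\<Prod>m \<in> sources G Or. ray_sign m (u, v))"
proof -
  have "int_number G Or \<ll> (u, v) = (\<Sum>j | j \<in> sources G Or \<and> ray_meets j (u, v). orient \<ll> (v - u))"
    by (simp add: int_number_def ray_meets_def)
  then have "(- 1 :: real) powi int_number G Or \<ll> (u, v) = (- 1) ^ card {j \<in> sources G Or. ray_meets j (u, v)}"
    using powi_minus_one_sum[OF orient_edge[OF assms]] by simp
  also have "\<dots> = (\<Prod>m \<in> sources G Or. ray_sign m (u, v))"
    using finite_sources[of Or] by (simp add: ray_sign_def prod.If_cases Int_def)
  finally show ?thesis .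
qed

text \<open>
  The sign of the corner at \<open>b\<close> between the directions \<open>b - a\<close> and \<open>d - b\<close>: it is \<open>- 1\<close> if the turn from
  one to the other passes the gauge direction.  For edges this is the sign given by the winding
  number (\<open>wind_sign\<close>).
\<close>

definition corner_sign :: "complex \<Rightarrow> complex \<Rightarrow> complex \<Rightarrow> real" where
  "corner_sign a b d = cross_sign (cnj \<ll> * (b - a)) (cnj \<ll> * (d - b))"

lemma upper_hgt: "hgt u \<noteq> hgt v \<Longrightarrow> upper (cnj \<ll> * (v - u)) \<longleftrightarrow> hgt v > hgt u"
  using hgt_diff[of v u] by (auto simp: upper_def)

lemma det_scale: "Im (cnj (cnj \<ll> * a) * (cnj \<ll> * b)) = (cmod \<ll>)\<^sup>2 * Im (cnj a * b)"
proof -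
  have "cnj (cnj \<ll> * a) * (cnj \<ll> * b) = (\<ll> * cnj \<ll>) * (cnj a * b)" by simp
  also have "\<dots> = of_real ((cmod \<ll>)\<^sup>2) * (cnj a * b)" by (simp only: complex_norm_square)
  finally have "Im (cnj (cnj \<ll> * a) * (cnj \<ll> * b)) = Im (of_real ((cmod \<ll>)\<^sup>2) * (cnj a * b))" by (simp only:)
  then show ?thesis by (simp only: Im_complex_of_real Re_complex_of_real times_complex.sel mult_zero_left add_0_right)
qed

lemma crosses_corner:
  assumes "hgt a \<noteq> hgt b" "hgt b \<noteq> hgt d"
  shows "crosses (cnj \<ll> * (b - a)) (cnj \<ll> * (d - b)) \<longleftrightarrow>
    (hgt b > hgt a \<and> hgt d < hgt b \<and> Im (cnj (b - a) * (d - b)) < 0) \<or>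
    (hgt b < hgt a \<and> hgt d > hgt b \<and> Im (cnj (b - a) * (d - b)) > 0)"
proof -
  have l: "(cmod \<ll>)\<^sup>2 > 0" using gauge by (simp add: gauge_direction_def)
  show ?thesis
    unfolding crosses_def upper_hgt[OF assms(1)] upper_hgt[OF assms(2)] det_scale
    using l assms by (auto simp: mult_less_0_iff zero_less_mult_iff)
qed

lemma wind_sign:
  assumes "hgt a \<noteq> hgt b" "hgt b \<noteq> hgt d"
  shows "(- 1 :: real) powi wind \<ll> (b - a) (d - b) = corner_sign a b d"
proof -
  define e1 e2 where "e1 = b - a" and "e2 = d - b"
  have h: "Im (cnj \<ll> * e1) = hgt b - hgt a" "Im (cnj \<ll> * e2) = hgt d - hgt b"
    by (simp_all add: e1_def e2_def hgt_diff)
  have h0: "Im (cnj e1 * \<ll>) = hgt a - hgt b" using h(1) by (simp add: algebra_simps)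
  have o: "orient e1 \<ll> = (if hgt b < hgt a then 1 else - 1)" "orient \<ll> e2 = (if hgt d > hgt b then 1 else - 1)"
    unfolding orient_def h0 h(2) using assms by auto
  show ?thesis
    unfolding corner_sign_def cross_sign_def crosses_corner[OF assms]
    unfolding e1_def[symmetric] e2_def[symmetric] wind_def o
    unfolding orient_def using assms by (auto simp: power_int_minus)
qed

text \<open>The sign of an arc in the Lam system.\<close>

definition arc_sign :: "(complex \<times> complex) set \<Rightarrow> complex \<times> complex \<Rightarrow> real" where
  "arc_sign Or e = (- 1) powi geometric_signature G Or \<ll> e"

text \<open>
  The contribution of the intersections with the gauge rays to the sign of an arc.
\<close>

definition ray_signs :: "(complex \<times> complex) set \<Rightarrow> complex \<times> complex \<Rightarrow> real" where
  "ray_signs Or e = (\<Prod>m \<in> sources G Or. ray_sign m e)"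

lemma po_adjp: "perfect_orientation G Or \<Longrightarrow> (u, v) \<in> Or \<Longrightarrow> adjp u v"
  using po_adjG adjG_adjp by blast

lemma arc_sign_into_white:
  assumes "perfect_orientation G Or" "(u, v) \<in> Or" "v \<in> white G"
  shows "arc_sign Or (u, v) = (if u \<in> internal G then 1 else - 1) * ray_signs Or (u, v)"
  using assms(3) int_sign[OF po_adjp[OF assms(1,2)], of Or]
  by (simp add: arc_sign_def geometric_signature_def ray_signs_def powi_minus_one_add Let_def)

lemma arc_sign_into_black:
  assumes O: "perfect_orientation G Or" and wb: "(w, b) \<in> Or" and b: "b \<in> black G" and pw: "(p, w) \<in> Or"
  shows "arc_sign Or (w, b) = - ray_signs Or (w, b) * corner_sign p w b *
    (if b \<in> iblack G then corner_sign w b (THE q. (b, q) \<in> Or) else 1)"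
proof -
  have w: "w \<in> white G" using po_colors[OF O wb] b black_white by blast
  have nb: "b \<notin> white G" using b black_white by blast
  have p: "(THE p. (p, w) \<in> Or) = p" using po_white[OF O w] pw by blast
  have ib: "b \<in> internal G \<longleftrightarrow> b \<in> iblack G" using nb by (simp add: internal_def)
  have c1: "(- 1 :: real) powi wind \<ll> (w - p) (b - w) = corner_sign p w b"
    using wind_sign[OF hgt_edge hgt_edge] po_adjp[OF O] pw wb by blast
  have c2: "(- 1 :: real) powi wind \<ll> (b - w) ((THE q. (b, q) \<in> Or) - b) = corner_sign w b (THE q. (b, q) \<in> Or)"
    if "b \<in> iblack G"
  proof -
    have "(b, THE q. (b, q) \<in> Or) \<in> Or" using theI'[OF po_black[OF O that]] .
    then show ?thesis using wind_sign[OF hgt_edge hgt_edge] po_adjp[OF O] wb by blast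
  qed
  show ?thesis
    using c1 c2 int_sign[OF po_adjp[OF O wb], of Or] nb
    by (simp add: arc_sign_def geometric_signature_def ray_signs_def powi_minus_one_add Let_def p ib mult_ac)
qed

lemma through_internal:
  assumes O: "perfect_orientation G Or" and "(x, y) \<in> Or" "(y, z) \<in> Or"
  shows "y \<in> internal G"
proof (rule ccontr)
  assume "y \<notin> internal G"
  then have "y \<in> bvertices G" using vertex_cases adjG_vertices[OF po_adjG[OF O assms(2)]] by blast
  then have "x = z"
    using bvertex_nbr_unique adjG_sym[OF po_adjG[OF O assms(2)]] po_adjG[OF O assms(3)] by blast
  then show False using assms(2,3) po_asym[OF O] by blast
qed

text \<open>
  The end of the arc that leaves an internal black vertex, as a list with one entry, and the empty list for a
  boundary vertex.
\<close>

definition next_arc :: "(complex \<times> complex) set \<Rightarrow> complex \<Rightarrow> complex list" where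
  "next_arc Or b = (if b \<in> iblack G then [THE q. (b, q) \<in> Or] else [])"

text \<open>
  The product of the signs along a directed path from a black to a black vertex.  Among the arcs of the
  path, the one that enters a black vertex carries the winding numbers at both of its ends, so each corner of the
  path counts once; the last arc also carries that of the corner with the arc that leaves the last
  vertex.  Each of the \<open>n\<close> arcs into black vertices contributes a factor \<open>- 1\<close>, and so does the arc that
  leaves a boundary source.
\<close>

lemma directed_path_sign:
  assumes O: "perfect_orientation G Or"
  shows "length xs = 2 * n + 1 \<Longrightarrow> hd xs \<in> black G \<Longrightarrow> successively (\<lambda>u v. (u, v) \<in> Or) xs \<Longrightarrow>
    prod_list (map (arc_sign Or) (steps xs)) =
      (if n = 0 \<or> hd xs \<in> internal G then 1 else - 1) * (- 1) ^ n *
      prod_list (map (ray_signs Or) (steps xs)) * corner_prod corner_sign (xs @ next_arc Or (last xs))"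
proof (induction n arbitrary: xs)
  case 0
  then obtain x where "xs = [x]" by (cases xs) auto
  then show ?case by (simp add: next_arc_def)
next
  case (Suc n)
  obtain b w b' rest where xs: "xs = b # w # b' # rest"
    using Suc.prems(1) by (cases xs; cases "tl xs"; cases "tl (tl xs)") auto
  have bw: "(b, w) \<in> Or" and wb: "(w, b') \<in> Or" and sc: "successively (\<lambda>u v. (u, v) \<in> Or) (b' # rest)"
    using Suc.prems(3) by (auto simp: xs)
  have bb: "b \<in> black G" using Suc.prems(2) by (simp add: xs)
  have w: "w \<in> white G" using po_colors[OF O bw] bb black_white by blast
  have b': "b' \<in> black G" using po_colors[OF O wb] w black_white by blast
  have IH: "prod_list (map (arc_sign Or) (steps (b' # rest))) =
      (if n = 0 \<or> b' \<in> internal G then 1 else - 1) * (- 1) ^ n *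
      prod_list (map (ray_signs Or) (steps (b' # rest))) * corner_prod corner_sign ((b' # rest) @ next_arc Or (last (b' # rest)))"
    using Suc.IH[of "b' # rest"] Suc.prems(1) b' sc by (simp add: xs)
  have one: "n = 0 \<or> b' \<in> internal G"
  proof (cases rest)
    case Nil
    then show ?thesis using Suc.prems(1) by (simp add: xs)
  next
    case (Cons w2 r)
    then have "(b', w2) \<in> Or" using sc by simp
    then show ?thesis using through_internal[OF O wb] by blast
  qed
  define tail where "tail = rest @ next_arc Or (last (b' # rest))"
  have nxt: "corner_prod corner_sign (w # b' # tail) =
      (if b' \<in> iblack G then corner_sign w b' (THE q. (b', q) \<in> Or) else 1) * corner_prod corner_sign (b' # tail)"
  proof (cases rest)
    case Nil
    then show ?thesis by (auto simp: tail_def next_arc_def)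
  next
    case (Cons w2 r)
    then have bw2: "(b', w2) \<in> Or" using sc by simp
    then have "b' \<in> internal G" using through_internal[OF O wb] by blast
    then have ib: "b' \<in> iblack G" using b' black_white by (auto simp: internal_def)
    have "(THE q. (b', q) \<in> Or) = w2" using po_black[OF O ib] bw2 by blast
    then show ?thesis using ib Cons by (simp add: tail_def)
  qed
  have "prod_list (map (arc_sign Or) (steps xs)) =
      arc_sign Or (b, w) * arc_sign Or (w, b') * prod_list (map (arc_sign Or) (steps (b' # rest)))"
    by (simp add: xs)
  also have "\<dots> = ((if b \<in> internal G then 1 else - 1) * ray_signs Or (b, w)) *
      (- ray_signs Or (w, b') * corner_sign b w b' * (if b' \<in> iblack G then corner_sign w b' (THE q. (b', q) \<in> Or) else 1)) *
      ((- 1) ^ n * prod_list (map (ray_signs Or) (steps (b' # rest))) * corner_prod corner_sign (b' # tail))"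
    unfolding arc_sign_into_white[OF O bw w] arc_sign_into_black[OF O wb b' bw] IH
    using one by (simp add: tail_def)
  also have "\<dots> = (if b \<in> internal G then 1 else - 1) * (- 1) ^ Suc n *
      (ray_signs Or (b, w) * ray_signs Or (w, b') * prod_list (map (ray_signs Or) (steps (b' # rest)))) *
      (corner_sign b w b' * corner_prod corner_sign (w # b' # tail))"
    unfolding nxt by (simp add: mult_ac)
  also have "\<dots> = (if b \<in> internal G then 1 else - 1) * (- 1) ^ Suc n *
      prod_list (map (ray_signs Or) (steps xs)) * corner_prod corner_sign (xs @ next_arc Or (last xs))"
    by (simp add: xs tail_def mult_ac)
  finally show ?case by (simp add: xs)
qed

text \<open>
  The colors alternate along a path.
\<close>

lemma color_parity:
  "xs \<noteq> [] \<Longrightarrow> successively adjG xs \<Longrightarrow> (hd xs \<in> white G \<longleftrightarrow> last xs \<in> white G) \<longleftrightarrow> odd (length xs)"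
proof (induction xs rule: induct_list012)
  case (3 a b xs)
  have "a \<in> white G \<longleftrightarrow> b \<notin> white G"
    using 3(4) edgesD black_white unfolding adjG_def by auto
  then show ?case using 3(2,4) by (cases "xs = []") auto
qed auto

lemma directed_adjG: "perfect_orientation G Or \<Longrightarrow> successively (\<lambda>u v. (u, v) \<in> Or) xs \<Longrightarrow> successively adjG xs"
  using po_adjG unfolding successively_steps by blast

lemma directed_cycle_adjp:
  "perfect_orientation G Or \<Longrightarrow> cycle (\<lambda>u v. (u, v) \<in> Or) cs \<Longrightarrow> cycle adjp cs"
  using po_adjp unfolding cycle_def successively_steps by blast

lemma directed_cycle_internal:
  assumes O: "perfect_orientation G Or" and C: "cycle (\<lambda>u v. (u, v) \<in> Or) cs"
  shows "set cs \<subseteq> internal G"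
proof
  fix x assume "x \<in> set cs"
  then obtain p s where "(p, x) \<in> set (steps (circ cs))" "(x, s) \<in> set (steps (circ cs))"
    using cycle_nbrs[OF C] by metis
  then show "x \<in> internal G"
    using C through_internal[OF O] unfolding cycle_def successively_steps by blast
qed

text \<open>The signs of the arcs with the same factor \<open>\<i>\<close> as in \<open>twist\<close>.\<close>

abbreviation twisted_arc :: "(complex \<times> complex) set \<Rightarrow> complex \<times> complex \<Rightarrow> complex" where
  "twisted_arc Or \<equiv> \<lambda>e. of_real (arc_sign Or e) * \<i>"

lemma twisted_arc_prod:
  "prod_list (map (twisted_arc Or) xs) = of_real (prod_list (map (arc_sign Or) xs)) * \<i> ^ length xs"
  by (induction xs) (simp_all add: mult_ac)

lemma length_steps: "length (steps xs) = length xs - 1"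
  by (simp add: steps_def)

lemma i_power_even: "\<i> ^ (2 * n) = (- 1) ^ n"
  by (simp add: power_mult)

lemma minus_one_power_sq: "(- 1 :: 'a :: comm_ring_1) ^ n * (- 1) ^ n = 1"
  by (simp add: power_mult_distrib[symmetric])

lemma directed_cycle_sign:
  assumes O: "perfect_orientation G Or" and C: "cycle (\<lambda>u v. (u, v) \<in> Or) cs"
  shows "prod_list (map (twisted_arc Or) (steps (circ cs))) = - 1"
proof -
  have "\<exists>x \<in> set cs. x \<in> black G"
  proof -
    obtain y where y: "y \<in> set cs" using cycle_nonempty[OF C] by (cases cs) auto
    then obtain p s where ps: "p \<in> set cs" "(p, y) \<in> set (steps (circ cs))"
      using cycle_nbrs[OF C] by metis
    then have "(p, y) \<in> Or" using C unfolding cycle_def successively_steps by blast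
    then show ?thesis using po_colors[OF O] y ps(1) by blast
  qed
  then obtain x us vs where x: "x \<in> black G" "cs = us @ x # vs" by (meson split_list)
  define ds where "ds = x # vs @ us"
  have ds: "ds = (x # vs) @ us" by (simp add: ds_def)
  have D: "cycle (\<lambda>u v. (u, v) \<in> Or) ds" using C cycle_rotate[of _ us "x # vs"] unfolding x(2) ds by blast
  have eq: "prod_list (map (twisted_arc Or) (steps (circ cs))) = prod_list (map (twisted_arc Or) (steps (circ ds)))"
    unfolding x(2) ds by (rule circ_rotate(1))
  have sc: "successively (\<lambda>u v. (u, v) \<in> Or) (circ ds)" and len: "3 \<le> length ds" using D by (auto simp: cycle_def)
  have c: "circ ds = ds @ [x]" by (simp add: circ_def ds_def)
  have "odd (length (circ ds))"
    using color_parity[of "circ ds"] directed_adjG[OF O sc] by (simp add: c) (simp add: ds_def)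
  then obtain n where n: "length (circ ds) = 2 * n + 1" by (metis oddE)
  have xi: "x \<in> internal G" using directed_cycle_internal[OF O D] by (simp add: ds_def)
  then have xb: "x \<in> iblack G" using x(1) black_white by (auto simp: internal_def)
  obtain y zs where yz: "ds = x # y # zs" using len by (cases "vs @ us") (auto simp: ds_def)
  have "(x, y) \<in> Or" using sc unfolding c by (simp add: yz)
  then have nx: "next_arc Or x = [y]" using po_black[OF O xb] xb by (auto simp: next_arc_def)
  have turn: "corner_prod corner_sign (circ ds @ next_arc Or (last (circ ds))) = - 1"
  proof -
    have "circ ds @ next_arc Or (last (circ ds)) = ds @ take 2 ds" by (simp add: c nx) (simp add: yz)
    moreover have "cnj \<ll> \<noteq> 0" using gauge by (simp add: gauge_direction_def)
    ultimately show ?thesis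
      using cycle_turning[OF adjp_plane directed_cycle_adjp[OF O D]]
      unfolding corner_sign_def[abs_def] by simp
  qed
  have ray: "prod_list (map (ray_signs Or) (steps (circ ds))) = 1"
  proof -
    have "prod_list (map (ray_sign m) (steps (circ ds))) = 1" if m: "m \<in> sources G Or" for m
    proof -
      have mb: "m < bnum G" using m by (simp add: sources_def)
      then have bm: "bdry G m \<notin> internal G" using bvertices_not_internal by (auto simp: bvertices_def)
      have "ray_sign m (u, v) = ray_side m u * ray_side m v" if uv: "(u, v) \<in> set (steps (circ ds))" for u v
      proof (rule ray_sign_edge[OF mb])
        show "adjG u v" using directed_adjG[OF O sc] uv unfolding successively_steps by blast
        have "u \<in> set ds" "v \<in> set ds" using steps_circ_set[OF uv] cycle_nonempty[OF D] by auto
        then show "u \<noteq> bdry G m" "v \<noteq> bdry G m" using directed_cycle_internal[OF O D] bm by blast+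
      qed
      then have eqm: "map (ray_sign m) (steps (circ ds)) = map (\<lambda>(u, v). ray_side m u * ray_side m v) (steps (circ ds))"
        by (intro map_cong) auto
      have "circ ds \<noteq> []" by (simp add: c)
      then have "prod_list (map (ray_sign m) (steps (circ ds))) = ray_side m (hd (circ ds)) * ray_side m (last (circ ds))"
        unfolding eqm by (rule prod_steps_telescope[of "ray_side m", OF ray_side_sq])
      then show ?thesis using ray_side_sq by (simp add: c) (simp add: ds_def)
    qed
    then show ?thesis unfolding ray_signs_def[abs_def] prod_list_prod by simp
  qed
  have h: "hd (circ ds) = x" unfolding c by (simp add: ds_def)
  have "prod_list (map (arc_sign Or) (steps (circ ds))) = - ((- 1) ^ n)"
    using directed_path_sign[OF O n _ sc] x(1) xi ray turn by (simp add: h)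
  then have "prod_list (map (twisted_arc Or) (steps (circ ds))) = - ((- 1) ^ n * (- 1) ^ n)"
    unfolding twisted_arc_prod length_steps n by (simp add: i_power_even)
  then show ?thesis unfolding eq minus_one_power_sq by simp
qed

subsection \<open>Directed paths between boundary vertices\<close>

text \<open>
  The boundary vertices from \<open>bdry G j\<close> to \<open>bdry G i\<close>, in this order.  They close up a path from
  \<open>bdry G i\<close> to \<open>bdry G j\<close>.
\<close>

definition boundary_walk :: "nat \<Rightarrow> nat \<Rightarrow> complex list" where
  "boundary_walk i j = map (bdry G) (if i < j then rev [i..<Suc j] else [j..<Suc i])"

text \<open>The boundary vertices strictly between \<open>bdry G j\<close> and \<open>bdry G i\<close>, in this order.\<close>

definition along_boundary :: "nat \<Rightarrow> nat \<Rightarrow> complex list" where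
  "along_boundary i j = map (bdry G) (if i < j then rev [Suc i..<j] else [Suc j..<i])"

lemma boundary_walk_eq:
  assumes "i \<noteq> j"
  shows "boundary_walk i j = bdry G j # along_boundary i j @ [bdry G i]"
proof (cases "i < j")
  case True
  then have "[i..<Suc j] = i # [Suc i..<j] @ [j]" by (simp add: upt_conv_Cons)
  then show ?thesis using True by (simp add: boundary_walk_def along_boundary_def)
next
  case False
  then have "j < i" using assms by simp
  then have "[j..<Suc i] = j # [Suc j..<i] @ [i]" by (simp add: upt_conv_Cons)
  then show ?thesis using False by (simp add: boundary_walk_def along_boundary_def)
qed

lemma successively_upt: "successively (\<lambda>a b. b = Suc a) [i..<j]"
  by (simp add: successively_conv_nth)

lemma boundary_walk_steps:
  assumes "i < bnum G" "j < bnum G" "(u, v) \<in> set (steps (boundary_walk i j))"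
  obtains a where "Suc a < bnum G" "min i j \<le> a" "Suc a \<le> max i j"
    "if i < j then u = bdry G (Suc a) \<and> v = bdry G a else u = bdry G a \<and> v = bdry G (Suc a)"
proof -
  have st: "\<exists>a. (u, v) = (bdry G a, bdry G (Suc a)) \<and> k \<le> a \<and> Suc a \<le> l"
    if uv: "(u, v) \<in> set (steps (map (bdry G) [k..<Suc l]))" for u v k l
  proof -
    have "steps (map (bdry G) xs) = map (\<lambda>(a, b). (bdry G a, bdry G b)) (steps xs)" for xs
      by (induction xs rule: induct_list012) auto
    then obtain a b where ab: "(a, b) \<in> set (steps [k..<Suc l])" "u = bdry G a" "v = bdry G b"
      using uv by (auto simp del: upt_Suc)
    have "b = Suc a" using successively_upt[of k "Suc l"] ab(1) unfolding successively_steps by blast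
    moreover have "k \<le> a" "b \<le> l" using in_steps[OF ab(1)] by auto
    ultimately show ?thesis using ab by blast
  qed
  show ?thesis
  proof (cases "i < j")
    case True
    then have "(v, u) \<in> set (steps (map (bdry G) [i..<Suc j]))"
      using assms(3) unfolding boundary_walk_def by (simp add: rev_map[symmetric] set_steps_rev del: upt_Suc)
    then obtain a where "(v, u) = (bdry G a, bdry G (Suc a)) \<and> i \<le> a \<and> Suc a \<le> j" using st by blast
    then show ?thesis using that[of a] True assms(2) by auto
  next
    case False
    then have "(u, v) \<in> set (steps (map (bdry G) [j..<Suc i]))"
      using assms(3) unfolding boundary_walk_def by (simp del: upt_Suc)
    then obtain a where "(u, v) = (bdry G a, bdry G (Suc a)) \<and> j \<le> a \<and> Suc a \<le> i" using st by blast
    then show ?thesis using that[of a] False assms(1) by auto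
  qed
qed

lemma boundary_walk_bottom:
  assumes "i < bnum G" "j < bnum G"
  shows "successively bottom (boundary_walk i j)"
  unfolding successively_steps
proof (clarify)
  fix u v assume "(u, v) \<in> set (steps (boundary_walk i j))"
  from boundary_walk_steps[OF assms this] obtain a where "Suc a < bnum G"
    "if i < j then u = bdry G (Suc a) \<and> v = bdry G a else u = bdry G a \<and> v = bdry G (Suc a)" by metis
  then show "bottom u v" unfolding bottom_def by (auto split: if_splits)
qed

lemma along_boundary_set:
  assumes "i < bnum G" "j < bnum G"
  shows "set (along_boundary i j) = bdry G ` {m. min i j < m \<and> m < max i j}"
    "distinct (along_boundary i j)"
proof -
  show "set (along_boundary i j) = bdry G ` {m. min i j < m \<and> m < max i j}"
    by (auto simp: along_boundary_def)
  have "inj_on (bdry G) {..<bnum G}" using inj_bdry by (simp add: inj_on_def)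
  then have "inj_on (bdry G) {Suc i..<j}" "inj_on (bdry G) {Suc j..<i}"
    by (rule inj_on_subset; use assms in auto)+
  then show "distinct (along_boundary i j)" by (simp add: along_boundary_def distinct_map)
qed

text \<open>The polygon formed by a directed path between boundary vertices and the boundary.\<close>

lemma boundary_polygon:
  assumes O: "perfect_orientation G Or" and d: "distinct xs" and sc: "successively (\<lambda>u v. (u, v) \<in> Or) xs"
    and ij: "i < bnum G" "j < bnum G" "i \<noteq> j" and h: "hd xs = bdry G i" and l: "last xs = bdry G j" and ne: "xs \<noteq> []"
  shows "cycle adjp (xs @ along_boundary i j)" "3 \<le> length xs"
    "set xs - {bdry G i, bdry G j} \<subseteq> internal G"
    "set (steps (circ (xs @ along_boundary i j))) = set (steps xs) \<union> set (steps (boundary_walk i j))"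
    "steps (circ (xs @ along_boundary i j)) = steps xs @ steps (boundary_walk i j)"
proof -
  have bb: "bdry G i \<in> bvertices G" "bdry G j \<in> bvertices G" using ij by (auto simp: bvertices_def)
  have bij: "bdry G i \<noteq> bdry G j" using inj_bdry ij by blast
  show len: "3 \<le> length xs"
  proof -
    have "bdry G i \<notin> white G" "bdry G j \<notin> white G" using bb bvertices_not_internal by (auto simp: internal_def)
    then have "odd (length xs)" using color_parity[OF ne directed_adjG[OF O sc]] h l by simp
    moreover have "length xs \<noteq> 1"
    proof
      assume "length xs = 1"
      then have "hd xs = last xs" by (cases xs) auto
      then show False using h l bij by simp
    qed
    ultimately show ?thesis using ne by (cases xs; cases "tl xs"; cases "tl (tl xs)") auto
  qed
  show mid: "set xs - {bdry G i, bdry G j} \<subseteq> internal G"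
  proof
    fix x assume x: "x \<in> set xs - {bdry G i, bdry G j}"
    then obtain ps qs where pq: "xs = ps @ x # qs" by (meson DiffD1 split_list)
    have "ps \<noteq> []" "qs \<noteq> []" using pq x h l by auto
    then have "(last ps, x) \<in> Or" "(x, hd qs) \<in> Or" using sc pq by (cases qs; simp add: successively_append_iff)+
    then show "x \<in> internal G" using through_internal[OF O] by blast
  qed
  obtain xs0 where xs0: "xs = xs0 @ [bdry G j]" using l ne by (metis append_butlast_last_id)
  show st: "steps (circ (xs @ along_boundary i j)) = steps xs @ steps (boundary_walk i j)"
  proof -
    have "circ (xs @ along_boundary i j) = xs0 @ bdry G j # (along_boundary i j @ [bdry G i])"
      using h ne by (simp add: circ_def) (simp add: xs0)
    then show ?thesis
      using steps_append[of xs0 "bdry G j" "along_boundary i j @ [bdry G i]"] boundary_walk_eq[OF ij(3)]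
      by (simp add: xs0)
  qed
  show "set (steps (circ (xs @ along_boundary i j))) = set (steps xs) \<union> set (steps (boundary_walk i j))"
    unfolding st by simp
  show "cycle adjp (xs @ along_boundary i j)"
    unfolding cycle_def
  proof (intro conjI)
    show "3 \<le> length (xs @ along_boundary i j)" using len by simp
    have "set xs \<inter> set (along_boundary i j) = {}"
    proof (rule ccontr)
      assume "\<not> ?thesis"
      then obtain m where m: "min i j < m" "m < max i j" "bdry G m \<in> set xs"
        unfolding along_boundary_set(1)[OF ij(1,2)] by auto
      have mb: "m < bnum G" using m ij by auto
      have "bdry G m \<noteq> bdry G i" "bdry G m \<noteq> bdry G j" using inj_bdry[OF mb] ij m by auto
      then have "bdry G m \<in> internal G" using mid m(3) by blast
      then show False using bvertices_not_internal mb by (auto simp: bvertices_def)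
    qed
    then show "distinct (xs @ along_boundary i j)" using d along_boundary_set(2)[OF ij(1,2)] by simp
    have "successively adjp xs" using sc po_adjp[OF O] unfolding successively_steps by blast
    moreover have "successively adjp (boundary_walk i j)"
      using boundary_walk_bottom[OF ij(1,2)] unfolding successively_steps adjp_def by blast
    ultimately show "successively adjp (circ (xs @ along_boundary i j))"
      unfolding successively_steps st by auto
  qed
qed

lemma corner_sign_monotone:
  assumes "successively (\<lambda>a b. hgt a < hgt b) ys \<or> successively (\<lambda>a b. hgt b < hgt a) ys"
  shows "corner_prod corner_sign ys = 1"
  using assms
proof (induction "corner_sign" ys rule: corner_prod.induct)
  case (1 a b d xs)
  have "\<not> crosses (cnj \<ll> * (b - a)) (cnj \<ll> * (d - b))"
    using 1(2) by (subst crosses_corner) auto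
  then have "corner_sign a b d = 1" by (simp add: corner_sign_def cross_sign_def)
  then show ?case using 1 by auto
qed auto

text \<open>The sources strictly between the boundary vertices \<open>i\<close> and \<open>j\<close>.\<close>

definition sources_between :: "(complex \<times> complex) set \<Rightarrow> nat \<Rightarrow> nat \<Rightarrow> nat set" where
  "sources_between Or i j = {m \<in> sources G Or. min i j < m \<and> m < max i j}"

text \<open>
  The corners at the two ends of a path that is closed up along the boundary.  The sign at the sink is
  always \<open>1\<close>.  The sign at the source depends on the side of its gauge ray to which the path starts.
\<close>

lemma sink_corner:
  assumes j: "j < bnum G" "i < bnum G" "i \<noteq> j" and w: "w \<in> int_disk" "hgt w \<noteq> hgt (bdry G j)"
    and st: "(bdry G j, \<beta>) \<in> set (steps (boundary_walk i j))"
  shows "corner_sign w (bdry G j) \<beta> = 1"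
proof -
  obtain a where a: "Suc a < bnum G"
    "if i < j then bdry G j = bdry G (Suc a) \<and> \<beta> = bdry G a else bdry G j = bdry G a \<and> \<beta> = bdry G (Suc a)"
    using boundary_walk_steps[OF j(2,1) st] by metis
  have "\<not> crosses (cnj \<ll> * (bdry G j - w)) (cnj \<ll> * (\<beta> - bdry G j))"
  proof (cases "i < j")
    case True
    define d where "d = bdry G j - \<beta>"
    have ja: "j = Suc a" "\<beta> = bdry G a" using a True inj_bdry[of j "Suc a"] j(1) by auto
    have hg: "hgt \<beta> < hgt (bdry G j)" using hgt_less[of a "Suc a"] a(1) ja by simp
    have "Im (cnj d * (w - bdry G j)) < 0"
      using boundary_orient'[of a "Suc a" w] a(1) w(1) ja by (simp add: d_def)
    moreover have "Im (cnj (bdry G j - w) * (\<beta> - bdry G j)) = - Im (cnj d * (w - bdry G j))"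
      unfolding d_def by (simp add: algebra_simps)
    ultimately show ?thesis using w(2) hg by (subst crosses_corner) auto
  next
    case False
    define d where "d = \<beta> - bdry G j"
    have ja: "j = a" "\<beta> = bdry G (Suc a)" using a False inj_bdry[of j a] j(1) by auto
    have hg: "hgt \<beta> > hgt (bdry G j)" using hgt_less[of a "Suc a"] a(1) ja by simp
    have "Im (cnj d * (w - bdry G j)) < 0"
      using boundary_orient[of a "Suc a" w] a(1) w(1) ja by (simp add: d_def)
    moreover have "Im (cnj (bdry G j - w) * (\<beta> - bdry G j)) = Im (cnj d * (w - bdry G j))"
      unfolding d_def by (simp add: algebra_simps)
    ultimately show ?thesis using w(2) hg by (subst crosses_corner) auto
  qed
  then show ?thesis by (simp add: corner_sign_def cross_sign_def)
qed

lemma source_corner: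
  assumes j: "j < bnum G" "i < bnum G" "i \<noteq> j" and w: "w \<in> int_disk" "hgt w \<noteq> hgt (bdry G i)"
    and st: "(\<alpha>, bdry G i) \<in> set (steps (boundary_walk i j))"
  shows "corner_sign \<alpha> (bdry G i) w = - ray_side i w * ray_side i (bdry G j)"
proof -
  obtain a where a: "Suc a < bnum G"
    "if i < j then \<alpha> = bdry G (Suc a) \<and> bdry G i = bdry G a else \<alpha> = bdry G a \<and> bdry G i = bdry G (Suc a)"
    using boundary_walk_steps[OF j(2,1) st] by metis
  show ?thesis
  proof (cases "i < j")
    case True
    define d where "d = \<alpha> - bdry G i"
    have ia: "i = a" "\<alpha> = bdry G (Suc a)" using a True inj_bdry[of i a] j(2) by auto
    have hg: "hgt \<alpha> > hgt (bdry G i)" using hgt_less[of a "Suc a"] a(1) ia by simp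
    have "Im (cnj d * (w - bdry G i)) < 0"
      using boundary_orient[of a "Suc a" w] a(1) w(1) ia by (simp add: d_def)
    moreover have "Im (cnj (bdry G i - \<alpha>) * (w - bdry G i)) = - Im (cnj d * (w - bdry G i))"
      unfolding d_def by (simp add: algebra_simps)
    ultimately have "crosses (cnj \<ll> * (bdry G i - \<alpha>)) (cnj \<ll> * (w - bdry G i)) \<longleftrightarrow> hgt w > hgt (bdry G i)"
      using w(2) hg by (subst crosses_corner) auto
    moreover have "ray_side i (bdry G j) = 1" using hgt_less[OF True j(1)] by (simp add: ray_side_def)
    ultimately show ?thesis by (simp add: corner_sign_def cross_sign_def ray_side_def)
  next
    case False
    define d where "d = bdry G i - \<alpha>"
    have ia: "i = Suc a" "\<alpha> = bdry G a" using a False inj_bdry[of i "Suc a"] j(2) by auto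
    have hg: "hgt \<alpha> < hgt (bdry G i)" using hgt_less[of a "Suc a"] a(1) ia by simp
    have "Im (cnj d * (w - bdry G i)) < 0"
      using boundary_orient'[of a "Suc a" w] a(1) w(1) ia by (simp add: d_def)
    then have "crosses (cnj \<ll> * (bdry G i - \<alpha>)) (cnj \<ll> * (w - bdry G i)) \<longleftrightarrow> hgt w < hgt (bdry G i)"
      unfolding d_def using w(2) hg by (subst crosses_corner) auto
    moreover have "ray_side i (bdry G j) = - 1"
      using hgt_less[of j i] False j by (simp add: ray_side_def)
    ultimately show ?thesis using w(2) by (auto simp: corner_sign_def cross_sign_def ray_side_def)
  qed
qed

text \<open>
  The number of intersections with the ray of a source other than \<open>i\<close> is odd if and only if this source
  lies between \<open>i\<close> and \<open>j\<close>.  The intersections with the ray of the source \<open>i\<close> itself cancel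
  against the corner at \<open>bdry G i\<close>.
\<close>

lemma directed_boundary_path_sign:
  assumes O: "perfect_orientation G Or" and d: "distinct xs" and sc: "successively (\<lambda>u v. (u, v) \<in> Or) xs"
    and ij: "i < bnum G" "j < bnum G" "i \<noteq> j" and h: "hd xs = bdry G i" and l: "last xs = bdry G j" and ne: "xs \<noteq> []"
  shows "prod_list (map (twisted_arc Or) (steps xs)) = - ((- 1) ^ card (sources_between Or i j))"
proof -
  note bp = boundary_polygon[OF O d sc ij h l ne]
  have bb: "bdry G i \<in> bvertices G" "bdry G j \<in> bvertices G" using ij by (auto simp: bvertices_def)
  have bbl: "bdry G i \<in> black G" "bdry G j \<in> black G" using bb by (auto simp: black_def)
  have bni: "bdry G i \<notin> internal G" "bdry G j \<notin> internal G" using bb bvertices_not_internal by blast+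
  have bnw: "bdry G i \<notin> white G" "bdry G j \<notin> white G" "bdry G j \<notin> iblack G" using bni by (auto simp: internal_def)
  have bij: "bdry G i \<noteq> bdry G j" using inj_bdry ij by blast
  have "odd (length xs)" using color_parity[OF ne directed_adjG[OF O sc]] h l bnw by simp
  then obtain n where n: "length xs = 2 * n + 1" by (metis oddE)
  then have n0: "n \<noteq> 0" using bp(2) by simp
  obtain w1 zs where xs1: "xs = bdry G i # w1 # zs" using bp(2) h by (cases xs; cases "tl xs") auto
  obtain vs w2 where xs2: "xs = vs @ [w2, bdry G j]"
  proof -
    have "xs = butlast xs @ [bdry G j]" using l ne by (metis append_butlast_last_id)
    moreover have "butlast xs \<noteq> []" using bp(2) by (cases xs; cases "tl xs") auto
    then have "butlast xs = butlast (butlast xs) @ [last (butlast xs)]" by simp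
    ultimately have "xs = butlast (butlast xs) @ [last (butlast xs), bdry G j]"
      by (metis append.assoc append_Cons append_Nil)
    then show ?thesis by (rule that)
  qed
  have s1: "(bdry G i, w1) \<in> Or" using sc by (simp add: xs1)
  have s2: "(w2, bdry G j) \<in> Or" using sc unfolding xs2 by (simp add: successively_append_iff)
  have w1: "w1 \<in> white G" using po_colors[OF O s1] bnw by blast
  have w2: "w2 \<in> white G" using po_colors[OF O s2] bbl(2) black_white by blast
  have i_src: "i \<in> sources G Or" using s1 ij by (auto simp: sources_def)
  have j_snk: "j \<notin> sources G Or"
  proof
    assume "j \<in> sources G Or"
    then obtain w where "(bdry G j, w) \<in> Or" by (auto simp: sources_def)
    then show False using through_internal[OF O s2] bni by blast
  qed
  \<comment> \<open>The gauge rays.\<close>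
  have rs: "prod_list (map (ray_sign m) (steps xs)) = ray_side m (bdry G i) * ray_side m (bdry G j)"
    if m: "m \<in> sources G Or" "m \<noteq> i" for m
  proof -
    have mb: "m < bnum G" using m by (simp add: sources_def)
    have mj: "m \<noteq> j" using m j_snk by blast
    have "bdry G m \<notin> set xs"
    proof
      assume "bdry G m \<in> set xs"
      moreover have "bdry G m \<noteq> bdry G i" "bdry G m \<noteq> bdry G j" using inj_bdry[OF mb] ij m(2) mj by blast+
      ultimately have "bdry G m \<in> internal G" using bp(3) by blast
      then show False using bvertices_not_internal mb by (auto simp: bvertices_def)
    qed
    then have "ray_sign m (u, v) = ray_side m u * ray_side m v" if uv: "(u, v) \<in> set (steps xs)" for u v
    proof (intro ray_sign_edge[OF mb])
      show "adjG u v" using directed_adjG[OF O sc] uv unfolding successively_steps by blast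
      show "u \<noteq> bdry G m" "v \<noteq> bdry G m" using in_steps[OF uv] \<open>bdry G m \<notin> set xs\<close> by blast+
    qed
    then have eqm: "map (ray_sign m) (steps xs) = map (\<lambda>(u, v). ray_side m u * ray_side m v) (steps xs)"
      by (intro map_cong) auto
    show ?thesis unfolding eqm h[symmetric] l[symmetric]
      using ne by (rule prod_steps_telescope[of "ray_side m", OF ray_side_sq])
  qed
  have ri: "prod_list (map (ray_sign i) (steps xs)) = ray_side i w1 * ray_side i (bdry G j)"
  proof -
    have dn: "bdry G i \<notin> set (w1 # zs)" using d by (simp add: xs1)
    have "ray_sign i (u, v) = ray_side i u * ray_side i v" if uv: "(u, v) \<in> set (steps (w1 # zs))" for u v
    proof (intro ray_sign_edge[OF ij(1)])
      have "(u, v) \<in> set (steps xs)" using uv by (simp add: xs1)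
      then show "adjG u v" using directed_adjG[OF O sc] unfolding successively_steps by blast
      show "u \<noteq> bdry G i" "v \<noteq> bdry G i" using in_steps[OF uv] dn by blast+
    qed
    then have eqm: "map (ray_sign i) (steps (w1 # zs)) = map (\<lambda>(u, v). ray_side i u * ray_side i v) (steps (w1 # zs))"
      by (intro map_cong) auto
    have "prod_list (map (ray_sign i) (steps (w1 # zs))) = ray_side i (hd (w1 # zs)) * ray_side i (last (w1 # zs))"
      unfolding eqm by (rule prod_steps_telescope[of "ray_side i", OF ray_side_sq]) simp
    moreover have "last (w1 # zs) = bdry G j" using l by (simp add: xs1)
    moreover have "ray_sign i (bdry G i, w1) = 1" using ray_sign_own[OF ij(1) po_adjG[OF O s1]] .
    ultimately show ?thesis by (simp add: xs1)
  qed
  \<comment> \<open>The ends \<open>i\<close> and \<open>j\<close> lie on different sides of the ray of \<open>m\<close> iff \<open>m\<close> lies between them.\<close>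
  have between: "(\<Prod>m \<in> sources G Or - {i}. ray_side m (bdry G i) * ray_side m (bdry G j)) = (- 1) ^ card (sources_between Or i j)"
  proof -
    have f: "finite (sources G Or - {i})" using finite_sources by simp
    have "ray_side m (bdry G i) * ray_side m (bdry G j) = (if m \<in> sources_between Or i j then - 1 else 1)"
      if m: "m \<in> sources G Or - {i}" for m
    proof -
      have mb: "m < bnum G" using m by (simp add: sources_def)
      have mj: "m \<noteq> j" "m \<noteq> i" using m j_snk by blast+
      show ?thesis
        using m mj hgt_less_iff[OF mb ij(1)] hgt_less_iff[OF mb ij(2)]
        by (auto simp: ray_side_def sources_between_def min_def max_def)
    qed
    then have "(\<Prod>m \<in> sources G Or - {i}. ray_side m (bdry G i) * ray_side m (bdry G j)) =
        (\<Prod>m \<in> sources G Or - {i}. if m \<in> sources_between Or i j then - 1 else 1)"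
      by (rule prod.cong[OF refl])
    also have "\<dots> = (- 1) ^ card (sources_between Or i j)"
    proof -
      have "{m \<in> sources G Or - {i}. m \<in> sources_between Or i j} = sources_between Or i j"
        by (auto simp: sources_between_def)
      then show ?thesis using f by (simp add: prod.If_cases Int_def)
    qed
    finally show ?thesis .
  qed
  have ray: "prod_list (map (ray_signs Or) (steps xs)) =
      (ray_side i w1 * ray_side i (bdry G j)) * (- 1) ^ card (sources_between Or i j)"
  proof -
    have "prod_list (map (ray_signs Or) (steps xs)) = (\<Prod>m \<in> sources G Or. prod_list (map (ray_sign m) (steps xs)))"
      unfolding ray_signs_def[abs_def] prod_list_prod ..
    also have "\<dots> = prod_list (map (ray_sign i) (steps xs)) *
        (\<Prod>m \<in> sources G Or - {i}. prod_list (map (ray_sign m) (steps xs)))"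
      by (rule prod.remove[OF finite_sources i_src])
    also have "(\<Prod>m \<in> sources G Or - {i}. prod_list (map (ray_sign m) (steps xs))) =
        (\<Prod>m \<in> sources G Or - {i}. ray_side m (bdry G i) * ray_side m (bdry G j))"
      by (rule prod.cong[OF refl]) (use rs in auto)
    finally show ?thesis unfolding ri between .
  qed
  \<comment> \<open>The corners.\<close>
  define B where "B = along_boundary i j"
  define W where "W = boundary_walk i j"
  have WB: "W = bdry G j # B @ [bdry G i]" unfolding W_def B_def by (rule boundary_walk_eq[OF ij(3)])
  obtain \<beta> Bt where b1: "B @ [bdry G i] = \<beta> # Bt" by (cases "B @ [bdry G i]") auto
  obtain Bs \<alpha> where b2: "bdry G j # B = Bs @ [\<alpha>]" by (metis append_butlast_last_id list.distinct(1))
  have W1: "W = bdry G j # \<beta> # Bt" and W2: "W = Bs @ [\<alpha>, bdry G i]"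
    using WB b1 b2 by (simp, metis append.assoc append_Cons append_Nil)
  have st1: "(bdry G j, \<beta>) \<in> set (steps (boundary_walk i j))" using W1 by (simp add: W_def)
  have st2: "(\<alpha>, bdry G i) \<in> set (steps (boundary_walk i j))"
    using W2 steps_append[of Bs \<alpha> "[bdry G i]"] by (simp add: W_def)
  have turn: "corner_prod corner_sign ((xs @ B) @ take 2 (xs @ B)) = - 1"
  proof -
    have "cnj \<ll> \<noteq> 0" using gauge by (simp add: gauge_direction_def)
    then show ?thesis
      using cycle_turning[OF adjp_plane bp(1)] unfolding corner_sign_def[abs_def] B_def by blast
  qed
  have "(xs @ B) @ take 2 (xs @ B) = vs @ w2 # bdry G j # (B @ [bdry G i, w1])"
    using xs1 xs2 by (metis append.assoc append_Cons append_Nil take_Suc_Cons take0 numeral_2_eq_2)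
  then have t1: "corner_prod corner_sign ((xs @ B) @ take 2 (xs @ B)) =
      corner_prod corner_sign xs * corner_prod corner_sign (w2 # bdry G j # (B @ [bdry G i, w1]))"
    using corner_prod_append[of corner_sign vs w2 "bdry G j" "B @ [bdry G i, w1]"] xs2 by simp
  have t2': "w2 # bdry G j # (B @ [bdry G i, w1]) = w2 # bdry G j # \<beta> # (Bt @ [w1])"
    using b1 by (metis append.assoc append_Cons append_Nil)
  have t2: "corner_prod corner_sign (w2 # bdry G j # (B @ [bdry G i, w1])) =
      corner_sign w2 (bdry G j) \<beta> * corner_prod corner_sign (W @ [w1])"
    unfolding t2' by (simp add: W1)
  have t3: "corner_prod corner_sign (W @ [w1]) = corner_prod corner_sign W * corner_sign \<alpha> (bdry G i) w1"
    using corner_prod_append[of corner_sign Bs \<alpha> "bdry G i" "[w1]"] by (simp add: W2)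
  have mono: "corner_prod corner_sign W = 1"
  proof (rule corner_sign_monotone)
    have st: "if i < j then hgt v < hgt u else hgt u < hgt v" if uv: "(u, v) \<in> set (steps W)" for u v
    proof -
      obtain a where "Suc a < bnum G"
        "if i < j then u = bdry G (Suc a) \<and> v = bdry G a else u = bdry G a \<and> v = bdry G (Suc a)"
        using boundary_walk_steps[OF ij(1,2) uv[unfolded W_def]] by metis
      then show ?thesis using hgt_less[of a "Suc a"] by (auto split: if_splits)
    qed
    show "successively (\<lambda>a b. hgt a < hgt b) W \<or> successively (\<lambda>a b. hgt b < hgt a) W"
      unfolding successively_steps using st by (cases "i < j") (simp_all, fast+)
  qed
  have e1: "hgt w2 \<noteq> hgt (bdry G j)" using hgt_edge[OF po_adjp[OF O s2]] .
  have e2: "hgt w1 \<noteq> hgt (bdry G i)" using hgt_edge[OF po_adjp[OF O s1]] by simp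
  have "corner_prod corner_sign xs * (- ray_side i w1 * ray_side i (bdry G j)) = - 1"
    using turn unfolding t1 t2 t3 mono
      sink_corner[OF ij(2,1,3) white_int[OF w2] e1 st1] source_corner[OF ij(2,1,3) white_int[OF w1] e2 st2] by simp
  then have cp: "corner_prod corner_sign xs = ray_side i w1 * ray_side i (bdry G j)"
    by (auto simp: ray_side_def split: if_splits)
  have nx: "next_arc Or (last xs) = []" using bnw(3) l by (simp add: next_arc_def)
  have "prod_list (map (arc_sign Or) (steps xs)) = - ((- 1) ^ n * (- 1) ^ card (sources_between Or i j))"
  proof -
    have "prod_list (map (arc_sign Or) (steps xs)) = (- 1) * (- 1) ^ n *
        ((ray_side i w1 * ray_side i (bdry G j)) * (- 1) ^ card (sources_between Or i j)) * (ray_side i w1 * ray_side i (bdry G j))"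
      using directed_path_sign[OF O n _ sc] h bbl(1) bni(1) n0 by (simp add: nx cp ray)
    also have "\<dots> = - ((- 1) ^ n * (- 1) ^ card (sources_between Or i j)) *
        ((ray_side i w1 * ray_side i w1) * (ray_side i (bdry G j) * ray_side i (bdry G j)))"
      by (simp add: mult_ac)
    finally show ?thesis by (simp add: ray_side_sq)
  qed
  then have "prod_list (map (twisted_arc Or) (steps xs)) =
      - ((- 1) ^ n * (- 1) ^ n * (- 1) ^ card (sources_between Or i j))"
    unfolding twisted_arc_prod length_steps n by (simp add: i_power_even mult_ac)
  then show ?thesis unfolding minus_one_power_sq by simp
qed

end

section \<open>The geometric and the Kasteleyn signature are gauge equivalent\<close>

lemma prod_list_ones: "(\<And>x. x \<in> set xs \<Longrightarrow> f x = 1) \<Longrightarrow> prod_list (map f xs) = 1"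
  by (induction xs) simp_all

lemma successively_split:
  "successively R (xs @ a # ys) \<longleftrightarrow> successively R (xs @ [a]) \<and> successively R (a # ys)"
  unfolding successively_steps by (subst set_steps_append) blast

context kp_graph
begin

text \<open>The end of the arc that leaves a black vertex.\<close>

definition out_arc :: "(complex \<times> complex) set \<Rightarrow> complex \<Rightarrow> complex" where
  "out_arc Or b = (THE w. (b, w) \<in> Or)"

lemma black_out_unique:
  assumes O: "perfect_orientation G Or" and b: "b \<in> black G" and "(b, w) \<in> Or" "(b, w') \<in> Or"
  shows "w = w'"
proof (cases "b \<in> iblack G")
  case True
  then show ?thesis using po_black[OF O True] assms(3,4) by blast
next
  case False
  then have "b \<in> bvertices G" using b black_cases by blast
  then show ?thesis using bvertex_nbr_unique po_adjG[OF O] assms(3,4) by blast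
qed

lemma out_arc_eq:
  assumes "perfect_orientation G Or" "b \<in> black G" "(b, w) \<in> Or"
  shows "out_arc Or b = w"
  unfolding out_arc_def using assms(3) black_out_unique[OF assms(1,2) _ assms(3)] by (rule the_equality)

text \<open>
  The arcs from black to white vertices match the vertices inside of a directed polygon with each
  other, except for those that are matched with sources on the boundary part of the polygon.
\<close>

lemma inside_vertices_matched:
  assumes O: "perfect_orientation G Or" and C: "cycle adjp cs" and M: "finite M"
    and M1: "M \<subseteq> bvertices G"
    and M2: "\<And>b. b \<in> M \<Longrightarrow> \<exists>w. (b, w) \<in> Or \<and> w \<in> inside (rim cs)"
    and W: "\<And>w b. w \<in> set cs \<Longrightarrow> w \<in> white G \<Longrightarrow> (b, w) \<in> Or \<Longrightarrow> b \<in> set cs"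
    and B: "\<And>b w. b \<in> set cs \<Longrightarrow> b \<in> black G \<Longrightarrow> b \<notin> M \<Longrightarrow> (b, w) \<in> Or \<Longrightarrow> w \<in> set cs"
  shows "(- 1 :: 'a :: comm_ring_1) ^ card (inside_vertices cs) = (- 1) ^ card M"
proof -
  define Bi where "Bi = iblack G \<inter> inside (rim cs)"
  define Wi where "Wi = white G \<inter> inside (rim cs)"
  have off: "x \<notin> set cs" if "x \<in> inside (rim cs)" for x
    using set_rim[OF C] inside_rim_disjoint[OF that] by blast
  have arc: "(b, out_arc Or b) \<in> Or \<and> out_arc Or b \<in> Wi" if b: "b \<in> Bi \<union> M" for b
  proof (cases "b \<in> M")
    case True
    then obtain w where w: "(b, w) \<in> Or" "w \<in> inside (rim cs)" using M2 by blast
    have bb: "b \<in> black G" using True M1 by (auto simp: black_def)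
    have "w \<in> white G" using po_colors[OF O w(1)] bb black_white by blast
    then show ?thesis using w out_arc_eq[OF O bb w(1)] by (simp add: Wi_def)
  next
    case False
    then have bi: "b \<in> iblack G" "b \<in> inside (rim cs)" using b by (auto simp: Bi_def)
    have bb: "b \<in> black G" using bi(1) by (simp add: black_def)
    obtain w where w: "(b, w) \<in> Or" using po_black[OF O bi(1)] by blast
    have ww: "w \<in> white G" using po_colors[OF O w] bb black_white by blast
    have "w \<in> inside (rim cs) \<or> w \<in> set cs" using edge_inside(2)[OF C po_adjp[OF O w] bi(2)] .
    then have "w \<in> inside (rim cs)" using W[OF _ ww w] off[OF bi(2)] by blast
    then show ?thesis using w out_arc_eq[OF O bb w] ww by (simp add: Wi_def)
  qed
  have "bij_betw (out_arc Or) (Bi \<union> M) Wi"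
  proof (rule bij_betwI')
    fix b b' assume b: "b \<in> Bi \<union> M" "b' \<in> Bi \<union> M"
    show "out_arc Or b = out_arc Or b' \<longleftrightarrow> b = b'"
    proof
      assume e: "out_arc Or b = out_arc Or b'"
      have "out_arc Or b \<in> white G" using arc[OF b(1)] by (simp add: Wi_def)
      moreover have "(b', out_arc Or b) \<in> Or" using arc[OF b(2)] e by simp
      ultimately show "b = b'" using po_white[OF O] arc[OF b(1)] by blast
    qed simp
  next
    fix b assume "b \<in> Bi \<union> M"
    then show "out_arc Or b \<in> Wi" using arc by blast
  next
    fix w assume w: "w \<in> Wi"
    then have ww: "w \<in> white G" "w \<in> inside (rim cs)" by (auto simp: Wi_def)
    obtain b where b: "(b, w) \<in> Or" using po_white[OF O ww(1)] by blast
    have bb: "b \<in> black G" using po_colors[OF O b] ww(1) black_white by blast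
    have "b \<in> inside (rim cs) \<or> b \<in> set cs"
      using edge_inside(2)[OF C adjp_sym[OF po_adjp[OF O b]] ww(2)] .
    then have "b \<in> Bi \<union> M"
    proof
      assume i: "b \<in> inside (rim cs)"
      then have "b \<notin> bvertices G" using bvertex_not_inside[OF C] by blast
      then show ?thesis using i bb black_cases by (auto simp: Bi_def)
    next
      assume "b \<in> set cs"
      then show ?thesis using B[OF _ bb _ b] off[OF ww(2)] by blast
    qed
    then show "\<exists>b \<in> Bi \<union> M. w = out_arc Or b" using out_arc_eq[OF O bb b] by blast
  qed
  then have "card (Bi \<union> M) = card Wi" by (rule bij_betw_same_card)
  moreover have "card (Bi \<union> M) = card Bi + card M"
  proof (rule card_Un_disjoint)
    show "finite Bi" "finite M" using finite_vertices(1) M by (simp_all add: Bi_def)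
    show "Bi \<inter> M = {}" using M1 bvertices_not_internal by (auto simp: Bi_def internal_def)
  qed
  moreover have "card (inside_vertices cs) = card Bi + card Wi"
  proof -
    have "inside_vertices cs = Bi \<union> Wi" by (auto simp: inside_vertices_def internal_def Bi_def Wi_def)
    moreover have "Bi \<inter> Wi = {}" using black_white by (auto simp: Bi_def Wi_def black_def)
    ultimately show ?thesis
      using finite_vertices(1,2) by (simp add: card_Un_disjoint Bi_def Wi_def)
  qed
  ultimately have "card (inside_vertices cs) = 2 * card Bi + card M" by simp
  then show ?thesis by (simp add: power_add power_mult)
qed

lemma directed_cycle_twist:
  assumes O: "perfect_orientation G Or" and C: "cycle (\<lambda>u v. (u, v) \<in> Or) cs" and K: "kasteleyn_signature G \<sigma>"
  shows "prod_list (map (twist \<sigma>) (steps (circ cs))) = - 1"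
proof -
  note Ca = directed_cycle_adjp[OF O C]
  have arc: "(u, v) \<in> Or" if "(u, v) \<in> set (steps (circ cs))" for u v
    using C that unfolding cycle_def successively_steps by blast
  have "(- 1 :: complex) ^ card (inside_vertices cs) = (- 1) ^ card ({} :: complex set)"
  proof (rule inside_vertices_matched[OF O Ca])
    fix w b assume w: "w \<in> set cs" "w \<in> white G" "(b, w) \<in> Or"
    obtain p s where p: "p \<in> set cs" "(p, w) \<in> set (steps (circ cs))" using cycle_nbrs[OF C w(1)] by metis
    then show "b \<in> set cs" using arc[OF p(2)] po_white[OF O w(2)] w(3) by blast
  next
    fix b w assume b: "b \<in> set cs" "b \<in> black G" "(b, w) \<in> Or"
    obtain p s where s: "s \<in> set cs" "(b, s) \<in> set (steps (circ cs))" using cycle_nbrs[OF C b(1)] by metis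
    then show "w \<in> set cs" using black_out_unique[OF O b(2) arc[OF s(2)] b(3)] by simp
  qed auto
  then show ?thesis
    using kasteleyn_polygon[OF flexible_continuable[OF all_flexible] K Ca] by simp
qed

lemma edge_fun_bottom: "bottom u v \<Longrightarrow> edge_fun g (u, v) = 1"
proof -
  assume "bottom u v"
  then have "u \<in> bvertices G" "v \<in> bvertices G"
    unfolding bottom_def bvertices_def by (auto simp: doubleton_eq_iff)
  then have "u \<notin> white G" "v \<notin> white G" using bvertices_not_internal by (auto simp: internal_def)
  then have "(u, v) \<notin> edges G" "(v, u) \<notin> edges G" using edgesD by blast+
  then show ?thesis by (simp add: edge_fun_def)
qed

lemma directed_boundary_path_twist:
  assumes O: "perfect_orientation G Or" and d: "distinct xs" and sc: "successively (\<lambda>u v. (u, v) \<in> Or) xs"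
    and ij: "i < bnum G" "j < bnum G" "i \<noteq> j" and h: "hd xs = bdry G i" and l: "last xs = bdry G j" and ne: "xs \<noteq> []"
    and K: "kasteleyn_signature G \<sigma>"
  shows "prod_list (map (twist \<sigma>) (steps xs)) = - ((- 1) ^ card (sources_between Or i j))"
proof -
  note bp = boundary_polygon[OF O d sc ij h l ne]
  define B where "B = along_boundary i j"
  define M where "M = bdry G ` sources_between Or i j"
  have C: "cycle adjp (xs @ B)" using bp(1) by (simp add: B_def)
  have setB: "set B = bdry G ` {m. min i j < m \<and> m < max i j}"
    using along_boundary_set(1)[OF ij(1,2)] by (simp add: B_def)
  have Bb: "set B \<subseteq> bvertices G" using setB ij by (auto simp: bvertices_def)
  have dB: "distinct (xs @ B)" using C by (simp add: cycle_def)
  have bb: "bdry G i \<in> bvertices G" "bdry G j \<in> bvertices G" using ij by (auto simp: bvertices_def)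
  have bij: "bdry G i \<noteq> bdry G j" using inj_bdry ij by blast
  have sb: "sources_between Or i j \<subseteq> {..<bnum G}" using ij by (auto simp: sources_between_def)
  have MB: "M \<subseteq> set B" using setB by (auto simp: M_def sources_between_def)
  have succ: "\<exists>s. (x, s) \<in> Or \<and> s \<in> set xs" if x: "x \<in> set xs" "x \<noteq> bdry G j" for x
  proof -
    obtain ps qs where pq: "xs = ps @ x # qs" using x(1) by (meson split_list)
    then have "qs \<noteq> []" using l x(2) by auto
    then obtain s r where "qs = s # r" by (cases qs) auto
    then show ?thesis using sc pq by (auto simp: successively_append_iff)
  qed
  have pred: "\<exists>s. (s, x) \<in> Or \<and> s \<in> set xs" if x: "x \<in> set xs" "x \<noteq> bdry G i" for x
  proof -
    obtain ps qs where pq: "xs = ps @ x # qs" using x(1) by (meson split_list)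
    then have "ps \<noteq> []" using h x(2) by auto
    then show ?thesis using sc pq last_in_set[of ps] by (auto simp: successively_append_iff)
  qed
  have j_snk: "(bdry G j, w) \<notin> Or" for w
  proof
    assume "(bdry G j, w) \<in> Or"
    moreover obtain s where "(s, bdry G j) \<in> Or" using pred[of "bdry G j"] l ne bij last_in_set[OF ne] by auto
    ultimately show False using through_internal[OF O] bvertices_not_internal[OF bb(2)] by blast
  qed
  have "(- 1 :: complex) ^ card (inside_vertices (xs @ B)) = (- 1) ^ card M"
  proof (rule inside_vertices_matched[OF O C])
    show "finite M" using sb finite_subset by (auto simp: M_def)
    show "M \<subseteq> bvertices G" using MB Bb by blast
  next
    fix w b assume w: "w \<in> set (xs @ B)" "w \<in> white G" "(b, w) \<in> Or"
    have "w \<notin> bvertices G" using w(2) bvertices_not_internal by (auto simp: internal_def)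
    then have "w \<in> set xs" "w \<noteq> bdry G i" using w(1) Bb bb by auto
    then obtain s where "(s, w) \<in> Or" "s \<in> set xs" using pred by blast
    then show "b \<in> set (xs @ B)" using po_white[OF O w(2)] w(3) by auto
  next
    fix b w assume b: "b \<in> set (xs @ B)" "b \<in> black G" "b \<notin> M" "(b, w) \<in> Or"
    show "w \<in> set (xs @ B)"
    proof (cases "b \<in> set xs")
      case True
      moreover have "b \<noteq> bdry G j" using j_snk b(4) by blast
      ultimately obtain s where "(b, s) \<in> Or" "s \<in> set xs" using succ by blast
      then show ?thesis using black_out_unique[OF O b(2)] b(4) by auto
    next
      case False
      then obtain m where m: "b = bdry G m" "min i j < m" "m < max i j" using b(1) setB by auto
      then have "m \<in> sources_between Or i j" using b(4) ij by (auto simp: sources_between_def sources_def)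
      then show ?thesis using b(3) m(1) by (simp add: M_def)
    qed
  next
    fix b assume bM: "b \<in> M"
    then obtain m where m: "b = bdry G m" "m \<in> sources_between Or i j" by (auto simp: M_def)
    then obtain w where w: "(b, w) \<in> Or" by (auto simp: sources_between_def sources_def)
    have bB: "b \<in> set B" "b \<notin> set xs" using bM MB dB by auto
    have bv: "b \<in> bvertices G" using bB Bb by blast
    have bl: "b \<in> black G" using bv by (simp add: black_def)
    have ww: "w \<in> white G" using po_colors[OF O w] bl black_white by blast
    note bw = po_adjG[OF O w]
    have off: "b \<notin> closed_segment u v" if uv: "side_of u v (xs @ B)" "adjG u v" for u v
    proof
      assume bs: "b \<in> closed_segment u v"
      have "u \<in> set xs \<and> v \<in> set xs"
      proof -
        have "(u, v) \<in> set (steps xs) \<or> (v, u) \<in> set (steps xs)"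
        proof (rule ccontr)
          assume "\<not> ?thesis"
          then have "(u, v) \<in> set (steps (boundary_walk i j)) \<or> (v, u) \<in> set (steps (boundary_walk i j))"
            using uv(1) bp(4) unfolding side_of_def B_def by blast
          then have "bottom u v \<or> bottom v u"
            using boundary_walk_bottom[OF ij(1,2)] unfolding successively_steps by blast
          then have "u \<in> bvertices G \<and> v \<in> bvertices G"
            unfolding bottom_def bvertices_def by (auto simp: doubleton_eq_iff)
          then have "u \<notin> white G" "v \<notin> white G" using bvertices_not_internal by (auto simp: internal_def)
          then show False using uv(2) edgesD by (auto simp: adjG_def)
        qed
        then show ?thesis using in_steps by metis
      qed
      then have "b \<notin> {u, v}" using bB(2) by blast
      then have "{b, w} \<noteq> {u, v}" by (auto simp: doubleton_eq_iff)
      then have "b \<in> {u, v}" using plane_adjD(3)[OF adjp_plane adjG_adjp[OF bw] adjG_adjp[OF uv(2)]] bs by auto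
      then show False using \<open>b \<notin> {u, v}\<close> by blast
    qed
    have "b \<in> rim (xs @ B)" using set_rim[OF C] bB(1) by auto
    then obtain r where r: "r > 0" "ball b r \<inter> int_disk \<subseteq> inside (rim (xs @ B))"
      using near_bottom[OF C _ off] by metis
    have "open_segment b w \<inter> ball b r \<noteq> {}"
      using open_segment_near[of "ball b r" b w] r(1) edge_irrefl[OF adjG_adjp[OF bw]] by simp
    then have "open_segment b w \<inter> inside (rim (xs @ B)) \<noteq> {}" using r(2) adjG_open_segment[OF bw] by blast
    then have "closed_segment b w \<inter> inside (rim (xs @ B)) \<noteq> {}" using segment_open_subset_closed by blast
    then have os: "open_segment b w \<subseteq> inside (rim (xs @ B))" using edge_meets_inside[OF C bw] by blast
    have "w \<in> closure (open_segment b w)" using edge_irrefl[OF adjG_adjp[OF bw]] by simp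
    then have "w \<in> closure (inside (rim (xs @ B)))" using os closure_mono by blast
    then have "w \<in> inside (rim (xs @ B)) \<or> w \<in> set (xs @ B)"
      using cycle_Jordan(6)[OF adjp_plane C] vertex_rim[OF C adjp_sym[OF adjG_adjp[OF bw]]] by blast
    moreover have "w \<notin> set (xs @ B)"
    proof
      assume "w \<in> set (xs @ B)"
      moreover have "w \<notin> bvertices G" using ww bvertices_not_internal by (auto simp: internal_def)
      ultimately have "w \<in> set xs" "w \<noteq> bdry G i" using Bb bb by auto
      then obtain s where "(s, w) \<in> Or" "s \<in> set xs" using pred by blast
      then show False using po_white[OF O ww] w bB(2) by blast
    qed
    ultimately show "\<exists>w. (b, w) \<in> Or \<and> w \<in> inside (rim (xs @ B))" using w by blast
  qed
  moreover have "card M = card (sources_between Or i j)"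
    unfolding M_def using sb inj_bdry by (intro card_image) (auto simp: inj_on_def subset_iff)
  ultimately have "prod_list (map (twist \<sigma>) (steps (circ (xs @ B)))) = - ((- 1) ^ card (sources_between Or i j))"
    using kasteleyn_polygon[OF flexible_continuable[OF all_flexible] K C] by simp
  moreover have "prod_list (map (twist \<sigma>) (steps (boundary_walk i j))) = 1"
  proof -
    have "twist \<sigma> e = 1" if e: "e \<in> set (steps (boundary_walk i j))" for e
    proof -
      have "bottom (fst e) (snd e)"
        using boundary_walk_bottom[OF ij(1,2)] e unfolding successively_steps by (simp add: case_prod_beta)
      then show ?thesis using edge_fun_bottom[of "fst e" "snd e"] by simp
    qed
    then show ?thesis by (rule prod_list_ones)
  qed
  ultimately show ?thesis using bp(5) by (simp add: B_def)
qed

subsection \<open>The gauge\<close>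

text \<open>
  The quotient of the two signs of an arc; both are \<open>1\<close> or \<open>- 1\<close>, so that it equals their product.
\<close>

definition gauge_ratio :: "(complex \<times> complex \<Rightarrow> real) \<Rightarrow> (complex \<times> complex) set \<Rightarrow> complex \<times> complex \<Rightarrow> real" where
  "gauge_ratio \<sigma> Or e = edge_fun \<sigma> e * arc_sign Or e"

lemma arc_sign_cases: "arc_sign Or e = 1 \<or> arc_sign Or e = - 1"
  unfolding arc_sign_def by (cases "even (geometric_signature G Or \<ll> e)") (auto simp: power_int_minus_left)

lemma edge_fun_sign:
  assumes "kasteleyn_signature G \<sigma>" "adjG u v"
  shows "edge_fun \<sigma> (u, v) = 1 \<or> edge_fun \<sigma> (u, v) = - 1"
  using assms unfolding kasteleyn_signature_def edge_fun_def adjG_def by auto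

lemma twist_gauge_ratio:
  assumes K: "kasteleyn_signature G \<sigma>" and xs: "set xs \<subseteq> {(u, v). adjG u v}"
  shows "prod_list (map (twist \<sigma>) xs) = of_real (prod_list (map (gauge_ratio \<sigma> Or) xs)) * prod_list (map (twisted_arc Or) xs)"
  using xs
proof (induction xs)
  case (Cons e xs)
  obtain u v where e: "e = (u, v)" "adjG u v" using Cons.prems by auto
  have "twist \<sigma> e = of_real (edge_fun \<sigma> e) * \<i>" using e by (auto simp: edge_fun_def adjG_def)
  also have "\<dots> = of_real (edge_fun \<sigma> e * (arc_sign Or e * arc_sign Or e)) * \<i>" using arc_sign_cases[of Or e] by auto
  also have "\<dots> = of_real (gauge_ratio \<sigma> Or e) * twisted_arc Or e" by (simp add: gauge_ratio_def)
  finally show ?case using Cons by (simp add: mult_ac)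
qed simp

text \<open>The quotient of the products of the two signatures along a walk.\<close>

abbreviation walk_ratio :: "(complex \<times> complex \<Rightarrow> real) \<Rightarrow> (complex \<times> complex) set \<Rightarrow> complex list \<Rightarrow> real" where
  "walk_ratio \<sigma> Or xs \<equiv> prod_list (map (gauge_ratio \<sigma> Or) (steps xs))"

lemma walk_ratio_split:
  "walk_ratio \<sigma> Or (xs @ a # ys) = walk_ratio \<sigma> Or (xs @ [a]) * walk_ratio \<sigma> Or (a # ys)"
  by (subst steps_append) simp

lemma walk_ratio_cases:
  assumes O: "perfect_orientation G Or" and K: "kasteleyn_signature G \<sigma>"
  shows "successively (\<lambda>u v. (u, v) \<in> Or) xs \<Longrightarrow> walk_ratio \<sigma> Or xs = 1 \<or> walk_ratio \<sigma> Or xs = - 1"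
proof (induction xs rule: induct_list012)
  case (3 a b xs)
  have "edge_fun \<sigma> (a, b) = 1 \<or> edge_fun \<sigma> (a, b) = - 1"
    using edge_fun_sign[OF K po_adjG[OF O]] 3(3) by simp
  then have "gauge_ratio \<sigma> Or (a, b) = 1 \<or> gauge_ratio \<sigma> Or (a, b) = - 1"
    using arc_sign_cases[of Or "(a, b)"] by (auto simp: gauge_ratio_def)
  then show ?case using 3 by auto
qed auto

text \<open>
  A closed directed walk decomposes into directed polygons, for which the two signatures have the same
  product.
\<close>

lemma closed_walk_ratio:
  assumes O: "perfect_orientation G Or" and K: "kasteleyn_signature G \<sigma>"
  shows "xs \<noteq> [] \<Longrightarrow> successively (\<lambda>u v. (u, v) \<in> Or) (circ xs) \<Longrightarrow> walk_ratio \<sigma> Or (circ xs) = 1"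
proof (induction "length xs" arbitrary: xs rule: less_induct)
  case less
  show ?case
  proof (cases "distinct xs")
    case True
    have "3 \<le> length xs"
    proof (rule ccontr)
      assume "\<not> ?thesis"
      then consider x where "xs = [x]" | x y where "xs = [x, y]"
        using less.prems(1) by (cases xs; cases "tl xs"; cases "tl (tl xs)") auto
      then show False using less.prems(2) po_asym[OF O] by cases (auto simp: circ_def)
    qed
    then have C: "cycle (\<lambda>u v. (u, v) \<in> Or) xs" using True less.prems(2) by (simp add: cycle_def)
    have "set (steps (circ xs)) \<subseteq> {(u, v). adjG u v}"
      using less.prems(2) po_adjG[OF O] unfolding successively_steps by blast
    from twist_gauge_ratio[OF K this, of Or]
    have "complex_of_real (walk_ratio \<sigma> Or (circ xs)) = 1"
      unfolding directed_cycle_twist[OF O C K] directed_cycle_sign[OF O C] by simp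
    then show ?thesis by (simp only: of_real_eq_1_iff)
  next
    case False
    then obtain as bs cs y where xs: "xs = as @ [y] @ bs @ [y] @ cs" using not_distinct_decomp by blast
    define h where "h = hd (as @ [y])"
    have hx: "hd xs = h" by (cases as) (simp_all add: xs h_def)
    have c: "circ xs = as @ y # bs @ y # (cs @ [h])" using hx by (simp add: circ_def xs)
    have ci: "circ (y # bs) = y # bs @ [y]" by (simp add: circ_def)
    have co: "circ (as @ y # cs) = as @ y # (cs @ [h])" by (cases as) (simp_all add: circ_def h_def)
    have s: "successively (\<lambda>u v. (u, v) \<in> Or) (circ (y # bs))" "successively (\<lambda>u v. (u, v) \<in> Or) (circ (as @ y # cs))"
      using less.prems(2) successively_split[of _ as y "bs @ y # (cs @ [h])"]
        successively_split[of _ "y # bs" y "cs @ [h]"] successively_split[of _ as y "cs @ [h]"]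
      unfolding c ci co by simp_all
    have "walk_ratio \<sigma> Or (circ (y # bs)) = 1" "walk_ratio \<sigma> Or (circ (as @ y # cs)) = 1"
      using less.hyps[OF _ _ s(1)] less.hyps[OF _ _ s(2)] by (simp_all add: xs)
    then show ?thesis
      unfolding c ci co
      using walk_ratio_split[of \<sigma> Or as y "bs @ y # (cs @ [h])"] walk_ratio_split[of \<sigma> Or "y # bs" y "cs @ [h]"]
        walk_ratio_split[of \<sigma> Or as y "cs @ [h]"] by simp
  qed
qed

text \<open>A directed walk between boundary vertices decomposes into a directed path and closed walks.\<close>

lemma boundary_walk_ratio:
  assumes O: "perfect_orientation G Or" and K: "kasteleyn_signature G \<sigma>"
  shows "xs \<noteq> [] \<Longrightarrow> successively (\<lambda>u v. (u, v) \<in> Or) xs \<Longrightarrow> hd xs \<in> bvertices G \<Longrightarrow> last xs \<in> bvertices G \<Longrightarrow>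
    walk_ratio \<sigma> Or xs = 1"
proof (induction "length xs" arbitrary: xs rule: less_induct)
  case less
  show ?case
  proof (cases "distinct xs")
    case True
    obtain i j where ij: "i < bnum G" "hd xs = bdry G i" "j < bnum G" "last xs = bdry G j"
      using less.prems(3,4) by (auto simp: bvertices_def)
    show ?thesis
    proof (cases "i = j")
      case True
      then have "hd xs = last xs" using ij by simp
      then have "tl xs = []" using \<open>distinct xs\<close> less.prems(1) by (cases xs) (auto split: if_splits)
      then show ?thesis using less.prems(1) by (cases xs) auto
    next
      case False
      have "set (steps xs) \<subseteq> {(u, v). adjG u v}"
        using less.prems(2) po_adjG[OF O] unfolding successively_steps by blast
      from twist_gauge_ratio[OF K this, of Or]
      have "- ((- 1) ^ card (sources_between Or i j)) =
          complex_of_real (walk_ratio \<sigma> Or xs) * - ((- 1) ^ card (sources_between Or i j))"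
        unfolding directed_boundary_path_twist[OF O True less.prems(2) ij(1,3) False ij(2,4) less.prems(1) K]
          directed_boundary_path_sign[OF O True less.prems(2) ij(1,3) False ij(2,4) less.prems(1)] .
      then have "complex_of_real (walk_ratio \<sigma> Or xs) = 1" by simp
      then show ?thesis by (simp only: of_real_eq_1_iff)
    qed
  next
    case False
    then obtain as bs cs y where xs: "xs = as @ [y] @ bs @ [y] @ cs" using not_distinct_decomp by blast
    have ci: "circ (y # bs) = y # bs @ [y]" by (simp add: circ_def)
    have s: "successively (\<lambda>u v. (u, v) \<in> Or) (circ (y # bs))" "successively (\<lambda>u v. (u, v) \<in> Or) (as @ y # cs)"
      using less.prems(2) successively_split[of _ as y "bs @ y # cs"]
        successively_split[of _ "y # bs" y cs] successively_split[of _ as y cs]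
      unfolding ci xs by simp_all
    have "hd (as @ y # cs) = hd xs" "last (as @ y # cs) = last xs" by (cases as; simp add: xs)+
    then have "walk_ratio \<sigma> Or (as @ y # cs) = 1"
      using less.hyps[OF _ _ s(2)] less.prems(3,4) by (simp add: xs)
    moreover have "walk_ratio \<sigma> Or (circ (y # bs)) = 1" using closed_walk_ratio[OF O K _ s(1)] by simp
    ultimately show ?thesis
      unfolding ci xs
      using walk_ratio_split[of \<sigma> Or as y "bs @ y # cs"] walk_ratio_split[of \<sigma> Or "y # bs" y cs]
        walk_ratio_split[of \<sigma> Or as y cs] by simp
  qed
qed

text \<open>Every vertex is connected with the boundary.\<close>

lemma adj_closed_all:
  assumes base: "\<And>b. b \<in> bvertices G \<Longrightarrow> P b" and step: "\<And>u v. adjG u v \<Longrightarrow> P v \<Longrightarrow> P u"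
    and u: "u \<in> black G \<union> white G"
  shows "P u"
proof -
  have "\<forall>u \<in> black G \<union> white G. \<exists>b \<in> bvertices G. (u, b) \<in> (edges G \<union> (edges G)\<inverse>)\<^sup>*"
    using reduced unfolding reduced_graph_def by (elim conjE)
  then obtain b where b: "b \<in> bvertices G" "(u, b) \<in> (edges G \<union> (edges G)\<inverse>)\<^sup>*" using u by blast
  show ?thesis
    using b(2)
  proof (induction rule: converse_rtrancl_induct)
    case base
    then show ?case using assms(1) b(1) by simp
  next
    case (step y z)
    then have "adjG y z" by (auto simp: adjG_def)
    then show ?case using assms(2) step by blast
  qed
qed

text \<open>
  An edge from \<open>u\<close> to \<open>v\<close> that is directed towards \<open>u\<close> is replaced by a directed path from \<open>u\<close> to \<open>v\<close> or
  to the boundary.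
\<close>

lemma walk_to_boundary:
  assumes O: "perfect_orientation G Or" and u: "u \<in> black G \<union> white G"
  shows "\<exists>xs. xs \<noteq> [] \<and> successively (\<lambda>u v. (u, v) \<in> Or) xs \<and> hd xs = u \<and> last xs \<in> bvertices G"
proof (rule adj_closed_all[OF _ _ u])
  fix b assume "b \<in> bvertices G"
  then show "\<exists>xs. xs \<noteq> [] \<and> successively (\<lambda>u v. (u, v) \<in> Or) xs \<and> hd xs = b \<and> last xs \<in> bvertices G"
    by (intro exI[of _ "[b]"]) simp
next
  fix u v assume uv: "adjG u v"
    and "\<exists>xs. xs \<noteq> [] \<and> successively (\<lambda>u v. (u, v) \<in> Or) xs \<and> hd xs = v \<and> last xs \<in> bvertices G"
  then obtain xs where xs: "xs \<noteq> []" "successively (\<lambda>u v. (u, v) \<in> Or) xs" "hd xs = v" "last xs \<in> bvertices G"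
    by blast
  obtain t where t: "xs = v # t" using xs(1,3) by (cases xs) auto
  consider "(u, v) \<in> Or" | "(v, u) \<in> Or" using po_total[OF O uv] by blast
  then show "\<exists>xs. xs \<noteq> [] \<and> successively (\<lambda>u v. (u, v) \<in> Or) xs \<and> hd xs = u \<and> last xs \<in> bvertices G"
  proof cases
    case 1
    then show ?thesis using xs t by (intro exI[of _ "u # xs"]) auto
  next
    case 2
    obtain qs where qs: "qs \<noteq> []" "successively (\<lambda>x y. (x, y) \<in> Or) qs" "hd qs = u"
      "last qs = v \<or> (last qs \<in> bvertices G \<and> v \<notin> set qs)"
      using follow_orientation[OF all_flexible O 2] by metis
    show ?thesis
    proof (cases "last qs = v")
      case True
      then have q: "qs = butlast qs @ [v]" using qs(1) by (metis append_butlast_last_id)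
      have "successively (\<lambda>u v. (u, v) \<in> Or) (butlast qs @ v # t)"
        using successively_split[of _ "butlast qs" v t] qs(2) xs(2) t q by simp
      moreover have "hd (butlast qs @ v # t) = u" using q qs(3) by (cases "butlast qs") auto
      moreover have "last (butlast qs @ v # t) \<in> bvertices G" using xs(4) t by simp
      ultimately show ?thesis by (intro exI[of _ "butlast qs @ v # t"]) simp
    next
      case False
      then show ?thesis using qs by (intro exI[of _ qs]) auto
    qed
  qed
qed

lemma walk_from_boundary:
  assumes O: "perfect_orientation G Or" and u: "u \<in> black G \<union> white G"
  shows "\<exists>xs. xs \<noteq> [] \<and> successively (\<lambda>u v. (u, v) \<in> Or) xs \<and> hd xs \<in> bvertices G \<and> last xs = u"
proof (rule adj_closed_all[OF _ _ u])
  fix b assume "b \<in> bvertices G"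
  then show "\<exists>xs. xs \<noteq> [] \<and> successively (\<lambda>u v. (u, v) \<in> Or) xs \<and> hd xs \<in> bvertices G \<and> last xs = b"
    by (intro exI[of _ "[b]"]) simp
next
  fix u v assume uv: "adjG u v"
    and "\<exists>xs. xs \<noteq> [] \<and> successively (\<lambda>u v. (u, v) \<in> Or) xs \<and> hd xs \<in> bvertices G \<and> last xs = v"
  then obtain xs where xs: "xs \<noteq> []" "successively (\<lambda>u v. (u, v) \<in> Or) xs" "hd xs \<in> bvertices G" "last xs = v"
    by blast
  consider "(v, u) \<in> Or" | "(u, v) \<in> Or" using po_total[OF O uv] by blast
  then show "\<exists>xs. xs \<noteq> [] \<and> successively (\<lambda>u v. (u, v) \<in> Or) xs \<and> hd xs \<in> bvertices G \<and> last xs = u"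
  proof cases
    case 1
    then show ?thesis using xs by (intro exI[of _ "xs @ [u]"]) (auto simp: successively_append_iff)
  next
    case 2
    obtain qs where qs: "qs \<noteq> []" "successively (\<lambda>x y. (x, y) \<in> Or) qs" "last qs = u"
      "hd qs = v \<or> (hd qs \<in> bvertices G \<and> v \<notin> set qs)"
      using follow_orientation_back[OF all_flexible O 2] by metis
    show ?thesis
    proof (cases "hd qs = v")
      case True
      then obtain t where t: "qs = v # t" using qs(1) by (cases qs) auto
      have x: "xs = butlast xs @ [v]" using xs(1,4) by (metis append_butlast_last_id)
      have "successively (\<lambda>u v. (u, v) \<in> Or) (butlast xs @ v # t)"
        using successively_split[of _ "butlast xs" v t] qs(2) xs(2) t x by simp
      moreover have "hd (butlast xs @ v # t) \<in> bvertices G" using x xs(3) by (cases "butlast xs") auto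
      moreover have "last (butlast xs @ v # t) = u" using qs(3) t by simp
      ultimately show ?thesis by (intro exI[of _ "butlast xs @ v # t"]) simp
    next
      case False
      then show ?thesis using qs by (intro exI[of _ qs]) auto
    qed
  qed
qed

text \<open>
  The gauge at a vertex is the product of the quotients of the two signatures along any walk
  from this vertex to the boundary.
\<close>

lemma gauge_exists:
  assumes O: "perfect_orientation G Or" and K: "kasteleyn_signature G \<sigma>"
  obtains \<eta> :: "complex \<Rightarrow> real" where "\<And>u. u \<in> black G \<union> white G \<Longrightarrow> \<eta> u = 1 \<or> \<eta> u = - 1"
    "\<And>b. b \<in> bvertices G \<Longrightarrow> \<eta> b = 1"
    "\<And>u v. (u, v) \<in> Or \<Longrightarrow> edge_fun \<sigma> (u, v) = arc_sign Or (u, v) * \<eta> u * \<eta> v"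
proof -
  obtain W where W: "\<And>u. u \<in> black G \<union> white G \<Longrightarrow>
      W u \<noteq> [] \<and> successively (\<lambda>u v. (u, v) \<in> Or) (W u) \<and> hd (W u) = u \<and> last (W u) \<in> bvertices G"
    using walk_to_boundary[OF O] by metis
  define \<eta> where "\<eta> u = walk_ratio \<sigma> Or (W u)" for u
  have unique: "walk_ratio \<sigma> Or xs = \<eta> u"
    if u: "u \<in> black G \<union> white G" and xs: "xs \<noteq> []" "successively (\<lambda>u v. (u, v) \<in> Or) xs" "hd xs = u" "last xs \<in> bvertices G"
    for u xs
  proof -
    obtain zs where zs: "zs \<noteq> []" "successively (\<lambda>u v. (u, v) \<in> Or) zs" "hd zs \<in> bvertices G" "last zs = u"
      using walk_from_boundary[OF O u] by blast
    have z: "zs = butlast zs @ [u]" using zs(1,4) by (metis append_butlast_last_id)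
    have one: "walk_ratio \<sigma> Or zs * walk_ratio \<sigma> Or ys = 1"
      if ys: "ys \<noteq> []" "successively (\<lambda>u v. (u, v) \<in> Or) ys" "hd ys = u" "last ys \<in> bvertices G" for ys
    proof -
      obtain t where t: "ys = u # t" using ys(1,3) by (cases ys) auto
      have "walk_ratio \<sigma> Or (butlast zs @ u # t) = 1"
      proof (rule boundary_walk_ratio[OF O K])
        show "successively (\<lambda>u v. (u, v) \<in> Or) (butlast zs @ u # t)"
          using successively_split[of _ "butlast zs" u t] zs(2) ys(2) t z by simp
        show "hd (butlast zs @ u # t) \<in> bvertices G" using z zs(3) by (cases "butlast zs") auto
        show "last (butlast zs @ u # t) \<in> bvertices G" using ys(4) t by simp
      qed simp
      then show ?thesis using walk_ratio_split[of \<sigma> Or "butlast zs" u t] t z by simp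
    qed
    have "walk_ratio \<sigma> Or zs * walk_ratio \<sigma> Or xs = walk_ratio \<sigma> Or zs * \<eta> u"
      using one[OF xs] one[of "W u"] W[OF u] unfolding \<eta>_def by simp
    moreover have "walk_ratio \<sigma> Or zs \<noteq> 0"
    proof
      assume "walk_ratio \<sigma> Or zs = 0"
      then show False using walk_ratio_cases[OF O K zs(2)] by linarith
    qed
    ultimately show ?thesis by (metis mult_left_cancel)
  qed
  show ?thesis
  proof (rule that[of \<eta>])
    fix u assume u: "u \<in> black G \<union> white G"
    show "\<eta> u = 1 \<or> \<eta> u = - 1" unfolding \<eta>_def using walk_ratio_cases[OF O K] W[OF u] by blast
  next
    fix b assume b: "b \<in> bvertices G"
    then have "b \<in> black G \<union> white G" by (simp add: black_def)
    from unique[OF this, of "[b]"] b show "\<eta> b = 1" by simp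
  next
    fix u v assume uv: "(u, v) \<in> Or"
    have V: "u \<in> black G \<union> white G" "v \<in> black G \<union> white G" using adjG_vertices[OF po_adjG[OF O uv]] by auto
    obtain t where t: "W v = v # t" using W[OF V(2)] by (cases "W v") auto
    have "walk_ratio \<sigma> Or (u # W v) = \<eta> u"
      using unique[OF V(1), of "u # W v"] W[OF V(2)] uv t by simp
    then have e: "\<eta> u = gauge_ratio \<sigma> Or (u, v) * \<eta> v" using t by (simp add: \<eta>_def)
    have "\<eta> v = 1 \<or> \<eta> v = - 1" unfolding \<eta>_def using walk_ratio_cases[OF O K] W[OF V(2)] by blast
    then have sq: "\<eta> v * \<eta> v = 1" "arc_sign Or (u, v) * arc_sign Or (u, v) = 1"
      using arc_sign_cases[of Or "(u, v)"] by auto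
    have "arc_sign Or (u, v) * \<eta> u * \<eta> v = edge_fun \<sigma> (u, v) * (arc_sign Or (u, v) * arc_sign Or (u, v)) * (\<eta> v * \<eta> v)"
      unfolding e gauge_ratio_def by (simp add: mult_ac)
    then show "edge_fun \<sigma> (u, v) = arc_sign Or (u, v) * \<eta> u * \<eta> v" using sq by simp
  qed
qed

section \<open>Uniqueness of the solution\<close>

text \<open>The list \<open>b\<^sub>1, f b\<^sub>1, b\<^sub>2, f b\<^sub>2, \<dots>\<close>.\<close>

fun weave :: "(complex \<Rightarrow> complex) \<Rightarrow> complex list \<Rightarrow> complex list" where
  "weave f [] = []"
| "weave f (b # bs) = b # f b # weave f bs"

lemma set_weave: "set (weave f bs) = set bs \<union> f ` set bs"
  by (induction bs) auto

lemma length_weave: "length (weave f bs) = 2 * length bs"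
  by (induction bs) auto

lemma hd_weave: "bs \<noteq> [] \<Longrightarrow> hd (weave f bs) = hd bs"
  by (cases bs) auto

lemma distinct_weave:
  "distinct bs \<Longrightarrow> set bs \<subseteq> black G \<Longrightarrow> f ` set bs \<subseteq> white G \<Longrightarrow> inj_on f (set bs) \<Longrightarrow> distinct (weave f bs)"
proof (induction bs)
  case (Cons b bs)
  have "b \<in> black G" "f b \<in> white G" using Cons.prems by auto
  then have "b \<notin> f ` set bs" "f b \<notin> set bs" "b \<noteq> f b"
    using Cons.prems(2,3) black_white by auto
  moreover have "f b \<notin> f ` set bs" using Cons.prems(1,4) by auto
  ultimately show ?case using Cons by (auto simp: set_weave)
qed simp

text \<open>A self-map of a finite nonempty set has a cycle.\<close>

lemma cyclic_list_exists:
  fixes f :: "'v \<Rightarrow> 'v"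
  assumes "finite N" "f ` N \<subseteq> N" "N \<noteq> {}"
  obtains bs where "bs \<noteq> []" "distinct bs" "set bs \<subseteq> N" "successively (\<lambda>x y. y = f x) bs" "f (last bs) = hd bs"
proof -
  define P where "P bs \<longleftrightarrow> bs \<noteq> [] \<and> distinct bs \<and> set bs \<subseteq> N \<and> successively (\<lambda>x y. y = f x) bs" for bs
  obtain x where x: "x \<in> N" using assms(3) by blast
  then have "P [x]" by (simp add: P_def)
  then obtain bs where bs: "P bs" "\<And>ys. P ys \<Longrightarrow> length ys \<le> length bs"
    using longest_list[OF assms(1), of P "[x]"] unfolding P_def by metis
  have b: "bs \<noteq> []" "distinct bs" "set bs \<subseteq> N" "successively (\<lambda>x y. y = f x) bs" using bs(1) by (auto simp: P_def)
  have lN: "f (last bs) \<in> N" using b(1,3) assms(2) last_in_set[OF b(1)] by blast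
  have "f (last bs) \<in> set bs"
  proof (rule ccontr)
    assume "f (last bs) \<notin> set bs"
    then have "P (bs @ [f (last bs)])" using b lN by (auto simp: P_def successively_append_iff)
    then show False using bs(2) by fastforce
  qed
  then obtain ps qs where pq: "bs = ps @ f (last bs) # qs" by (meson split_list)
  define cs where "cs = f (last bs) # qs"
  have pc: "bs = ps @ cs" using pq by (simp add: cs_def)
  have cn: "cs \<noteq> []" by (simp add: cs_def)
  have "last cs = last bs" using last_appendR[OF cn, of ps] pc by simp
  moreover have "hd cs = f (last bs)" by (simp add: cs_def)
  moreover have "distinct cs" "set cs \<subseteq> N" "successively (\<lambda>x y. y = f x) cs"
    using b(2-4) unfolding pc by (simp_all add: successively_append_iff)
  ultimately show ?thesis using that[of cs] cn by simp
qed

lemma square_pos: "(a :: real) \<noteq> 0 \<Longrightarrow> a * a > 0"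
  by (auto simp: zero_less_mult_iff)

text \<open>
  Multiplying the inequalities \<open>g (b, f b) * u b * (g (f b, nx b) * u (nx b)) < 0\<close> along a chain
  \<open>b, nx b, nx (nx b), \<dots>\<close>: the values of \<open>u\<close> between the ends occur as squares.
\<close>

lemma sign_chain:
  fixes g :: "complex \<times> complex \<Rightarrow> real" and u :: "complex \<Rightarrow> real"
  assumes neg: "\<And>b. b \<in> N \<Longrightarrow> u b \<noteq> 0 \<and> g (b, f b) * u b * (g (f b, nx b) * u (nx b)) < 0"
  shows "bs \<noteq> [] \<Longrightarrow> set bs \<subseteq> N \<Longrightarrow> successively (\<lambda>x y. y = nx x) (bs @ [c]) \<Longrightarrow>
    (- 1) ^ length bs * prod_list (map g (steps (weave f bs @ [c]))) * u (hd bs) * u c > 0"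
proof (induction bs)
  case (Cons b bs)
  have bN: "b \<in> N" using Cons.prems(2) by simp
  have n1: "u b \<noteq> 0" "g (b, f b) * u b * (g (f b, nx b) * u (nx b)) < 0" using neg[OF bN] by auto
  show ?case
  proof (cases bs)
    case Nil
    then have "c = nx b" using Cons.prems(3) by simp
    then show ?thesis using n1(2) Nil by (simp add: mult_ac)
  next
    case bs: (Cons b' bs')
    then have b': "b' = nx b" "b' \<in> N" using Cons.prems(2,3) by auto
    define P where "P = prod_list (map g (steps (weave f bs @ [c])))"
    have "(- 1) ^ length bs * P * u (hd bs) * u c > 0"
      unfolding P_def by (rule Cons.IH) (use Cons.prems(2,3) bs in auto)
    then have IH: "(- 1) ^ length bs * P * u b' * u c > 0" using bs by simp
    have st: "prod_list (map g (steps (weave f (b # bs) @ [c]))) = g (b, f b) * (g (f b, b') * P)"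
      by (simp add: P_def bs)
    have ub: "u b' \<noteq> 0" using neg[OF b'(2)] by blast
    have "(- 1) ^ length (b # bs) * (g (b, f b) * (g (f b, b') * P)) * u b * u c * (u b' * u b')
        = - (g (b, f b) * u b * (g (f b, b') * u b')) * ((- 1) ^ length bs * P * u b' * u c)"
      by (simp add: mult_ac)
    also have "\<dots> > 0"
    proof (rule mult_pos_pos[OF _ IH])
      show "- (g (b, f b) * u b * (g (f b, b') * u b')) > 0" using n1(2) unfolding b'(1) by linarith
    qed
    finally have "(- 1) ^ length (b # bs) * (g (b, f b) * (g (f b, b') * P)) * u b * u c * (u b' * u b') > 0" .
    moreover have "u b' * u b' > 0" using ub by (rule square_pos)
    ultimately have "(- 1) ^ length (b # bs) * (g (b, f b) * (g (f b, b') * P)) * u b * u c > 0"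
      using zero_less_mult_pos2 by blast
    then show ?thesis unfolding st by simp
  qed
qed simp

text \<open>
  A solution of the homogeneous system that vanishes at the boundary sinks is zero.  If it does not
  vanish at a black vertex, this is not a sink; follow the arc from it to a white vertex \<open>w\<close>.  Some
  other term of the equation at \<open>w\<close> has the opposite sign and belongs to a black vertex that is
  reached by an arc from \<open>w\<close>.  Going on, one obtains a directed polygon, and the product of the signs
  around it contradicts \<open>directed_cycle_twist\<close>.
\<close>

theorem kernel_trivial:
  fixes u :: "complex \<Rightarrow> real"
  assumes O: "perfect_orientation G Or" and K: "kasteleyn_signature G \<sigma>" and t: "\<And>e. e \<in> edges G \<Longrightarrow> t e > 0"
    and eq: "\<And>w. w \<in> white G \<Longrightarrow> (\<Sum>e \<in> {e \<in> edges G. snd e = w}. \<sigma> e * t e * u (fst e)) = 0"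
    and bd: "\<And>j. j < bnum G \<Longrightarrow> j \<notin> sources G Or \<Longrightarrow> u (bdry G j) = 0"
    and b: "b \<in> black G"
  shows "u b = 0"
proof (rule ccontr)
  assume nz: "u b \<noteq> 0"
  define N where "N = {b \<in> black G. u b \<noteq> 0}"
  define g where "g = edge_fun \<sigma>"
  have "\<exists>w b'. b' \<in> N \<and> (b, w) \<in> Or \<and> (w, b') \<in> Or \<and> g (b, w) * u b * (g (w, b') * u b') < 0" if bN: "b \<in> N" for b
  proof -
    have bb: "b \<in> black G" "u b \<noteq> 0" using bN by (auto simp: N_def)
    have "\<exists>w. (b, w) \<in> Or"
    proof (cases "b \<in> iblack G")
      case True
      then show ?thesis using po_black[OF O] by blast
    next
      case False
      then have "b \<in> bvertices G" using bb(1) black_cases by blast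
      then obtain j where j: "j < bnum G" "b = bdry G j" by (auto simp: bvertices_def)
      then have "j \<in> sources G Or" using bd bb(2) by blast
      then show ?thesis using j(2) by (auto simp: sources_def)
    qed
    then obtain w where w: "(b, w) \<in> Or" by blast
    have ww: "w \<in> white G" "(b, w) \<in> edges G" using po_colors[OF O w] bb(1) black_white by blast+
    define E where "E = {e \<in> edges G. snd e = w}"
    define f where "f e = \<sigma> e * t e * u (fst e)" for e
    have finE: "finite E" using finite_edges by (simp add: E_def)
    have bE: "(b, w) \<in> E" using ww by (simp add: E_def)
    have sg: "\<sigma> e \<noteq> 0" if "e \<in> edges G" for e
    proof -
      have "\<sigma> e = 1 \<or> \<sigma> e = - 1" using K that unfolding kasteleyn_signature_def by blast
      then show ?thesis by auto
    qed
    have fb: "f (b, w) \<noteq> 0" using bb(2) sg[OF ww(2)] t[OF ww(2)] by (simp add: f_def)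
    have "(\<Sum>e \<in> E. f (b, w) * f e) = 0" using eq[OF ww(1)] by (simp add: E_def f_def sum_distrib_left[symmetric])
    then have s: "f (b, w) * f (b, w) + (\<Sum>e \<in> E - {(b, w)}. f (b, w) * f e) = 0"
      using sum.remove[OF finE bE, of "\<lambda>e. f (b, w) * f e"] by simp
    moreover have "f (b, w) * f (b, w) > 0" using fb by (rule square_pos)
    ultimately have "(\<Sum>e \<in> E - {(b, w)}. f (b, w) * f e) < 0" by linarith
    then obtain e where e: "e \<in> E - {(b, w)}" "f (b, w) * f e < 0"
      using sum_nonneg[of "E - {(b, w)}" "\<lambda>e. f (b, w) * f e"] by (meson not_less)
    obtain b' where b': "e = (b', w)" "(b', w) \<in> edges G" "b' \<noteq> b" using e(1) by (cases e) (auto simp: E_def)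
    have "(b', w) \<notin> Or" using po_white[OF O ww(1)] w b'(3) by blast
    then have wb': "(w, b') \<in> Or" using po_edge[OF O b'(2)] by blast
    have lt: "(\<sigma> (b, w) * u b * (\<sigma> (b', w) * u b')) * (t (b, w) * t (b', w)) < 0"
      using e(2) by (simp add: f_def b'(1) mult_ac)
    have "t (b, w) * t (b', w) > 0" using t ww(2) b'(2) by simp
    then have neg: "\<sigma> (b, w) * u b * (\<sigma> (b', w) * u b') < 0"
      using lt mult_nonneg_nonneg[OF _ less_imp_le] by (metis not_less)
    have "u b' \<noteq> 0" using neg by auto
    then have "b' \<in> N" using edgesD[OF b'(2)] by (simp add: N_def)
    moreover have "g (b, w) = \<sigma> (b, w)" "g (w, b') = \<sigma> (b', w)"
      using ww(2) b'(2) edge_asym by (auto simp: g_def edge_fun_def)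
    ultimately have "b' \<in> N \<and> (b, w) \<in> Or \<and> (w, b') \<in> Or \<and> g (b, w) * u b * (g (w, b') * u b') < 0"
      using w wb' neg by simp
    then show ?thesis by blast
  qed
  then obtain f nx where fn: "\<And>b. b \<in> N \<Longrightarrow> nx b \<in> N \<and> (b, f b) \<in> Or \<and> (f b, nx b) \<in> Or \<and>
      g (b, f b) * u b * (g (f b, nx b) * u (nx b)) < 0" by metis
  have "finite N" using finite_vertices by (simp add: N_def)
  moreover have "nx ` N \<subseteq> N" using fn by blast
  moreover have "N \<noteq> {}" using b nz by (auto simp: N_def)
  ultimately obtain bs where bs: "bs \<noteq> []" "distinct bs" "set bs \<subseteq> N" "successively (\<lambda>x y. y = nx x) bs" "nx (last bs) = hd bs"
    using cyclic_list_exists by metis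
  have colors: "set bs \<subseteq> black G" "f ` set bs \<subseteq> white G"
  proof -
    show 1: "set bs \<subseteq> black G" using bs(3) by (auto simp: N_def)
    have "f b \<in> white G" if "b \<in> set bs" for b
    proof -
      have "(b, f b) \<in> Or" using fn that bs(3) by blast
      then show ?thesis using po_colors[OF O] 1 that black_white by blast
    qed
    then show "f ` set bs \<subseteq> white G" by blast
  qed
  have inj: "inj_on f (set bs)"
  proof (rule inj_onI)
    fix x y assume xy: "x \<in> set bs" "y \<in> set bs" "f x = f y"
    have "(x, f x) \<in> Or" "(y, f x) \<in> Or" "f x \<in> white G" using fn xy bs(3) colors(2) by (metis subsetD, metis subsetD, blast)
    then show "x = y" using po_white[OF O] by blast
  qed
  define cs where "cs = weave f bs"
  have circ_cs: "circ cs = weave f bs @ [hd bs]" using hd_weave[OF bs(1)] by (simp add: circ_def cs_def)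
  have sn: "successively (\<lambda>x y. y = nx x) (bs @ [hd bs])"
    using bs(1,4,5) by (simp add: successively_append_iff)
  have arcs: "successively (\<lambda>u v. (u, v) \<in> Or) (weave f ys @ [c])"
    if "set ys \<subseteq> N" "successively (\<lambda>x y. y = nx x) (ys @ [c])" for ys c
    using that
  proof (induction ys)
    case (Cons y ys)
    have y: "(y, f y) \<in> Or" "(f y, nx y) \<in> Or" using fn Cons.prems(1) by auto
    show ?case using Cons y by (cases ys) auto
  qed simp
  have sc: "successively (\<lambda>u v. (u, v) \<in> Or) (circ cs)" unfolding circ_cs using arcs[OF bs(3) sn] .
  have "length bs \<noteq> 1"
  proof
    assume "length bs = 1"
    then obtain x where x: "bs = [x]" by (cases bs) auto
    then have "(x, f x) \<in> Or" "(f x, x) \<in> Or" using fn[of x] bs(3,5) by auto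
    then show False using po_asym[OF O] by blast
  qed
  then have "2 \<le> length bs" using bs(1) by (cases bs; cases "tl bs") auto
  then have C: "cycle (\<lambda>u v. (u, v) \<in> Or) cs"
    unfolding cycle_def using sc distinct_weave[OF bs(2) colors inj] by (simp add: cs_def length_weave)
  define k where "k = length bs"
  have un: "u b \<noteq> 0" if "b \<in> N" for b using that by (simp add: N_def)
  have "(- 1) ^ k * prod_list (map g (steps (circ cs))) * u (hd bs) * u (hd bs) > 0"
    unfolding circ_cs k_def using fn un by (intro sign_chain[OF _ bs(1,3) sn]) blast
  then have pos: "(- 1) ^ k * prod_list (map g (steps (circ cs))) > 0"
    by (metis mult.assoc zero_less_mult_iff not_square_less_zero)
  have tw: "twist \<sigma> e = of_real (g e) * \<i>" if "e \<in> set (steps (circ cs))" for e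
  proof -
    obtain x y where e: "e = (x, y)" by (cases e)
    then have "(x, y) \<in> Or" using that sc unfolding successively_steps by blast
    then have "adjG x y" by (rule po_adjG[OF O])
    then show ?thesis by (auto simp: g_def edge_fun_def e adjG_def)
  qed
  have prod_tw: "prod_list (map (twist \<sigma>) xs) = of_real (prod_list (map g xs)) * \<i> ^ length xs"
    if "\<And>e. e \<in> set xs \<Longrightarrow> twist \<sigma> e = of_real (g e) * \<i>" for xs
    using that
  proof (induction xs)
    case (Cons e xs)
    have "prod_list (map (twist \<sigma>) xs) = of_real (prod_list (map g xs)) * \<i> ^ length xs"
      by (rule Cons.IH) (use Cons.prems in simp)
    then show ?case using Cons.prems[of e] by (simp add: mult_ac)
  qed simp
  have "length (steps (circ cs)) = 2 * k" by (simp add: length_steps circ_def cs_def length_weave k_def)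
  then have "- 1 = complex_of_real (prod_list (map g (steps (circ cs)))) * (- 1) ^ k"
    using directed_cycle_twist[OF O C K] prod_tw[of "steps (circ cs)"] tw by (simp add: i_power_even)
  also have "\<dots> = complex_of_real ((- 1) ^ k * prod_list (map g (steps (circ cs))))" by simp
  finally have "complex_of_real ((- 1) ^ k * prod_list (map g (steps (circ cs)))) = complex_of_real (- 1)" by simp
  then have "(- 1) ^ k * prod_list (map g (steps (circ cs))) = - 1" by (simp only: of_real_eq_iff)
  then show False using pos by simp
qed

end

section \<open>Comparison of the two constructions\<close>

context kp_graph
begin

text \<open>
  The equation of the Lam system at a white vertex in terms of the values at the black vertices.  The
  half-edge variable at the white end of an edge is the same multiple of the value at the black end for
  both directions of the edge, up to the sign of the arc, which is its own inverse.
\<close>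

lemma lam_equation:
  assumes O: "perfect_orientation G Or" and t: "\<And>e. e \<in> edges G \<Longrightarrow> t e > 0"
    and lam: "lam_solution G Or \<ll> t \<psi> h z" and x: "x \<in> kp_times" and w: "w \<in> white G"
  shows "(\<Sum>e \<in> {e \<in> edges G. snd e = w}.
      (if e \<in> Or then arc_sign Or e else arc_sign Or (snd e, fst e)) * t e * z (fst e) x) = 0"
proof -
  have arcs: "\<forall>(u, v) \<in> Or. h u (arc_edge G (u, v)) x =
           (- 1) powi geometric_signature G Or \<ll> (u, v) * arc_weight G t (u, v) * h v (arc_edge G (u, v)) x"
    and hsum: "\<forall>w \<in> white G. (\<Sum>e \<in> {e \<in> edges G. snd e = w}. h w e x) = 0"
    and bl: "\<forall>(b, w) \<in> edges G. h b (b, w) x = z b x"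
    using lam x unfolding lam_solution_def by blast+
  have arc: "h u (arc_edge G (u, v)) x = arc_sign Or (u, v) * arc_weight G t (u, v) * h v (arc_edge G (u, v)) x"
    if "(u, v) \<in> Or" for u v
    using arcs that unfolding arc_sign_def by blast
  have hw: "h w e x = (if e \<in> Or then arc_sign Or e else arc_sign Or (snd e, fst e)) * t e * z (fst e) x"
    if e: "e \<in> edges G" "snd e = w" for e
  proof -
    obtain b where b: "e = (b, w)" "(b, w) \<in> edges G" using e by (cases e) auto
    have hb: "h b (b, w) x = z b x" using bl b(2) by blast
    have t0: "t (b, w) \<noteq> 0" using t[OF b(2)] by simp
    show ?thesis
    proof (cases "(b, w) \<in> Or")
      case True
      have "z b x = arc_sign Or (b, w) * inverse (t (b, w)) * h w (b, w) x"
        using arc[OF True] b(2) hb by (simp add: arc_edge_def arc_weight_def)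
      then have "arc_sign Or (b, w) * t (b, w) * z b x =
          (arc_sign Or (b, w) * arc_sign Or (b, w)) * (t (b, w) * inverse (t (b, w))) * h w (b, w) x"
        by (simp only: mult_ac)
      then have "arc_sign Or (b, w) * t (b, w) * z b x = h w (b, w) x"
        using t0 arc_sign_cases[of Or "(b, w)"] by auto
      then show ?thesis using True b(1) by simp
    next
      case False
      then have wb: "(w, b) \<in> Or" using po_edge[OF O b(2)] by blast
      have "(w, b) \<notin> edges G" using edge_asym[OF b(2)] .
      then have "h w (b, w) x = arc_sign Or (w, b) * t (b, w) * z b x"
        using arc[OF wb] hb by (simp add: arc_edge_def arc_weight_def)
      then show ?thesis using False b(1) by simp
    qed
  qed
  have "(\<Sum>e \<in> {e \<in> edges G. snd e = w}.
      (if e \<in> Or then arc_sign Or e else arc_sign Or (snd e, fst e)) * t e * z (fst e) x) =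
      (\<Sum>e \<in> {e \<in> edges G. snd e = w}. h w e x)"
    by (rule sum.cong[OF refl], elim CollectE conjE, rule hw[symmetric])
  also have "\<dots> = 0" using hsum w by blast
  finally show ?thesis .
qed

text \<open>The solutions of the two systems agree up to signs that do not depend on the times.\<close>

theorem solutions_agree:
  assumes O: "perfect_orientation G Or" and K: "kasteleyn_signature G \<sigma>" and t: "\<And>e. e \<in> edges G \<Longrightarrow> t e > 0"
    and v: "kasteleyn_solution G \<sigma> t \<psi> v" and z: "lam_solution G Or \<ll> t \<psi> h z"
  obtains \<eta> :: "complex \<Rightarrow> real" where "\<And>b. b \<in> black G \<Longrightarrow> \<eta> b \<noteq> 0"
    "\<And>b x. b \<in> black G \<Longrightarrow> x \<in> kp_times \<Longrightarrow> z b x = \<eta> b * v b x"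
proof -
  obtain \<eta> where \<eta>: "\<And>u. u \<in> black G \<union> white G \<Longrightarrow> \<eta> u = 1 \<or> \<eta> u = - 1"
    "\<And>b. b \<in> bvertices G \<Longrightarrow> \<eta> b = 1"
    "\<And>u v. (u, v) \<in> Or \<Longrightarrow> edge_fun \<sigma> (u, v) = arc_sign Or (u, v) * \<eta> u * \<eta> v"
    using gauge_exists[OF O K] by metis
  have \<sigma>: "\<sigma> e = (if e \<in> Or then arc_sign Or e else arc_sign Or (snd e, fst e)) * \<eta> (fst e) * \<eta> (snd e)"
    if e: "e \<in> edges G" for e
  proof -
    obtain b w where bw: "e = (b, w)" by (cases e)
    have s: "edge_fun \<sigma> (b, w) = \<sigma> (b, w)" "edge_fun \<sigma> (w, b) = \<sigma> (b, w)"
      using e bw edge_asym by (auto simp: edge_fun_def)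
    show ?thesis
    proof (cases "(b, w) \<in> Or")
      case True
      then show ?thesis using \<eta>(3)[OF True] s bw by simp
    next
      case False
      then have "(w, b) \<in> Or" using po_edge[OF O] e bw by blast
      then show ?thesis using \<eta>(3)[of w b] s bw False by (simp add: mult_ac)
    qed
  qed
  have zero: "v b x - \<eta> b * z b x = 0" if b: "b \<in> black G" and x: "x \<in> kp_times" for b x
  proof (rule kernel_trivial[where u = "\<lambda>b. v b x - \<eta> b * z b x", OF O K t _ _ b])
    fix w assume w: "w \<in> white G"
    define E where "E = {e \<in> edges G. snd e = w}"
    have finE: "finite E" using finite_edges by (simp add: E_def)
    have "(\<Sum>b \<in> black G. kasteleyn_matrix G \<sigma> t b w * v b x) = 0"
      using v x w unfolding kasteleyn_solution_def by blast
    moreover have "(\<Sum>b \<in> black G. kasteleyn_matrix G \<sigma> t b w * v b x) = (\<Sum>e \<in> E. \<sigma> e * t e * v (fst e) x)"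
    proof -
      have "(\<Sum>e \<in> E. \<sigma> e * t e * v (fst e) x) = (\<Sum>b \<in> fst ` E. kasteleyn_matrix G \<sigma> t b w * v b x)"
        by (rule sum.reindex_cong[symmetric, of fst E])
          (auto simp: inj_on_def E_def kasteleyn_matrix_def)
      also have "\<dots> = (\<Sum>b \<in> black G. kasteleyn_matrix G \<sigma> t b w * v b x)"
      proof (rule sum.mono_neutral_left)
        show "finite (black G)" by (rule finite_vertices)
        show "fst ` E \<subseteq> black G" using edgesD by (auto simp: E_def)
        show "\<forall>b \<in> black G - fst ` E. kasteleyn_matrix G \<sigma> t b w * v b x = 0"
          by (force simp: kasteleyn_matrix_def E_def)
      qed
      finally show ?thesis ..
    qed
    ultimately have 1: "(\<Sum>e \<in> E. \<sigma> e * t e * v (fst e) x) = 0" by simp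
    have "(\<Sum>e \<in> E. \<sigma> e * t e * (\<eta> (fst e) * z (fst e) x)) =
        (\<Sum>e \<in> E. \<eta> w * ((if e \<in> Or then arc_sign Or e else arc_sign Or (snd e, fst e)) * t e * z (fst e) x))"
    proof (rule sum.cong[OF refl])
      fix e assume e: "e \<in> E"
      then have ee: "e \<in> edges G" "snd e = w" by (auto simp: E_def)
      have "fst e \<in> black G" using edgesD(1) ee(1) by (metis prod.collapse)
      then have sq: "\<eta> (fst e) * \<eta> (fst e) = 1" using \<eta>(1)[of "fst e"] by auto
      define s where "s = (if e \<in> Or then arc_sign Or e else arc_sign Or (snd e, fst e))"
      have "\<sigma> e = s * \<eta> (fst e) * \<eta> w" using \<sigma>[OF ee(1)] ee(2) by (simp add: s_def)
      then have "\<sigma> e * t e * (\<eta> (fst e) * z (fst e) x) = (\<eta> (fst e) * \<eta> (fst e)) * (\<eta> w * (s * t e * z (fst e) x))"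
        by (simp add: mult_ac)
      then show "\<sigma> e * t e * (\<eta> (fst e) * z (fst e) x) =
          \<eta> w * ((if e \<in> Or then arc_sign Or e else arc_sign Or (snd e, fst e)) * t e * z (fst e) x)"
        using sq by (simp add: s_def)
    qed
    also have "\<dots> = 0" using lam_equation[OF O t z x w] by (simp add: E_def sum_distrib_left[symmetric])
    finally have 2: "(\<Sum>e \<in> E. \<sigma> e * t e * (\<eta> (fst e) * z (fst e) x)) = 0" .
    have "(\<Sum>e \<in> E. \<sigma> e * t e * (v (fst e) x - \<eta> (fst e) * z (fst e) x)) =
        (\<Sum>e \<in> E. \<sigma> e * t e * v (fst e) x) - (\<Sum>e \<in> E. \<sigma> e * t e * (\<eta> (fst e) * z (fst e) x))"
      by (simp add: right_diff_distrib sum_subtractf)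
    then show "(\<Sum>e \<in> {e \<in> edges G. snd e = w}. \<sigma> e * t e * (v (fst e) x - \<eta> (fst e) * z (fst e) x)) = 0"
      using 1 2 by (simp add: E_def)
  next
    fix j assume j: "j < bnum G" "j \<notin> sources G Or"
    have "v (bdry G j) x = \<psi> j x" using v x j(1) unfolding kasteleyn_solution_def by blast
    moreover have "z (bdry G j) x = \<psi> j x" using z x j unfolding lam_solution_def by blast
    moreover have "\<eta> (bdry G j) = 1" using \<eta>(2) j(1) by (auto simp: bvertices_def)
    ultimately show "v (bdry G j) x - \<eta> (bdry G j) * z (bdry G j) x = 0" by simp
  qed
  show ?thesis
  proof (rule that[of \<eta>])
    fix b x assume b: "b \<in> black G"
    then show "\<eta> b \<noteq> 0" using \<eta>(1)[of b] by auto
    assume x: "x \<in> kp_times"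
    have "\<eta> b * \<eta> b = 1" using \<eta>(1)[of b] b by auto
    then have "z b x = \<eta> b * (\<eta> b * z b x)" by (simp add: mult.assoc[symmetric])
    then show "z b x = \<eta> b * v b x" using zero[OF b x] by simp
  qed
qed

text \<open>A point of the normalization lies in the node of at most one edge.\<close>

lemma node_unique:
  assumes mk: "marking G mk" and \<kappa>: "inj_on \<kappa> {..<bnum G}"
    and e: "e \<in> edges G" "p \<in> node G mk \<kappa> e" and e': "e' \<in> edges G" "p \<in> node G mk \<kappa> e'"
  shows "e = e'"
proof -
  obtain b w b' w' where bw: "e = (b, w)" "e' = (b', w')" by (cases e; cases e')
  have E: "(b, w) \<in> edges G" "(b', w') \<in> edges G" using e e' bw by auto
  have inj: "inj_on (mk u) (nbrs G u)" if "u \<in> internal G" for u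
    using mk that unfolding marking_def by blast
  have wi: "w \<in> internal G" "w' \<in> internal G" using edgesD[OF E(1)] edgesD[OF E(2)] by (auto simp: internal_def)
  have cases: "(p = (Vert w, mk w b)) \<or> (b \<in> iblack G \<and> p = (Vert b, mk b w)) \<or>
      (\<exists>j < bnum G. bdry G j = b \<and> p = (Sato, Fin (of_real (\<kappa> j))))"
    if "p \<in> node G mk \<kappa> (b, w)" for b w
    using that by (auto simp: node_def Let_def split: if_splits)
  have ww: "w \<noteq> b'" "w' \<noteq> b" using E edgesD black_white by blast+
  have nb: "b \<in> nbrs G w" "b' \<in> nbrs G w'" "w \<in> nbrs G b" "w' \<in> nbrs G b'"
    using E by (auto simp: nbrs_def)
  from cases[of b w] cases[of b' w'] e(2) e'(2) bw have
    c1: "(p = (Vert w, mk w b)) \<or> (b \<in> iblack G \<and> p = (Vert b, mk b w)) \<or>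
      (\<exists>j < bnum G. bdry G j = b \<and> p = (Sato, Fin (of_real (\<kappa> j))))" and
    c2: "(p = (Vert w', mk w' b')) \<or> (b' \<in> iblack G \<and> p = (Vert b', mk b' w')) \<or>
      (\<exists>j < bnum G. bdry G j = b' \<and> p = (Sato, Fin (of_real (\<kappa> j))))" by auto
  from c1 show ?thesis
  proof (elim disjE)
    assume p: "p = (Vert w, mk w b)"
    then have "w' = w" "mk w b' = mk w b" using c2 ww by auto
    then have "b = b'" using inj[OF wi(1)] nb by (metis inj_onD)
    then show ?thesis using bw \<open>w' = w\<close> by simp
  next
    assume p: "b \<in> iblack G \<and> p = (Vert b, mk b w)"
    then have "b' = b" "mk b w' = mk b w" using c2 ww by auto
    moreover have "b \<in> internal G" using p by (simp add: internal_def)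
    ultimately have "w = w'" using inj nb by (metis inj_onD)
    then show ?thesis using bw \<open>b' = b\<close> by simp
  next
    assume "\<exists>j < bnum G. bdry G j = b \<and> p = (Sato, Fin (of_real (\<kappa> j)))"
    then obtain j where j: "j < bnum G" "bdry G j = b" "p = (Sato, Fin (of_real (\<kappa> j)))" by blast
    then obtain j' where j': "j' < bnum G" "bdry G j' = b'" "\<kappa> j = \<kappa> j'" using c2 by auto
    then have "j = j'" using \<kappa> j(1) by (simp add: inj_on_def)
    then have bb: "b = b'" using j(2) j'(2) by simp
    have "b \<in> bvertices G" using j by (auto simp: bvertices_def)
    then have "w = w'" using bvertex_nbr_unique E bb unfolding adjG_def by blast
    then show ?thesis using bw bb by simp
  qed
qed

lemma nbr_at_black:
  assumes mk: "marking G mk" and w: "w \<in> trivalent_white G" and q: "q \<in> {Fin 0, Fin 1, Infty}"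
  shows "nbr_at G mk w q \<in> black G"
proof -
  have wi: "w \<in> internal G" "w \<in> white G" "degr G w = 3" using w by (auto simp: trivalent_white_def internal_def)
  have inj: "inj_on (mk w) (nbrs G w)" using mk wi(1) unfolding marking_def by blast
  obtain q1 q2 q3 where "nbrs G w = {q1, q2, q3}" "mk w q1 = Fin 0" "mk w q2 = Fin 1" "mk w q3 = Infty"
    using mk wi(1,3) unfolding marking_def by metis
  then obtain b where b: "b \<in> nbrs G w" "mk w b = q" using q by auto
  have "nbr_at G mk w q = b"
    unfolding nbr_at_def using b inj by (intro the_equality) (auto dest: inj_onD)
  moreover have "b \<in> black G"
    using b(1) wi(2) edgesD black_white unfolding nbrs_def by blast
  ultimately show ?thesis by simp
qed

text \<open>
  The wave function and the divisor depend on the values at the black vertices through the normalized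
  values only.
\<close>

theorem constructions_agree:
  assumes mk: "marking G mk" and \<kappa>: "inj_on \<kappa> {..<bnum G}"
    and agree: "\<And>b x. b \<in> black G \<Longrightarrow> x \<in> kp_times \<Longrightarrow> normalized_value y x0 b x = normalized_value y' x0 b x"
  shows "\<forall>P \<in> curve G mk \<kappa>. \<forall>x \<in> kp_times.
            wave_function G mk k \<kappa> \<gamma> x0 y P x = wave_function G mk k \<kappa> \<gamma> x0 y' P x"
    and "kp_divisor G mk k \<kappa> \<gamma> x0 y = kp_divisor G mk k \<kappa> \<gamma> x0 y'"
proof -
  have num: "white_divisor_number G mk y x0 w = white_divisor_number G mk y' x0 w" if w: "w \<in> trivalent_white G" for w
  proof -
    have "(\<forall>x \<in> kp_times. c * normalized_value y x0 (nbr_at G mk w (Fin 0)) x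
          + (1 - c) * normalized_value y x0 (nbr_at G mk w (Fin 1)) x = normalized_value y x0 (nbr_at G mk w Infty) x) \<longleftrightarrow>
        (\<forall>x \<in> kp_times. c * normalized_value y' x0 (nbr_at G mk w (Fin 0)) x
          + (1 - c) * normalized_value y' x0 (nbr_at G mk w (Fin 1)) x = normalized_value y' x0 (nbr_at G mk w Infty) x)" for c
      using agree nbr_at_black[OF mk w] by (intro ball_cong) auto
    then show ?thesis unfolding white_divisor_number_def by presburger
  qed
  show "kp_divisor G mk k \<kappa> \<gamma> x0 y = kp_divisor G mk k \<kappa> \<gamma> x0 y'"
  proof -
    have "finite (trivalent_white G)" using finite_vertices(2) by (simp add: trivalent_white_def)
    then have "image_mset (\<lambda>w. curve_point G mk \<kappa> (Vert w, Fin (of_real (white_divisor_number G mk y x0 w)))) (mset_set (trivalent_white G)) =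
        image_mset (\<lambda>w. curve_point G mk \<kappa> (Vert w, Fin (of_real (white_divisor_number G mk y' x0 w)))) (mset_set (trivalent_white G))"
      using num by (intro image_mset_cong) simp
    then show ?thesis unfolding kp_divisor_def by simp
  qed
  have norm: "wave_normalization G mk k \<kappa> \<gamma> x0 y p x = wave_normalization G mk k \<kappa> \<gamma> x0 y' p x"
    if p: "p \<in> normalization G" and x: "x \<in> kp_times" for p x
  proof (cases "\<exists>e \<in> edges G. p \<in> node G mk \<kappa> e")
    case True
    then obtain e where e: "e \<in> edges G" "p \<in> node G mk \<kappa> e" by blast
    then have "(THE e. e \<in> edges G \<and> p \<in> node G mk \<kappa> e) = e"
      using node_unique[OF mk \<kappa>] by (intro the_equality) blast+
    moreover have "fst e \<in> black G" using edgesD[of "fst e" "snd e"] e(1) by simp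
    ultimately show ?thesis using True agree x unfolding wave_normalization_def by simp
  next
    case False
    show ?thesis
    proof (cases "fst p")
      case Sato
      then show ?thesis using False unfolding wave_normalization_def by simp
    next
      case (Vert u)
      have u: "u \<in> internal G" using p Vert by (auto simp: normalization_def)
      consider "u \<in> trivalent_white G" | "u \<notin> trivalent_white G" "u \<in> white G" | "u \<notin> trivalent_white G" "u \<notin> white G"
        by blast
      then show ?thesis
      proof cases
        case 1
        then show ?thesis
          using False Vert num[OF 1] agree nbr_at_black[OF mk 1] x unfolding wave_normalization_def by simp
      next
        case 2
        have "u \<in> black G \<union> white G" using 2 by simp
        then have "nbrs G u \<noteq> {}" using has_nbr by (auto simp: nbrs_eq)
        then have "(SOME b. b \<in> nbrs G u) \<in> nbrs G u" by (simp add: some_in_eq)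
        then have "(SOME b. b \<in> nbrs G u) \<in> black G"
          using 2(2) edgesD black_white unfolding nbrs_def by blast
        then show ?thesis using False Vert 2 agree x unfolding wave_normalization_def by simp
      next
        case 3
        then have "u \<in> black G" using u by (auto simp: internal_def black_def)
        then show ?thesis using False Vert 3 agree x unfolding wave_normalization_def by simp
      qed
    qed
  qed
  show "\<forall>P \<in> curve G mk \<kappa>. \<forall>x \<in> kp_times.
            wave_function G mk k \<kappa> \<gamma> x0 y P x = wave_function G mk k \<kappa> \<gamma> x0 y' P x"
  proof (intro ballI)
    fix P x assume P: "P \<in> curve G mk \<kappa>" and x: "x \<in> kp_times"
    have "P \<subseteq> normalization G"
      using P unfolding curve_def quotient_def gluing_def by auto
    then have "(\<lambda>p. wave_normalization G mk k \<kappa> \<gamma> x0 y p x) ` P = (\<lambda>p. wave_normalization G mk k \<kappa> \<gamma> x0 y' p x) ` P"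
      using norm x by (intro image_cong) auto
    then show "wave_function G mk k \<kappa> \<gamma> x0 y P x = wave_function G mk k \<kappa> \<gamma> x0 y' P x"
      unfolding wave_function_def by simp
  qed
qed

end

theorem proposition6p12:
  fixes G :: disk_graph and k n g :: nat
    and \<kappa> :: "nat \<Rightarrow> real" and A :: "real mat"
    and t \<sigma> :: "complex \<times> complex \<Rightarrow> real"
    and wc \<gamma> :: "nat \<Rightarrow> (nat \<Rightarrow> real) \<Rightarrow> real"
    and mk :: "complex \<Rightarrow> complex \<Rightarrow> cp1"
    and Or :: "(complex \<times> complex) set" and \<ll> :: complex
    and v z :: "complex \<Rightarrow> (nat \<Rightarrow> real) \<Rightarrow> real"
    and h :: "complex \<Rightarrow> complex \<times> complex \<Rightarrow> (nat \<Rightarrow> real) \<Rightarrow> real"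
    and x0 :: "nat \<Rightarrow> real"
  assumes phases: "strict_mono_on {..<n} \<kappa>"
    and graph: "planar_bipartite_disk_graph G" "bnum G = n" "reduced_graph G"
    and valency: "\<forall>u \<in> internal G. degr G u = 2 \<or> degr G u = 3"
    and cell: "irreducible_positroid n (positroid G)"
      "cell_dimension (positroid_cell k n (positroid G)) g"
    and point: "represents_cell_point k n (positroid G) A"
    and weights: "weights_represent G k t A"
    and sato: "dressing_coeffs k \<kappa> A wc" "sato_roots k n \<kappa> wc \<gamma>"
    and curve_marking: "marking G mk"
    and kasteleyn: "kasteleyn_signature G \<sigma>"
      "kasteleyn_solution G \<sigma> t (sato_psi k \<kappa> \<gamma>) v"
    and lam: "perfect_orientation G Or" "gauge_direction G \<ll>"
      "lam_solution G Or \<ll> t (sato_psi k \<kappa> \<gamma>) h z"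
    and reference_time: "x0 \<in> kp_times" "\<forall>b \<in> black G. v b x0 \<noteq> 0"
  shows "(\<forall>P \<in> curve G mk \<kappa> - {curve_point G mk \<kappa> (Sato, Infty)}. \<forall>x \<in> kp_times.
            wave_function G mk k \<kappa> \<gamma> x0 v P x = wave_function G mk k \<kappa> \<gamma> x0 z P x) \<and>
         kp_divisor G mk k \<kappa> \<gamma> x0 v = kp_divisor G mk k \<kappa> \<gamma> x0 z"
proof -
  interpret kp_graph G \<ll>
    using graph valency cell(1) lam(2) by unfold_locales auto
  have t: "t e > 0" if "e \<in> edges G" for e
    using weights that unfolding weights_represent_def by blast
  obtain \<eta> where \<eta>: "\<And>b. b \<in> black G \<Longrightarrow> \<eta> b \<noteq> (0 :: real)"
    "\<And>b x. b \<in> black G \<Longrightarrow> x \<in> kp_times \<Longrightarrow> z b x = \<eta> b * v b x"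
    using solutions_agree[OF lam(1) kasteleyn(1) t kasteleyn(2) lam(3)] by metis
  have agree: "normalized_value v x0 b x = normalized_value z x0 b x" if "b \<in> black G" "x \<in> kp_times" for b x
    using \<eta> that reference_time(1) by (simp add: normalized_value_def)
  have "inj_on \<kappa> {..<bnum G}" using strict_mono_on_imp_inj_on[OF phases] graph(2) by simp
  from constructions_agree[OF curve_marking this agree] show ?thesis by blast
qed

end
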